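(* Let $d\geq 3$, $k\geq 2$ and let $\Delta$ be a stacked cross-polytopal $(d-1)$-sphere on $kd$ vertices. Then $\beta_{0,0}(\mathbb{F}[\Delta])=\beta_{(k-1)d,kd}(\mathbb{F}[\Delta])=1$ and for $i\geq 0$: $$\beta_{i,i+j}(\mathbb{F}[\Delta])=\begin{cases}(k-2)\binom{d(k-1)}{i+1}-(k-1)\binom{d(k-2)}{i+1}+d(k-1)\binom{d(k-2)}{i-1}, & j=1,\\ (k-1)\binom{d}{j}\binom{d(k-2)}{i-j}, & 2\leq j\leq d-2,\\ (k-2)\binom{d(k-1)}{i-1}-(k-1)\binom{d(k-2)}{i-d-1}+d(k-1)\binom{d(k-2)}{i-d+1}, & j=d-1.\end{cases}$$
   Context: $\mathbb{F}$ is a field; $\beta_{i,i+j}(\mathbb{F}[\Delta])=\dim_{\mathbb{F}}\mathrm{Tor}_i^S(\mathbb{F}[\Delta],\mathbb{F})_{i+j}$ for the Stanley–Reisner ring $\mathbb{F}[\Delta]=S/I_\Delta$; binomial coefficients $\binom{a}{c}$ are $0$ if $c<0$ or $c>a$. $\mathcal{C}_d=\{v_1,w_1\}*\dots*\{v_d,w_d\}$ is the boundary complex of the $d$-dimensional cross-polytope. For pure $(d-1)$-dimensional complexes $\Delta,\Gamma$ on disjoint vertex sets with facets $F\in\Delta$, $G\in\Gamma$ and a bijection $\varphi:F\to G$, the connected sum is obtained from $(\Delta\setminus\{F\})\cup(\Gamma\setminus\{G\})$ by identifying $v$ with $\varphi(v)$ for $v\in F$. A stacked cross-polytopal $(d-1)$-sphere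 on $kd$ vertices is a complex obtained by iterated connected sums of $k-1$ copies of $\mathcal{C}_d$.
   Formalization: The formula for j = d−1 is claimed only for i ≠ (k−1)d+1; at i = (k−1)d+1 its right-hand side equals (k−2)−(k−1)+0 = −1, which cannot be a Betti number. *)

theory Defs
  imports Complex_Main "HOL-Library.Poly_Mapping"
begin

section \<open>Binomial coefficients\<close>

text \<open>The convention is that the coefficient vanishes for negative lower index; for lower index
  larger than the upper one this already holds for \<open>choose\<close>.\<close>

definition binom :: "nat \<Rightarrow> int \<Rightarrow> int" where
  "binom a c = (if c < 0 then 0 else int (a choose nat c))"


section \<open>Simplicial complexes and stacked cross-polytopal spheres\<close>

text \<open>A complex is given by its set of faces (the empty face included); \<open>\<Union>\<Delta>\<close> is its vertex set.\<close>

definition is_facet :: "'v set set \<Rightarrow> 'v set \<Rightarrow> bool" where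
  "is_facet \<Delta> F \<longleftrightarrow> F \<in> \<Delta> \<and> (\<forall>H\<in>\<Delta>. F \<subseteq> H \<longrightarrow> H = F)"

definition join :: "'v set set \<Rightarrow> 'v set set \<Rightarrow> 'v set set" where
  "join \<Delta> \<Gamma> = {\<sigma> \<union> \<tau> | \<sigma> \<tau>. \<sigma> \<in> \<Delta> \<and> \<tau> \<in> \<Gamma>}"

definition two_points :: "'v \<Rightarrow> 'v \<Rightarrow> 'v set set" where
  "two_points x y = {{}, {x}, {y}}"

primrec cross_polytope :: "nat \<Rightarrow> (nat \<Rightarrow> 'v) \<Rightarrow> (nat \<Rightarrow> 'v) \<Rightarrow> 'v set set" where
  "cross_polytope 0 v w = {{}}"
| "cross_polytope (Suc d) v w = join (cross_polytope d v w) (two_points (v d) (w d))"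

definition is_cross_polytope :: "nat \<Rightarrow> 'v set set \<Rightarrow> bool" where
  "is_cross_polytope d \<Gamma> \<longleftrightarrow>
     (\<exists>v w. inj_on v {..<d} \<and> inj_on w {..<d} \<and> v ` {..<d} \<inter> w ` {..<d} = {} \<and>
            \<Gamma> = cross_polytope d v w)"

text \<open>The identification of \<open>v \<in> F\<close> with \<open>\<phi> v \<in> G\<close> is carried out by taking \<open>v\<close> as the
  representative of the class, i.e. by replacing every vertex of \<open>G\<close> by its preimage.\<close>

definition connected_sum ::
  "'v set set \<Rightarrow> 'v set set \<Rightarrow> 'v set \<Rightarrow> 'v set \<Rightarrow> ('v \<Rightarrow> 'v) \<Rightarrow> 'v set set" where
  "connected_sum \<Delta> \<Gamma> F G \<phi> =
     (\<lambda>\<sigma>. (\<lambda>x. if x \<in> G then inv_into F \<phi> x else x) ` \<sigma>) ` ((\<Delta> - {F}) \<union> (\<Gamma> - {G}))"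

text \<open>\<open>iterated_sum d n \<Delta>\<close>: the complex \<open>\<Delta>\<close> is an iterated connected sum of \<open>n\<close> copies of the
  boundary of the \<open>d\<close>-dimensional cross-polytope. Fresh vertices are needed for every new copy, so
  the construction takes place on the infinite vertex supply \<open>nat\<close>; isomorphic copies on other
  vertex types are admitted afterwards.\<close>

inductive iterated_sum :: "nat \<Rightarrow> nat \<Rightarrow> nat set set \<Rightarrow> bool" for d where
  single: "is_cross_polytope d \<Delta> \<Longrightarrow> iterated_sum d 1 \<Delta>"
| glue: "\<lbrakk>iterated_sum d n \<Delta>; is_cross_polytope d \<Gamma>; \<Union>\<Delta> \<inter> \<Union>\<Gamma> = {};
          is_facet \<Delta> F; is_facet \<Gamma> G; bij_betw \<phi> F G\<rbrakk>
         \<Longrightarrow> iterated_sum d (Suc n) (connected_sum \<Delta> \<Gamma> F G \<phi>)"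

definition simplicial_iso :: "'v set set \<Rightarrow> 'w set set \<Rightarrow> bool" where
  "simplicial_iso \<Delta> \<Gamma> \<longleftrightarrow> (\<exists>f. inj_on f (\<Union>\<Delta>) \<and> \<Gamma> = (\<lambda>\<sigma>. f ` \<sigma>) ` \<Delta>)"

text \<open>Stacked cross-polytopal \<open>(d-1)\<close>-sphere on \<open>k*d\<close> vertices: one copy has \<open>2*d\<close> vertices and
  each gluing adds \<open>d\<close>, so the number of copies is \<open>k-1\<close>.\<close>

definition stacked_cross_polytopal_sphere :: "nat \<Rightarrow> nat \<Rightarrow> 'v set set \<Rightarrow> bool" where
  "stacked_cross_polytopal_sphere d k \<Delta> \<longleftrightarrow>
     (\<exists>\<Delta>0. iterated_sum d (k - 1) \<Delta>0 \<and> simplicial_iso \<Delta>0 \<Delta>)"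


section \<open>Polynomials with variables in a given set\<close>

type_synonym ('v, 'f) mpoly = "('v \<Rightarrow>\<^sub>0 nat) \<Rightarrow>\<^sub>0 'f"

text \<open>The polynomial ring \<open>S = \<F>[x_v : v \<in> V]\<close> is a subring of the type of polynomials in variables
  indexed by all of \<open>'v\<close>.\<close>

definition poly_ring :: "'v set \<Rightarrow> ('v, 'f::field) mpoly set" where
  "poly_ring V = {p. \<forall>m \<in> Poly_Mapping.keys p. Poly_Mapping.keys m \<subseteq> V}"

definition var :: "'v \<Rightarrow> ('v, 'f::field) mpoly" where
  "var v = Poly_Mapping.single (Poly_Mapping.single v 1) 1"

definition mdeg :: "('v \<Rightarrow>\<^sub>0 nat) \<Rightarrow> nat" where
  "mdeg m = (\<Sum>v\<in>Poly_Mapping.keys m. Poly_Mapping.lookup m v)"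

definition ideal_gen ::
  "'v set \<Rightarrow> ('v, 'f::field) mpoly set \<Rightarrow> ('v, 'f) mpoly set" where
  "ideal_gen V A = {\<Sum>a\<in>T. c a * a | T c. finite T \<and> T \<subseteq> A \<and> (\<forall>a\<in>T. c a \<in> poly_ring V)}"

definition stanley_reisner_ideal :: "'v set set \<Rightarrow> ('v, 'f::field) mpoly set" where
  "stanley_reisner_ideal \<Delta> = ideal_gen (\<Union>\<Delta>) {\<Prod>v\<in>\<sigma>. var v | \<sigma>. finite \<sigma> \<and> \<sigma> \<subseteq> \<Union>\<Delta> \<and> \<sigma> \<notin> \<Delta>}"

definition irrelevant_ideal :: "'v set \<Rightarrow> ('v, 'f::field) mpoly set" where
  "irrelevant_ideal V = ideal_gen V (var ` V)"


section \<open>Graded free modules and resolutions\<close>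

text \<open>A vector with entries in \<open>S\<close>; an element of a free module of rank \<open>r\<close> has its support in
  \<open>{..<r}\<close>.\<close>

type_synonym ('v, 'f) fvec = "nat \<Rightarrow>\<^sub>0 ('v, 'f) mpoly"

definition smult :: "('v, 'f::field) mpoly \<Rightarrow> ('v, 'f) fvec \<Rightarrow> ('v, 'f) fvec" where
  "smult p u = Poly_Mapping.map (\<lambda>q. p * q) u"

definition fscale :: "'f::field \<Rightarrow> ('v, 'f) fvec \<Rightarrow> ('v, 'f) fvec" where
  "fscale c u = smult (Poly_Mapping.single 0 c) u"

lemma lookup_smult: "Poly_Mapping.lookup (smult p u) b = p * Poly_Mapping.lookup u b"
  by (simp add: smult_def Poly_Mapping.map.rep_eq when_def)

lemma vector_space_fscale: "vector_space fscale"
proof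
  fix a b :: "'a::field" and x y :: "('v, 'a) fvec"
  show "fscale a (x + y) = fscale a x + fscale a y"
    by (rule poly_mapping_eqI) (simp add: fscale_def lookup_smult lookup_add distrib_left)
  show "fscale (a + b) x = fscale a x + fscale b x"
    by (rule poly_mapping_eqI)
      (simp add: fscale_def lookup_smult lookup_add distrib_right Poly_Mapping.single_add)
  show "fscale a (fscale b x) = fscale (a * b) x"
    by (rule poly_mapping_eqI)
      (simp add: fscale_def lookup_smult mult.assoc[symmetric] mult_single)
  show "fscale 1 x = x"
    by (rule poly_mapping_eqI) (simp add: fscale_def lookup_smult)
qed

text \<open>Data of a sequence of graded free modules of finite rank
  \<open>G\<^sub>i = \<Oplus>\<^bsub>b < rk i\<^esub> S(- shift i b)\<close> and of maps \<open>bd i : G\<^bsub>i+1\<^esub> \<rightarrow> G\<^bsub>i\<^esub>\<close>.\<close>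

record (overloaded) ('v, 'f) free_seq =
  rk :: "nat \<Rightarrow> nat"
  shift :: "nat \<Rightarrow> nat \<Rightarrow> nat"
  bd :: "nat \<Rightarrow> ('v, 'f) fvec \<Rightarrow> ('v, 'f) fvec"

definition fmod :: "'v set \<Rightarrow> ('v, 'f::field) free_seq \<Rightarrow> nat \<Rightarrow> ('v, 'f) fvec set" where
  "fmod V G i = {u. Poly_Mapping.keys u \<subseteq> {..<rk G i} \<and>
                    (\<forall>b. Poly_Mapping.lookup u b \<in> poly_ring V)}"

definition fmod_deg ::
  "'v set \<Rightarrow> ('v, 'f::field) free_seq \<Rightarrow> nat \<Rightarrow> nat \<Rightarrow> ('v, 'f) fvec set" where
  "fmod_deg V G i n = {u \<in> fmod V G i.
     \<forall>b. \<forall>m \<in> Poly_Mapping.keys (Poly_Mapping.lookup u b). mdeg m + shift G i b = n}"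

text \<open>As \<open>G\<^sub>i\<close> is free, \<open>I G\<^sub>i\<close> consists of the vectors all of whose entries lie in \<open>I\<close>.\<close>

definition ideal_fmod ::
  "'v set \<Rightarrow> ('v, 'f::field) mpoly set \<Rightarrow> ('v, 'f) free_seq \<Rightarrow> nat \<Rightarrow> ('v, 'f) fvec set" where
  "ideal_fmod V I G i = {u \<in> fmod V G i. \<forall>b. Poly_Mapping.lookup u b \<in> I}"

text \<open>\<open>\<dots> \<rightarrow> G\<^sub>2 \<rightarrow> G\<^sub>1 \<rightarrow> G\<^sub>0 = S \<rightarrow> S/J \<rightarrow> 0\<close> is a graded free resolution of the cyclic module \<open>S/J\<close>,
  the last map being the canonical projection: the maps are \<open>S\<close>-linear and homogeneous of degree
  \<open>0\<close>, and the sequence is exact.\<close>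

definition graded_free_resolution ::
  "'v set \<Rightarrow> ('v, 'f::field) mpoly set \<Rightarrow> ('v, 'f) free_seq \<Rightarrow> bool" where
  "graded_free_resolution V J G \<longleftrightarrow>
     rk G 0 = 1 \<and> shift G 0 0 = 0 \<and>
     (\<forall>i. \<forall>u \<in> fmod V G (Suc i). \<forall>w \<in> fmod V G (Suc i). bd G i (u + w) = bd G i u + bd G i w) \<and>
     (\<forall>i. \<forall>p \<in> poly_ring V. \<forall>u \<in> fmod V G (Suc i). bd G i (smult p u) = smult p (bd G i u)) \<and>
     (\<forall>i n. bd G i ` fmod_deg V G (Suc i) n \<subseteq> fmod_deg V G i n) \<and>
     bd G 0 ` fmod V G 1 = ideal_fmod V J G 0 \<and>
     (\<forall>i. bd G (Suc i) ` fmod V G (Suc (Suc i)) = {u \<in> fmod V G (Suc i). bd G i u = 0})"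


section \<open>Graded Tor and Betti numbers\<close>

text \<open>\<open>Tor\<^sub>i\<^sup>S(S/I, S/J)\<close> is the \<open>i\<close>-th homology of \<open>S/I \<otimes>\<^sub>S G\<close> for a free resolution \<open>G\<close> of \<open>S/J\<close>.
  As \<open>S/I \<otimes>\<^sub>S G\<^sub>i = G\<^sub>i / I G\<^sub>i\<close>, its cycles and boundaries of degree \<open>n\<close> are the images of the following
  two subspaces of the degree \<open>n\<close> part of \<open>G\<^sub>i\<close>, both of which contain the degree \<open>n\<close> part of
  \<open>I G\<^sub>i\<close>.\<close>

definition tor_cycles ::
  "'v set \<Rightarrow> ('v, 'f::field) mpoly set \<Rightarrow> ('v, 'f) free_seq \<Rightarrow> nat \<Rightarrow> nat \<Rightarrow> ('v, 'f) fvec set" where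
  "tor_cycles V I G i n =
     (case i of 0 \<Rightarrow> fmod_deg V G 0 n
      | Suc h \<Rightarrow> {u \<in> fmod_deg V G (Suc h) n. bd G h u \<in> ideal_fmod V I G h})"

definition tor_boundaries ::
  "'v set \<Rightarrow> ('v, 'f::field) mpoly set \<Rightarrow> ('v, 'f) free_seq \<Rightarrow> nat \<Rightarrow> nat \<Rightarrow> ('v, 'f) fvec set" where
  "tor_boundaries V I G i n =
     {bd G i w + t | w t. w \<in> fmod_deg V G (Suc i) n \<and> t \<in> ideal_fmod V I G i \<inter> fmod_deg V G i n}"

text \<open>The vector space dimension of \<open>Tor\<^sub>i\<^sup>S(S/I, S/J)\<^sub>n\<close> for homogeneous ideals \<open>I\<close>, \<open>J\<close>, computed
  from any graded free resolution of \<open>S/J\<close>. For finite \<open>V\<close> the degree \<open>n\<close> part of \<open>G\<^sub>i\<close> is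
  finite-dimensional, so the difference is the dimension of the quotient.\<close>

definition tor_dim ::
  "'v set \<Rightarrow> ('v, 'f::field) mpoly set \<Rightarrow> ('v, 'f) mpoly set \<Rightarrow> nat \<Rightarrow> nat \<Rightarrow> nat" where
  "tor_dim V I J i n =
     (let G = (SOME G. graded_free_resolution V J G)
      in vector_space.dim fscale (tor_cycles V I G i n)
         - vector_space.dim fscale (tor_boundaries V I G i n))"

text \<open>\<open>betti TYPE('f) \<Delta> i n = dim Tor\<^sub>i\<^sup>S(\<F>[\<Delta>], \<F>)\<^sub>n\<close> for the field \<open>\<F>\<close> given by the type \<open>'f\<close>, where
  \<open>\<F>[\<Delta>]\<close> is the quotient of \<open>S\<close> by the Stanley--Reisner ideal and \<open>\<F>\<close> the quotient by the ideal
  of all variables. Note that \<open>n\<close> is the total degree, i.e. \<open>i + j\<close> in \<open>\<beta>\<^bsub>i,i+j\<^esub>\<close>.\<close>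

definition betti :: "'f::field itself \<Rightarrow> 'v set set \<Rightarrow> nat \<Rightarrow> nat \<Rightarrow> nat" where
  "betti _ \<Delta> i n =
     tor_dim (\<Union>\<Delta>) (stanley_reisner_ideal \<Delta> :: ('v, 'f) mpoly set) (irrelevant_ideal (\<Union>\<Delta>)) i n"

end

theory Submission
  imports Defs "HOL-Library.Function_Algebras"
begin

text \<open>Any two graded free resolutions of \<open>\<F>\<close> give the same Tor, so the Betti numbers can be computed
  from the Koszul complex. Tensored with the Stanley--Reisner ring, it splits by multidegree: the
  strand of a multidegree with an entry at least 2 is exact, and the strand of a squarefree one with
  support \<open>W\<close> is, after complementation in \<open>W\<close>, the reduced cochain complex of the induced subcomplex
  on \<open>W\<close>. This is Hochster's formula, expressing a Betti number as a sum over all \<open>W\<close> of a given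
  size.

  An induced subcomplex of a cross-polytope is a simplex or a smaller cross-polytope. Gluing two
  complexes along the boundary of a common facet \<open>F\<close> adds up the cohomology of their induced
  subcomplexes, up to a correction in the lowest degree when \<open>W\<close> misses \<open>F\<close> and in the two highest
  degrees when \<open>W\<close> contains \<open>F\<close>. In top degree only the full vertex set carries cohomology, because
  the facet graph is connected. Counting the sets \<open>W\<close> that meet the vertex set of each cross-polytope
  or facet in a prescribed way gives the binomial coefficients.\<close>

section \<open>Dimensions of subspaces\<close>

text \<open>No quotient space is ever formed. By rank-nullity the dimension of a homology or
  cohomology group is an integer combination of dimensions of cycle or cocycle spaces and of numbers
  of faces, and only these are tracked through cones, gluings and the passage from Tor to simplicial
  complexes. Deleting the common facet of a connected sum leaves face numbers below size
  \<open>d\<close> and cocycle spaces on faces of size at most \<open>d - 2\<close> untouched, so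
  the middle degrees follow from additivity of cocycle spaces under gluing along a simplex. In the
  two extreme degrees the cocycle space that misbehaves cancels from a difference of two
  neighbouring cohomology dimensions, and one term of each difference is found separately. In degree
  -1 this is trivial. At the top, the cycles of size \<open>d\<close> are shown to be the multiples
  of one cycle that vanishes on no facet. This property passes to suspensions and connected sums,
  and it forces a cycle that avoids a single facet to be zero, so that subcomplexes induced on
  proper vertex subsets have no top cohomology.\<close>

definition fin_dim :: "('a::field \<Rightarrow> 'b \<Rightarrow> 'b::ab_group_add) \<Rightarrow> 'b set \<Rightarrow> bool" where
  "fin_dim s U \<longleftrightarrow> (\<exists>B. finite B \<and> U \<subseteq> module.span s B)"

text \<open>The maps of a resolution are only known to be additive and \<open>S\<close>-linear on
  its free modules, and nothing is known of them elsewhere in the type. Linearity is therefore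
  relative to a subspace \<open>U\<close>.\<close>

definition lin_on :: "('a::field \<Rightarrow> 'b \<Rightarrow> 'b::ab_group_add) \<Rightarrow> ('a \<Rightarrow> 'c \<Rightarrow> 'c::ab_group_add) \<Rightarrow> 'b set \<Rightarrow> ('b \<Rightarrow> 'c) \<Rightarrow> bool"
  where "lin_on s1 s2 U f \<longleftrightarrow> module.subspace s1 U \<and> (\<forall>x\<in>U. \<forall>y\<in>U. f (x + y) = f x + f y) \<and>
     (\<forall>c. \<forall>x\<in>U. f (s1 c x) = s2 c (f x))"

lemma (in vector_space) fin_dim_subset: "fin_dim scale U \<Longrightarrow> U' \<subseteq> U \<Longrightarrow> fin_dim scale U'"
  unfolding fin_dim_def by blast

lemma (in vector_space) fin_dim_basis:
  assumes "fin_dim scale U" "subspace U" "B0 \<subseteq> U" "independent B0"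
  obtains B where "finite B" "B0 \<subseteq> B" "independent B" "span B = U" "dim U = card B"
proof -
  obtain B where B: "B0 \<subseteq> B" "B \<subseteq> U" "independent B" "U \<subseteq> span B"
    using maximal_independent_subset_extend[OF assms(3,4)] by blast
  have "span B = U" using B assms(2) by (simp add: span_minimal subset_antisym)
  moreover have "finite B"
    using assms(1) B independent_span_bound unfolding fin_dim_def by (meson order_trans)
  moreover have "dim U = card B" using B by (simp add: basis_card_eq_dim)
  ultimately show ?thesis using that B by blast
qed

lemma (in vector_space) fin_dim_basis0:
  assumes "fin_dim scale U" "subspace U"
  shows "\<exists>B. finite B \<and> independent B \<and> span B = U \<and> dim U = card B"
  by (rule fin_dim_basis[OF assms, of "{}"]) (auto simp: independent_empty)

text \<open>The coordinates of \<open>x\<close> with respect to \<open>B\<close> are supported in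
  \<open>A\<close> and in \<open>C\<close> at once, hence nowhere.\<close>

lemma (in vector_space) span_Int_independent:
  assumes "independent B" "A \<subseteq> B" "C \<subseteq> B" "A \<inter> C = {}" "x \<in> span A" "x \<in> span C"
  shows "x = 0"
proof -
  have "representation B x = representation A x" "representation B x = representation C x"
    using assms by (auto intro: representation_extend)
  then have "representation B x b = 0" for b
    using representation_ne_zero[of A x b] representation_ne_zero[of C x b] assms(4) by fastforce
  moreover have "x \<in> span B" using assms span_mono by blast
  ultimately show ?thesis
    using sum_nonzero_representation_eq[OF assms(1)] by fastforce
qed

lemma (in vector_space) dim_mono_fin:
  assumes "fin_dim scale U" "subspace U" "subspace U'" "U' \<subseteq> U"
  shows "dim U' \<le> dim U"
proof -
  have "fin_dim scale U'" using assms fin_dim_subset by blast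
  then obtain B0 where B0: "span B0 = U'" "independent B0" "dim U' = card B0"
    using fin_dim_basis0[OF _ assms(3)] by blast
  have "B0 \<subseteq> U" using B0 assms(4) span_superset by blast
  then obtain B where "finite B" "B0 \<subseteq> B" "dim U = card B"
    using fin_dim_basis[OF assms(1,2) _ B0(2)] by metis
  then show ?thesis using B0 by (simp add: card_mono)
qed

context vector_space_pair
begin

text \<open>Extends from a basis of \<open>U\<close>. Results on linear maps of the whole space
  thereby become available for \<open>lin_on\<close>.\<close>

lemma lin_on_extend:
  assumes "lin_on s1 s2 U f"
  obtains g where "Vector_Spaces.linear s1 s2 g" "\<And>x. x \<in> U \<Longrightarrow> g x = f x"
proof -
  obtain B where B: "B \<subseteq> U" "vs1.independent B" "U \<subseteq> vs1.span B"
    by (rule vs1.basis_exists[of U])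
  obtain g where g: "Vector_Spaces.linear s1 s2 g" "\<forall>x\<in>B. g x = f x"
    using linear_independent_extend[OF B(2)] by blast
  have "0 \<in> U" using assms vs1.subspace_0 by (auto simp: lin_on_def)
  then have "f (s1 0 0) = s2 0 (f 0)" using assms unfolding lin_on_def by blast
  then have f0: "f 0 = 0" by simp
  have "vs1.subspace {x \<in> U. g x = f x}"
    using assms g(1) f0 unfolding vs1.subspace_def lin_on_def
    by (auto simp: linear_0 linear_add linear_scale)
  then have "U \<subseteq> {x \<in> U. g x = f x}"
    using vs1.span_minimal[of B "{x \<in> U. g x = f x}"] B g(2) by blast
  then show ?thesis using that g(1) by blast
qed

lemma lin_on_0: "lin_on s1 s2 U f \<Longrightarrow> f 0 = 0"
  by (metis lin_on_def vs1.scale_zero_left vs2.scale_zero_left vs1.subspace_0)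

lemma subspace_image_on:
  assumes "lin_on s1 s2 U f" shows "vs2.subspace (f ` U)"
proof -
  obtain g where g: "Vector_Spaces.linear s1 s2 g" "\<And>x. x \<in> U \<Longrightarrow> g x = f x"
    using lin_on_extend assms by blast
  then have "f ` U = g ` U" by auto
  then show ?thesis using linear_subspace_image[OF g(1)] assms by (simp add: lin_on_def)
qed

lemma subspace_kernel_on: "lin_on s1 s2 U f \<Longrightarrow> vs1.subspace {x \<in> U. f x = 0}"
  unfolding vs1.subspace_def using lin_on_0[of U f] by (auto simp: lin_on_def vs1.subspace_def)

lemma fin_dim_image: 
  assumes "lin_on s1 s2 U f" "fin_dim s1 U" shows "fin_dim s2 (f ` U)"
proof -
  obtain B where "finite B" "vs1.span B = U"
    using vs1.fin_dim_basis0[of U] assms unfolding lin_on_def by blast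
  moreover obtain g where g: "Vector_Spaces.linear s1 s2 g" "\<And>x. x \<in> U \<Longrightarrow> g x = f x"
    using lin_on_extend assms by blast
  ultimately have "f ` U = vs2.span (g ` B)" using linear_span_image[OF g(1), of B]
    by (metis image_cong)
  then show ?thesis unfolding fin_dim_def using \<open>finite B\<close> by blast
qed

text \<open>A basis of the kernel is extended to a basis of \<open>U\<close>; the added vectors are
  mapped injectively to a basis of the image.\<close>

lemma rank_nullity_on:
  assumes "lin_on s1 s2 U f" "fin_dim s1 U"
  shows "vs1.dim U = vs2.dim (f ` U) + vs1.dim {x \<in> U. f x = 0}"
proof -
  let ?N = "{x \<in> U. f x = 0}"
  have U: "vs1.subspace U" using assms by (simp add: lin_on_def)
  obtain g where g: "Vector_Spaces.linear s1 s2 g" "\<And>x. x \<in> U \<Longrightarrow> g x = f x"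
    using lin_on_extend assms by blast
  have N: "vs1.subspace ?N" using subspace_kernel_on assms by blast
  have "fin_dim s1 ?N" by (rule vs1.fin_dim_subset[OF assms(2)]) auto
  then obtain A where A: "finite A" "vs1.independent A" "vs1.span A = ?N" "vs1.dim ?N = card A"
    using vs1.fin_dim_basis0[OF _ N] by blast
  have "A \<subseteq> U" using A(3) vs1.span_superset by blast
  then obtain B where B: "finite B" "A \<subseteq> B" "vs1.independent B" "vs1.span B = U" "vs1.dim U = card B"
    using vs1.fin_dim_basis[OF assms(2) U _ A(2)] by metis
  let ?E = "B - A"
  have sub: "vs1.span ?E \<subseteq> U" using B(4) vs1.span_mono[of ?E B] by auto
  have ker: "x = 0" if "x \<in> vs1.span ?E" "g x = 0" for x
  proof -
    have "x \<in> vs1.span A" using that sub A(3) g(2)[of x] by auto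
    then show ?thesis using vs1.span_Int_independent[OF B(3), of ?E A x] that B(2) by blast
  qed
  have inj: "inj_on g (vs1.span ?E)"
    using linear_inj_on_iff_eq_0[OF g(1) vs1.subspace_span] ker by blast
  have indE: "vs1.independent ?E" using B(3) vs1.independent_mono by blast
  have "vs2.dim (f ` U) = card (g ` ?E)"
  proof (rule vs2.dim_unique[OF _ _ _ refl])
    have "?E \<subseteq> U" using B(4) vs1.span_superset by blast
    then show "g ` ?E \<subseteq> f ` U" using g(2) by force
    show "vs2.independent (g ` ?E)" by (rule linear_independent_injective_image[OF g(1) indE inj])
    show "f ` U \<subseteq> vs2.span (g ` ?E)"
    proof
      fix y assume "y \<in> f ` U"
      then obtain u where u: "u \<in> U" "y = g u" using g(2) by auto
      have "u \<in> vs1.span (?E \<union> A)" using u B(2,4) by (simp add: Un_absorb2)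
      then obtain e n where en: "u = e + n" "e \<in> vs1.span ?E" "n \<in> vs1.span A"
        unfolding vs1.span_Un by auto
      have "g n = 0" using en(3) A(3) g(2) by auto
      then have "y = g e" using u en(1) linear_add[OF g(1)] by simp
      then show "y \<in> vs2.span (g ` ?E)" using en(2) linear_span_image[OF g(1)] by blast
    qed
  qed
  moreover have "card (g ` ?E) = card ?E"
    using inj inj_on_subset vs1.span_superset card_image by metis
  moreover have "card ?E + card A = card B"
    using B A(1) by (metis Nat.le_imp_diff_is_add card_Diff_subset card_mono)
  ultimately show ?thesis using A(4) B(5) by simp
qed

lemma fin_dim_inj:
  assumes "lin_on s1 s2 U f" "\<And>x. x \<in> U \<Longrightarrow> f x = 0 \<Longrightarrow> x = 0" "fin_dim s2 (f ` U)"
  shows "fin_dim s1 U"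
proof -
  obtain B where B: "B \<subseteq> U" "vs1.independent B" "U \<subseteq> vs1.span B"
    by (rule vs1.basis_exists[of U])
  have U: "vs1.subspace U" using assms by (simp add: lin_on_def)
  have eq: "vs1.span B = U" using B U by (simp add: vs1.span_minimal subset_antisym)
  obtain g where g: "Vector_Spaces.linear s1 s2 g" "\<And>x. x \<in> U \<Longrightarrow> g x = f x"
    using lin_on_extend assms by blast
  have inj: "inj_on g (vs1.span B)"
    using linear_inj_on_iff_eq_0[OF g(1) vs1.subspace_span] assms(2) g(2) eq by force
  have "vs2.independent (g ` B)" using linear_independent_injective_image[OF g(1) B(2) inj] .
  moreover have "g ` B \<subseteq> f ` U" using B g(2) by force
  ultimately have "finite (g ` B)"
    using assms(3) vs2.independent_span_bound unfolding fin_dim_def by (meson order_trans)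
  then have "finite B" using inj inj_on_subset vs1.span_superset finite_imageD by metis
  then show ?thesis unfolding fin_dim_def using B by blast
qed

lemma dim_bij_on:
  assumes "lin_on s1 s2 U f" "fin_dim s1 U" "\<And>x. x \<in> U \<Longrightarrow> f x = 0 \<Longrightarrow> x = 0" "f ` U = U'"
  shows "vs1.dim U = vs2.dim U'"
proof -
  have "0 \<in> U" "f 0 = 0" using assms(1) vs1.subspace_0 lin_on_0 by (auto simp: lin_on_def)
  then have "{x \<in> U. f x = 0} = {0}" using assms(3) by auto
  moreover have "vs1.dim {0} = 0" using vs1.dim_unique[of "{}" "{0}" 0] by (simp add: vs1.independent_empty)
  ultimately show ?thesis using rank_nullity_on[OF assms(1,2)] assms(4) by simp
qed

end

text \<open>A stand-in for the quotient map with kernel \<open>U0\<close>: the map kills a basis of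
  \<open>U0\<close> and fixes the vectors that complete it to a basis of \<open>U\<close>.\<close>

lemma (in vector_space) projection_exists:
  assumes "fin_dim scale U" "subspace U" "subspace U0" "U0 \<subseteq> U"
  obtains g where "Vector_Spaces.linear scale scale g" "\<And>x. x \<in> U \<Longrightarrow> g x = 0 \<longleftrightarrow> x \<in> U0"
proof -
  interpret vector_space_pair scale scale ..
  have "fin_dim scale U0" using assms fin_dim_subset by blast
  then obtain A where A: "span A = U0" "independent A"
    using fin_dim_basis0[OF _ assms(3)] by blast
  have "A \<subseteq> U" using A assms(4) span_superset by blast
  then obtain B where B: "A \<subseteq> B" "independent B" "span B = U"
    using fin_dim_basis[OF assms(1,2) _ A(2)] by metis
  obtain g where g: "Vector_Spaces.linear scale scale g" "\<forall>x\<in>B. g x = (if x \<in> A then 0 else x)"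
    using linear_independent_extend[OF B(2), of "\<lambda>x. if x \<in> A then 0 else x"] by blast
  have 0: "g x = 0" if "x \<in> span A" for x
    using linear_eq_0_on_span[OF g(1) _ that] g(2) B(1) by (simp add: subset_iff)
  have 1: "g x = x" if "x \<in> span (B - A)" for x
    using linear_eq_on[OF g(1) linear_id that] g(2) by simp
  have "x \<in> U0" if "x \<in> U" "g x = 0" for x
  proof -
    have "x \<in> span (A \<union> (B - A))" using that B by (simp add: Un_absorb1)
    then obtain a e where "x = a + e" "a \<in> span A" "e \<in> span (B - A)"
      unfolding span_Un by auto
    moreover from this have "e = 0" using that(2) 0 1 linear_add[OF g(1)] by simp
    ultimately show ?thesis using A by simp
  qed
  then show ?thesis using that g(1) 0 A(1) by blast
qed

context vector_space_pair
begin

text \<open>The last assumption says that \<open>f\<close> induces an injective map from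
  \<open>U / U0\<close> to \<open>U' / U0'\<close>. A projection with kernel \<open>U0'\<close>
  turns both quotients into images, where dimensions can be compared.\<close>

lemma quotient_dim_le:
  assumes f: "lin_on s1 s2 U f" and fU: "f ` U \<subseteq> U'" and fd: "fin_dim s1 U" "fin_dim s2 U'"
    and sub: "vs2.subspace U'" "vs2.subspace U0'" "U0' \<subseteq> U'" "U0 \<subseteq> U"
    and iff: "\<And>x. x \<in> U \<Longrightarrow> f x \<in> U0' \<longleftrightarrow> x \<in> U0"
  shows "vs1.dim U - vs1.dim U0 \<le> vs2.dim U' - vs2.dim U0'"
proof -
  interpret p: vector_space_pair s2 s2 ..
  obtain g where g: "Vector_Spaces.linear s2 s2 g" "\<And>x. x \<in> U' \<Longrightarrow> g x = 0 \<longleftrightarrow> x \<in> U0'"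
    using vs2.projection_exists[OF fd(2) sub(1,2,3)] by blast
  have gU: "lin_on s2 s2 U' g"
    using g(1) sub(1) by (auto simp: lin_on_def p.linear_add p.linear_scale)
  have gf: "lin_on s1 s2 U (\<lambda>x. g (f x))"
    using f g(1) by (auto simp: lin_on_def p.linear_add p.linear_scale)
  have "{x \<in> U'. g x = 0} = U0'" using g(2) sub(3) by auto
  then have 1: "vs2.dim U' = vs2.dim (g ` U') + vs2.dim U0'"
    using p.rank_nullity_on[OF gU fd(2)] by simp
  have "{x \<in> U. g (f x) = 0} = U0" using g(2) fU iff sub(4) by blast
  then have 2: "vs1.dim U = vs2.dim ((\<lambda>x. g (f x)) ` U) + vs1.dim U0"
    using rank_nullity_on[OF gf fd(1)] by simp
  have "vs2.dim ((\<lambda>x. g (f x)) ` U) \<le> vs2.dim (g ` U')"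
  proof (rule vs2.dim_mono_fin)
    show "fin_dim s2 (g ` U')" using p.fin_dim_image[OF gU fd(2)] .
    show "vs2.subspace (g ` U')" using p.subspace_image_on[OF gU] .
    show "vs2.subspace ((\<lambda>x. g (f x)) ` U)" using subspace_image_on[OF gf] .
  qed (use fU in auto)
  then show ?thesis using 1 2 by simp
qed

end

section \<open>Spaces of functions\<close>

definition fsc :: "'f::field \<Rightarrow> ('a \<Rightarrow> 'f) \<Rightarrow> 'a \<Rightarrow> 'f" where
  "fsc c g = (\<lambda>x. c * g x)"

lemma fsc_apply: "fsc c g x = c * g x" by (simp add: fsc_def)

interpretation ff: vector_space fsc
  by unfold_locales (auto simp: fsc_def fun_eq_iff algebra_simps)

interpretation fv: vector_space fscale by (rule vector_space_fscale)

interpretation ff2: vector_space_pair fsc fsc ..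
interpretation fvff: vector_space_pair fscale fsc ..
interpretation fv2: vector_space_pair fscale fscale ..

definition fun_on :: "'a set \<Rightarrow> ('a \<Rightarrow> 'f::field) set" where
  "fun_on X = {c. \<forall>x. c x \<noteq> 0 \<longrightarrow> x \<in> X}"

lemma subspace_fun_on [simp]: "ff.subspace (fun_on X)"
  by (auto simp: ff.subspace_def fun_on_def fsc_apply) (metis add.right_neutral)

lemma fun_onD: "c \<in> fun_on X \<Longrightarrow> x \<notin> X \<Longrightarrow> c x = 0" by (auto simp: fun_on_def)

definition unit_fun :: "'a \<Rightarrow> 'a \<Rightarrow> 'f::field" where
  "unit_fun x = (\<lambda>y. if y = x then 1 else 0)"

lemma sum_fun_apply: "(\<Sum>x\<in>A. g x) y = (\<Sum>x\<in>A. g x y)"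
  for g :: "'a \<Rightarrow> 'b \<Rightarrow> 'c::comm_monoid_add"
  by (induction A rule: infinite_finite_induct) auto

lemma fun_on_expand:
  assumes "finite X" "c \<in> fun_on X"
  shows "c = (\<Sum>x\<in>X. fsc (c x) (unit_fun x))"
proof
  fix y
  have "(\<Sum>x\<in>X. fsc (c x) (unit_fun x)) y = (\<Sum>x\<in>X. if y = x then c x else 0)"
    unfolding sum_fun_apply by (rule sum.cong) (auto simp: unit_fun_def fsc_apply)
  then show "c y = (\<Sum>x\<in>X. fsc (c x) (unit_fun x)) y" using assms by (auto simp: fun_on_def)
qed

lemma fun_on_dim:
  assumes "finite X"
  shows "ff.dim (fun_on X :: ('a \<Rightarrow> 'f::field) set) = card X" "fin_dim fsc (fun_on X :: ('a \<Rightarrow> 'f::field) set)"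
proof -
  let ?B = "unit_fun ` X :: ('a \<Rightarrow> 'f) set"
  have inj: "inj_on (unit_fun :: 'a \<Rightarrow> 'a \<Rightarrow> 'f) X"
    by (auto simp: inj_on_def unit_fun_def fun_eq_iff split: if_splits)
  have sp: "fun_on X \<subseteq> ff.span ?B"
  proof
    fix c :: "'a \<Rightarrow> 'f" assume "c \<in> fun_on X"
    then show "c \<in> ff.span ?B"
      by (subst fun_on_expand[OF assms], assumption)
        (rule ff.span_sum, rule ff.span_scale, rule ff.span_base, rule imageI)
  qed
  have ind: "ff.independent ?B"
  proof (rule ff.independent_if_scalars_zero)
    fix u :: "('a \<Rightarrow> 'f) \<Rightarrow> 'f" and b
    assume 0: "(\<Sum>b\<in>?B. fsc (u b) b) = 0" and "b \<in> ?B"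
    then obtain x where x: "x \<in> X" "b = unit_fun x" by blast
    have "0 = (\<Sum>b\<in>?B. fsc (u b) b) x" using 0 by simp
    also have "\<dots> = (\<Sum>y\<in>X. u (unit_fun y) * unit_fun y x)"
      unfolding sum_fun_apply by (simp add: sum.reindex[OF inj] fsc_apply)
    also have "\<dots> = (\<Sum>y\<in>X. if x = y then u b else 0)"
      by (rule sum.cong) (auto simp: unit_fun_def x)
    also have "\<dots> = u b" using x assms by simp
    finally show "u b = 0" by simp
  qed (use assms in \<open>auto\<close>)
  show "ff.dim (fun_on X :: ('a \<Rightarrow> 'f) set) = card X"
    by (rule ff.dim_unique[OF _ sp ind]) (use inj in \<open>simp_all add: card_image\<close>, auto simp: fun_on_def unit_fun_def split: if_splits)
  show "fin_dim fsc (fun_on X :: ('a \<Rightarrow> 'f) set)" unfolding fin_dim_def using sp assms by blast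
qed

lemma fun_on_fin_dim_subset:
  assumes "finite X" "U \<subseteq> fun_on X" shows "fin_dim fsc U"
  using ff.fin_dim_subset[OF fun_on_dim(2)[OF assms(1)] assms(2)] .

lemma dim_zero_space [simp]: "ff.dim {0} = 0"
  using ff.dim_unique[of "{}" "{0}" 0] by (simp add: ff.independent_empty)

text \<open>Allows a space of coboundaries to be recovered from its annihilator, the cycles. If
  \<open>y\<close> were outside \<open>U\<close>, a nonzero coordinate of its image under a
  projection with kernel \<open>U\<close> would be a functional vanishing on \<open>U\<close> but
  not at \<open>y\<close>.\<close>

lemma double_annihilator:
  fixes U :: "('a \<Rightarrow> 'f::field) set"
  assumes "finite Y" "ff.subspace U" "U \<subseteq> fun_on Y" "y \<in> fun_on Y"
    and ann: "\<And>z. z \<in> fun_on Y \<Longrightarrow> (\<And>u. u \<in> U \<Longrightarrow> (\<Sum>x\<in>Y. z x * u x) = 0) \<Longrightarrow> (\<Sum>x\<in>Y. z x * y x) = 0"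
  shows "y \<in> U"
proof (rule ccontr)
  assume "y \<notin> U"
  obtain g :: "('a \<Rightarrow> 'f) \<Rightarrow> 'a \<Rightarrow> 'f"
    where g: "Vector_Spaces.linear fsc fsc g" "\<And>x. x \<in> fun_on Y \<Longrightarrow> g x = 0 \<longleftrightarrow> x \<in> U"
    using ff.projection_exists[OF fun_on_dim(2)[OF assms(1)] subspace_fun_on assms(2,3)] by blast
  obtain a where a: "g y a \<noteq> 0" using g(2)[OF assms(4)] \<open>y \<notin> U\<close> by (auto simp: fun_eq_iff)
  \<comment> \<open>\<open>z\<close> represents the functional sending \<open>u\<close> to
    \<open>g u a\<close> with respect to the unit functions.\<close>
  define z where "z x = (if x \<in> Y then g (unit_fun x) a else 0)" for x
  have ev: "g u a = (\<Sum>x\<in>Y. z x * u x)" if "u \<in> fun_on Y" for u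
  proof -
    have "g u = g (\<Sum>x\<in>Y. fsc (u x) (unit_fun x))" using fun_on_expand[OF assms(1) that] by simp
    also have "\<dots> = (\<Sum>x\<in>Y. fsc (u x) (g (unit_fun x)))"
      by (simp add: ff2.linear_sum[OF g(1)] ff2.linear_scale[OF g(1)])
    finally show ?thesis by (simp add: sum_fun_apply z_def mult.commute fsc_apply)
  qed
  have "(\<Sum>x\<in>Y. z x * y x) = 0"
  proof (rule ann)
    show "z \<in> fun_on Y" by (auto simp: fun_on_def z_def)
    fix u assume "u \<in> U"
    then show "(\<Sum>x\<in>Y. z x * u x) = 0" using ev[of u] g(2)[of u] assms(3) by auto
  qed
  then show False using ev[OF assms(4)] a by simp
qed

text \<open>A function on pairs with its slices in given spaces is an element of their direct sum.
  Restricting to one slice splits off one summand at a time.\<close>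

lemma dim_fibrewise:
  fixes Z :: "'a \<Rightarrow> ('b \<Rightarrow> 'f::field) set"
  assumes "finite A" "finite X" "\<And>a. a \<in> A \<Longrightarrow> ff.subspace (Z a)" "\<And>a. a \<in> A \<Longrightarrow> Z a \<subseteq> fun_on X"
  shows "ff.dim {c :: 'a \<times> 'b \<Rightarrow> 'f. (\<forall>a\<in>A. (\<lambda>b. c (a, b)) \<in> Z a) \<and> (\<forall>a. a \<notin> A \<longrightarrow> (\<forall>b. c (a, b) = 0))}
     = (\<Sum>a\<in>A. ff.dim (Z a))"
  using assms(1,3,4)
proof (induction A)
  case empty
  have "{c :: 'a \<times> 'b \<Rightarrow> 'f. (\<forall>a\<in>{}. (\<lambda>b. c (a, b)) \<in> Z a) \<and> (\<forall>a. a \<notin> {} \<longrightarrow> (\<forall>b. c (a, b) = 0))} = {0}"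
    by (auto simp: fun_eq_iff)
  then show ?case by simp
next
  case (insert a0 A)
  let ?S = "\<lambda>A. {c :: 'a \<times> 'b \<Rightarrow> 'f. (\<forall>a\<in>A. (\<lambda>b. c (a, b)) \<in> Z a) \<and> (\<forall>a. a \<notin> A \<longrightarrow> (\<forall>b. c (a, b) = 0))}"
  let ?r = "\<lambda>c :: 'a \<times> 'b \<Rightarrow> 'f. (\<lambda>b. c (a0, b))"
  have plus: "(\<lambda>b. (c + c') (a, b)) = (\<lambda>b. c (a, b)) + (\<lambda>b. c' (a, b))" for a and c c' :: "'a \<times> 'b \<Rightarrow> 'f"
    by (simp add: fun_eq_iff)
  have scale: "(\<lambda>b. (fsc r c) (a, b)) = fsc r (\<lambda>b. c (a, b))" for a r and c :: "'a \<times> 'b \<Rightarrow> 'f"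
    by (simp add: fun_eq_iff fsc_apply)
  have Z0: "0 \<in> Z a" if "a \<in> insert a0 A" for a using insert.prems(1)[OF that] ff.subspace_0 by blast
  have sub: "ff.subspace (?S (insert a0 A))"
  proof (rule ff.subspaceI)
    show "0 \<in> ?S (insert a0 A)" using Z0 by (auto simp: zero_fun_def)
    fix c c' r assume c: "c \<in> ?S (insert a0 A)"
    have "(\<lambda>b. fsc r c (a, b)) \<in> Z a" if "a \<in> insert a0 A" for a
      unfolding scale by (rule ff.subspace_scale[OF insert.prems(1)[OF that]]) (use that c in blast)
    moreover have "fsc r c (a, b) = 0" if "a \<notin> insert a0 A" for a b using c that by (auto simp add: fsc_apply)
    ultimately show "fsc r c \<in> ?S (insert a0 A)" by blast
    assume "c' \<in> ?S (insert a0 A)"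
    note c' = this
    have "(\<lambda>b. (c + c') (a, b)) \<in> Z a" if "a \<in> insert a0 A" for a
      unfolding plus by (rule ff.subspace_add[OF insert.prems(1)[OF that]]) (use that c c' in blast)+
    moreover have "(c + c') (a, b) = 0" if "a \<notin> insert a0 A" for a b using c c' that by simp
    ultimately show "c + c' \<in> ?S (insert a0 A)" by blast
  qed
  have lin: "lin_on fsc fsc (?S (insert a0 A)) ?r"
    unfolding lin_on_def by (intro conjI ballI allI sub) (simp_all add: fun_eq_iff fsc_apply)
  have "?S (insert a0 A) \<subseteq> fun_on (insert a0 A \<times> X)"
  proof
    fix c assume c: "c \<in> ?S (insert a0 A)"
    have "a \<in> insert a0 A \<and> b \<in> X" if "c (a, b) \<noteq> 0" for a b
    proof -
      have a: "a \<in> insert a0 A" using c that by blast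
      then have "(\<lambda>b. c (a, b)) \<in> fun_on X" using c insert.prems(2) by blast
      then show ?thesis using a fun_onD[of _ X b] that by blast
    qed
    then show "c \<in> fun_on (insert a0 A \<times> X)" by (auto simp: fun_on_def)
  qed
  then have fd: "fin_dim fsc (?S (insert a0 A))"
    by (rule fun_on_fin_dim_subset[rotated]) (use insert.hyps assms(2) in auto)
  have im: "?r ` ?S (insert a0 A) = Z a0"
  proof
    show "?r ` ?S (insert a0 A) \<subseteq> Z a0" by blast
    show "Z a0 \<subseteq> ?r ` ?S (insert a0 A)"
    proof
      fix d assume d: "d \<in> Z a0"
      define c where "c = (\<lambda>(a, b). if a = a0 then d b else 0)"
      have r: "(\<lambda>b. c (a, b)) = (if a = a0 then d else 0)" for a by (simp add: c_def fun_eq_iff)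
      have "c \<in> ?S (insert a0 A)" unfolding mem_Collect_eq r using d insert.hyps(2) Z0
        by (simp add: c_def)
      then show "d \<in> ?r ` ?S (insert a0 A)" by (rule rev_image_eqI) (simp add: r)
    qed
  qed
  have ker: "{c \<in> ?S (insert a0 A). ?r c = 0} = ?S A"
  proof (intro equalityI subsetI)
    fix c assume "c \<in> {c \<in> ?S (insert a0 A). ?r c = 0}"
    then have c: "c \<in> ?S (insert a0 A)" "\<And>b. c (a0, b) = 0" by (auto dest: fun_cong)
    have "c (a, b) = 0" if "a \<notin> A" for a b using c that by (cases "a = a0") auto
    then show "c \<in> ?S A" using c(1) by blast
  next
    fix c assume c: "c \<in> ?S A"
    then have 0: "c (a0, b) = 0" for b using insert.hyps(2) by blast
    then have "?r c = 0" by (simp add: zero_fun_def)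
    then show "c \<in> {c \<in> ?S (insert a0 A). ?r c = 0}" using c Z0 0 by force
  qed
  have "ff.dim (?S (insert a0 A)) = ff.dim (Z a0) + ff.dim (?S A)"
    using ff2.rank_nullity_on[OF lin fd] unfolding im ker .
  then show ?case using insert by simp
qed

section \<open>Cohomology of simplicial complexes\<close>

text \<open>Signs only need a tournament on the vertices, not a linear order.\<close>

definition before :: "'v \<Rightarrow> 'v \<Rightarrow> bool" where
  "before = (SOME R. \<forall>x y. x \<noteq> y \<longrightarrow> R x y \<noteq> R y x)"

lemma before_swap: "x \<noteq> y \<Longrightarrow> before x y \<longleftrightarrow> \<not> before y x"
proof -
  obtain r :: "('a \<times> 'a) set" where "well_order_on UNIV r" using well_order_on by blast
  then have "total_on UNIV r" "antisym r"
    by (auto simp: well_order_on_def linear_order_on_def partial_order_on_def)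
  then have "\<forall>x y. x \<noteq> y \<longrightarrow> ((x, y) \<in> r) \<noteq> ((y, x) \<in> r)"
    by (auto simp: total_on_def antisym_def)
  then have "\<exists>R :: 'a \<Rightarrow> 'a \<Rightarrow> bool. \<forall>x y. x \<noteq> y \<longrightarrow> R x y \<noteq> R y x"
    by (intro exI[of _ "\<lambda>x y. (x, y) \<in> r"])
  from someI_ex[OF this] show "x \<noteq> y \<Longrightarrow> before x y \<longleftrightarrow> \<not> before y x"
    unfolding before_def by blast
qed

text \<open>The incidence number of \<open>T\<close> in \<open>insert x T\<close> for the
  orientation given by \<open>before\<close>.\<close>

definition eps :: "'v \<Rightarrow> 'v set \<Rightarrow> 'f::field" where
  "eps x T = (- 1) ^ card {u \<in> T. before u x}"

lemma eps_neq_0 [simp]: "eps x T \<noteq> 0"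
  by (simp add: eps_def)

lemma eps_square: "eps x T * eps x T = 1"
  by (simp add: eps_def power_mult_distrib[symmetric])

lemma eps_square_left: "eps x T * (eps x T * a) = a"
  by (simp add: mult.assoc[symmetric] eps_square)

lemma eps_insert:
  assumes "finite T" "u \<notin> T"
  shows "eps x (insert u T) = (if before u x then - eps x T else eps x T)"
proof -
  have "{w \<in> insert u T. before w x} =
      (if before u x then insert u {w \<in> T. before w x} else {w \<in> T. before w x})" by auto
  then show ?thesis using assms by (simp add: eps_def)
qed

text \<open>Of two distinct vertices exactly one comes before the other, so exactly one of the two
  insertions changes a sign. This is the sign rule behind the vanishing of squared boundaries and
  coboundaries.\<close>

lemma eps_swap:
  assumes "finite T" "x \<noteq> v" "x \<notin> T" "v \<notin> T"
  shows "eps x (insert v T) * eps v T = - (eps v (insert x T) * eps x T)"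
  using assms before_swap[of x v] by (simp add: eps_insert)

lemma eps_Un:
  assumes "finite A" "finite B" "A \<inter> B = {}"
  shows "eps x (A \<union> B) = eps x A * eps x B"
proof -
  have "{w \<in> A \<union> B. before w x} = {w \<in> A. before w x} \<union> {w \<in> B. before w x}" by auto
  moreover have "card \<dots> = card {w \<in> A. before w x} + card {w \<in> B. before w x}"
    using assms by (intro card_Un_disjoint) auto
  ultimately show ?thesis by (simp add: eps_def power_add)
qed

text \<open>Characteristic two is allowed, so \<open>S = - S\<close> would not suffice.\<close>

lemma antisymmetric_sum:
  fixes t :: "'a \<Rightarrow> 'a \<Rightarrow> 'b::ab_group_add"
  assumes "finite A" "\<And>x y. x \<in> A \<Longrightarrow> y \<in> A \<Longrightarrow> x \<noteq> y \<Longrightarrow> t x y = - t y x"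
  shows "(\<Sum>x\<in>A. \<Sum>y\<in>A - {x}. t x y) = 0"
  using assms
proof (induction A)
  case (insert a A)
  have "(\<Sum>y\<in>insert a A - {x}. t x y) = t x a + (\<Sum>y\<in>A - {x}. t x y)" if "x \<in> A" for x
  proof -
    have "insert a A - {x} = insert a (A - {x})" using that insert.hyps by auto
    then show ?thesis using insert.hyps by simp
  qed
  moreover have "insert a A - {a} = A" using insert.hyps by auto
  ultimately have "(\<Sum>x\<in>insert a A. \<Sum>y\<in>insert a A - {x}. t x y) =
      (\<Sum>y\<in>A. t a y) + (\<Sum>x\<in>A. t x a) + (\<Sum>x\<in>A. \<Sum>y\<in>A - {x}. t x y)"
    using insert.hyps by (simp add: sum.distrib add.assoc)
  also have "(\<Sum>y\<in>A. t a y) = (\<Sum>y\<in>A. - t y a)"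
    by (rule sum.cong[OF refl], rule insert.prems) (use insert.hyps in auto)
  also have "(\<Sum>x\<in>A. \<Sum>y\<in>A - {x}. t x y) = 0"
    by (rule insert.IH, rule insert.prems) auto
  finally show ?case by (simp add: sum_negf)
qed simp

section \<open>Cochains, cocycles and reduced cohomology\<close>

definition cplx :: "'v set set \<Rightarrow> bool" where
  "cplx K \<longleftrightarrow> finite K \<and> {} \<in> K \<and> (\<forall>\<sigma>\<in>K. finite \<sigma> \<and> (\<forall>\<tau>. \<tau> \<subseteq> \<sigma> \<longrightarrow> \<tau> \<in> K))"

lemma cplxD:
  assumes "cplx K" shows "finite K" "{} \<in> K" "\<sigma> \<in> K \<Longrightarrow> finite \<sigma>" "\<sigma> \<in> K \<Longrightarrow> \<tau> \<subseteq> \<sigma> \<Longrightarrow> \<tau> \<in> K"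
  using assms by (auto simp: cplx_def)

definition faces :: "'v set set \<Rightarrow> nat \<Rightarrow> 'v set set" where
  "faces K q = {\<sigma> \<in> K. card \<sigma> = q}"

lemma facesD: "\<sigma> \<in> faces K q \<Longrightarrow> \<sigma> \<in> K" "\<sigma> \<in> faces K q \<Longrightarrow> card \<sigma> = q" by (auto simp: faces_def)

lemma finite_faces: "cplx K \<Longrightarrow> finite (faces K q)" by (simp add: faces_def cplx_def)

lemma faces_0: "cplx K \<Longrightarrow> faces K 0 = {{}}" by (auto simp: faces_def cplx_def)

lemma faces_remove:
  assumes "cplx K" "\<sigma> \<in> faces K (Suc q)" "x \<in> \<sigma>" shows "\<sigma> - {x} \<in> faces K q"
  using assms cplxD(3,4)[OF assms(1), of \<sigma>] by (auto simp: faces_def)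

lemma faces_finite: "cplx K \<Longrightarrow> \<sigma> \<in> faces K q \<Longrightarrow> finite \<sigma>"
  using cplxD(3) facesD(1) by metis

definition cob :: "('v set \<Rightarrow> 'f::field) \<Rightarrow> 'v set \<Rightarrow> 'f" where
  "cob c \<sigma> = (\<Sum>x\<in>\<sigma>. eps x (\<sigma> - {x}) * c (\<sigma> - {x}))"

lemma cob_cong: "(\<And>x. x \<in> \<sigma> \<Longrightarrow> c (\<sigma> - {x}) = c' (\<sigma> - {x})) \<Longrightarrow> cob c \<sigma> = cob c' \<sigma>"
  unfolding cob_def by (rule sum.cong) auto

lemma cob_plus: "cob (c + c') \<sigma> = cob c \<sigma> + cob c' \<sigma>" for c c' :: "'v set \<Rightarrow> 'f::field"
  unfolding cob_def sum.distrib[symmetric] by (rule sum.cong[OF refl]) (simp add: distrib_left)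

lemma cob_scale: "cob (fsc r c) \<sigma> = r * cob c \<sigma>" for c :: "'v set \<Rightarrow> 'f::field"
  unfolding cob_def sum_distrib_left by (rule sum.cong[OF refl]) (simp add: fsc_def)

lemma cob_zero: "(\<And>x. x \<in> \<sigma> \<Longrightarrow> c (\<sigma> - {x}) = 0) \<Longrightarrow> cob c \<sigma> = 0"
  by (simp add: cob_def)

lemma cob_cob:
  assumes "finite \<sigma>" shows "cob (cob c) \<sigma> = 0"
proof -
  define t where "t x y = eps x (\<sigma> - {x}) * eps y (\<sigma> - {x} - {y}) * c (\<sigma> - {x} - {y})" for x y
  have "cob (cob c) \<sigma> = (\<Sum>x\<in>\<sigma>. \<Sum>y\<in>\<sigma> - {x}. t x y)"
    unfolding cob_def t_def by (simp add: sum_distrib_left mult.assoc)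
  also have "\<dots> = 0"
  proof (rule antisymmetric_sum[OF assms])
    fix x y assume xy: "x \<in> \<sigma>" "y \<in> \<sigma>" "x \<noteq> y"
    let ?T = "\<sigma> - {x} - {y}"
    have 1: "\<sigma> - {x} = insert y ?T" "\<sigma> - {y} = insert x ?T" "\<sigma> - {y} - {x} = ?T" using xy by auto
    have "eps x (insert y ?T) * eps y ?T = - (eps y (insert x ?T) * eps x ?T :: 'b)"
      by (rule eps_swap) (use assms xy in auto)
    then show "t x y = - t y x" unfolding t_def 1(3) by (simp only: 1(1,2)[symmetric]) simp
  qed
  finally show ?thesis .
qed

definition cocyc :: "'v set set \<Rightarrow> nat \<Rightarrow> ('v set \<Rightarrow> 'f::field) set" where
  "cocyc K q = {c \<in> fun_on (faces K q). \<forall>\<sigma>\<in>faces K (Suc q). cob c \<sigma> = 0}"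

definition zdim :: "'f::field itself \<Rightarrow> 'v set set \<Rightarrow> nat \<Rightarrow> nat" where
  "zdim _ K q = ff.dim (cocyc K q :: ('v set \<Rightarrow> 'f) set)"

definition fnum :: "'v set set \<Rightarrow> nat \<Rightarrow> nat" where "fnum K q = card (faces K q)"

text \<open>The dimension of the reduced cohomology in degree \<open>q - 1\<close>, indexed by the size \<open>q\<close> of the
  faces.\<close>

definition hdim :: "'f::field itself \<Rightarrow> 'v set set \<Rightarrow> nat \<Rightarrow> int" where
  "hdim F K q = int (zdim F K q) + (case q of 0 \<Rightarrow> 0 | Suc p \<Rightarrow> int (zdim F K p) - int (fnum K p))"

lemma cocycI: "c \<in> fun_on (faces K q) \<Longrightarrow> (\<And>\<sigma>. \<sigma> \<in> faces K (Suc q) \<Longrightarrow> cob c \<sigma> = 0) \<Longrightarrow> c \<in> cocyc K q"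
  by (simp add: cocyc_def)

lemma cocycD: "c \<in> cocyc K q \<Longrightarrow> c \<in> fun_on (faces K q)"
  "c \<in> cocyc K q \<Longrightarrow> \<sigma> \<in> faces K (Suc q) \<Longrightarrow> cob c \<sigma> = 0"
  by (auto simp: cocyc_def)

lemma fun_onI: "(\<And>x. x \<notin> X \<Longrightarrow> c x = 0) \<Longrightarrow> c \<in> fun_on X" by (auto simp: fun_on_def)

lemma subspace_cocyc [simp]: "ff.subspace (cocyc K q)"
proof (rule ff.subspaceI)
  show "0 \<in> cocyc K q" by (intro cocycI fun_onI cob_zero) auto
  fix c c' :: "'b set \<Rightarrow> 'a" and r assume c: "c \<in> cocyc K q"
  show "fsc r c \<in> cocyc K q"
    by (rule cocycI[OF ff.subspace_scale[OF subspace_fun_on cocycD(1)[OF c]]]) (simp add: cob_scale cocycD(2)[OF c])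
  assume c': "c' \<in> cocyc K q"
  show "c + c' \<in> cocyc K q"
    by (rule cocycI[OF ff.subspace_add[OF subspace_fun_on cocycD(1)[OF c] cocycD(1)[OF c']]])
      (simp add: cob_plus cocycD(2)[OF c] cocycD(2)[OF c'])
qed

lemma fin_dim_cocyc: "cplx K \<Longrightarrow> fin_dim fsc (cocyc K q)"
  by (rule fun_on_fin_dim_subset[OF finite_faces]) (auto simp: cocyc_def)

definition cobK :: "'v set set \<Rightarrow> nat \<Rightarrow> ('v set \<Rightarrow> 'f::field) \<Rightarrow> 'v set \<Rightarrow> 'f" where
  "cobK K q b = (\<lambda>\<sigma>. if \<sigma> \<in> faces K (Suc q) then cob b \<sigma> else 0)"

lemma cobK_in_cocyc:
  assumes "cplx K" shows "cobK K q b \<in> cocyc K (Suc q)"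
proof (intro cocycI fun_onI)
  fix \<sigma> assume \<sigma>: "\<sigma> \<in> faces K (Suc (Suc q))"
  have "cob (cobK K q b) \<sigma> = cob (cob b) \<sigma>"
    by (rule cob_cong) (simp add: cobK_def faces_remove[OF assms \<sigma>])
  then show "cob (cobK K q b) \<sigma> = 0" using cob_cob faces_finite[OF assms \<sigma>] by metis
qed (simp add: cobK_def)

lemma lin_on_cobK: "lin_on fsc fsc (fun_on (faces K q)) (cobK K q)"
  unfolding lin_on_def
  by (intro conjI ballI allI subspace_fun_on) (auto simp: cobK_def fun_eq_iff cob_plus cob_scale fsc_apply)

text \<open>This justifies the subtraction in \<open>hdim\<close>: coboundaries have dimension
  \<open>fnum - zdim\<close>, taken one size lower.\<close>

lemma dim_coboundaries:
  fixes K :: "'v set set"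
  assumes "cplx K"
  shows "ff.dim (cobK K q ` fun_on (faces K q) :: ('v set \<Rightarrow> 'f::field) set) + zdim TYPE('f) K q = fnum K q"
proof -
  have "{b \<in> fun_on (faces K q). cobK K q b = 0} = (cocyc K q :: ('v set \<Rightarrow> 'f) set)"
    by (auto simp: cocyc_def cobK_def fun_eq_iff)
  then show ?thesis
    using ff2.rank_nullity_on[OF lin_on_cobK[where 'a='f, of K q] fun_on_dim(2)[OF finite_faces[OF assms]]]
    by (simp add: zdim_def fnum_def fun_on_dim(1)[OF finite_faces[OF assms]])
qed

lemma cocyc_0:
  assumes "cplx K" "c \<in> cocyc K 0" "{x} \<in> K" shows "c = 0"
proof -
  have "cob c {x} = 0" using assms by (intro cocycD(2)) (auto simp: faces_def)
  then have "c {} = 0" by (simp add: cob_def)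
  moreover have "c \<in> fun_on {{}}" using cocycD(1)[OF assms(2)] faces_0[OF assms(1)] by simp
  ultimately show ?thesis by (metis ext fun_onD singletonD zero_fun_apply)
qed

lemma zdim_0:
  assumes "cplx K" shows "zdim TYPE('f::field) K 0 = (if K = {{}} then 1 else 0)"
proof (cases "K = {{}}")
  case True
  have "cocyc K 0 = (fun_on {{}} :: ('a set \<Rightarrow> 'f) set)"
    using faces_0[OF assms] by (auto simp: cocyc_def faces_def True)
  then show ?thesis using True by (simp add: zdim_def fun_on_dim)
next
  case False
  then obtain \<sigma> x where "\<sigma> \<in> K" "x \<in> \<sigma>" using cplxD(2)[OF assms] by blast
  then have "{x} \<in> K" using cplxD(4)[OF assms] by blast
  then have "cocyc K 0 = {0 :: 'a set \<Rightarrow> 'f}"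
    using cocyc_0[OF assms] ff.subspace_0[OF subspace_cocyc] by blast
  then show ?thesis using False by (simp add: zdim_def)
qed

lemma hdim_0: "cplx K \<Longrightarrow> hdim TYPE('f::field) K 0 = (if K = {{}} then 1 else 0)"
  by (simp add: hdim_def zdim_0)

subsection \<open>Cones and suspensions\<close>

definition cone :: "'v \<Rightarrow> 'v set set \<Rightarrow> 'v set set" where
  "cone w K = K \<union> insert w ` K"

text \<open>On faces containing \<open>w\<close> a cochain is described by its twisted link part, on which the
  coboundary of the attached complex becomes the ordinary one up to a global sign.\<close>

definition link_part :: "'v \<Rightarrow> 'v set set \<Rightarrow> nat \<Rightarrow> ('v set \<Rightarrow> 'f::field) \<Rightarrow> 'v set \<Rightarrow> 'f" where
  "link_part w K q c = (\<lambda>\<sigma>. if \<sigma> \<in> faces K q then eps w \<sigma> * c (insert w \<sigma>) else 0)"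

lemma link_part_fun_on: "link_part w K q c \<in> fun_on (faces K q)"
  by (simp add: link_part_def fun_on_def)

text \<open>The summand for \<open>w\<close> yields \<open>c \<sigma>\<close>, and in every other
  summand \<open>eps_swap\<close> pulls out the sign of \<open>w\<close>. Hence \<open>c\<close>
  satisfies the cocycle condition at a new face exactly if on the base it is the coboundary of its
  own link part.\<close>

lemma cob_insert:
  assumes "cplx K" "w \<notin> \<Union>K" "\<sigma> \<in> faces K (Suc q)"
  shows "cob c (insert w \<sigma>) = eps w \<sigma> * (c \<sigma> - cob (link_part w K q c) \<sigma>)"
proof -
  have w: "w \<notin> \<sigma>" and f: "finite \<sigma>" using assms facesD(1) faces_finite by blast+
  have "cob c (insert w \<sigma>) = eps w \<sigma> * c \<sigma> + (\<Sum>x\<in>\<sigma>. eps x (insert w \<sigma> - {x}) * c (insert w \<sigma> - {x}))"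
    unfolding cob_def using w f by simp
  also have "(\<Sum>x\<in>\<sigma>. eps x (insert w \<sigma> - {x}) * c (insert w \<sigma> - {x})) =
      (\<Sum>x\<in>\<sigma>. - (eps w \<sigma> * (eps x (\<sigma> - {x}) * link_part w K q c (\<sigma> - {x}))))"
  proof (rule sum.cong[OF refl])
    fix x assume x: "x \<in> \<sigma>"
    let ?r = "\<sigma> - {x}"
    have e: "insert w \<sigma> - {x} = insert w ?r" "insert x ?r = \<sigma>" using x w by auto
    have "eps x (insert w ?r) * eps w ?r = - (eps w (insert x ?r) * eps x ?r :: 'b)"
      by (rule eps_swap) (use x w f in auto)
    then have "eps x (insert w ?r) * (eps w ?r * eps w ?r) = - (eps w \<sigma> * eps x ?r * eps w ?r :: 'b)"
      by (simp only: e mult.assoc[symmetric]) simp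
    then have s: "eps x (insert w ?r) = - (eps w \<sigma> * eps x ?r * eps w ?r :: 'b)"
      by (simp add: eps_square)
    show "eps x (insert w \<sigma> - {x}) * c (insert w \<sigma> - {x}) =
        - (eps w \<sigma> * (eps x ?r * link_part w K q c ?r))"
      unfolding e(1) s using faces_remove[OF assms(1,3) x] by (simp add: link_part_def mult.assoc)
  qed
  also have "\<dots> = - (eps w \<sigma> * cob (link_part w K q c) \<sigma>)"
    by (simp add: cob_def sum_negf sum_distrib_left)
  finally show ?thesis by (simp add: algebra_simps)
qed

lemma faces_attach:
  assumes "cplx L" "cplx K" "K \<subseteq> L" "w \<notin> \<Union>L"
  shows "faces (L \<union> insert w ` K) (Suc q) = faces L (Suc q) \<union> insert w ` faces K q"
proof -
  have "card (insert w \<sigma>) = Suc (card \<sigma>)" if "\<sigma> \<in> K" for \<sigma>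
    using that assms cplxD(3)[OF assms(2)] by (subst card_insert_disjoint) auto
  then show ?thesis by (auto simp: faces_def)
qed

lemma cplx_attach:
  assumes "cplx L" "cplx K" "K \<subseteq> L"
  shows "cplx (L \<union> insert w ` K)"
proof -
  have "\<tau> \<in> L \<union> insert w ` K" if "\<sigma> \<in> K" "\<tau> \<subseteq> insert w \<sigma>" for \<sigma> \<tau>
  proof (cases "w \<in> \<tau>")
    case True
    have "\<tau> - {w} \<in> K" using that cplxD(4)[OF assms(2) that(1)] by blast
    then show ?thesis using True by (metis UnI2 image_eqI insert_Diff)
  next
    case False
    then have "\<tau> \<subseteq> \<sigma>" using that by blast
    then show ?thesis using cplxD(4)[OF assms(2) that(1)] assms(3) by blast
  qed
  then show ?thesis using assms unfolding cplx_def by auto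
qed

text \<open>A cochain on the enlarged complex amounts to its restriction \<open>a\<close> to
  \<open>L\<close> and its link part \<open>b\<close> on \<open>K\<close>. It is a cocycle if
  \<open>a\<close> is one and \<open>a\<close> agrees with the coboundary of \<open>b\<close> on
  \<open>K\<close>. Forgetting \<open>b\<close> has as image the cocycles \<open>a\<close> that
  become coboundaries over \<open>K\<close>, and as kernel the cocycles \<open>b\<close> of
  \<open>K\<close>.\<close>

lemma zdim_attach:
  fixes K L :: "'v set set"
  assumes "cplx L" "cplx K" "K \<subseteq> L" "w \<notin> \<Union>L"
  shows "zdim TYPE('f::field) (L \<union> insert w ` K) (Suc q) = zdim TYPE('f) K q +
    ff.dim {a \<in> cocyc L (Suc q) :: ('v set \<Rightarrow> 'f) set.
      \<exists>b\<in>fun_on (faces K q). \<forall>\<sigma>\<in>faces K (Suc q). a \<sigma> = cob b \<sigma>}"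
proof -
  let ?M = "L \<union> insert w ` K"
  let ?I = "{a \<in> cocyc L (Suc q) :: ('v set \<Rightarrow> 'f) set. \<exists>b\<in>fun_on (faces K q). \<forall>\<sigma>\<in>faces K (Suc q). a \<sigma> = cob b \<sigma>}"
  have M: "cplx ?M" by (rule cplx_attach) fact+
  have wK: "w \<notin> \<Union>K" using assms by blast
  have fM: "faces ?M (Suc p) = faces L (Suc p) \<union> insert w ` faces K p" for p by (rule faces_attach) fact+
  have wL: "w \<notin> \<sigma>" if "\<sigma> \<in> faces L p" for \<sigma> p using that assms(4) facesD(1) by blast
  have wK': "w \<notin> \<sigma>" if "\<sigma> \<in> faces K p" for \<sigma> p using that wK facesD(1) by blast
  \<comment> \<open>The inverse construction: \<open>mk a b\<close> is the cochain with restriction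
    \<open>a\<close> and link part \<open>b\<close>. The sign \<open>eps\<close> undoes the twist in
    \<open>link_part\<close>.\<close>
  define mk :: "('v set \<Rightarrow> 'f) \<Rightarrow> ('v set \<Rightarrow> 'f) \<Rightarrow> 'v set \<Rightarrow> 'f"
    where "mk a b \<sigma> = (if w \<in> \<sigma> then eps w (\<sigma> - {w}) * b (\<sigma> - {w}) else a \<sigma>)" for a b \<sigma>
  have mk_fun: "mk a b \<in> fun_on (faces ?M (Suc q))"
    if a: "a \<in> fun_on (faces L (Suc q))" and b: "b \<in> fun_on (faces K q)" for a b
  proof (rule fun_onI)
    fix \<sigma> assume *: "\<sigma> \<notin> faces ?M (Suc q)"
    show "mk a b \<sigma> = 0"
    proof (cases "w \<in> \<sigma>")
      case True
      then have "\<sigma> - {w} \<notin> faces K q" using * fM by (metis UnI2 image_eqI insert_Diff)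
      then show ?thesis using True fun_onD[OF b] by (simp add: mk_def)
    next
      case False then show ?thesis using * fM fun_onD[OF a] by (simp add: mk_def)
    qed
  qed
  have mk_link: "link_part w K q (mk a b) = b" if "b \<in> fun_on (faces K q)" for a b
  proof
    fix \<sigma> show "link_part w K q (mk a b) \<sigma> = b \<sigma>"
      using wK'[of \<sigma> q] fun_onD[OF that, of \<sigma>] by (auto simp: link_part_def mk_def eps_square_left)
  qed
  have mk_L: "cob (mk a b) \<sigma> = cob a \<sigma>" if "w \<notin> \<sigma>" for a b \<sigma>
    by (rule cob_cong) (use that in \<open>auto simp: mk_def\<close>)
  have mk_cocyc: "mk a b \<in> cocyc ?M (Suc q)"
    if a: "a \<in> cocyc L (Suc q)" and b: "b \<in> fun_on (faces K q)" and ab: "\<forall>\<sigma>\<in>faces K (Suc q). a \<sigma> = cob b \<sigma>" for a b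
  proof (rule cocycI)
    show "mk a b \<in> fun_on (faces ?M (Suc q))" by (rule mk_fun) (use a b cocycD in auto)
    fix \<sigma> assume "\<sigma> \<in> faces ?M (Suc (Suc q))"
    then consider "\<sigma> \<in> faces L (Suc (Suc q))" | \<rho> where "\<sigma> = insert w \<rho>" "\<rho> \<in> faces K (Suc q)"
      using fM by blast
    then show "cob (mk a b) \<sigma> = 0"
    proof cases
      case 1 then show ?thesis using mk_L[OF wL[OF 1]] cocycD(2)[OF a] by simp
    next
      case 2
      have "mk a b \<rho> = a \<rho>" using wK'[OF 2(2)] by (simp add: mk_def)
      then show ?thesis using cob_insert[OF assms(2) wK 2(2), of "mk a b"] 2 mk_link[OF b] ab by simp
    qed
  qed
  define r :: "('v set \<Rightarrow> 'f) \<Rightarrow> 'v set \<Rightarrow> 'f" where "r c = (\<lambda>\<sigma>. if w \<in> \<sigma> then 0 else c \<sigma>)" for c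
  have lin: "lin_on fsc fsc (cocyc ?M (Suc q)) r"
    unfolding lin_on_def by (intro conjI ballI allI subspace_cocyc) (auto simp: r_def fun_eq_iff fsc_apply)
  have im: "r ` cocyc ?M (Suc q) = ?I"
  proof (intro equalityI subsetI)
    fix a assume "a \<in> r ` cocyc ?M (Suc q)"
    then obtain c where c: "c \<in> cocyc ?M (Suc q)" "a = r c" by blast
    have "a \<in> cocyc L (Suc q)"
    proof (intro cocycI fun_onI)
      fix \<sigma> assume "\<sigma> \<notin> faces L (Suc q)"
      then have "w \<notin> \<sigma> \<Longrightarrow> \<sigma> \<notin> faces ?M (Suc q)" using fM by auto
      then show "a \<sigma> = 0" using c fun_onD[OF cocycD(1)] by (auto simp: r_def)
    next
      fix \<sigma> assume \<sigma>: "\<sigma> \<in> faces L (Suc (Suc q))"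
      have "cob a \<sigma> = cob c \<sigma>" by (rule cob_cong) (use wL[OF \<sigma>] c in \<open>auto simp: r_def\<close>)
      then show "cob a \<sigma> = 0" using cocycD(2)[OF c(1)] \<sigma> fM by auto
    qed
    moreover have "a \<sigma> = cob (link_part w K q c) \<sigma>" if \<sigma>: "\<sigma> \<in> faces K (Suc q)" for \<sigma>
    proof -
      have "cob c (insert w \<sigma>) = 0" using cocycD(2)[OF c(1)] \<sigma> fM by blast
      then show ?thesis using cob_insert[OF assms(2) wK \<sigma>, of c] wK'[OF \<sigma>] c by (simp add: r_def)
    qed
    ultimately show "a \<in> ?I"
      by (intro CollectI conjI bexI[OF _ link_part_fun_on[of w K q c]] ballI)
  next
    fix a assume "a \<in> ?I"
    then obtain b where a: "a \<in> cocyc L (Suc q)" and b: "b \<in> fun_on (faces K q)" "\<forall>\<sigma>\<in>faces K (Suc q). a \<sigma> = cob b \<sigma>" by blast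
    have "r (mk a b) = a"
    proof
      fix \<sigma> show "r (mk a b) \<sigma> = a \<sigma>"
        using wL[of \<sigma> "Suc q"] fun_onD[OF cocycD(1)[OF a], of \<sigma>] by (auto simp: r_def mk_def)
    qed
    then show "a \<in> r ` cocyc ?M (Suc q)" using mk_cocyc[OF a b] by (metis image_eqI)
  qed
  let ?N = "{c \<in> cocyc ?M (Suc q). r c = 0}"
  have zeroL: "(0 :: 'v set \<Rightarrow> 'f) \<in> cocyc L (Suc q)" by (rule ff.subspace_0) simp
  have lin': "lin_on fsc fsc (cocyc K q) (mk 0)"
    unfolding lin_on_def by (intro conjI ballI allI subspace_cocyc) (auto simp: mk_def fun_eq_iff fsc_apply algebra_simps)
  have im': "mk 0 ` cocyc K q = ?N"
  proof (intro equalityI subsetI)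
    fix c assume "c \<in> mk 0 ` cocyc K q"
    then obtain b where b: "b \<in> cocyc K q" "c = mk 0 b" by blast
    have "mk 0 b \<in> cocyc ?M (Suc q)" by (rule mk_cocyc[OF zeroL]) (use b cocycD in auto)
    moreover have "r (mk 0 b) = 0" by (simp add: r_def mk_def fun_eq_iff)
    ultimately show "c \<in> ?N" using b(2) by simp
  next
    fix c assume c: "c \<in> ?N"
    let ?b = "link_part w K q c"
    have "r c = 0" using c by blast
    then have "r c \<sigma> = 0" for \<sigma> by simp
    then have r0: "c \<sigma> = 0" if "w \<notin> \<sigma>" for \<sigma> using that unfolding r_def by metis
    have "?b \<in> cocyc K q"
    proof (rule cocycI[OF link_part_fun_on])
      fix \<sigma> assume \<sigma>: "\<sigma> \<in> faces K (Suc q)"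
      have "cob c (insert w \<sigma>) = 0" using c \<sigma> fM cocycD(2) by blast
      then show "cob ?b \<sigma> = 0" using cob_insert[OF assms(2) wK \<sigma>, of c] r0[OF wK'[OF \<sigma>]] by simp
    qed
    moreover have "c = mk 0 ?b"
    proof
      fix \<sigma> show "c \<sigma> = mk 0 ?b \<sigma>"
      proof (cases "w \<in> \<sigma>")
        case True
        then have i: "insert w (\<sigma> - {w}) = \<sigma>" by blast
        show ?thesis
        proof (cases "\<sigma> - {w} \<in> faces K q")
          case in1: True then show ?thesis using True i by (simp add: mk_def link_part_def eps_square_left)
        next
          case False
          have "\<sigma> \<notin> faces L (Suc q)" using wL True by blast
          moreover have "\<sigma> \<notin> insert w ` faces K q"
          proof
            assume "\<sigma> \<in> insert w ` faces K q"
            then obtain \<rho> where "\<sigma> = insert w \<rho>" "\<rho> \<in> faces K q" by blast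
            then show False using False wK' by (metis Diff_insert_absorb)
          qed
          ultimately have "\<sigma> \<notin> faces ?M (Suc q)" using fM by blast
          then have "c \<sigma> = 0" using c fun_onD[OF cocycD(1)] by blast
          then show ?thesis using True False by (simp add: mk_def link_part_def)
        qed
      qed (simp add: r0 mk_def)
    qed
    ultimately show "c \<in> mk 0 ` cocyc K q" by blast
  qed
  have "b = 0" if "b \<in> cocyc K q" "mk 0 b = 0" for b
  proof
    fix \<sigma> show "b \<sigma> = 0 \<sigma>"
      using fun_cong[OF mk_link[OF cocycD(1)[OF that(1)], of 0], of \<sigma>] unfolding that(2)
      by (simp add: link_part_def split: if_splits)
  qed
  then have "zdim TYPE('f) K q = ff.dim ?N"
    unfolding zdim_def by (intro ff2.dim_bij_on[OF lin' fin_dim_cocyc[OF assms(2)] _ im'])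
  then show ?thesis
    using ff2.rank_nullity_on[OF lin fin_dim_cocyc[OF M]] unfolding im by (simp add: zdim_def)
qed

lemma cplx_cone: "cplx K \<Longrightarrow> cplx (cone w K)"
  unfolding cone_def by (rule cplx_attach) auto

text \<open>With \<open>L = K\<close> the extendable \<open>a\<close> are the coboundaries of
  \<open>K\<close>, and their dimension together with that of the cocycles is the number of
  faces.\<close>

lemma zdim_cone:
  fixes K :: "'v set set"
  assumes "cplx K" "w \<notin> \<Union>K"
  shows "zdim TYPE('f::field) (cone w K) (Suc q) = fnum K q"
proof -
  have "{a \<in> cocyc K (Suc q) :: ('v set \<Rightarrow> 'f) set. \<exists>b\<in>fun_on (faces K q). \<forall>\<sigma>\<in>faces K (Suc q). a \<sigma> = cob b \<sigma>}
      = cobK K q ` fun_on (faces K q)" (is "?A = ?B")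
  proof
    show "?B \<subseteq> ?A" using cobK_in_cocyc[OF assms(1)] by (auto simp: cobK_def)
    show "?A \<subseteq> ?B"
    proof
      fix a assume "a \<in> ?A"
      then obtain b where b: "a \<in> cocyc K (Suc q)" "b \<in> fun_on (faces K q)" "\<forall>\<sigma>\<in>faces K (Suc q). a \<sigma> = cob b \<sigma>" by blast
      have "a = cobK K q b" using b(3) fun_onD[OF cocycD(1)[OF b(1)]] by (auto simp: cobK_def)
      then show "a \<in> ?B" using b(2) by blast
    qed
  qed
  then show ?thesis unfolding cone_def
    using zdim_attach[OF assms(1,1) order_refl assms(2), where 'f='f, of q] dim_coboundaries[OF assms(1), where 'f='f, of q] by simp
qed

text \<open>Acyclicity of a cone in explicit form: on the base, every cocycle has its link part at
  the apex as a primitive.\<close>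

lemma cocyc_cone_base:
  assumes "cplx K" "w \<notin> \<Union>K" "a \<in> cocyc (cone w K) (Suc q)" "\<sigma> \<in> faces K (Suc q)"
  shows "a \<sigma> = cob (link_part w K q a) \<sigma>"
proof -
  have "insert w \<sigma> \<in> faces (cone w K) (Suc (Suc q))"
    unfolding cone_def using faces_attach[OF assms(1,1) order_refl assms(2)] assms(4) by blast
  then show ?thesis using cob_insert[OF assms(1,2,4), of a] cocycD(2)[OF assms(3)] by simp
qed

text \<open>At the second cone point the condition of \<open>zdim_attach\<close> is automatic, since
  on the base every cocycle of the first cone is a coboundary.\<close>

lemma zdim_suspension:
  fixes K :: "'v set set"
  assumes "cplx K" "v \<notin> \<Union>K" "w \<notin> \<Union>K" "v \<noteq> w"
  shows "zdim TYPE('f::field) (cone v K \<union> insert w ` K) (Suc q) = fnum K q + zdim TYPE('f) K q"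
proof -
  have "{a \<in> cocyc (cone v K) (Suc q) :: ('v set \<Rightarrow> 'f) set. \<exists>b\<in>fun_on (faces K q). \<forall>\<sigma>\<in>faces K (Suc q). a \<sigma> = cob b \<sigma>}
      = cocyc (cone v K) (Suc q)"
  proof (intro equalityI subsetI)
    fix a :: "'v set \<Rightarrow> 'f" assume a: "a \<in> cocyc (cone v K) (Suc q)"
    show "a \<in> {a \<in> cocyc (cone v K) (Suc q). \<exists>b\<in>fun_on (faces K q). \<forall>\<sigma>\<in>faces K (Suc q). a \<sigma> = cob b \<sigma>}"
      by (intro CollectI conjI a bexI[OF _ link_part_fun_on[of v K q a]] ballI cocyc_cone_base[OF assms(1,2) a])
  qed blast
  moreover have "w \<notin> \<Union>(cone v K)" using assms by (auto simp: cone_def)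
  ultimately show ?thesis
    using zdim_attach[OF cplx_cone[OF assms(1)] assms(1), where 'f='f, of v w q] zdim_cone[OF assms(1,2), where 'f='f, of q]
    by (simp add: zdim_def cone_def)
qed

lemma fnum_attach:
  assumes "cplx L" "cplx K" "K \<subseteq> L" "w \<notin> \<Union>L"
  shows "fnum (L \<union> insert w ` K) (Suc q) = fnum L (Suc q) + fnum K q"
proof -
  have inj: "inj_on (insert w) (faces K q)"
    using assms(3,4) by (intro inj_onI) (metis UnionI facesD(1) insert_ident subsetD)
  have "faces L (Suc q) \<inter> insert w ` faces K q = {}" using assms(4) facesD(1) by fastforce
  then show ?thesis unfolding fnum_def faces_attach[OF assms]
    using finite_faces[OF assms(1)] finite_faces[OF assms(2)] card_image[OF inj] by (subst card_Un_disjoint) auto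
qed

lemma fnum_0: "cplx K \<Longrightarrow> fnum K 0 = 1" by (simp add: fnum_def faces_0)

lemma zdim_0_attach:
  assumes "cplx L" "cplx K" "K \<subseteq> L"
  shows "zdim TYPE('f::field) (L \<union> insert w ` K) 0 = 0"
proof -
  have "{w} \<in> L \<union> insert w ` K" using cplxD(2)[OF assms(2)] by blast
  then have "L \<union> insert w ` K \<noteq> {{}}" by (metis insert_not_empty singletonD)
  then show ?thesis by (subst zdim_0[OF cplx_attach[OF assms]]) simp
qed

lemma hdim_cone:
  assumes "cplx K" "w \<notin> \<Union>K"
  shows "hdim TYPE('f::field) (cone w K) q = 0"
proof -
  have z: "zdim TYPE('f) (cone w K) (Suc p) = fnum K p" for p by (rule zdim_cone[OF assms])
  have z0: "zdim TYPE('f) (cone w K) 0 = 0"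
    unfolding cone_def by (rule zdim_0_attach[OF assms(1,1) order_refl])
  have f: "fnum (cone w K) (Suc p) = fnum K (Suc p) + fnum K p" for p
    unfolding cone_def by (rule fnum_attach[OF assms(1,1) order_refl assms(2)])
  note f0 = fnum_0[OF cplx_cone[OF assms(1)]] fnum_0[OF assms(1)]
  show ?thesis
  proof (cases q)
    case (Suc p) then show ?thesis by (cases p) (simp_all add: hdim_def z z0 f f0)
  qed (simp add: hdim_def z0)
qed

text \<open>The face numbers of neighbouring sizes cancel. Size 1 is treated apart, as
  \<open>zdim\<close> at size 0 does not follow the general pattern.\<close>

lemma hdim_suspension:
  assumes "cplx K" "v \<notin> \<Union>K" "w \<notin> \<Union>K" "v \<noteq> w"
  shows "hdim TYPE('f::field) (cone v K \<union> insert w ` K) q = (case q of 0 \<Rightarrow> 0 | Suc p \<Rightarrow> hdim TYPE('f) K p)"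
proof -
  let ?L = "cone v K"
  have L: "cplx ?L" by (rule cplx_cone[OF assms(1)])
  have L': "K \<subseteq> ?L" "w \<notin> \<Union>?L" using assms by (auto simp: cone_def)
  have z: "zdim TYPE('f) (?L \<union> insert w ` K) (Suc p) = fnum K p + zdim TYPE('f) K p" for p
    by (rule zdim_suspension[OF assms])
  have z0: "zdim TYPE('f) (?L \<union> insert w ` K) 0 = 0" by (rule zdim_0_attach[OF L assms(1) L'(1)])
  have f: "fnum (?L \<union> insert w ` K) (Suc p) = fnum K (Suc p) + 2 * fnum K p" for p
  proof -
    have "fnum ?L (Suc p) = fnum K (Suc p) + fnum K p"
      unfolding cone_def by (rule fnum_attach[OF assms(1,1) order_refl assms(2)])
    then show ?thesis unfolding fnum_attach[OF L assms(1) L'] by simp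
  qed
  note f0 = fnum_0[OF cplx_attach[OF L assms(1) L'(1)]] fnum_0[OF assms(1)]
  show ?thesis
  proof (cases q)
    case (Suc p) then show ?thesis by (cases p) (simp_all add: hdim_def z z0 f f0)
  qed (simp add: hdim_def z0)
qed

subsection \<open>Gluing along a simplex\<close>

lemma cplx_Pow: "finite \<tau> \<Longrightarrow> cplx (Pow \<tau>)"
  by (auto simp: cplx_def dest: finite_subset)

lemma Pow_cone: assumes "v \<in> \<tau>" shows "Pow \<tau> = cone v (Pow (\<tau> - {v}))"
proof -
  have "Pow (insert v (\<tau> - {v})) = cone v (Pow (\<tau> - {v}))" unfolding cone_def by (rule Pow_insert)
  then show ?thesis by (simp only: insert_Diff[OF assms])
qed

text \<open>The excluded case is the complex with the empty face alone, whose reduced cohomology in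
  degree -1 has dimension 1. A nonempty simplex is a cone.\<close>

lemma hdim_Pow:
  fixes \<tau> :: "'v set"
  assumes "finite \<tau>" "q > 0 \<or> \<tau> \<noteq> {}"
  shows "hdim TYPE('f::field) (Pow \<tau>) q = 0"
proof (cases "\<tau> = {}")
  case True
  have p: "cplx (Pow {} :: 'v set set)" by (rule cplx_Pow) simp
  obtain p where q: "q = Suc p" using True assms(2) by (cases q) auto
  have e: "faces {{} :: 'v set} (Suc p) = {}" for p by (auto simp: faces_def)
  have z: "zdim TYPE('f) {{} :: 'v set} (Suc p) = 0" for p
  proof -
    have "cocyc {{}} (Suc p) = {0 :: 'v set \<Rightarrow> 'f}"
      by (auto simp: cocyc_def e fun_on_def fun_eq_iff)
    then show ?thesis by (simp add: zdim_def)
  qed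
  show ?thesis
  proof (cases p)
    case 0 then show ?thesis using True q z zdim_0[OF p, where 'f='f] fnum_0[OF p] by (simp add: hdim_def)
  next
    case (Suc p') then show ?thesis using True q z by (simp add: hdim_def fnum_def e)
  qed
next
  case False
  then obtain v where v: "v \<in> \<tau>" by blast
  have "cplx (Pow (\<tau> - {v}))" by (rule cplx_Pow) (use assms(1) in simp)
  then show ?thesis unfolding Pow_cone[OF v] by (rule hdim_cone) simp
qed

text \<open>The primitive is the link part at \<open>v\<close>. At a face through \<open>v\<close>
  only the summand deleting \<open>v\<close> survives; at the others the cone argument
  applies.\<close>

lemma Pow_exact:
  fixes a :: "'v set \<Rightarrow> 'f::field"
  assumes "finite \<tau>" "v \<in> \<tau>" "a \<in> cocyc (Pow \<tau>) (Suc q)"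
  shows "\<exists>b. b \<in> fun_on (faces (Pow \<tau>) q) \<and> (\<forall>\<sigma>\<in>faces (Pow \<tau>) (Suc q). a \<sigma> = cob b \<sigma>)"
proof (intro exI conjI ballI)
  let ?K = "Pow (\<tau> - {v})"
  have K: "cplx ?K" "v \<notin> \<Union>?K" using assms cplx_Pow[of "\<tau> - {v}"] by auto
  let ?b = "link_part v ?K q a"
  show "?b \<in> fun_on (faces (Pow \<tau>) q)" by (auto simp: link_part_def fun_on_def faces_def split: if_splits)
  fix \<sigma> assume \<sigma>: "\<sigma> \<in> faces (Pow \<tau>) (Suc q)"
  show "a \<sigma> = cob ?b \<sigma>"
  proof (cases "v \<in> \<sigma>")
    case False
    then have "\<sigma> \<in> faces ?K (Suc q)" using \<sigma> by (auto simp: faces_def)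
    then show ?thesis using cocyc_cone_base[OF K] assms(3) Pow_cone[OF assms(2)] by metis
  next
    case True
    have fin: "finite \<sigma>" using \<sigma> assms(1) by (auto simp: faces_def dest: finite_subset)
    have "cob ?b \<sigma> = (\<Sum>x\<in>\<sigma>. if x = v then a \<sigma> else 0)"
      unfolding cob_def
    proof (rule sum.cong[OF refl])
      fix x assume x: "x \<in> \<sigma>"
      show "eps x (\<sigma> - {x}) * ?b (\<sigma> - {x}) = (if x = v then a \<sigma> else 0)"
      proof (cases "x = v")
        case True
        have "\<sigma> - {v} \<in> faces ?K q" using \<sigma> \<open>v \<in> \<sigma>\<close> fin by (auto simp: faces_def)
        then show ?thesis using True x by (simp add: link_part_def eps_square_left insert_absorb)
      next
        case False
        then have "\<sigma> - {x} \<notin> faces ?K q" using \<open>v \<in> \<sigma>\<close> by (auto simp: faces_def)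
        then show ?thesis using False by (simp add: link_part_def)
      qed
    qed
    then show ?thesis using True fin by simp
  qed
qed

text \<open>A primitive on the simplex is also a cochain of \<open>A\<close>, and its coboundary
  there is the extension. For the empty simplex and \<open>q = 0\<close> this fails: a nonzero value
  on the empty face does not extend to a cocycle as soon as \<open>A\<close> has a vertex.\<close>

lemma cocyc_Pow_extend:
  fixes a :: "'v set \<Rightarrow> 'f::field"
  assumes "cplx A" "Pow \<tau> \<subseteq> A" "a \<in> cocyc (Pow \<tau>) q" "q > 0 \<or> \<tau> \<noteq> {}"
  shows "\<exists>a'\<in>cocyc A q. \<forall>\<sigma>\<in>Pow \<tau>. a' \<sigma> = a \<sigma>"
proof -
  have fin: "finite \<tau>" using assms cplxD(3) by blast
  show ?thesis
  proof (cases "a = 0")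
    case True then show ?thesis using ff.subspace_0[OF subspace_cocyc] by (metis)
  next
    case False
    obtain v where v: "v \<in> \<tau>"
    proof (cases "\<tau> = {}")
      case True
      then have "faces (Pow \<tau>) q = {}" using assms(4) by (auto simp: faces_def)
      then have "a = 0" using cocycD(1)[OF assms(3)] by (auto simp: fun_on_def)
      then show ?thesis using False by simp
    qed (use that in blast)
    have "q \<noteq> 0" using False cocyc_0[OF cplx_Pow[OF fin], of a v] assms(3) v by auto
    then obtain p where p: "q = Suc p" by (cases q) auto
    obtain b where b: "b \<in> fun_on (faces (Pow \<tau>) p)" "\<forall>\<sigma>\<in>faces (Pow \<tau>) (Suc p). a \<sigma> = cob b \<sigma>"
      using Pow_exact[OF fin v] assms(3) p by blast
    have "cobK A p b \<sigma> = a \<sigma>" if "\<sigma> \<in> Pow \<tau>" for \<sigma>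
    proof (cases "card \<sigma> = Suc p")
      case True
      then show ?thesis using b(2) that assms(2) by (auto simp: cobK_def faces_def)
    next
      case False
      then show ?thesis using fun_onD[OF cocycD(1)[OF assms(3)], of \<sigma>] p by (auto simp: cobK_def faces_def)
    qed
    then show ?thesis using cobK_in_cocyc[OF assms(1)] p by blast
  qed
qed

definition restr :: "'v set set \<Rightarrow> ('v set \<Rightarrow> 'f::field) \<Rightarrow> 'v set \<Rightarrow> 'f" where
  "restr A c = (\<lambda>\<sigma>. if \<sigma> \<in> A then c \<sigma> else 0)"

lemma lin_on_restr: "ff.subspace U \<Longrightarrow> lin_on fsc fsc U (restr A)"
  unfolding lin_on_def by (auto simp: restr_def fun_eq_iff fsc_apply)

lemma cob_eq_on:
  assumes "cplx A" "\<sigma> \<in> A" "\<And>\<rho>. \<rho> \<in> A \<Longrightarrow> c \<rho> = c' \<rho>" shows "cob c \<sigma> = cob c' \<sigma>"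
  by (rule cob_cong) (use assms(3) cplxD(4)[OF assms(1,2)] in blast)

lemma restr_cocyc:
  assumes "cplx A" "A \<subseteq> M" "c \<in> cocyc M q" shows "restr A c \<in> cocyc A q"
proof (intro cocycI fun_onI)
  fix \<sigma> assume "\<sigma> \<notin> faces A q"
  then show "restr A c \<sigma> = 0"
    using fun_onD[OF cocycD(1)[OF assms(3)], of \<sigma>] by (auto simp: restr_def faces_def)
next
  fix \<sigma> assume \<sigma>: "\<sigma> \<in> faces A (Suc q)"
  have "cob (restr A c) \<sigma> = cob c \<sigma>"
    by (rule cob_eq_on[OF assms(1) facesD(1)[OF \<sigma>]]) (simp add: restr_def)
  moreover have "\<sigma> \<in> faces M (Suc q)" using \<sigma> assms(2) by (auto simp: faces_def)
  ultimately show "cob (restr A c) \<sigma> = 0" using cocycD(2)[OF assms(3)] by metis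
qed

lemma restr_eq:
  assumes "c \<in> fun_on (faces A q)" "\<And>\<sigma>. \<sigma> \<in> A \<Longrightarrow> b \<sigma> = c \<sigma>"
  shows "restr A b = c"
proof
  fix \<sigma> show "restr A b \<sigma> = c \<sigma>"
    using assms(2)[of \<sigma>] fun_onD[OF assms(1), of \<sigma>] facesD(1)[of \<sigma> A q] by (auto simp: restr_def)
qed

lemma restr_eq_0: "restr A c = 0 \<longleftrightarrow> (\<forall>\<sigma>\<in>A. c \<sigma> = 0)"
  by (metis (no_types, lifting) ext restr_def zero_fun_apply)

lemma cplx_Un: "cplx A \<Longrightarrow> cplx B \<Longrightarrow> cplx (A \<union> B)" by (auto simp: cplx_def)

text \<open>The cocycle version of Mayer-Vietoris. Restriction from \<open>B\<close> to the simplex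
  and restriction from the union to \<open>A\<close> are both onto by
  \<open>cocyc_Pow_extend\<close>, and both have as kernel the cocycles of \<open>B\<close> that
  vanish on the simplex.\<close>

lemma zdim_glue:
  assumes A: "cplx A" and B: "cplx B" and AB: "A \<inter> B = Pow \<tau>" and q: "q > 0 \<or> \<tau> \<noteq> {}"
  shows "zdim TYPE('f::field) (A \<union> B) q + zdim TYPE('f) (Pow \<tau>) q = zdim TYPE('f) A q + zdim TYPE('f) B q"
proof -
  let ?M = "A \<union> B"
  let ?N = "{c \<in> cocyc B q :: ('a set \<Rightarrow> 'f) set. restr (Pow \<tau>) c = 0}"
  have M: "cplx ?M" using cplx_Un A B .
  have "finite \<tau>" using A AB cplxD(3) by blast
  then have P: "cplx (Pow \<tau>)" by (rule cplx_Pow)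
  have PA: "Pow \<tau> \<subseteq> A" and PB: "Pow \<tau> \<subseteq> B" using AB by blast+
  have imB: "restr (Pow \<tau>) ` cocyc B q = (cocyc (Pow \<tau>) q :: ('a set \<Rightarrow> 'f) set)"
  proof (intro equalityI subsetI)
    fix a :: "'a set \<Rightarrow> 'f" assume a: "a \<in> cocyc (Pow \<tau>) q"
    then obtain b where b: "b \<in> cocyc B q" "\<forall>\<sigma>\<in>Pow \<tau>. b \<sigma> = a \<sigma>"
      using cocyc_Pow_extend[OF B PB a q] by blast
    have "restr (Pow \<tau>) b = a" by (rule restr_eq[OF cocycD(1)[OF a]]) (use b(2) in simp)
    then show "a \<in> restr (Pow \<tau>) ` cocyc B q" using b(1) by blast
  next
    fix a :: "'a set \<Rightarrow> 'f" assume "a \<in> restr (Pow \<tau>) ` cocyc B q"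
    then show "a \<in> cocyc (Pow \<tau>) q" using restr_cocyc[OF P PB] by auto
  qed
  have 1: "zdim TYPE('f) B q = zdim TYPE('f) (Pow \<tau>) q + ff.dim ?N"
    unfolding zdim_def imB[symmetric]
    by (rule ff2.rank_nullity_on[OF lin_on_restr[OF subspace_cocyc] fin_dim_cocyc[OF B]])
  have im: "restr A ` cocyc ?M q = (cocyc A q :: ('a set \<Rightarrow> 'f) set)"
  proof (intro equalityI subsetI)
    fix a :: "'a set \<Rightarrow> 'f" assume a: "a \<in> cocyc A q"
    have "restr (Pow \<tau>) a \<in> cocyc (Pow \<tau>) q" by (rule restr_cocyc[OF P PA a])
    then obtain b where b: "b \<in> cocyc B q" "\<forall>\<sigma>\<in>Pow \<tau>. b \<sigma> = restr (Pow \<tau>) a \<sigma>"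
      using cocyc_Pow_extend[OF B PB _ q] by blast
    define c where "c \<sigma> = (if \<sigma> \<in> A then a \<sigma> else b \<sigma>)" for \<sigma>
    have cB: "c \<sigma> = b \<sigma>" if "\<sigma> \<in> B" for \<sigma>
    proof (cases "\<sigma> \<in> A")
      case True
      then have "\<sigma> \<in> Pow \<tau>" using that AB by blast
      then show ?thesis using b(2) True by (simp add: c_def restr_def)
    qed (simp add: c_def)
    have "c \<in> cocyc ?M q"
    proof (intro cocycI fun_onI)
      fix \<sigma> assume "\<sigma> \<notin> faces ?M q"
      then show "c \<sigma> = 0" using fun_onD[OF cocycD(1)[OF a], of \<sigma>] fun_onD[OF cocycD(1)[OF b(1)], of \<sigma>]
        by (auto simp: c_def faces_def)
    next
      fix \<sigma> assume "\<sigma> \<in> faces ?M (Suc q)"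
      then consider "\<sigma> \<in> faces A (Suc q)" | "\<sigma> \<in> faces B (Suc q)" by (auto simp: faces_def)
      then show "cob c \<sigma> = 0"
      proof cases
        case 1
        have "cob c \<sigma> = cob a \<sigma>" by (rule cob_eq_on[OF A facesD(1)[OF 1]]) (simp add: c_def)
        then show ?thesis using cocycD(2)[OF a 1] by simp
      next
        case 2
        have "cob c \<sigma> = cob b \<sigma>" by (rule cob_eq_on[OF B facesD(1)[OF 2]]) (simp add: cB)
        then show ?thesis using cocycD(2)[OF b(1) 2] by simp
      qed
    qed
    moreover have "restr A c = a" by (rule restr_eq[OF cocycD(1)[OF a]]) (simp add: c_def)
    ultimately show "a \<in> restr A ` cocyc ?M q" by blast
  next
    fix a :: "'a set \<Rightarrow> 'f" assume "a \<in> restr A ` cocyc ?M q"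
    then show "a \<in> cocyc A q" using restr_cocyc[OF A, of ?M _ q] by auto
  qed
  have ker: "{c \<in> cocyc ?M q. restr A c = 0} = ?N"
  proof (intro equalityI subsetI)
    fix c :: "'a set \<Rightarrow> 'f" assume "c \<in> {c \<in> cocyc ?M q. restr A c = 0}"
    then have c: "c \<in> cocyc ?M q" "\<And>\<sigma>. \<sigma> \<in> A \<Longrightarrow> c \<sigma> = 0" by (simp_all add: restr_eq_0)
    have rB: "restr B c \<in> cocyc B q" by (rule restr_cocyc[OF B _ c(1)]) simp
    moreover have "restr B c = c"
    proof
      fix \<sigma> show "restr B c \<sigma> = c \<sigma>"
        using c(2)[of \<sigma>] fun_onD[OF cocycD(1)[OF c(1)], of \<sigma>] by (auto simp: restr_def faces_def)
    qed
    moreover have "restr (Pow \<tau>) c = 0" using c(2) PA by (simp add: restr_eq_0 subset_iff)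
    ultimately show "c \<in> ?N" by simp
  next
    fix c assume "c \<in> ?N"
    then have c: "c \<in> cocyc B q" "\<And>\<sigma>. \<sigma> \<in> Pow \<tau> \<Longrightarrow> c \<sigma> = 0" by (simp_all add: restr_eq_0)
    have cA: "c \<sigma> = 0" if "\<sigma> \<in> A" for \<sigma>
      using that c(2)[of \<sigma>] AB fun_onD[OF cocycD(1)[OF c(1)], of \<sigma>] facesD(1) by blast
    have "c \<in> cocyc ?M q"
    proof (intro cocycI fun_onI)
      fix \<sigma> assume "\<sigma> \<notin> faces ?M q"
      then show "c \<sigma> = 0" using fun_onD[OF cocycD(1)[OF c(1)], of \<sigma>] by (auto simp: faces_def)
    next
      fix \<sigma> assume "\<sigma> \<in> faces ?M (Suc q)"
      then consider "\<sigma> \<in> faces A (Suc q)" | "\<sigma> \<in> faces B (Suc q)" by (auto simp: faces_def)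
      then show "cob c \<sigma> = 0"
      proof cases
        case 1
        then show ?thesis using cA cplxD(4)[OF A facesD(1)[OF 1]] by (intro cob_zero) blast
      next
        case 2 then show ?thesis using cocycD(2)[OF c(1)] by blast
      qed
    qed
    moreover have "restr A c = 0" using cA by (simp add: restr_eq_0)
    ultimately show "c \<in> {c \<in> cocyc ?M q. restr A c = 0}" by simp
  qed
  have "zdim TYPE('f) ?M q = zdim TYPE('f) A q + ff.dim ?N"
    unfolding zdim_def im[symmetric] ker[symmetric]
    by (rule ff2.rank_nullity_on[OF lin_on_restr[OF subspace_cocyc] fin_dim_cocyc[OF M]])
  then show ?thesis using 1 by simp
qed

lemma fnum_glue:
  assumes "cplx A" "cplx B" "A \<inter> B = Pow \<tau>"
  shows "fnum (A \<union> B) q + fnum (Pow \<tau>) q = fnum A q + fnum B q"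
proof -
  have "faces (A \<union> B) q = faces A q \<union> faces B q" "faces (Pow \<tau>) q = faces A q \<inter> faces B q"
    using assms(3) by (auto simp: faces_def)
  then show ?thesis unfolding fnum_def
    using card_Un_Int[OF finite_faces[OF assms(1)] finite_faces[OF assms(2)]] by simp
qed

section \<open>Induced subcomplexes of cross-polytopes\<close>

definition induced :: "'v set set \<Rightarrow> 'v set \<Rightarrow> 'v set set" where
  "induced K W = {\<sigma> \<in> K. \<sigma> \<subseteq> W}"

lemma cplx_induced: "cplx K \<Longrightarrow> cplx (induced K W)"
  by (auto simp: cplx_def induced_def)

definition suspend :: "'v set set \<Rightarrow> 'v \<Rightarrow> 'v \<Rightarrow> 'v set set" where
  "suspend K a b = cone a K \<union> insert b ` K"

lemma suspend_cases:
  assumes "\<sigma> \<in> suspend K a b"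
  obtains "\<sigma> \<in> K" | \<tau> where "\<tau> \<in> K" "\<sigma> = insert a \<tau>" | \<tau> where "\<tau> \<in> K" "\<sigma> = insert b \<tau>"
  using assms by (auto simp: suspend_def cone_def)

lemma suspendI: "\<sigma> \<in> K \<Longrightarrow> \<sigma> \<in> suspend K a b" "\<sigma> \<in> K \<Longrightarrow> insert a \<sigma> \<in> suspend K a b"
  "\<sigma> \<in> K \<Longrightarrow> insert b \<sigma> \<in> suspend K a b"
  by (auto simp: suspend_def cone_def)

lemma cplx_suspend: "cplx K \<Longrightarrow> cplx (suspend K a b)"
  unfolding suspend_def by (rule cplx_attach[OF cplx_cone]) (auto simp: cone_def)

lemma join_two_points: "join K (two_points a b) = suspend K a b"
proof (intro equalityI subsetI)
  fix \<rho> assume "\<rho> \<in> join K (two_points a b)"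
  then obtain \<sigma> \<tau> where "\<sigma> \<in> K" "\<tau> = {} \<or> \<tau> = {a} \<or> \<tau> = {b}" "\<rho> = \<sigma> \<union> \<tau>"
    unfolding join_def two_points_def by blast
  then show "\<rho> \<in> suspend K a b" using suspendI[of \<sigma> K] by auto
next
  fix \<rho> assume "\<rho> \<in> suspend K a b"
  then obtain \<sigma> \<tau> where "\<sigma> \<in> K" "\<tau> \<in> two_points a b" "\<rho> = \<sigma> \<union> \<tau>"
  proof (cases rule: suspend_cases)
    case 1 then show ?thesis using that[of \<rho> "{}"] by (simp add: two_points_def)
  next
    case (2 \<tau>) then show ?thesis using that[of \<tau> "{a}"] by (simp add: two_points_def)
  next
    case (3 \<tau>) then show ?thesis using that[of \<tau> "{b}"] by (simp add: two_points_def)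
  qed
  then show "\<rho> \<in> join K (two_points a b)" unfolding join_def by blast
qed

lemma cross_polytope_Suc: "cross_polytope (Suc d) v w = suspend (cross_polytope d v w) (v d) (w d)"
  by (simp add: join_two_points)

definition cross_vertices :: "nat \<Rightarrow> (nat \<Rightarrow> 'v) \<Rightarrow> (nat \<Rightarrow> 'v) \<Rightarrow> bool" where
  "cross_vertices d v w \<longleftrightarrow> inj_on v {..<d} \<and> inj_on w {..<d} \<and> v ` {..<d} \<inter> w ` {..<d} = {}"

lemma cross_vertices_SucD:
  assumes "cross_vertices (Suc d) v w"
  shows "cross_vertices d v w" "v d \<noteq> w d" "v d \<notin> v ` {..<d} \<union> w ` {..<d}" "w d \<notin> v ` {..<d} \<union> w ` {..<d}"
  using assms by (auto simp: cross_vertices_def lessThan_Suc)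

lemma Union_suspend: "{} \<in> K \<Longrightarrow> \<Union>(suspend K a b) = insert a (insert b (\<Union>K))"
  by (auto simp: suspend_def cone_def)

lemma cplx_cross_polytope: "cplx (cross_polytope d v w)"
proof (induction d)
  case (Suc d) then show ?case unfolding cross_polytope_Suc by (rule cplx_suspend)
qed (simp add: cplx_def)

lemma Union_cross_polytope: "\<Union>(cross_polytope d v w) = v ` {..<d} \<union> w ` {..<d}"
proof (induction d)
  case (Suc d)
  show ?case unfolding cross_polytope_Suc Union_suspend[OF cplxD(2)[OF cplx_cross_polytope]] Suc
    by (auto simp: lessThan_Suc)
qed simp

lemma card_cross_vertices: "cross_vertices d v w \<Longrightarrow> card (v ` {..<d} \<union> w ` {..<d}) = 2 * d"
  unfolding cross_vertices_def by (subst card_Un_disjoint) (auto simp: card_image)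

lemma induced_suspend:
  assumes "a \<notin> \<Union>K" "b \<notin> \<Union>K"
  shows "induced (suspend K a b) W = (if a \<in> W then cone a (induced K W) else induced K W) \<union>
     (if b \<in> W then insert b ` induced K W else {})"
  by (auto simp: induced_def suspend_def cone_def)

text \<open>Unions of \<open>q\<close> antipodal pairs. They are the vertex sets on which a
  cross-polytope induces a smaller cross-polytope; a set containing exactly one point of some pair
  induces a cone.\<close>

definition pair_unions :: "nat \<Rightarrow> (nat \<Rightarrow> 'v) \<Rightarrow> (nat \<Rightarrow> 'v) \<Rightarrow> nat \<Rightarrow> 'v set set" where
  "pair_unions d v w q = {S. S \<subseteq> v ` {..<d} \<union> w ` {..<d} \<and> (\<forall>i<d. v i \<in> S \<longleftrightarrow> w i \<in> S) \<and> card {i. i < d \<and> v i \<in> S} = q}"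

lemma pair_unions_iff:
  "W \<inter> (v ` {..<d} \<union> w ` {..<d}) \<in> pair_unions d v w q \<longleftrightarrow>
     (\<forall>i<d. v i \<in> W \<longleftrightarrow> w i \<in> W) \<and> card {i. i < d \<and> v i \<in> W} = q"
proof -
  have "{i. i < d \<and> v i \<in> W \<inter> (v ` {..<d} \<union> w ` {..<d})} = {i. i < d \<and> v i \<in> W}" by auto
  then show ?thesis by (auto simp: pair_unions_def)
qed

text \<open>A further pair leaves the induced complex unchanged, makes it a cone or suspends it,
  according to the number of its points in \<open>W\<close>.\<close>

lemma hdim_cross_polytope:
  fixes v w :: "nat \<Rightarrow> 'v"
  assumes "cross_vertices d v w"
  shows "hdim TYPE('f::field) (induced (cross_polytope d v w) W) q =
    of_bool (W \<inter> \<Union>(cross_polytope d v w) \<in> pair_unions d v w q)"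
  unfolding Union_cross_polytope pair_unions_iff using assms
proof (induction d arbitrary: q)
  case 0
  have e: "induced (cross_polytope 0 v w) W = Pow {}" by (auto simp: induced_def)
  show ?case
  proof (cases "q = 0")
    case True
    have "hdim TYPE('f) (Pow {} :: 'v set set) 0 = 1"
      by (subst hdim_0[OF cplx_Pow]) auto
    then show ?thesis using True unfolding e by simp
  next
    case False
    have "hdim TYPE('f) (Pow {} :: 'v set set) q = 0" by (rule hdim_Pow) (use False in auto)
    then show ?thesis using False unfolding e by simp
  qed
next
  case (Suc d)
  let ?C = "cross_polytope d v w" and ?a = "v d" and ?b = "w d"
  note cv = cross_vertices_SucD[OF Suc.prems]
  have a: "?a \<notin> \<Union>?C" "?b \<notin> \<Union>?C" using cv unfolding Union_cross_polytope by auto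
  let ?K = "induced ?C W"
  have K: "cplx ?K" "?a \<notin> \<Union>?K" "?b \<notin> \<Union>?K" using a cplx_induced[OF cplx_cross_polytope] by (auto simp: induced_def)
  have ind: "induced (cross_polytope (Suc d) v w) W = (if ?a \<in> W then cone ?a ?K else ?K) \<union>
     (if ?b \<in> W then insert ?b ` ?K else {})"
    unfolding cross_polytope_Suc by (rule induced_suspend[OF a])
  have IH: "hdim TYPE('f) ?K q = of_bool ((\<forall>i<d. v i \<in> W \<longleftrightarrow> w i \<in> W) \<and> card {i. i < d \<and> v i \<in> W} = q)" for q
    by (rule Suc.IH[OF cv(1)])
  have all: "(\<forall>i<Suc d. v i \<in> W \<longleftrightarrow> w i \<in> W) \<longleftrightarrow> (\<forall>i<d. v i \<in> W \<longleftrightarrow> w i \<in> W) \<and> (?a \<in> W \<longleftrightarrow> ?b \<in> W)"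
    using less_Suc_eq by auto
  have set: "{i. i < Suc d \<and> v i \<in> W} = (if ?a \<in> W then insert d {i. i < d \<and> v i \<in> W} else {i. i < d \<and> v i \<in> W})"
    using less_Suc_eq by auto
  have card: "card {i. i < Suc d \<and> v i \<in> W} = (if ?a \<in> W then Suc (card {i. i < d \<and> v i \<in> W}) else card {i. i < d \<and> v i \<in> W})"
    unfolding set by simp
  consider "?a \<notin> W" "?b \<notin> W" | "?a \<in> W" "?b \<notin> W" | "?a \<notin> W" "?b \<in> W" | "?a \<in> W" "?b \<in> W" by blast
  then show ?case
  proof cases
    case 1 then show ?thesis unfolding ind all card using IH by simp
  next
    case 2
    then show ?thesis unfolding ind all using hdim_cone[OF K(1,2), where 'f='f] by simp
  next
    case 3
    have "?K \<union> insert ?b ` ?K = cone ?b ?K" by (simp add: cone_def)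
    then show ?thesis unfolding ind all using 3 hdim_cone[OF K(1,3), where 'f='f] by simp
  next
    case 4
    have "hdim TYPE('f) (cone ?a ?K \<union> insert ?b ` ?K) q = (case q of 0 \<Rightarrow> 0 | Suc p \<Rightarrow> hdim TYPE('f) ?K p)"
      by (rule hdim_suspension[OF K cv(2)])
    then show ?thesis unfolding ind all card using 4 IH by (simp split: nat.split)
  qed
qed

lemma pair_unions_top:
  "pair_unions d v w d = {v ` {..<d} \<union> w ` {..<d}}"
proof -
  have "S = v ` {..<d} \<union> w ` {..<d}" if "S \<in> pair_unions d v w d" for S
  proof -
    have S: "S \<subseteq> v ` {..<d} \<union> w ` {..<d}" "\<forall>i<d. v i \<in> S \<longleftrightarrow> w i \<in> S" "card {i. i < d \<and> v i \<in> S} = d"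
      using that by (auto simp: pair_unions_def)
    have "{i. i < d \<and> v i \<in> S} = {..<d}" by (rule card_subset_eq) (use S(3) in auto)
    then show ?thesis using S by auto
  qed
  moreover have "v ` {..<d} \<union> w ` {..<d} \<in> pair_unions d v w d"
  proof -
    have "{i. i < d \<and> v i \<in> v ` {..<d} \<union> w ` {..<d}} = {..<d}" by auto
    then show ?thesis by (simp add: pair_unions_def)
  qed
  ultimately show ?thesis by blast
qed

lemma pair_unions_0: "pair_unions d v w 0 = {{}}"
  by (auto simp: pair_unions_def)

lemma pair_unions_card:
  assumes "cross_vertices d v w"
  shows "card (pair_unions d v w q) = d choose q" "S \<in> pair_unions d v w q \<Longrightarrow> card S = 2 * q"
proof -
  have inj: "inj_on v {..<d}" "inj_on w {..<d}" and dis: "v ` {..<d} \<inter> w ` {..<d} = {}"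
    using assms by (auto simp: cross_vertices_def)
  let ?I = "{P. P \<subseteq> {..<d} \<and> card P = q}"
  have mem: "{i. i < d \<and> v i \<in> v ` P \<union> w ` P} = P" if "P \<subseteq> {..<d}" for P
    using that inj dis by (auto simp: inj_on_def) (metis disjoint_iff image_eqI lessThan_iff subsetD)
  have mem2: "v i \<in> v ` P \<union> w ` P \<longleftrightarrow> w i \<in> v ` P \<union> w ` P" if "P \<subseteq> {..<d}" "i < d" for P i
  proof -
    have "v i \<in> v ` P \<union> w ` P \<longleftrightarrow> i \<in> P" using mem[OF that(1)] that(2) by blast
    moreover have "w i \<in> v ` P \<union> w ` P \<longleftrightarrow> i \<in> P"
    proof -
      have "w i \<notin> v ` P" using that dis by blast
      moreover have "w i \<in> w ` P \<longleftrightarrow> i \<in> P"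
        by (rule inj_on_image_mem_iff[OF inj(2)]) (use that in auto)
      ultimately show ?thesis by blast
    qed
    ultimately show ?thesis by blast
  qed
  have form: "S = v ` {i. i < d \<and> v i \<in> S} \<union> w ` {i. i < d \<and> v i \<in> S}" if "S \<in> pair_unions d v w q" for S q
    using that unfolding pair_unions_def by auto
  have "bij_betw (\<lambda>P. v ` P \<union> w ` P) ?I (pair_unions d v w q)"
  proof (rule bij_betw_byWitness[where f' = "\<lambda>S. {i. i < d \<and> v i \<in> S}"])
    show "(\<lambda>P. v ` P \<union> w ` P) ` ?I \<subseteq> pair_unions d v w q"
    proof
      fix S assume "S \<in> (\<lambda>P. v ` P \<union> w ` P) ` ?I"
      then obtain P where P: "P \<subseteq> {..<d}" "card P = q" "S = v ` P \<union> w ` P" by blast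
      show "S \<in> pair_unions d v w q"
        using mem[OF P(1)] mem2[OF P(1)] P unfolding pair_unions_def by auto
    qed
    show "(\<lambda>S. {i. i < d \<and> v i \<in> S}) ` pair_unions d v w q \<subseteq> ?I" by (auto simp: pair_unions_def)
    show "\<forall>P\<in>?I. {i. i < d \<and> v i \<in> v ` P \<union> w ` P} = P" using mem by blast
    show "\<forall>S\<in>pair_unions d v w q. v ` {i. i < d \<and> v i \<in> S} \<union> w ` {i. i < d \<and> v i \<in> S} = S"
      using form by metis
  qed
  then have "card (pair_unions d v w q) = card ?I" by (rule bij_betw_same_card[symmetric])
  then show "card (pair_unions d v w q) = d choose q" using n_subsets[of "{..<d}" q] by simp
  assume S: "S \<in> pair_unions d v w q"
  let ?P = "{i. i < d \<and> v i \<in> S}"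
  have P: "?P \<subseteq> {..<d}" "card ?P = q" using S by (auto simp: pair_unions_def)
  have "card (v ` ?P) = q" "card (w ` ?P) = q"
    using P inj by (auto simp: card_image inj_on_subset)
  moreover have "v ` ?P \<inter> w ` ?P = {}" using dis P(1) by blast
  ultimately have "card (v ` ?P \<union> w ` ?P) = 2 * q" by (subst card_Un_disjoint) auto
  then show "card S = 2 * q" using form[OF S] by simp
qed

section \<open>Top-dimensional cycles\<close>

text \<open>The simplicial boundary, transpose of \<open>cob\<close>. Only the ambient vertex set
  enters, since chains vanish outside their complex.\<close>

definition bdry :: "'v set \<Rightarrow> ('v set \<Rightarrow> 'f::field) \<Rightarrow> 'v set \<Rightarrow> 'f" where
  "bdry V y \<rho> = (\<Sum>x\<in>V - \<rho>. eps x \<rho> * y (insert x \<rho>))"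

text \<open>The condition concerns all subsets of \<open>V\<close> and not only faces of
  \<open>K\<close>, so that cycles of different complexes on \<open>V\<close> can be added and
  compared. Writing \<open>Suc (card \<rho>) = d\<close> makes it vacuous for
  \<open>d = 0\<close>.\<close>

definition cycles :: "'v set \<Rightarrow> 'v set set \<Rightarrow> nat \<Rightarrow> ('v set \<Rightarrow> 'f::field) set" where
  "cycles V K d = {y \<in> fun_on (faces K d). \<forall>\<rho>. \<rho> \<subseteq> V \<and> Suc (card \<rho>) = d \<longrightarrow> bdry V y \<rho> = 0}"

lemma cyclesD: "y \<in> cycles V K d \<Longrightarrow> y \<in> fun_on (faces K d)"
  "y \<in> cycles V K d \<Longrightarrow> \<rho> \<subseteq> V \<Longrightarrow> Suc (card \<rho>) = d \<Longrightarrow> bdry V y \<rho> = 0"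
  by (auto simp: cycles_def)

lemma cyclesI: "y \<in> fun_on (faces K d) \<Longrightarrow> (\<And>\<rho>. \<rho> \<subseteq> V \<Longrightarrow> Suc (card \<rho>) = d \<Longrightarrow> bdry V y \<rho> = 0) \<Longrightarrow> y \<in> cycles V K d"
  by (auto simp: cycles_def)

lemma bdry_lin: "bdry V (\<lambda>\<sigma>. r * y \<sigma> + s * y' \<sigma>) \<rho> = r * bdry V y \<rho> + s * bdry V y' \<rho>"
  unfolding bdry_def sum_distrib_left sum.distrib[symmetric]
  by (rule sum.cong[OF refl]) (simp add: algebra_simps)

lemma bdry_bdry:
  fixes y :: "'v set \<Rightarrow> 'f::field"
  assumes "finite V" "\<tau> \<subseteq> V"
  shows "bdry V (bdry V y) \<tau> = 0"
proof -
  define t where "t x u = eps x \<tau> * (eps u (insert x \<tau>) * y (insert u (insert x \<tau>)))" for x u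
  have "bdry V (bdry V y) \<tau> = (\<Sum>x\<in>V - \<tau>. \<Sum>u\<in>(V - \<tau>) - {x}. t x u)"
    unfolding bdry_def sum_distrib_left t_def by (intro sum.cong refl) auto
  also have "\<dots> = 0"
  proof (rule antisymmetric_sum)
    fix x u assume xu: "x \<in> V - \<tau>" "u \<in> V - \<tau>" "x \<noteq> u"
    have "eps x (insert u \<tau>) * eps u \<tau> = - (eps u (insert x \<tau>) * eps x \<tau> :: 'f)"
      by (rule eps_swap) (use xu assms finite_subset in auto)
    then have e: "eps u \<tau> * eps x (insert u \<tau>) = - (eps x \<tau> * eps u (insert x \<tau>) :: 'f)" by (simp add: mult.commute)
    have "t u x = eps u \<tau> * eps x (insert u \<tau>) * y (insert u (insert x \<tau>))"
      unfolding t_def by (simp add: mult.assoc insert_commute)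
    then show "t x u = - t u x" unfolding e t_def by (simp add: mult.assoc)
  qed (use assms in simp)
  finally show ?thesis .
qed

text \<open>Both sides are sums over the pairs of a face and a vertex deleted from it.\<close>

lemma pairing:
  fixes y b :: "'v set \<Rightarrow> 'f::field"
  assumes K: "cplx K" and V: "finite V" "\<Union>K \<subseteq> V" and y: "y \<in> fun_on (faces K (Suc e))"
  shows "(\<Sum>\<sigma>\<in>faces K (Suc e). y \<sigma> * cob b \<sigma>) = (\<Sum>\<rho>\<in>faces K e. b \<rho> * bdry V y \<rho>)"
proof -
  let ?A = "SIGMA \<sigma>:faces K (Suc e). \<sigma>" and ?B = "SIGMA \<rho>:faces K e. V - \<rho>"
  let ?g = "\<lambda>(\<sigma>, x). y \<sigma> * (eps x (\<sigma> - {x}) * b (\<sigma> - {x}))" and ?h = "\<lambda>(\<rho>, x). b \<rho> * (eps x \<rho> * y (insert x \<rho>))"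
  let ?B' = "{(\<rho>, x) \<in> ?B. insert x \<rho> \<in> faces K (Suc e)}"
  have fB: "finite ?B" using finite_faces[OF K] V by auto
  have "(\<Sum>\<sigma>\<in>faces K (Suc e). y \<sigma> * cob b \<sigma>) = sum ?g ?A"
    unfolding cob_def sum_distrib_left using finite_faces[OF K] faces_finite[OF K]
    by (subst sum.Sigma) auto
  also have "\<dots> = sum ?h ?B'"
  proof (rule sum.reindex_bij_witness[where i = "\<lambda>(\<rho>, x). (insert x \<rho>, x)" and j = "\<lambda>(\<sigma>, x). (\<sigma> - {x}, x)"])
    fix p assume "p \<in> ?A"
    then obtain \<sigma> x where p: "p = (\<sigma>, x)" "\<sigma> \<in> faces K (Suc e)" "x \<in> \<sigma>" by auto
    have "x \<in> V" using p(2,3) V(2) facesD(1) by blast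
    then show "(case p of (\<sigma>, x) \<Rightarrow> (\<sigma> - {x}, x)) \<in> ?B'"
      using p faces_remove[OF K p(2,3)] by (simp add: insert_absorb)
    show "(case case p of (\<sigma>, x) \<Rightarrow> (\<sigma> - {x}, x) of (\<rho>, x) \<Rightarrow> (insert x \<rho>, x)) = p"
      using p by (simp add: insert_absorb)
    show "?h (case p of (\<sigma>, x) \<Rightarrow> (\<sigma> - {x}, x)) = ?g p"
      using p by (simp add: insert_absorb)
  next
    fix p assume "p \<in> ?B'"
    then obtain \<rho> x where p: "p = (\<rho>, x)" "\<rho> \<in> faces K e" "x \<notin> \<rho>" "insert x \<rho> \<in> faces K (Suc e)" by auto
    show "(case p of (\<rho>, x) \<Rightarrow> (insert x \<rho>, x)) \<in> ?A" using p by simp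
    show "(case case p of (\<rho>, x) \<Rightarrow> (insert x \<rho>, x) of (\<sigma>, x) \<Rightarrow> (\<sigma> - {x}, x)) = p" using p by simp
  qed
  also have "\<dots> = sum ?h ?B"
  proof (rule sum.mono_neutral_left[OF fB])
    show "\<forall>p\<in>?B - ?B'. ?h p = 0"
    proof
      fix p assume "p \<in> ?B - ?B'"
      then obtain \<rho> x where "p = (\<rho>, x)" "insert x \<rho> \<notin> faces K (Suc e)" by blast
      then show "?h p = 0" using fun_onD[OF y] by simp
    qed
  qed auto
  also have "\<dots> = (\<Sum>\<rho>\<in>faces K e. b \<rho> * bdry V y \<rho>)"
    unfolding bdry_def sum_distrib_left using finite_faces[OF K] V(1) by (subst sum.Sigma) auto
  finally show ?thesis .
qed

lemma cobK_fun_on: "cobK K q b \<in> fun_on (faces K (Suc q))"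
  by (rule fun_onI) (simp add: cobK_def)

lemma cycles_annihilator:
  fixes y :: "'v set \<Rightarrow> 'f::field"
  assumes K: "cplx K" and V: "finite V" "\<Union>K \<subseteq> V" and y: "y \<in> fun_on (faces K (Suc e))"
  shows "y \<in> cycles V K (Suc e) \<longleftrightarrow>
    (\<forall>u\<in>cobK K e ` fun_on (faces K e). (\<Sum>\<sigma>\<in>faces K (Suc e). y \<sigma> * u \<sigma>) = 0)"
proof -
  have eq: "(\<Sum>\<sigma>\<in>faces K (Suc e). y \<sigma> * cobK K e b \<sigma>) = (\<Sum>\<rho>\<in>faces K e. b \<rho> * bdry V y \<rho>)" for b
    unfolding pairing[OF K V y, symmetric] by (rule sum.cong) (auto simp: cobK_def)
  have fV: "\<rho> \<subseteq> V \<and> Suc (card \<rho>) = Suc e" if "\<rho> \<in> faces K e" for \<rho> using that V(2) by (auto simp: faces_def)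
  show ?thesis
  proof
    assume c: "y \<in> cycles V K (Suc e)"
    show "\<forall>u\<in>cobK K e ` fun_on (faces K e). (\<Sum>\<sigma>\<in>faces K (Suc e). y \<sigma> * u \<sigma>) = 0"
      using cyclesD(2)[OF c] fV by (auto simp: eq intro!: sum.neutral)
  next
    assume a: "\<forall>u\<in>cobK K e ` fun_on (faces K e). (\<Sum>\<sigma>\<in>faces K (Suc e). y \<sigma> * u \<sigma>) = 0"
    show "y \<in> cycles V K (Suc e)"
    proof (rule cyclesI[OF y])
      fix \<rho> assume \<rho>: "\<rho> \<subseteq> V" "Suc (card \<rho>) = Suc e"
      show "bdry V y \<rho> = 0"
      proof (cases "\<rho> \<in> K")
        case True
        then have m: "\<rho> \<in> faces K e" using \<rho> by (simp add: faces_def)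
        \<comment> \<open>Testing against the unit function at \<open>\<rho>\<close> isolates a
          single value of the boundary.\<close>
        have "(unit_fun \<rho> :: 'v set \<Rightarrow> 'f) \<in> fun_on (faces K e)" using m by (auto simp: fun_on_def unit_fun_def)
        then have "(\<Sum>\<rho>'\<in>faces K e. unit_fun \<rho> \<rho>' * bdry V y \<rho>') = 0" using a eq by (metis imageI)
        moreover have "(\<Sum>\<rho>'\<in>faces K e. unit_fun \<rho> \<rho>' * bdry V y \<rho>') = (\<Sum>\<rho>'\<in>faces K e. if \<rho>' = \<rho> then bdry V y \<rho>' else 0)"
          by (rule sum.cong) (auto simp: unit_fun_def)
        ultimately show ?thesis using m finite_faces[OF K] by simp
      next
        case False
        have "y (insert x \<rho>) = 0" for x
        proof (rule fun_onD[OF y])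
          show "insert x \<rho> \<notin> faces K (Suc e)" using False cplxD(4)[OF K, of "insert x \<rho>" \<rho>] by (auto simp: faces_def)
        qed
        then show ?thesis by (simp add: bdry_def)
      qed
    qed
  qed
qed

lemma hdim_top_eq:
  fixes K :: "'v set set"
  assumes K: "cplx K" and top: "\<And>\<sigma>. \<sigma> \<in> K \<Longrightarrow> card \<sigma> \<le> Suc e"
  shows "hdim TYPE('f::field) K (Suc e) = int (fnum K (Suc e)) - int (ff.dim (cobK K e ` fun_on (faces K e) :: ('v set \<Rightarrow> 'f) set))"
proof -
  have "faces K (Suc (Suc e)) = {}" using top by (fastforce simp: faces_def)
  then have "cocyc K (Suc e) = (fun_on (faces K (Suc e)) :: ('v set \<Rightarrow> 'f) set)" by (simp add: cocyc_def)
  then have "zdim TYPE('f) K (Suc e) = fnum K (Suc e)" by (simp add: zdim_def fnum_def fun_on_dim(1)[OF finite_faces[OF K]])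
  then show ?thesis using dim_coboundaries[OF K, where 'f='f, of e] by (simp add: hdim_def)
qed

text \<open>Without cycles nothing but zero annihilates the coboundaries, so by biduality every top
  cochain is a coboundary.\<close>

lemma hdim_top_0:
  fixes K :: "'v set set"
  assumes K: "cplx K" and top: "\<And>\<sigma>. \<sigma> \<in> K \<Longrightarrow> card \<sigma> \<le> Suc e" and V: "finite V" "\<Union>K \<subseteq> V"
    and cyc: "\<And>y :: 'v set \<Rightarrow> 'f::field. y \<in> cycles V K (Suc e) \<Longrightarrow> y = 0"
  shows "hdim TYPE('f) K (Suc e) = 0"
proof -
  let ?B = "cobK K e ` fun_on (faces K e) :: ('v set \<Rightarrow> 'f) set" and ?Y = "faces K (Suc e)"
  have B: "ff.subspace ?B" by (rule ff2.subspace_image_on[OF lin_on_cobK])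
  have BY: "?B \<subseteq> fun_on ?Y" using cobK_fun_on by blast
  have "fun_on ?Y \<subseteq> ?B"
  proof
    fix y :: "'v set \<Rightarrow> 'f" assume y: "y \<in> fun_on ?Y"
    show "y \<in> ?B"
    proof (rule double_annihilator[OF finite_faces[OF K] B BY y])
      fix z :: "'v set \<Rightarrow> 'f" assume z: "z \<in> fun_on ?Y" and a: "\<And>u. u \<in> ?B \<Longrightarrow> (\<Sum>x\<in>?Y. z x * u x) = 0"
      have "z = 0" using cyc cycles_annihilator[OF K V z] a by blast
      then show "(\<Sum>x\<in>?Y. z x * y x) = 0" by simp
    qed
  qed
  then have "?B = fun_on ?Y" using BY by blast
  then show ?thesis using hdim_top_eq[OF K top, where 'f='f] by (simp add: fun_on_dim(1)[OF finite_faces[OF K]] fnum_def)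
qed

text \<open>Pairing with \<open>z\<close> is a nonzero functional whose kernel is the space of
  coboundaries, which therefore has codimension one.\<close>

lemma hdim_top_1:
  fixes K :: "'v set set" and z :: "'v set \<Rightarrow> 'f::field"
  assumes K: "cplx K" and top: "\<And>\<sigma>. \<sigma> \<in> K \<Longrightarrow> card \<sigma> \<le> Suc e" and V: "finite V" "\<Union>K \<subseteq> V"
    and z: "z \<in> cycles V K (Suc e)" "z \<noteq> 0" and cyc: "\<And>y. y \<in> cycles V K (Suc e) \<Longrightarrow> \<exists>l. y = fsc l z"
  shows "hdim TYPE('f) K (Suc e) = 1"
proof -
  let ?B = "cobK K e ` fun_on (faces K e) :: ('v set \<Rightarrow> 'f) set" and ?Y = "faces K (Suc e)"
  have B: "ff.subspace ?B" by (rule ff2.subspace_image_on[OF lin_on_cobK])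
  have BY: "?B \<subseteq> fun_on ?Y" using cobK_fun_on by blast
  have fin: "finite ?Y" by (rule finite_faces[OF K])
  \<comment> \<open>The functional takes its values in functions on a one-point type, so that
    rank-nullity between function spaces applies to it.\<close>
  define f :: "('v set \<Rightarrow> 'f) \<Rightarrow> unit \<Rightarrow> 'f" where "f y = (\<lambda>_. \<Sum>x\<in>?Y. z x * y x)" for y
  have lin: "lin_on fsc fsc (fun_on ?Y) f"
    unfolding lin_on_def
    by (intro conjI ballI allI subspace_fun_on)
      (auto simp: f_def fsc_def fun_eq_iff distrib_left sum.distrib sum_distrib_left mult.left_commute)
  have "{y \<in> fun_on ?Y. f y = 0} = ?B"
  proof (intro equalityI subsetI)
    fix u assume u: "u \<in> ?B"
    have "\<forall>u\<in>?B. (\<Sum>\<sigma>\<in>?Y. z \<sigma> * u \<sigma>) = 0"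
      by (rule iffD1[OF cycles_annihilator[OF K V cyclesD(1)[OF z(1)]] z(1)])
    then have "(\<Sum>\<sigma>\<in>?Y. z \<sigma> * u \<sigma>) = 0" using u by (rule bspec)
    then have "f u = 0" by (simp add: f_def zero_fun_def)
    then show "u \<in> {y \<in> fun_on ?Y. f y = 0}" using u BY by blast
  next
    fix y assume "y \<in> {y \<in> fun_on ?Y. f y = 0}"
    then have y: "y \<in> fun_on ?Y" and fy: "f y = 0" by auto
    have fy: "(\<Sum>x\<in>?Y. z x * y x) = 0" using fun_cong[OF fy, of "()"] by (simp add: f_def)
    show "y \<in> ?B"
    proof (rule double_annihilator[OF fin B BY y])
      fix z' :: "'v set \<Rightarrow> 'f" assume z': "z' \<in> fun_on ?Y" and a: "\<And>u. u \<in> ?B \<Longrightarrow> (\<Sum>x\<in>?Y. z' x * u x) = 0"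
      have "z' \<in> cycles V K (Suc e)" by (rule iffD2[OF cycles_annihilator[OF K V z']]) (rule ballI, rule a)
      then obtain l where l: "z' = fsc l z" using cyc by blast
      have "(\<Sum>x\<in>?Y. z' x * y x) = l * (\<Sum>x\<in>?Y. z x * y x)"
        unfolding l fsc_def sum_distrib_left by (simp add: mult.assoc)
      then show "(\<Sum>x\<in>?Y. z' x * y x) = 0" using fy by simp
    qed
  qed
  then have rn: "ff.dim (fun_on ?Y :: ('v set \<Rightarrow> 'f) set) = ff.dim (f ` fun_on ?Y) + ff.dim ?B"
    using ff2.rank_nullity_on[OF lin fun_on_dim(2)[OF fin]] by simp
  obtain H where H: "z H \<noteq> 0" using z(2) by (auto simp: fun_eq_iff)
  have HY: "H \<in> ?Y" using fun_onD[OF cyclesD(1)[OF z(1)]] H by blast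
  have "f ` fun_on ?Y = fun_on {()}"
  proof (intro equalityI subsetI)
    fix g :: "unit \<Rightarrow> 'f" assume "g \<in> fun_on {()}"
    let ?y = "fsc (g () / z H) (unit_fun H)"
    have "?y \<in> fun_on ?Y" using HY by (auto simp: fun_on_def fsc_def unit_fun_def)
    moreover have "f ?y = g"
    proof
      fix u :: unit
      have "(\<Sum>x\<in>?Y. z x * ?y x) = (\<Sum>x\<in>?Y. if x = H then g () else 0)"
        by (rule sum.cong) (use H in \<open>auto simp: fsc_def unit_fun_def\<close>)
      then show "f ?y u = g u" using HY fin by (simp add: f_def)
    qed
    ultimately show "g \<in> f ` fun_on ?Y" by (metis imageI)
  qed (auto simp: fun_on_def)
  then have "ff.dim (f ` fun_on ?Y) = 1" using fun_on_dim(1)[of "{()}"] by simp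
  then show ?thesis using rn hdim_top_eq[OF K top, where 'f='f] by (simp add: fun_on_dim(1)[OF fin] fnum_def)
qed

section \<open>Stacked cross-polytopal spheres\<close>

definition pure_cplx :: "nat \<Rightarrow> 'v set set \<Rightarrow> bool" where
  "pure_cplx d K \<longleftrightarrow> cplx K \<and> (\<forall>\<sigma>\<in>K. card \<sigma> \<le> d \<and> (\<exists>H\<in>faces K d. \<sigma> \<subseteq> H))"

text \<open>No ridge of a facet is free, as in a closed pseudomanifold; a facet can then be deleted
  without losing its proper faces.\<close>

definition flippable :: "nat \<Rightarrow> 'v set set \<Rightarrow> bool" where
  "flippable d K \<longleftrightarrow> (\<forall>F\<in>faces K d. \<forall>x\<in>F. \<exists>H\<in>faces K d. F - {x} \<subseteq> H \<and> H \<noteq> F)"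

text \<open>Top homology is a line whose generator vanishes on no facet. This is the algebraic form
  of a connected and orientable arrangement of facets, and it makes a cycle that avoids one facet
  zero.\<close>

definition one_cycle :: "'f::field itself \<Rightarrow> 'v set \<Rightarrow> 'v set set \<Rightarrow> nat \<Rightarrow> bool" where
  "one_cycle _ V K d \<longleftrightarrow> (\<exists>z \<in> cycles V K d. (\<forall>H\<in>faces K d. z H \<noteq> (0 :: 'f)) \<and>
     (\<forall>y\<in>cycles V K d. \<exists>l. y = fsc l z))"

lemma pure_cplxD:
  assumes "pure_cplx d K"
  shows "cplx K" "\<sigma> \<in> K \<Longrightarrow> card \<sigma> \<le> d" "\<sigma> \<in> K \<Longrightarrow> \<exists>H\<in>faces K d. \<sigma> \<subseteq> H"
  using assms by (auto simp: pure_cplx_def)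

lemma facet_iff:
  assumes "pure_cplx d K" shows "is_facet K F \<longleftrightarrow> F \<in> faces K d"
proof
  assume F: "is_facet K F"
  then have FK: "F \<in> K" and mx: "\<And>H. H \<in> K \<Longrightarrow> F \<subseteq> H \<Longrightarrow> H = F" unfolding is_facet_def by blast+
  obtain H where H: "H \<in> faces K d" "F \<subseteq> H" using pure_cplxD(3)[OF assms FK] by blast
  then show "F \<in> faces K d" using mx[OF facesD(1)[OF H(1)] H(2)] by simp
next
  assume F: "F \<in> faces K d"
  have "H = F" if "H \<in> K" "F \<subseteq> H" for H
  proof -
    have "finite H" using cplxD(3)[OF pure_cplxD(1)[OF assms] that(1)] .
    moreover have "card H \<le> card F" using pure_cplxD(2)[OF assms that(1)] F by (simp add: faces_def)
    ultimately show ?thesis using card_seteq[of H F] that(2) by blast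
  qed
  then show "is_facet K F" using F facesD(1) unfolding is_facet_def by blast
qed

section \<open>Purity, flips and top cycles of suspensions\<close>

lemma faces_suspend:
  assumes "cplx K" "a \<notin> \<Union>K" "b \<notin> \<Union>K" "a \<noteq> b"
  shows "faces (suspend K a b) (Suc q) = faces K (Suc q) \<union> insert a ` faces K q \<union> insert b ` faces K q"
proof -
  have "faces (cone a K) (Suc q) = faces K (Suc q) \<union> insert a ` faces K q"
    unfolding cone_def by (rule faces_attach[OF assms(1,1) order_refl assms(2)])
  moreover have "faces (suspend K a b) (Suc q) = faces (cone a K) (Suc q) \<union> insert b ` faces K q"
    unfolding suspend_def
    by (rule faces_attach[OF cplx_cone[OF assms(1)] assms(1)]) (use assms in \<open>auto simp: cone_def\<close>)
  ultimately show ?thesis by simp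
qed

lemma faces_above: "pure_cplx d K \<Longrightarrow> faces K (Suc d) = {}"
  using pure_cplxD(2) by (fastforce simp: faces_def)

lemma pure_suspend:
  assumes K: "pure_cplx d K" and ab: "a \<notin> \<Union>K" "b \<notin> \<Union>K" "a \<noteq> b"
  shows "pure_cplx (Suc d) (suspend K a b)"
  unfolding pure_cplx_def
proof (intro conjI ballI)
  note c = pure_cplxD(1)[OF K]
  show "cplx (suspend K a b)" by (rule cplx_suspend[OF c])
  fix \<sigma> assume "\<sigma> \<in> suspend K a b"
  then obtain \<tau> x where \<tau>: "\<tau> \<in> K" "x = a \<or> x = b" "\<sigma> \<subseteq> insert x \<tau>"
    by (cases rule: suspend_cases) blast+
  have "card \<sigma> \<le> card (insert x \<tau>)" using \<tau> cplxD(3)[OF c \<tau>(1)] by (intro card_mono) auto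
  also have "\<dots> \<le> Suc (card \<tau>)" by (rule card_insert_le_m1) auto
  finally show "card \<sigma> \<le> Suc d" using pure_cplxD(2)[OF K \<tau>(1)] by simp
  obtain H where H: "H \<in> faces K d" "\<tau> \<subseteq> H" using pure_cplxD(3)[OF K \<tau>(1)] by blast
  have "insert x H \<in> faces (suspend K a b) (Suc d)" unfolding faces_suspend[OF c ab] using H \<tau> by blast
  then show "\<exists>H\<in>faces (suspend K a b) (Suc d). \<sigma> \<subseteq> H" using H \<tau> by blast
qed

text \<open>Across the ridge without the apex lies the facet through the other apex; across any
  other ridge one flips in the base.\<close>

lemma flippable_suspend:
  assumes K: "pure_cplx d K" "flippable d K" and ab: "a \<notin> \<Union>K" "b \<notin> \<Union>K" "a \<noteq> b"
  shows "flippable (Suc d) (suspend K a b)"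
  unfolding flippable_def
proof (intro ballI)
  note c = pure_cplxD(1)[OF K(1)]
  have fs: "faces (suspend K a b) (Suc d) = insert a ` faces K d \<union> insert b ` faces K d"
    unfolding faces_suspend[OF c ab] using faces_above[OF K(1)] by simp
  fix F x assume F: "F \<in> faces (suspend K a b) (Suc d)" and x: "x \<in> F"
  obtain p q F0 where p: "(p = a \<and> q = b) \<or> (p = b \<and> q = a)" "F = insert p F0" "F0 \<in> faces K d"
    using F unfolding fs by blast
  have nin: "p \<notin> H" "q \<notin> H" if "H \<in> faces K d" for H using p(1) ab that facesD(1) by blast+
  have pq: "p \<noteq> q" using p ab by blast
  show "\<exists>H\<in>faces (suspend K a b) (Suc d). F - {x} \<subseteq> H \<and> H \<noteq> F"
  proof (cases "x = p")
    case True
    have "insert q F0 \<in> faces (suspend K a b) (Suc d)" using p unfolding fs by blast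
    moreover have "insert q F0 \<noteq> F" using p pq nin[OF p(3)] by blast
    ultimately show ?thesis using True p(2) by blast
  next
    case False
    then have "x \<in> F0" using x p by blast
    then obtain H where H: "H \<in> faces K d" "F0 - {x} \<subseteq> H" "H \<noteq> F0"
      using K(2) p(3) unfolding flippable_def by blast
    have "insert p H \<in> faces (suspend K a b) (Suc d)" using p H unfolding fs by blast
    moreover have "insert p H \<noteq> F" using p(2) H(3) nin[OF H(1)] nin[OF p(3)] by (metis insert_ident)
    moreover have "F - {x} \<subseteq> insert p H" using p(2) H(2) by blast
    ultimately show ?thesis by blast
  qed
qed

text \<open>The generator is the suspension of \<open>z0\<close>. Conversely the signed link of a
  cycle at \<open>a\<close> is a cycle of \<open>K\<close>, hence a multiple of \<open>z0\<close>,
  and it determines the values at \<open>b\<close> because a facet of \<open>K\<close> lies in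
  exactly two facets of the suspension.\<close>

lemma one_cycle_suspend:
  fixes K :: "'v set set"
  assumes K: "pure_cplx d K" and ab: "a \<notin> \<Union>K" "b \<notin> \<Union>K" "a \<noteq> b"
    and V: "finite V" "\<Union>(suspend K a b) \<subseteq> V" and one: "one_cycle TYPE('f::field) V K d"
  shows "one_cycle TYPE('f) V (suspend K a b) (Suc d)"
proof -
  let ?S = "suspend K a b"
  note c = pure_cplxD(1)[OF K]
  have fs: "faces ?S (Suc d) = insert a ` faces K d \<union> insert b ` faces K d"
    unfolding faces_suspend[OF c ab] using faces_above[OF K] by simp
  have abV: "a \<in> V" "b \<in> V" using V(2) Union_suspend[OF cplxD(2)[OF c], of a b] by auto
  have nin: "a \<notin> H" "b \<notin> H" if "H \<in> faces K d" for H using ab that facesD(1) by blast+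
  have mema: "insert a H \<in> faces ?S (Suc d) \<longleftrightarrow> H \<in> faces K d" if "a \<notin> H" for H
  proof
    assume "insert a H \<in> faces ?S (Suc d)"
    then obtain H' where "H' \<in> faces K d" "insert a H = insert a H' \<or> insert a H = insert b H'" unfolding fs by blast
    then show "H \<in> faces K d" using nin[of H'] ab(3) that by (metis insertE insertI1 insert_ident)
  qed (auto simp: fs)
  have memb: "insert b H \<in> faces ?S (Suc d) \<longleftrightarrow> H \<in> faces K d" if "b \<notin> H" for H
  proof
    assume "insert b H \<in> faces ?S (Suc d)"
    then obtain H' where "H' \<in> faces K d" "insert b H = insert a H' \<or> insert b H = insert b H'" unfolding fs by blast
    then show "H \<in> faces K d" using nin[of H'] ab(3) that by (metis insertE insertI1 insert_ident)
  qed (auto simp: fs)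
  have memab: "\<sigma> \<notin> faces ?S (Suc d)" if "a \<in> \<sigma> \<longleftrightarrow> b \<in> \<sigma>" for \<sigma>
    using that nin ab(3) unfolding fs by auto
  have two: "(\<Sum>x\<in>V - \<rho>. g x) = g a + g b"
    if "a \<notin> \<rho>" "b \<notin> \<rho>" "\<And>x. x \<noteq> a \<Longrightarrow> x \<noteq> b \<Longrightarrow> g x = (0::'f)" for g \<rho>
  proof -
    have "(\<Sum>x\<in>V - \<rho>. g x) = (\<Sum>x\<in>{a, b}. g x)"
      by (rule sum.mono_neutral_right) (use that V abV in auto)
    then show ?thesis using ab(3) by simp
  qed
  obtain z0 :: "'v set \<Rightarrow> 'f" where z0: "z0 \<in> cycles V K d" "\<forall>H\<in>faces K d. z0 H \<noteq> 0" "\<forall>y\<in>cycles V K d. \<exists>l. y = fsc l z0"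
    using one unfolding one_cycle_def by blast
  \<comment> \<open>\<open>y0\<close> is the signed link of \<open>y\<close> at \<open>p\<close>. At
    a ridge through \<open>p\<close> the boundary of \<open>y\<close> is that of \<open>y0\<close>
    up to sign.\<close>
  have link: "bdry V y (insert p r) = - eps p r * bdry V y0 r"
    if p: "p \<in> V" "p \<notin> r" "finite r" and y: "\<And>H. p \<notin> H \<Longrightarrow> finite H \<Longrightarrow> y (insert p H) = eps p H * y0 H"
      and y0: "\<And>H. p \<in> H \<Longrightarrow> y0 H = 0" for p r and y y0 :: "'v set \<Rightarrow> 'f"
  proof -
    have e: "V - r = insert p (V - insert p r)" using p by blast
    have "bdry V y0 r = (\<Sum>x\<in>V - insert p r. eps x r * y0 (insert x r))"
      unfolding bdry_def e using V(1) by (subst sum.insert) (auto simp: y0)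
    moreover have "bdry V y (insert p r) = (\<Sum>x\<in>V - insert p r. - eps p r * (eps x r * y0 (insert x r)))"
      unfolding bdry_def
    proof (rule sum.cong[OF refl])
      fix x assume x: "x \<in> V - insert p r"
      have "eps x (insert p r) * eps p r = - (eps p (insert x r) * eps x r :: 'f)"
        by (rule eps_swap) (use x p in auto)
      then have s: "eps x (insert p r) * eps p (insert x r) = - (eps p r * eps x r :: 'f)"
      proof -
        have "eps x (insert p r) * eps p (insert x r) = eps x (insert p r) * eps p r * (eps p r * eps p (insert x r) :: 'f)"
          by (simp add: mult.assoc eps_square_left)
        also have "\<dots> = - (eps p (insert x r) * eps p (insert x r)) * (eps p r * eps x r)"
          unfolding \<open>eps x (insert p r) * eps p r = - (eps p (insert x r) * eps x r :: 'f)\<close> by (simp add: mult_ac)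
        finally show ?thesis by (simp add: eps_square)
      qed
      have "y (insert x (insert p r)) = eps p (insert x r) * y0 (insert x r)"
        using y[of "insert x r"] x p by (auto simp add: insert_commute)
      then show "eps x (insert p r) * y (insert x (insert p r)) = - eps p r * (eps x r * y0 (insert x r))"
        by (simp add: mult.assoc[symmetric] s)
    qed
    ultimately show ?thesis by (simp add: sum_distrib_left)
  qed
  \<comment> \<open>The two cones over \<open>z0\<close> with opposite signs, so that their
    boundaries cancel on the base.\<close>
  define z where "z H = (if a \<in> H \<and> b \<notin> H then eps a (H - {a}) * z0 (H - {a})
    else if b \<in> H \<and> a \<notin> H then - (eps b (H - {b}) * z0 (H - {b})) else 0)" for H
  have z0f: "z0 H = 0" if "H \<notin> faces K d" for H using fun_onD[OF cyclesD(1)[OF z0(1)] that] .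
  have z0a: "z0 H = 0" if "a \<in> H" for H using z0f nin that by blast
  have z0b: "z0 H = 0" if "b \<in> H" for H using z0f nin that by blast
  have za: "z (insert a H) = eps a H * z0 H" if "a \<notin> H" for H
    using that ab(3) z0b[of H] by (auto simp: z_def)
  have zb: "z (insert b H) = eps b H * - z0 H" if "b \<notin> H" for H
    using that ab(3) z0a[of H] by (auto simp: z_def)
  have z_supp: "z \<sigma> = 0" if "\<sigma> \<notin> faces ?S (Suc d)" for \<sigma>
  proof (cases "a \<in> \<sigma>")
    case True
    then have e: "insert a (\<sigma> - {a}) = \<sigma>" by blast
    then have "\<sigma> - {a} \<notin> faces K d" using mema[of "\<sigma> - {a}"] that by simp
    then show ?thesis using za[of "\<sigma> - {a}"] z0f e by simp
  next
    case a: False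
    show ?thesis
    proof (cases "b \<in> \<sigma>")
      case True
      then have e: "insert b (\<sigma> - {b}) = \<sigma>" by blast
      then have "\<sigma> - {b} \<notin> faces K d" using memb[of "\<sigma> - {b}"] that by simp
      then show ?thesis using zb[of "\<sigma> - {b}"] z0f e by simp
    qed (simp add: a z_def)
  qed
  have zc: "z \<in> cycles V ?S (Suc d)"
  proof (rule cyclesI)
    show "z \<in> fun_on (faces ?S (Suc d))" by (rule fun_onI) (rule z_supp)
    fix \<rho> assume \<rho>: "\<rho> \<subseteq> V" "Suc (card \<rho>) = Suc d"
    have fin: "finite \<rho>" using \<rho> V finite_subset by blast
    have bz: "bdry V z0 (\<rho> - {x}) = 0" if "x \<in> \<rho>" for x
    proof (rule cyclesD(2)[OF z0(1)])
      show "Suc (card (\<rho> - {x})) = d" using that \<rho> fin by (metis card_Suc_Diff1 Suc_inject)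
    qed (use \<rho> in auto)
    have bz': "bdry V (\<lambda>H. - z0 H) (\<rho> - {x}) = 0" if "x \<in> \<rho>" for x
      using bz[OF that] by (simp add: bdry_def sum_negf)
    consider "a \<in> \<rho>" | "b \<in> \<rho>" | "a \<notin> \<rho>" "b \<notin> \<rho>" by blast
    then show "bdry V z \<rho> = 0"
    proof cases
      case 1
      have "bdry V z (insert a (\<rho> - {a})) = - eps a (\<rho> - {a}) * bdry V z0 (\<rho> - {a})"
        by (rule link) (use abV fin za z0a in auto)
      then show ?thesis using bz[OF 1] 1 by (simp add: insert_absorb)
    next
      case 2
      have "bdry V z (insert b (\<rho> - {b})) = - eps b (\<rho> - {b}) * bdry V (\<lambda>H. - z0 H) (\<rho> - {b})"
        by (rule link) (use abV fin zb z0b in auto)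
      then show ?thesis using bz'[OF 2] 2 by (simp add: insert_absorb)
    next
      case 3
      have "bdry V z \<rho> = eps a \<rho> * z (insert a \<rho>) + eps b \<rho> * z (insert b \<rho>)"
        unfolding bdry_def by (rule two) (use 3 in \<open>auto simp: z_def\<close>)
      then show ?thesis using za[OF 3(1)] zb[OF 3(2)] by (simp add: eps_square_left)
    qed
  qed
  show ?thesis unfolding one_cycle_def
  proof (intro bexI[OF _ zc] conjI ballI)
    fix H assume "H \<in> faces ?S (Suc d)"
    then obtain H' where "H' \<in> faces K d" "H = insert a H' \<or> H = insert b H'" unfolding fs by blast
    then show "z H \<noteq> 0" using za zb nin z0(2) by auto
  next
    fix y :: "'v set \<Rightarrow> 'f" assume y: "y \<in> cycles V ?S (Suc d)"
    have y_supp: "y \<sigma> = 0" if "\<sigma> \<notin> faces ?S (Suc d)" for \<sigma> using fun_onD[OF cyclesD(1)[OF y] that] .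
    define y0 where "y0 H = (if H \<in> faces K d then eps a H * y (insert a H) else 0)" for H
    have ya: "y (insert a H) = eps a H * y0 H" if "a \<notin> H" for H
      using mema[OF that] y_supp[of "insert a H"] by (simp add: y0_def eps_square_left)
    have y0a: "y0 H = 0" if "a \<in> H" for H using that nin by (auto simp: y0_def)
    have "y0 \<in> cycles V K d"
    proof (rule cyclesI)
      show "y0 \<in> fun_on (faces K d)" by (rule fun_onI) (simp add: y0_def)
      fix r assume r: "r \<subseteq> V" "Suc (card r) = d"
      have fin: "finite r" using r V finite_subset by blast
      show "bdry V y0 r = 0"
      proof (cases "a \<in> r")
        case True then show ?thesis by (simp add: bdry_def y0a)
      next
        case False
        have "bdry V y (insert a r) = - eps a r * bdry V y0 r"
          by (rule link) (use abV fin ya y0a False in auto)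
        moreover have "bdry V y (insert a r) = 0"
          by (rule cyclesD(2)[OF y]) (use r abV fin False in auto)
        ultimately show ?thesis by simp
      qed
    qed
    then obtain l where l: "y0 = fsc l z0" using z0(3) by blast
    \<comment> \<open>The boundary of \<open>y\<close> at the base facet \<open>H\<close> has only
      the summands for \<open>a\<close> and \<open>b\<close>, since any other vertex added to
      \<open>H\<close> leaves both apices out.\<close>
    have yb: "y (insert b H) = - (eps b H * y0 H)" if H: "H \<in> faces K d" for H
    proof -
      have "bdry V y H = eps a H * y (insert a H) + eps b H * y (insert b H)"
        unfolding bdry_def
      proof (rule two)
        fix x assume "x \<noteq> a" "x \<noteq> b"
        then show "eps x H * y (insert x H) = 0" using y_supp[OF memab[of "insert x H"]] nin[OF H] by simp
      qed (use nin[OF H] in auto)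
      moreover have "bdry V y H = 0"
      proof (rule cyclesD(2)[OF y])
        have "H \<in> ?S" using facesD(1)[OF H] by (rule suspendI)
        then show "H \<subseteq> V" using V(2) by blast
        show "Suc (card H) = Suc d" using facesD(2)[OF H] by simp
      qed
      ultimately have "eps b H * y (insert b H) = - y0 H"
        using ya[of H] nin[OF H] by (simp add: eps_square_left add_eq_0_iff)
      then have "eps b H * (eps b H * y (insert b H)) = - (eps b H * y0 H)" by simp
      then show ?thesis by (simp only: eps_square_left)
    qed
    show "\<exists>l. y = fsc l z"
    proof (intro exI ext)
      fix \<sigma> show "y \<sigma> = fsc l z \<sigma>"
      proof (cases "\<sigma> \<in> faces ?S (Suc d)")
        case True
        then obtain H where H: "H \<in> faces K d" "\<sigma> = insert a H \<or> \<sigma> = insert b H" unfolding fs by blast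
        then show ?thesis using ya[of H] yb[OF H(1)] za[of H] zb[of H] nin[OF H(1)] l by (auto simp: fsc_apply)
      next
        case False then show ?thesis using y_supp z_supp by (simp add: fsc_apply)
      qed
    qed
  qed
qed

lemma cross_polytope_structure:
  fixes v w :: "nat \<Rightarrow> 'v"
  assumes "cross_vertices d v w"
  shows "pure_cplx d (cross_polytope d v w)" "flippable d (cross_polytope d v w)"
    "finite V \<Longrightarrow> \<Union>(cross_polytope d v w) \<subseteq> V \<Longrightarrow> one_cycle TYPE('f::field) V (cross_polytope d v w) d"
  using assms
proof (induction d)
  case 0
  have f: "faces {{} :: 'v set} 0 = {{}}" by (auto simp: faces_def)
  { case 1 show ?case by (auto simp: pure_cplx_def cplx_def faces_def) }
  { case 2 show ?case by (auto simp: flippable_def f) }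
  { case 3
    \<comment> \<open>For \<open>d = 0\<close> the only face is the empty one, and every function on
      it is a cycle.\<close>
    show ?case unfolding one_cycle_def
    proof (intro bexI[of _ "unit_fun {}"] conjI ballI)
      fix y :: "'v set \<Rightarrow> 'f" assume "y \<in> cycles V (cross_polytope 0 v w) 0"
      then have y: "y \<in> fun_on {{}}" using cyclesD(1) f by (metis cross_polytope.simps(1))
      have "y = fsc (y {}) (unit_fun {})" using fun_on_expand[OF _ y] by simp
      then show "\<exists>l. y = fsc l (unit_fun {})" by blast
    qed (auto simp: f unit_fun_def cycles_def fun_on_def) }
next
  case (Suc d)
  { case 1
    note cv = cross_vertices_SucD[OF 1]
    have a: "v d \<notin> \<Union>(cross_polytope d v w)" "w d \<notin> \<Union>(cross_polytope d v w)"
      using cv unfolding Union_cross_polytope by auto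
    show ?case unfolding cross_polytope_Suc by (rule pure_suspend[OF Suc.IH(1)[OF cv(1)] a cv(2)]) }
  { case 2
    note cv = cross_vertices_SucD[OF 2]
    have a: "v d \<notin> \<Union>(cross_polytope d v w)" "w d \<notin> \<Union>(cross_polytope d v w)"
      using cv unfolding Union_cross_polytope by auto
    show ?case unfolding cross_polytope_Suc by (rule flippable_suspend[OF Suc.IH(1,2)[OF cv(1)] a cv(2)]) }
  { case 3
    note cv = cross_vertices_SucD[OF 3(3)]
    have a: "v d \<notin> \<Union>(cross_polytope d v w)" "w d \<notin> \<Union>(cross_polytope d v w)"
      using cv unfolding Union_cross_polytope by auto
    have sub: "\<Union>(cross_polytope d v w) \<subseteq> V" using 3(2) unfolding Union_cross_polytope by (auto simp: lessThan_Suc)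
    show ?case unfolding cross_polytope_Suc
      by (rule one_cycle_suspend[OF Suc.IH(1)[OF cv(1)] a cv(2) 3(1) _ Suc.IH(3)[OF 3(1) sub cv(1)]])
        (use 3(2) cross_polytope_Suc in metis) }
qed

text \<open>Iterated connected sums with the identification of the glued facets already carried out.\<close>

inductive glued :: "nat \<Rightarrow> nat \<Rightarrow> 'v set set \<Rightarrow> bool" for d where
  single: "is_cross_polytope d \<Gamma> \<Longrightarrow> glued d 1 \<Gamma>"
| glue: "\<lbrakk>glued d n \<Delta>; is_cross_polytope d \<Gamma>; \<Union>\<Delta> \<inter> \<Union>\<Gamma> = F; is_facet \<Delta> F; is_facet \<Gamma> F\<rbrakk>
         \<Longrightarrow> glued d (Suc n) ((\<Delta> - {F}) \<union> (\<Gamma> - {F}))"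

lemma is_cross_polytopeE:
  assumes "is_cross_polytope d \<Gamma>"
  obtains v w where "cross_vertices d v w" "\<Gamma> = cross_polytope d v w"
  using assms unfolding is_cross_polytope_def cross_vertices_def by blast

lemma image_suspend: "(`) f ` suspend K a b = suspend ((`) f ` K) (f a) (f b)"
  by (simp add: suspend_def cone_def image_Un image_image)

lemma image_cross_polytope: "(`) f ` cross_polytope d v w = cross_polytope d (f \<circ> v) (f \<circ> w)"
  by (induction d) (simp_all add: cross_polytope_Suc image_suspend del: cross_polytope.simps(2))

lemma is_cross_polytope_image:
  assumes "is_cross_polytope d \<Gamma>" "inj_on f (\<Union>\<Gamma>)"
  shows "is_cross_polytope d ((`) f ` \<Gamma>)"
proof -
  obtain v w where vw: "cross_vertices d v w" "\<Gamma> = cross_polytope d v w"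
    using assms(1) by (rule is_cross_polytopeE)
  have inj: "inj_on f (v ` {..<d} \<union> w ` {..<d})" using assms(2) unfolding vw(2) Union_cross_polytope .
  have "inj_on (f \<circ> v) {..<d}" "inj_on (f \<circ> w) {..<d}"
    using vw(1) inj unfolding cross_vertices_def by (auto intro!: comp_inj_on intro: inj_on_subset)
  moreover have "(f \<circ> v) ` {..<d} \<inter> (f \<circ> w) ` {..<d} = {}"
  proof -
    have "f ` (v ` {..<d}) \<inter> f ` (w ` {..<d}) = f ` (v ` {..<d} \<inter> w ` {..<d})"
      by (rule inj_on_image_Int[OF inj, symmetric]) auto
    then show ?thesis using vw(1) by (simp add: cross_vertices_def image_comp)
  qed
  ultimately show ?thesis unfolding is_cross_polytope_def vw(2) image_cross_polytope by blast
qed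

lemma is_facet_image:
  assumes "is_facet K F" "inj_on f (\<Union>K)" shows "is_facet ((`) f ` K) (f ` F)"
  unfolding is_facet_def
proof (intro conjI ballI impI)
  show "f ` F \<in> (`) f ` K" using assms(1) unfolding is_facet_def by blast
  fix H' assume "H' \<in> (`) f ` K" and sub: "f ` F \<subseteq> H'"
  then obtain H where H: "H \<in> K" "H' = f ` H" by blast
  have "F \<subseteq> \<Union>K" "H \<subseteq> \<Union>K" using H assms(1) unfolding is_facet_def by blast+
  then have "F \<subseteq> H" using sub H(2) inj_on_image_mem_iff[OF assms(2), of _ H] by blast
  then show "H' = f ` F" using assms(1) H unfolding is_facet_def by blast
qed

lemma image_remove:
  assumes "inj_on f (\<Union>K)" "F \<in> K" shows "(`) f ` (K - {F}) = (`) f ` K - {f ` F}"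
proof -
  have "inj_on ((`) f) K" using assms(1) inj_on_image by blast
  then have "(`) f ` (K - {F}) = (`) f ` K - (`) f ` {F}"
    by (rule inj_on_image_set_diff) (use assms(2) in auto)
  then show ?thesis by simp
qed

text \<open>Renaming along \<open>r\<close> fixes \<open>\<Delta>\<close> and turns
  \<open>\<Gamma>\<close> into an isomorphic copy that meets \<open>\<Delta>\<close> in
  \<open>F\<close>. It is injective on \<open>\<Gamma>\<close> because the new names lie in
  \<open>F\<close>, away from all old vertices of \<open>\<Gamma>\<close>.\<close>

lemma iterated_sum_glued: "iterated_sum d n \<Delta> \<Longrightarrow> glued d n \<Delta>"
proof (induction rule: iterated_sum.induct)
  case (single \<Delta>) then show ?case by (rule glued.single)
next
  case (glue n \<Delta> \<Gamma> F G \<phi>)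
  define r where "r x = (if x \<in> G then inv_into F \<phi> x else x)" for x
  have bij: "bij_betw (inv_into F \<phi>) G F" using glue.hyps(6) by (rule bij_betw_inv_into)
  have FD: "F \<in> \<Delta>" "F \<subseteq> \<Union>\<Delta>" and GG: "G \<in> \<Gamma>" "G \<subseteq> \<Union>\<Gamma>" using glue.hyps(4,5) unfolding is_facet_def by blast+
  have dis: "\<Union>\<Delta> \<inter> \<Union>\<Gamma> = {}" by fact
  have rG: "r ` G = F" using bij unfolding r_def bij_betw_def by (simp cong: image_cong)
  have rD: "r x = x" if "x \<in> \<Union>\<Delta>" for x using that dis GG(2) by (auto simp: r_def)
  have rD': "(`) r ` (\<Delta> - {F}) = \<Delta> - {F}"
  proof -
    have "r ` \<sigma> = \<sigma>" if "\<sigma> \<in> \<Delta>" for \<sigma>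
    proof -
      have "r ` \<sigma> = (\<lambda>x. x) ` \<sigma>" by (rule image_cong[OF refl], rule rD) (use that in blast)
      then show ?thesis by simp
    qed
    then show ?thesis by (auto simp: image_iff)
  qed
  have inj: "inj_on r (\<Union>\<Gamma>)"
  proof (rule inj_onI)
    fix x y assume xy: "x \<in> \<Union>\<Gamma>" "y \<in> \<Union>\<Gamma>" "r x = r y"
    have in_F: "r x \<in> F \<longleftrightarrow> x \<in> G" if "x \<in> \<Union>\<Gamma>" for x
      using that rG FD(2) dis by (auto simp: r_def)
    show "x = y"
    proof (cases "x \<in> G")
      case True
      then have "y \<in> G" using in_F xy by metis
      then show ?thesis using True xy(3) bij unfolding r_def bij_betw_def inj_on_def by simp
    next
      case False
      then have "y \<notin> G" using in_F xy by metis
      then show ?thesis using False xy(3) by (simp add: r_def)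
    qed
  qed
  have "connected_sum \<Delta> \<Gamma> F G \<phi> = (`) r ` (\<Delta> - {F}) \<union> (`) r ` (\<Gamma> - {G})"
    unfolding connected_sum_def r_def[abs_def] image_Un[symmetric] by simp
  then have eq: "connected_sum \<Delta> \<Gamma> F G \<phi> = (\<Delta> - {F}) \<union> ((`) r ` \<Gamma> - {F})"
    unfolding rD' image_remove[OF inj GG(1)] rG .
  have "\<Union>((`) r ` \<Gamma>) = r ` \<Union>\<Gamma>" by (rule image_Union[symmetric])
  also have "\<dots> = r ` (\<Union>\<Gamma> - G) \<union> r ` G" using GG(2) by (metis Diff_partition Un_commute image_Un)
  also have "r ` (\<Union>\<Gamma> - G) = \<Union>\<Gamma> - G" proof -
    have "r ` (\<Union>\<Gamma> - G) = (\<lambda>x. x) ` (\<Union>\<Gamma> - G)" by (rule image_cong) (auto simp: r_def)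
    then show ?thesis by simp
  qed
  finally have U: "\<Union>((`) r ` \<Gamma>) = (\<Union>\<Gamma> - G) \<union> F" unfolding rG .
  have "\<Union>\<Delta> \<inter> \<Union>((`) r ` \<Gamma>) = F" unfolding U using FD(2) dis by blast
  moreover have "is_facet ((`) r ` \<Gamma>) F" using is_facet_image[OF glue.hyps(5) inj] rG by simp
  ultimately show ?case unfolding eq
    using glue.IH is_cross_polytope_image[OF glue.hyps(2) inj] glue.hyps(4) by (intro glued.glue)
qed

lemma cross_polytope_props:
  fixes \<Gamma> :: "'v set set"
  assumes "is_cross_polytope d \<Gamma>"
  shows "pure_cplx d \<Gamma>" "flippable d \<Gamma>" "card (\<Union>\<Gamma>) = 2 * d" "finite (\<Union>\<Gamma>)"
    "finite V \<Longrightarrow> \<Union>\<Gamma> \<subseteq> V \<Longrightarrow> one_cycle TYPE('f::field) V \<Gamma> d"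
proof -
  obtain v w where vw: "cross_vertices d v w" "\<Gamma> = cross_polytope d v w"
    using assms by (rule is_cross_polytopeE)
  show "pure_cplx d \<Gamma>" "flippable d \<Gamma>" "finite V \<Longrightarrow> \<Union>\<Gamma> \<subseteq> V \<Longrightarrow> one_cycle TYPE('f) V \<Gamma> d"
    unfolding vw(2) using cross_polytope_structure[OF vw(1)] by blast+
  show "card (\<Union>\<Gamma>) = 2 * d" "finite (\<Union>\<Gamma>)"
    unfolding vw(2) Union_cross_polytope using card_cross_vertices[OF vw(1)] by auto
qed

text \<open>Removing \<open>F\<close> loses none of its proper faces, because \<open>\<Gamma>\<close> has a second facet across every
  ridge of \<open>F\<close>.\<close>

lemma pure_glue:
  assumes D: "pure_cplx d \<Delta>" and G: "pure_cplx d \<Gamma>" "flippable d \<Gamma>"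
    and F: "\<Union>\<Delta> \<inter> \<Union>\<Gamma> = F" "F \<in> faces \<Delta> d" "F \<in> faces \<Gamma> d" and d: "d \<ge> 1"
  shows "pure_cplx d ((\<Delta> - {F}) \<union> (\<Gamma> - {F}))"
proof -
  let ?D = "(\<Delta> - {F}) \<union> (\<Gamma> - {F})"
  note cD = pure_cplxD(1)[OF D] and cG = pure_cplxD(1)[OF G(1)]
  have card: "card \<sigma> \<le> d" if "\<sigma> \<in> \<Delta> \<union> \<Gamma>" for \<sigma> using that pure_cplxD(2)[OF D] pure_cplxD(2)[OF G(1)] by blast
  have fin: "finite \<sigma>" if "\<sigma> \<in> \<Delta> \<union> \<Gamma>" for \<sigma> using that cplxD(3)[OF cD] cplxD(3)[OF cG] by blast
  have down: "\<tau> \<in> ?D" if "\<sigma> \<in> ?D" "\<tau> \<subseteq> \<sigma>" for \<sigma> \<tau>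
  proof (cases "\<tau> = \<sigma>")
    case True then show ?thesis using that by simp
  next
    case False
    have s: "\<sigma> \<in> \<Delta> \<union> \<Gamma>" using that by blast
    have "card \<tau> < card \<sigma>" using False that(2) by (intro psubset_card_mono fin[OF s]) blast
    then have "card \<tau> < d" using card[OF s] by simp
    then have "\<tau> \<noteq> F" using F(2) by (auto simp: faces_def)
    moreover have "\<tau> \<in> \<Delta> \<union> \<Gamma>" using that cplxD(4)[OF cD] cplxD(4)[OF cG] by blast
    ultimately show ?thesis by blast
  qed
  have "{} \<noteq> F" using F(2) d by (auto simp: faces_def)
  then have "{} \<in> ?D" using cplxD(2)[OF cD] by blast
  then have "cplx ?D" unfolding cplx_def using down fin cplxD(1)[OF cD] cplxD(1)[OF cG] by blast
  moreover have "\<exists>H\<in>faces ?D d. \<sigma> \<subseteq> H" if s: "\<sigma> \<in> ?D" for \<sigma>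
  proof (cases "\<sigma> \<subseteq> F")
    case True
    then obtain x where "x \<in> F" "x \<notin> \<sigma>" using s by blast
    then obtain H where "H \<in> faces \<Gamma> d" "F - {x} \<subseteq> H" "H \<noteq> F" using G(2) F(3) unfolding flippable_def by blast
    then have "H \<in> faces ?D d" "\<sigma> \<subseteq> H" using True \<open>x \<notin> \<sigma>\<close> by (auto simp: faces_def)
    then show ?thesis by blast
  next
    case False
    obtain H where H: "H \<in> faces \<Delta> d \<union> faces \<Gamma> d" "\<sigma> \<subseteq> H"
      using s pure_cplxD(3)[OF D, of \<sigma>] pure_cplxD(3)[OF G(1), of \<sigma>] by blast
    then have "H \<in> faces ?D d" using False by (auto simp: faces_def)
    then show ?thesis using H by blast
  qed
  ultimately show ?thesis unfolding pure_cplx_def using card by blast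
qed

text \<open>Deleting \<open>F\<close> could only lose a vertex if \<open>F\<close> were that single
  vertex.\<close>

lemma Union_glue:
  assumes "cplx \<Delta>" "cplx \<Gamma>" "card F \<ge> 2"
  shows "\<Union>((\<Delta> - {F}) \<union> (\<Gamma> - {F})) = \<Union>\<Delta> \<union> \<Union>\<Gamma>"
proof -
  have "x \<in> \<Union>(K - {F})" if "cplx K" "x \<in> \<Union>K" for x K
  proof -
    have "{x} \<in> K" using that cplxD(4)[OF that(1)] by blast
    moreover have "{x} \<noteq> F" using assms(3) by auto
    ultimately show ?thesis by blast
  qed
  then show ?thesis using assms by blast
qed

lemma glued_structure:
  assumes "glued d n \<Delta>" "d \<ge> 2"
  shows "pure_cplx d \<Delta> \<and> finite (\<Union>\<Delta>) \<and> card (\<Union>\<Delta>) = Suc n * d \<and> n \<ge> 1"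
  using assms(1)
proof (induction rule: glued.induct)
  case (single \<Gamma>) then show ?case using cross_polytope_props[OF single] by simp
next
  case (glue n \<Delta> \<Gamma> F)
  note G = cross_polytope_props[OF glue.hyps(2)]
  have D: "pure_cplx d \<Delta>" using glue.IH by blast
  have FD: "F \<in> faces \<Delta> d" using glue.hyps(4) facet_iff[OF D] by blast
  have FG: "F \<in> faces \<Gamma> d" using glue.hyps(5) facet_iff[OF G(1)] by blast
  have U: "\<Union>((\<Delta> - {F}) \<union> (\<Gamma> - {F})) = \<Union>\<Delta> \<union> \<Union>\<Gamma>"
    by (rule Union_glue[OF pure_cplxD(1)[OF D] pure_cplxD(1)[OF G(1)]]) (use facesD(2)[OF FD] assms(2) in simp)
  have "card (\<Union>\<Delta> \<union> \<Union>\<Gamma>) + card F = card (\<Union>\<Delta>) + card (\<Union>\<Gamma>)"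
    using card_Un_Int[of "\<Union>\<Delta>" "\<Union>\<Gamma>"] glue.IH G(4) glue.hyps(3) by simp
  then have "card (\<Union>\<Delta> \<union> \<Union>\<Gamma>) = Suc (Suc n) * d"
    using glue.IH G(3) facesD(2)[OF FD] by simp
  moreover have "pure_cplx d ((\<Delta> - {F}) \<union> (\<Gamma> - {F}))"
    by (rule pure_glue[OF D G(1,2) glue.hyps(3) FD FG]) (use assms(2) in simp)
  ultimately show ?case using U glue.IH G(4) by simp
qed

text \<open>The inductive construction lives on natural numbers, while the sphere may have vertices
  of any type.\<close>

lemma glued_image:
  assumes "glued d n \<Delta>" "d \<ge> 2" "inj_on f (\<Union>\<Delta>)"
  shows "glued d n ((`) f ` \<Delta>)"
  using assms(1,3)
proof (induction rule: glued.induct)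
  case (single \<Gamma>) then show ?case using is_cross_polytope_image glued.single by blast
next
  case (glue n \<Delta> \<Gamma> F)
  have D: "pure_cplx d \<Delta>" using glued_structure[OF glue.hyps(1) assms(2)] by blast
  have G: "pure_cplx d \<Gamma>" using cross_polytope_props[OF glue.hyps(2)] by blast
  have FD: "F \<in> faces \<Delta> d" using glue.hyps(4) facet_iff[OF D] by blast
  have FD': "F \<in> \<Delta>" "F \<in> \<Gamma>" using glue.hyps(4,5) unfolding is_facet_def by blast+
  have "\<Union>((\<Delta> - {F}) \<union> (\<Gamma> - {F})) = \<Union>\<Delta> \<union> \<Union>\<Gamma>"
    by (rule Union_glue[OF pure_cplxD(1)[OF D] pure_cplxD(1)[OF G]]) (use facesD(2)[OF FD] assms(2) in simp)
  then have inj: "inj_on f (\<Union>\<Delta> \<union> \<Union>\<Gamma>)" using glue.prems by simp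
  then have injD: "inj_on f (\<Union>\<Delta>)" and injG: "inj_on f (\<Union>\<Gamma>)" by (auto intro: inj_on_subset)
  have eq: "(`) f ` ((\<Delta> - {F}) \<union> (\<Gamma> - {F})) = ((`) f ` \<Delta> - {f ` F}) \<union> ((`) f ` \<Gamma> - {f ` F})"
    unfolding image_Un image_remove[OF injD FD'(1)] image_remove[OF injG FD'(2)] ..
  have "f ` \<Union>\<Delta> \<inter> f ` \<Union>\<Gamma> = f ` F"
    unfolding glue.hyps(3)[symmetric] by (rule inj_on_image_Int[OF inj, symmetric]) auto
  then have int: "\<Union>((`) f ` \<Delta>) \<inter> \<Union>((`) f ` \<Gamma>) = f ` F" by (simp only: image_Union)
  show ?case unfolding eq
    by (rule glued.glue[OF glue.IH[OF injD] is_cross_polytope_image[OF glue.hyps(2) injG] int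
        is_facet_image[OF glue.hyps(4) injD] is_facet_image[OF glue.hyps(5) injG]])
qed

lemma stacked_glued:
  assumes "stacked_cross_polytopal_sphere d k \<Delta>" "d \<ge> 2"
  shows "glued d (k - 1) \<Delta>"
proof -
  obtain \<Delta>0 f where "iterated_sum d (k - 1) \<Delta>0" "inj_on f (\<Union>\<Delta>0)" "\<Delta> = (`) f ` \<Delta>0"
    using assms(1) unfolding stacked_cross_polytopal_sphere_def simplicial_iso_def by blast
  then show ?thesis using glued_image[OF iterated_sum_glued assms(2)] by simp
qed

section \<open>The unique top cycle of a glued complex\<close>

lemma cycles_support:
  assumes "y \<in> cycles V K d" "y \<in> fun_on (faces K' d)" shows "y \<in> cycles V K' d"
  using assms unfolding cycles_def by blast

lemma cycles_combine:
  fixes y y' :: "'v set \<Rightarrow> 'f::field"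
  assumes "\<And>\<rho>. \<rho> \<subseteq> V \<Longrightarrow> Suc (card \<rho>) = d \<Longrightarrow> r * bdry V y \<rho> + s * bdry V y' \<rho> = 0"
    "(\<lambda>\<sigma>. r * y \<sigma> + s * y' \<sigma>) \<in> fun_on (faces K d)"
  shows "(\<lambda>\<sigma>. r * y \<sigma> + s * y' \<sigma>) \<in> cycles V K d"
  by (rule cyclesI[OF assms(2)]) (unfold bdry_lin, rule assms(1))

lemma bdry_supported:
  assumes "cplx K" "y \<in> fun_on (faces K d)" "\<rho> \<notin> K" shows "bdry V y \<rho> = 0"
proof -
  have "y (insert x \<rho>) = 0" for x
  proof (rule fun_onD[OF assms(2)])
    show "insert x \<rho> \<notin> faces K d" using assms(3) cplxD(4)[OF assms(1), of "insert x \<rho>" \<rho>] by (auto simp: faces_def)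
  qed
  then show ?thesis by (simp add: bdry_def)
qed

lemma bdry_unit:
  assumes "finite V" "\<rho> \<subseteq> V" "F \<subseteq> V"
  shows "bdry V (unit_fun F) \<rho> = (if \<exists>x\<in>F. \<rho> = F - {x} then eps (THE x. x \<in> F \<and> \<rho> = F - {x}) \<rho> else 0)"
proof (cases "\<exists>x\<in>F. \<rho> = F - {x}")
  case True
  then obtain x where x: "x \<in> F" "\<rho> = F - {x}" by blast
  have u: "x' = x" if "x' \<in> F" "\<rho> = F - {x'}" for x' using that x by blast
  have "bdry V (unit_fun F) \<rho> = (\<Sum>x'\<in>V - \<rho>. if x' = x then eps x \<rho> else 0)"
    unfolding bdry_def
  proof (rule sum.cong[OF refl])
    fix x' assume "x' \<in> V - \<rho>"
    then have "insert x' \<rho> = F \<longleftrightarrow> x' = x" using x by blast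
    then show "eps x' \<rho> * unit_fun F (insert x' \<rho>) = (if x' = x then eps x \<rho> else 0)"
      by (simp add: unit_fun_def)
  qed
  also have "\<dots> = eps x \<rho>" using x assms by auto
  finally have "bdry V (unit_fun F) \<rho> = eps x \<rho>" .
  moreover have "(THE x. x \<in> F \<and> \<rho> = F - {x}) = x" using x u by blast
  ultimately show ?thesis using True by simp
next
  case False
  have "eps x \<rho> * unit_fun F (insert x \<rho>) = 0" if "x \<in> V - \<rho>" for x
  proof -
    have "insert x \<rho> \<noteq> F"
    proof
      assume "insert x \<rho> = F"
      then have "x \<in> F" "\<rho> = F - {x}" using that by auto
      then show False using False by blast
    qed
    then show ?thesis by (simp add: unit_fun_def)
  qed
  then have "bdry V (unit_fun F) \<rho> = 0" unfolding bdry_def by (rule sum.neutral[OF ballI])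
  then show ?thesis using False by simp
qed

lemma bdry_unit_face:
  assumes "finite V" "F \<subseteq> V" "x \<in> F"
  shows "bdry V (unit_fun F) (F - {x}) = eps x (F - {x})"
proof -
  have "(THE x'. x' \<in> F \<and> F - {x} = F - {x'}) = x" using assms(3) by blast
  then show ?thesis using assms by (subst bdry_unit) auto
qed

text \<open>Two ridges of \<open>F\<close> share the face that omits both vertices. The boundary of
  \<open>g\<close> at this face has just two summands, so the coefficients of \<open>g\<close> at
  the two ridges, taken relative to the boundary of \<open>F\<close>, agree.\<close>

lemma simplex_boundary_cycle:
  fixes g :: "'v set \<Rightarrow> 'f::field"
  assumes V: "finite V" "F \<subseteq> V" and F: "F \<noteq> {}"
    and supp: "\<And>\<rho>. \<rho> \<subseteq> V \<Longrightarrow> Suc (card \<rho>) = card F \<Longrightarrow> g \<rho> \<noteq> 0 \<Longrightarrow> \<rho> \<subseteq> F"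
    and zero: "\<And>\<tau>. \<tau> \<subseteq> V \<Longrightarrow> Suc (Suc (card \<tau>)) = card F \<Longrightarrow> bdry V g \<tau> = 0"
  shows "\<exists>c. \<forall>\<rho>. \<rho> \<subseteq> V \<and> Suc (card \<rho>) = card F \<longrightarrow> g \<rho> = c * bdry V (unit_fun F) \<rho>"
proof -
  have fF: "finite F" using V finite_subset by blast
  obtain v0 where v0: "v0 \<in> F" using F by blast
  \<comment> \<open>The ratio of \<open>g\<close> to the boundary of \<open>F\<close> at the ridge
    opposite \<open>v\<close>; a sign is its own inverse.\<close>
  define c where "c v = g (F - {v}) * eps v (F - {v})" for v
  have eq: "c v = c v0" if v: "v \<in> F" for v
  proof (cases "v = v0")
    case False
    let ?t = "F - {v} - {v0}"
    have e: "insert v ?t = F - {v0}" "insert v0 ?t = F - {v}" using v v0 False by auto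
    have "card (F - {v}) = Suc (card ?t)" by (rule card.remove) (use v0 False fF in auto)
    then have ct: "Suc (Suc (card ?t)) = card F" using card.remove[OF fF v] by simp
    have "bdry V g ?t = (\<Sum>x\<in>{v, v0}. eps x ?t * g (insert x ?t))"
      unfolding bdry_def
    proof (rule sum.mono_neutral_right)
      show "\<forall>x\<in>V - ?t - {v, v0}. eps x ?t * g (insert x ?t) = 0"
      proof
        fix x assume x: "x \<in> V - ?t - {v, v0}"
        have "card (insert x ?t) = Suc (card ?t)" by (rule card_insert_disjoint) (use x fF in blast)+
        then have "g (insert x ?t) = 0" using supp[of "insert x ?t"] x V(2) ct by auto
        then show "eps x ?t * g (insert x ?t) = 0" by simp
      qed
    qed (use V v v0 in auto)
    moreover have "bdry V g ?t = 0" by (rule zero[OF _ ct]) (use V in auto)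
    ultimately have s: "eps v ?t * g (F - {v0}) + eps v0 ?t * g (F - {v}) = 0"
      using False e by simp
    have sw: "eps v (F - {v}) * eps v0 ?t = - (eps v0 (F - {v0}) * eps v ?t :: 'f)"
    proof -
      have "eps v (insert v0 ?t) * eps v0 ?t = - (eps v0 (insert v ?t) * eps v ?t :: 'f)"
        by (rule eps_swap) (use fF False in auto)
      then show ?thesis unfolding e .
    qed
    let ?A = "eps v (F - {v}) :: 'f" and ?B = "eps v0 ?t :: 'f" and ?C = "eps v0 (F - {v0}) :: 'f" and ?D = "eps v ?t :: 'f"
    have gv: "g (F - {v}) = ?A * c v" "g (F - {v0}) = ?C * c v0"
      unfolding c_def by (simp_all add: eps_square_left mult.commute[of "g _"])
    have "?D * (?C * c v0) + ?B * (?A * c v) = 0" using s unfolding gv .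
    moreover have "?B * (?A * c v) = - (?D * (?C * c v))"
    proof -
      have "?B * (?A * c v) = (?A * ?B) * c v" by (simp add: mult_ac)
      then show ?thesis unfolding sw by (simp add: mult_ac)
    qed
    ultimately have "?D * (?C * (c v0 - c v)) = 0" by (simp add: right_diff_distrib)
    then show ?thesis by simp
  qed simp
  have "g \<rho> = c v0 * bdry V (unit_fun F) \<rho>" if r: "\<rho> \<subseteq> V" "Suc (card \<rho>) = card F" for \<rho>
  proof (cases "\<exists>x\<in>F. \<rho> = F - {x}")
    case True
    then obtain x where x: "x \<in> F" "\<rho> = F - {x}" by blast
    have "g \<rho> = c x * eps x \<rho>" unfolding c_def x(2) by (simp add: mult.assoc eps_square)
    moreover have "bdry V (unit_fun F) \<rho> = (eps x \<rho> :: 'f)" unfolding x(2) by (rule bdry_unit_face[OF V x(1)])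
    ultimately show ?thesis using eq[OF x(1)] by simp
  next
    case False
    have "\<not> \<rho> \<subseteq> F"
    proof
      assume s: "\<rho> \<subseteq> F"
      then have "card (F - \<rho>) = 1" using r(2) fF card_Diff_subset[OF finite_subset[OF s fF] s] by simp
      then obtain x where "F - \<rho> = {x}" using card_1_singletonE by blast
      then have "x \<in> F" "\<rho> = F - {x}" using s by blast+
      then show False using False by blast
    qed
    then have "g \<rho> = 0" using supp[OF r] by blast
    moreover have "bdry V (unit_fun F) \<rho> = (0 :: 'f)" by (subst bdry_unit[OF V(1) r(1) V(2)]) (simp add: False)
    ultimately show ?thesis by simp
  qed
  then show ?thesis by blast
qed

text \<open>A combination of the two generators that cancels at \<open>F\<close> generates the new
  cycles. Conversely a cycle splits into a part on \<open>\<Delta>\<close> and a part on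
  \<open>\<Gamma>\<close> with opposite boundaries. These live on common faces, thus on the boundary
  of \<open>F\<close>, and are multiples of it, so both parts become cycles after adding a multiple
  of \<open>F\<close>.\<close>

lemma one_cycle_glue:
  fixes \<Delta> \<Gamma> :: "'v set set"
  assumes D: "pure_cplx d \<Delta>" and G: "pure_cplx d \<Gamma>"
    and F: "\<Union>\<Delta> \<inter> \<Union>\<Gamma> = F" "F \<in> faces \<Delta> d" "F \<in> faces \<Gamma> d" and d: "d \<ge> 1"
    and V: "finite V" "\<Union>\<Delta> \<union> \<Union>\<Gamma> \<subseteq> V"
    and one: "one_cycle TYPE('f::field) V \<Delta> d" "one_cycle TYPE('f) V \<Gamma> d"
  shows "one_cycle TYPE('f) V ((\<Delta> - {F}) \<union> (\<Gamma> - {F})) d"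
proof -
  let ?D = "(\<Delta> - {F}) \<union> (\<Gamma> - {F})"
  note cD = pure_cplxD(1)[OF D] and cG = pure_cplxD(1)[OF G]
  obtain zD :: "'v set \<Rightarrow> 'f" where zD: "zD \<in> cycles V \<Delta> d" "\<forall>H\<in>faces \<Delta> d. zD H \<noteq> 0" "\<forall>y\<in>cycles V \<Delta> d. \<exists>l. y = fsc l zD"
    using one(1) unfolding one_cycle_def by blast
  obtain zG :: "'v set \<Rightarrow> 'f" where zG: "zG \<in> cycles V \<Gamma> d" "\<forall>H\<in>faces \<Gamma> d. zG H \<noteq> 0" "\<forall>y\<in>cycles V \<Gamma> d. \<exists>l. y = fsc l zG"
    using one(2) unfolding one_cycle_def by blast
  have FV: "F \<subseteq> V" and cF: "card F = d" using F(1) V(2) facesD(2)[OF F(2)] by auto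
  have Fne: "F \<noteq> {}" using cF d by auto
  have onlyF: "H = F" if "H \<in> faces \<Delta> d" "H \<in> faces \<Gamma> d" for H
  proof -
    have "H \<subseteq> F" using that F(1) facesD(1) by blast
    moreover have "finite F" using FV V finite_subset by blast
    ultimately show ?thesis using card_subset_eq[of F H] cF facesD(2)[OF that(1)] by simp
  qed
  have nz: "zD F \<noteq> 0" "zG F \<noteq> 0" using zD(2) zG(2) F by auto
  \<comment> \<open>Chosen to cancel the values at \<open>F\<close>, the facet that the connected
    sum deletes.\<close>
  define k where "k = - zD F / zG F"
  define z where "z = (\<lambda>\<sigma>. 1 * zD \<sigma> + k * zG \<sigma>)"
  have zF: "z F = 0" using nz by (simp add: z_def k_def)
  have z_supp: "z \<in> fun_on (faces ?D d)"
  proof (rule fun_onI)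
    fix \<sigma> assume s: "\<sigma> \<notin> faces ?D d"
    show "z \<sigma> = 0"
    proof (cases "\<sigma> = F")
      case False
      then have "\<sigma> \<notin> faces \<Delta> d" "\<sigma> \<notin> faces \<Gamma> d" using s by (auto simp: faces_def)
      then show ?thesis using fun_onD[OF cyclesD(1)[OF zD(1)]] fun_onD[OF cyclesD(1)[OF zG(1)]] by (simp add: z_def)
    qed (use zF in simp)
  qed
  have zc: "z \<in> cycles V ?D d"
    unfolding z_def by (rule cycles_combine) (use cyclesD(2)[OF zD(1)] cyclesD(2)[OF zG(1)] z_supp[unfolded z_def] in auto)
  show ?thesis unfolding one_cycle_def
  proof (intro bexI[OF _ zc] conjI ballI)
    fix H assume H: "H \<in> faces ?D d"
    then have HF: "H \<noteq> F" "H \<in> faces \<Delta> d \<or> H \<in> faces \<Gamma> d" by (auto simp: faces_def)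
    then consider "H \<in> faces \<Delta> d" "H \<notin> faces \<Gamma> d" | "H \<notin> faces \<Delta> d" "H \<in> faces \<Gamma> d" using onlyF by blast
    then show "z H \<noteq> 0"
    proof cases
      case 1 then show ?thesis using zD(2) fun_onD[OF cyclesD(1)[OF zG(1)] 1(2)] by (simp add: z_def)
    next
      case 2 then show ?thesis using zG(2) fun_onD[OF cyclesD(1)[OF zD(1)] 2(1)] nz by (simp add: z_def k_def)
    qed
  next
    fix y :: "'v set \<Rightarrow> 'f" assume y: "y \<in> cycles V ?D d"
    have yF: "y F = 0" by (rule fun_onD[OF cyclesD(1)[OF y]]) (simp add: faces_def)
    define a where "a = (\<lambda>\<sigma>. if \<sigma> \<in> faces \<Delta> d then y \<sigma> else 0)"
    define b where "b = (\<lambda>\<sigma>. if \<sigma> \<in> faces \<Gamma> d then y \<sigma> else 0)"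
    have ab: "y = (\<lambda>\<sigma>. 1 * a \<sigma> + 1 * b \<sigma>)"
    proof
      fix \<sigma> show "y \<sigma> = 1 * a \<sigma> + 1 * b \<sigma>"
        using onlyF[of \<sigma>] yF fun_onD[OF cyclesD(1)[OF y], of \<sigma>] by (auto simp: a_def b_def faces_def)
    qed
    have aD: "a \<in> fun_on (faces \<Delta> d)" and bG: "b \<in> fun_on (faces \<Gamma> d)" by (auto simp: a_def b_def fun_on_def)
    have sum0: "bdry V a \<rho> + bdry V b \<rho> = 0" if "\<rho> \<subseteq> V" "Suc (card \<rho>) = d" for \<rho>
      using cyclesD(2)[OF y that] bdry_lin[of V 1 a 1 b \<rho>] ab by simp
    have "\<exists>c. \<forall>\<rho>. \<rho> \<subseteq> V \<and> Suc (card \<rho>) = card F \<longrightarrow> bdry V a \<rho> = c * bdry V (unit_fun F) \<rho>"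
    proof (rule simplex_boundary_cycle[OF V(1) FV Fne])
      fix \<rho> assume r: "\<rho> \<subseteq> V" "Suc (card \<rho>) = card F" "bdry V a \<rho> \<noteq> 0"
      then have "bdry V b \<rho> \<noteq> 0" using sum0[OF r(1)] cF by auto
      then have "\<rho> \<in> \<Delta>" "\<rho> \<in> \<Gamma>" using r(3) bdry_supported[OF cD aD] bdry_supported[OF cG bG] by blast+
      then show "\<rho> \<subseteq> F" using F(1) by blast
    next
      fix \<tau> assume "\<tau> \<subseteq> V" then show "bdry V (bdry V a) \<tau> = 0" by (rule bdry_bdry[OF V(1)])
    qed
    then obtain c where c: "\<And>\<rho>. \<rho> \<subseteq> V \<Longrightarrow> Suc (card \<rho>) = d \<Longrightarrow> bdry V a \<rho> = c * bdry V (unit_fun F) \<rho>"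
      using cF by blast
    have uF: "unit_fun F \<sigma> = (0 :: 'f)" if "\<sigma> \<notin> faces \<Delta> d \<or> \<sigma> \<notin> faces \<Gamma> d" for \<sigma>
      using that F(2,3) by (auto simp: unit_fun_def)
    \<comment> \<open>The chain \<open>a\<close> has the same boundary as \<open>c\<close> times the
      simplex \<open>F\<close>. Subtracting this multiple of \<open>F\<close> closes
      \<open>a\<close> up, and adding it closes up \<open>b\<close>.\<close>
    have "(\<lambda>\<sigma>. 1 * a \<sigma> + (- c) * unit_fun F \<sigma>) \<in> cycles V \<Delta> d"
    proof (rule cycles_combine)
      show "(\<lambda>\<sigma>. 1 * a \<sigma> + - c * unit_fun F \<sigma>) \<in> fun_on (faces \<Delta> d)"
        by (rule fun_onI) (simp add: fun_onD[OF aD] uF)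
    qed (simp add: c)
    then obtain l where l: "(\<lambda>\<sigma>. 1 * a \<sigma> + (- c) * unit_fun F \<sigma>) = fsc l zD" using zD(3) by blast
    have "(\<lambda>\<sigma>. 1 * b \<sigma> + c * unit_fun F \<sigma>) \<in> cycles V \<Gamma> d"
    proof (rule cycles_combine)
      show "(\<lambda>\<sigma>. 1 * b \<sigma> + c * unit_fun F \<sigma>) \<in> fun_on (faces \<Gamma> d)"
        by (rule fun_onI) (simp add: fun_onD[OF bG] uF)
      fix \<rho> assume r: "\<rho> \<subseteq> V" "Suc (card \<rho>) = d"
      show "1 * bdry V b \<rho> + c * bdry V (unit_fun F) \<rho> = 0" using c[OF r] sum0[OF r] by (simp add: add.commute)
    qed
    then obtain m where m: "(\<lambda>\<sigma>. 1 * b \<sigma> + c * unit_fun F \<sigma>) = fsc m zG" using zG(3) by blast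
    have ys: "y \<sigma> = l * zD \<sigma> + m * zG \<sigma>" for \<sigma>
      using fun_cong[OF l, of \<sigma>] fun_cong[OF m, of \<sigma>] fun_cong[OF ab, of \<sigma>] by (simp add: fsc_def algebra_simps)
    \<comment> \<open>The value of \<open>y\<close> at \<open>F\<close> is zero, which ties the two
      coefficients together.\<close>
    then have "m = l * k" using yF nz by (simp add: k_def field_simps add_eq_0_iff)
    then have "y = fsc l z" by (intro ext) (simp add: ys z_def fsc_def algebra_simps)
    then show "\<exists>l. y = fsc l z" by blast
  qed
qed

lemma glued_one_cycle:
  assumes "glued d n \<Delta>" "d \<ge> 2" "finite V" "\<Union>\<Delta> \<subseteq> V"
  shows "one_cycle TYPE('f::field) V \<Delta> d"
  using assms(1,4)
proof (induction rule: glued.induct)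
  case (single \<Gamma>) then show ?case using cross_polytope_props(5) assms(3) by blast
next
  case (glue n \<Delta> \<Gamma> F)
  note G = cross_polytope_props[OF glue.hyps(2)]
  have D: "pure_cplx d \<Delta>" using glued_structure[OF glue.hyps(1) assms(2)] by blast
  have FD: "F \<in> faces \<Delta> d" using glue.hyps(4) facet_iff[OF D] by blast
  have FG: "F \<in> faces \<Gamma> d" using glue.hyps(5) facet_iff[OF G(1)] by blast
  have U: "\<Union>((\<Delta> - {F}) \<union> (\<Gamma> - {F})) = \<Union>\<Delta> \<union> \<Union>\<Gamma>"
    by (rule Union_glue[OF pure_cplxD(1)[OF D] pure_cplxD(1)[OF G(1)]]) (use facesD(2)[OF FD] assms(2) in simp)
  have sub: "\<Union>\<Delta> \<union> \<Union>\<Gamma> \<subseteq> V" using glue.prems unfolding U .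
  have "one_cycle TYPE('f) V \<Delta> d" by (rule glue.IH) (use sub in blast)
  moreover have "one_cycle TYPE('f) V \<Gamma> d" by (rule G(5)[OF assms(3)]) (use sub in blast)
  ultimately show ?case
    by (intro one_cycle_glue[OF D G(1) glue.hyps(3) FD FG _ assms(3) sub]) (use assms(2) in simp_all)
qed

text \<open>A set \<open>W\<close> that misses a vertex also misses a facet through it. A top cycle
  of the induced complex is then a multiple of \<open>z\<close> that vanishes at this facet, hence
  zero.\<close>

lemma glued_hdim_top:
  fixes \<Delta> :: "'v set set"
  assumes "glued d n \<Delta>" "d \<ge> 2"
  shows "hdim TYPE('f::field) (induced \<Delta> W) d = of_bool (\<Union>\<Delta> \<subseteq> W)"
proof -
  let ?V = "\<Union>\<Delta>" and ?K = "induced \<Delta> W"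
  have P: "pure_cplx d \<Delta>" and V: "finite ?V" using glued_structure[OF assms] by auto
  have K: "cplx ?K" "\<Union>?K \<subseteq> ?V" using cplx_induced[OF pure_cplxD(1)[OF P]] by (auto simp: induced_def)
  have top: "card \<sigma> \<le> d" if "\<sigma> \<in> ?K" for \<sigma> using that pure_cplxD(2)[OF P] by (auto simp: induced_def)
  obtain e where e: "d = Suc e" using assms(2) by (cases d) auto
  obtain z :: "'v set \<Rightarrow> 'f" where z: "z \<in> cycles ?V \<Delta> d" "\<forall>H\<in>faces \<Delta> d. z H \<noteq> 0" "\<forall>y\<in>cycles ?V \<Delta> d. \<exists>l. y = fsc l z"
    using glued_one_cycle[OF assms V order_refl, where 'f='f] unfolding one_cycle_def by blast
  show ?thesis
  proof (cases "?V \<subseteq> W")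
    case True
    then have K': "?K = \<Delta>" by (auto simp: induced_def)
    obtain H where H: "H \<in> faces \<Delta> d" using pure_cplxD(3)[OF P cplxD(2)[OF pure_cplxD(1)[OF P]]] by blast
    then have "z \<noteq> 0" using z(2) by auto
    then have "hdim TYPE('f) ?K (Suc e) = 1"
      using z pure_cplxD(2)[OF P] unfolding K' e
      by (intro hdim_top_1[OF pure_cplxD(1)[OF P] _ V order_refl, of e z]) auto
    then show ?thesis using True e by simp
  next
    case False
    then obtain x \<sigma> where x: "x \<notin> W" "x \<in> \<sigma>" "\<sigma> \<in> \<Delta>" by blast
    obtain H where H: "H \<in> faces \<Delta> d" "\<sigma> \<subseteq> H" using pure_cplxD(3)[OF P x(3)] by blast
    have "hdim TYPE('f) ?K (Suc e) = 0"
    proof (rule hdim_top_0[OF K(1) _ V K(2)])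
      fix y :: "'v set \<Rightarrow> 'f" assume y: "y \<in> cycles ?V ?K (Suc e)"
      have "y \<in> fun_on (faces \<Delta> d)"
        using cyclesD(1)[OF y] unfolding e by (auto simp: fun_on_def faces_def induced_def)
      then have "y \<in> cycles ?V \<Delta> d" using cycles_support[OF y] unfolding e by blast
      then obtain l where l: "y = fsc l z" using z(3) by blast
      have "H \<notin> faces ?K (Suc e)" using x H by (auto simp: faces_def induced_def)
      then have "y H = 0" using fun_onD[OF cyclesD(1)[OF y]] by blast
      then have "l = 0" using l z(2) H(1) by (auto simp: fsc_def)
      then show "y = 0" using l by (auto simp: fsc_def)
    qed (use top e in auto)
    then show ?thesis using False e by simp
  qed
qed

section \<open>Cohomology of induced subcomplexes under gluing\<close>

lemma zdim_cong:
  assumes "faces K q = faces K' q" "faces K (Suc q) = faces K' (Suc q)"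
  shows "zdim F K q = zdim F K' q"
  using assms by (simp add: zdim_def cocyc_def)

text \<open>The term \<open>zdim F K 0\<close> cancels. It is the one that need not add up under
  gluing when the common simplex is empty.\<close>

lemma hdim_1_diff:
  assumes "cplx K" shows "hdim F K 1 - hdim F K 0 = int (zdim F K 1) - 1"
  using fnum_0[OF assms] by (simp add: hdim_def)

text \<open>The cocycle space on faces of size \<open>Suc e\<close> cancels. When the facets have
  size \<open>Suc (Suc e)\<close>, it is the one whose defining condition changes with the deletion
  of a facet.\<close>

lemma hdim_top_diff:
  assumes K: "cplx K" and top: "faces K (Suc (Suc (Suc e))) = {}"
  shows "hdim TYPE('f::field) K (Suc e) - hdim TYPE('f) K (Suc (Suc e)) =
    int (zdim TYPE('f) K e) - int (fnum K e) + int (fnum K (Suc e)) - int (fnum K (Suc (Suc e)))"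
proof -
  have "cocyc K (Suc (Suc e)) = (fun_on (faces K (Suc (Suc e))) :: ('a set \<Rightarrow> 'f) set)"
    using top by (simp add: cocyc_def)
  then have "zdim TYPE('f) K (Suc (Suc e)) = fnum K (Suc (Suc e))"
    by (simp add: zdim_def fnum_def fun_on_dim(1)[OF finite_faces[OF K]])
  then show ?thesis by (simp add: hdim_def)
qed

text \<open>Records what the counting uses: \<open>C\<close> is the vertex set of one cross-polytope
  and \<open>U q\<close> its family of unions of \<open>q\<close> antipodal pairs.\<close>

definition layout :: "nat \<Rightarrow> 'v set \<Rightarrow> ('v set \<times> (nat \<Rightarrow> 'v set set)) list \<Rightarrow> bool" where
  "layout d V Cs \<longleftrightarrow> (\<forall>(C, U)\<in>set Cs. C \<subseteq> V \<and> card C = 2 * d \<and>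
     (\<forall>q. card (U q) = d choose q \<and> (\<forall>S\<in>U q. S \<subseteq> C \<and> card S = 2 * q)))"

lemma layout_mono: "layout d V Cs \<Longrightarrow> V \<subseteq> V' \<Longrightarrow> layout d V' Cs"
  unfolding layout_def by blast

text \<open>In a complex glued from cross-polytopes with vertex sets \<open>C\<close> along facets \<open>F\<close>, the cohomology of
  an induced subcomplex is the sum of the contributions of the cross-polytopes, corrected in the
  lowest degree by counting components and in the top two degrees by the removed facets. The
  differences are additive under gluing, unlike the two cohomology dimensions themselves.\<close>

definition hdim_formulas ::
  "'f::field itself \<Rightarrow> nat \<Rightarrow> 'v set set \<Rightarrow> ('v set \<times> (nat \<Rightarrow> 'v set set)) list \<Rightarrow> 'v set list \<Rightarrow> 'v set \<Rightarrow> bool"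
where
  "hdim_formulas Q d \<Delta> Cs Fs W \<longleftrightarrow>
    (\<forall>q. 2 \<le> q \<and> q \<le> d - 2 \<longrightarrow> hdim Q (induced \<Delta> W) q = (\<Sum>(C, U)\<leftarrow>Cs. of_bool (W \<inter> C \<in> U q))) \<and>
    hdim Q (induced \<Delta> W) 1 - hdim Q (induced \<Delta> W) 0 =
      (\<Sum>(C, U)\<leftarrow>Cs. of_bool (W \<inter> C \<in> U 1) - of_bool (W \<inter> C = {})) + (\<Sum>F\<leftarrow>Fs. of_bool (W \<inter> F = {})) \<and>
    hdim Q (induced \<Delta> W) (d - 1) - hdim Q (induced \<Delta> W) d =
      (\<Sum>(C, U)\<leftarrow>Cs. of_bool (W \<inter> C \<in> U (d - 1)) - of_bool (C \<subseteq> W)) + (\<Sum>F\<leftarrow>Fs. of_bool (F \<subseteq> W))"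

lemma hdim_formulas_cross_polytope:
  fixes v w :: "nat \<Rightarrow> 'v"
  assumes "cross_vertices d v w" 
  shows "hdim_formulas TYPE('f::field) d (cross_polytope d v w)
    [(\<Union>(cross_polytope d v w), pair_unions d v w)] [] W"
proof -
  let ?V = "v ` {..<d} \<union> w ` {..<d}"
  note h = hdim_cross_polytope[OF assms, where 'f='f, of W]
  have "W \<inter> ?V \<in> pair_unions d v w d \<longleftrightarrow> ?V \<subseteq> W" unfolding pair_unions_top by blast
  moreover have "W \<inter> ?V \<in> pair_unions d v w 0 \<longleftrightarrow> W \<inter> ?V = {}" unfolding pair_unions_0 by blast
  ultimately show ?thesis unfolding hdim_formulas_def h Union_cross_polytope by simp
qed

lemma hdim_formulas_glue:
  fixes \<Delta> \<Gamma> :: "'v set set"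
  assumes D: "pure_cplx d \<Delta>" and G: "pure_cplx d \<Gamma>"
    and F: "\<Union>\<Delta> \<inter> \<Union>\<Gamma> = F" "F \<in> faces \<Delta> d" "F \<in> faces \<Gamma> d" and d: "d \<ge> 3"
    and D': "pure_cplx d ((\<Delta> - {F}) \<union> (\<Gamma> - {F}))"
    and fD: "hdim_formulas TYPE('f::field) d \<Delta> Cs Fs W" and fG: "hdim_formulas TYPE('f) d \<Gamma> [(C, U)] [] W"
  shows "hdim_formulas TYPE('f) d ((\<Delta> - {F}) \<union> (\<Gamma> - {F})) ((C, U) # Cs) (F # Fs) W"
proof -
  let ?A = "induced \<Delta> W" and ?B = "induced \<Gamma> W" and ?t = "F \<inter> W" and ?N = "induced ((\<Delta> - {F}) \<union> (\<Gamma> - {F})) W"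
  \<comment> \<open>\<open>?M\<close> is the union with \<open>F\<close> still present, whose two
    pieces meet in the simplex on \<open>F \<inter> W\<close>. Passing to \<open>?N\<close> deletes
    \<open>F\<close> if it lies in \<open>W\<close>; below size \<open>d\<close> both have the same
    faces.\<close>
  let ?M = "?A \<union> ?B"
  note cD = pure_cplxD(1)[OF D] and cG = pure_cplxD(1)[OF G]
  note A = cplx_induced[OF cD, of W] and B = cplx_induced[OF cG, of W]
  have N: "cplx ?N" by (rule cplx_induced[OF pure_cplxD(1)[OF D']])
  have M: "cplx ?M" by (rule cplx_Un[OF A B])
  have AB: "?A \<inter> ?B = Pow ?t"
    using F(1) cplxD(4)[OF cD facesD(1)[OF F(2)]] cplxD(4)[OF cG facesD(1)[OF F(3)]]
    by (auto simp: induced_def)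
  have finF: "finite F" by (rule faces_finite[OF cD F(2)])
  have cF: "card F = d" by (rule facesD(2)[OF F(2)])
  have ft: "finite ?t" using finF by simp
  have P: "cplx (Pow ?t)" by (rule cplx_Pow[OF ft])
  have low: "faces ?N q = faces ?M q" if "q < d" for q
    using that cF by (auto simp: faces_def induced_def)
  have zlow: "zdim TYPE('f) ?N q = zdim TYPE('f) ?M q" if "Suc q < d" for q
    by (rule zdim_cong) (use low that in auto)
  have flow: "fnum ?N q = fnum ?M q" if "q < d" for q using low[OF that] by (simp add: fnum_def)
  have zM: "zdim TYPE('f) ?M q + zdim TYPE('f) (Pow ?t) q = zdim TYPE('f) ?A q + zdim TYPE('f) ?B q" if "q > 0" for q
    by (rule zdim_glue[OF A B AB]) (use that in simp)
  note fM = fnum_glue[OF A B AB]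
  have hP: "hdim TYPE('f) (Pow ?t) q = 0" if "q > 0" for q by (rule hdim_Pow[OF ft]) (use that in simp)
  obtain e where e: "d = Suc (Suc e)" "e > 0" using d by (cases d; cases "d - 1") auto
  have "hdim TYPE('f) ?N q = hdim TYPE('f) ?A q + hdim TYPE('f) ?B q" if q: "2 \<le> q" "q \<le> d - 2" for q
  proof -
    obtain p where p: "q = Suc p" "p > 0" using q by (cases q) auto
    have "Suc q < d" "Suc p < d" "p < d" using q p d by auto
    then have "hdim TYPE('f) ?N q = hdim TYPE('f) ?M q" using p zlow flow by (simp add: hdim_def)
    moreover have "hdim TYPE('f) ?M q + hdim TYPE('f) (Pow ?t) q = hdim TYPE('f) ?A q + hdim TYPE('f) ?B q"
      using zM[of q] zM[of p] fM[of p] p by (simp add: hdim_def)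
    ultimately show ?thesis using hP[of q] q by simp
  qed
  moreover have "hdim TYPE('f) ?N 1 - hdim TYPE('f) ?N 0 = (hdim TYPE('f) ?A 1 - hdim TYPE('f) ?A 0) +
      (hdim TYPE('f) ?B 1 - hdim TYPE('f) ?B 0) + of_bool (W \<inter> F = {})"
  proof -
    \<comment> \<open>On a nonempty simplex these cocycles are the constant functions on the
      vertices. The correction appears because the two pieces are not joined when \<open>W\<close>
      misses \<open>F\<close>.\<close>
    have "int (zdim TYPE('f) (Pow ?t) 1) = 1 - of_bool (W \<inter> F = {})"
    proof -
      have "Pow ?t = {{}} \<longleftrightarrow> W \<inter> F = {}" by blast
      then have "hdim TYPE('f) (Pow ?t) 0 = of_bool (W \<inter> F = {})" unfolding hdim_0[OF P] by simp
      then show ?thesis using hdim_1_diff[OF P, of "TYPE('f)"] hP[of 1] by simp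
    qed
    then show ?thesis using hdim_1_diff[OF N, of "TYPE('f)"] hdim_1_diff[OF A, of "TYPE('f)"]
        hdim_1_diff[OF B, of "TYPE('f)"] zM[of 1] zlow[of 1] d by simp
  qed
  moreover have "hdim TYPE('f) ?N (d - 1) - hdim TYPE('f) ?N d = (hdim TYPE('f) ?A (d - 1) - hdim TYPE('f) ?A d) +
      (hdim TYPE('f) ?B (d - 1) - hdim TYPE('f) ?B d) + of_bool (F \<subseteq> W)"
  proof -
    have top: "faces (induced K W) (Suc (Suc (Suc e))) = {}" if "pure_cplx d K" for K :: "'v set set"
      using faces_above[OF that] e(1) by (auto simp: faces_def induced_def)
    have fP: "faces (Pow ?t) d = (if F \<subseteq> W then {F} else {})"
    proof -
      have "\<sigma> = F" if "\<sigma> \<subseteq> F" "card \<sigma> = d" for \<sigma> using that card_subset_eq[OF finF] cF by simp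
      then have "\<sigma> \<in> faces (Pow ?t) d \<longleftrightarrow> F \<subseteq> W \<and> \<sigma> = F" for \<sigma>
        unfolding faces_def using cF by blast
      then show ?thesis by auto
    qed
    have topP: "faces (Pow ?t) (Suc (Suc (Suc e))) = {}"
    proof -
      have "card \<sigma> \<le> d" if "\<sigma> \<subseteq> ?t" for \<sigma> using that card_mono[OF finF, of \<sigma>] cF by auto
      then have "card \<sigma> \<noteq> Suc (Suc (Suc e))" if "\<sigma> \<in> Pow ?t" for \<sigma>
        using that e(1) by (metis PowD not_less_eq_eq order_refl)
      then show ?thesis unfolding faces_def by blast
    qed
    have "faces ?M d = faces ?N d \<union> (if F \<subseteq> W then {F} else {})"
      using F(2) cF by (auto simp: faces_def induced_def)
    moreover have "F \<notin> faces ?N d" by (auto simp: faces_def induced_def)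
    ultimately have fd: "int (fnum ?M d) = int (fnum ?N d) + of_bool (F \<subseteq> W)"
      using finite_faces[OF N] by (simp add: fnum_def)
    have fPd: "int (fnum (Pow ?t) d) = of_bool (F \<subseteq> W)" using fP by (simp add: fnum_def)
    have t: "hdim TYPE('f) K (d - 1) - hdim TYPE('f) K d =
        int (zdim TYPE('f) K e) - int (fnum K e) + int (fnum K (d - 1)) - int (fnum K d)"
      if "cplx K" "faces K (Suc (Suc (Suc e))) = {}" for K :: "'v set set"
      using hdim_top_diff[OF that, where 'f='f] unfolding e(1) by simp
    have "int (zdim TYPE('f) ?N e) = zdim TYPE('f) ?A e + zdim TYPE('f) ?B e - int (zdim TYPE('f) (Pow ?t) e)"
      using zM[OF e(2)] zlow[of e] e(1) by simp
    moreover have "int (fnum ?N e) = fnum ?A e + fnum ?B e - int (fnum (Pow ?t) e)"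
      using fM[of e] flow[of e] e(1) by simp
    moreover have "int (fnum ?N (d - 1)) = fnum ?A (d - 1) + fnum ?B (d - 1) - int (fnum (Pow ?t) (d - 1))"
      using fM[of "d - 1"] flow[of "d - 1"] e(1) by simp
    \<comment> \<open>\<open>F\<close> is subtracted twice: once as a common face of both pieces and
      once because the connected sum deletes it.\<close>
    moreover have "int (fnum ?N d) = int (fnum ?A d) + int (fnum ?B d) - 2 * of_bool (F \<subseteq> W)"
      using fM[of d] fd fPd by linarith
    \<comment> \<open>The cohomology of the simplex on \<open>F \<inter> W\<close> vanishes in the
      two top degrees. This gives the linear relation that removes its terms.\<close>
    moreover have "0 = int (zdim TYPE('f) (Pow ?t) e) - fnum (Pow ?t) e + fnum (Pow ?t) (d - 1) - of_bool (F \<subseteq> W)"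
      using t[OF P topP] hP[of "d - 1"] hP[of d] d fPd by simp
    ultimately show ?thesis
      unfolding t[OF N top[OF D']] t[OF A top[OF D]] t[OF B top[OF G]] by linarith
  qed
  ultimately show ?thesis using fD fG unfolding hdim_formulas_def by simp
qed

lemma glued_hdim:
  fixes \<Delta> :: "'v set set"
  assumes "glued d n \<Delta>" "d \<ge> 3"
  shows "\<exists>Cs Fs. length Cs = n \<and> Suc (length Fs) = n \<and> layout d (\<Union>\<Delta>) Cs \<and> (\<forall>F\<in>set Fs. F \<subseteq> \<Union>\<Delta> \<and> card F = d) \<and>
    (\<forall>W. hdim_formulas TYPE('f::field) d \<Delta> Cs Fs W)"
  using assms(1)
proof (induction rule: glued.induct)
  case (single \<Gamma>)
  then obtain v w where vw: "cross_vertices d v w" "\<Gamma> = cross_polytope d v w" by (rule is_cross_polytopeE)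
  have "layout d (\<Union>\<Gamma>) [(\<Union>\<Gamma>, pair_unions d v w)]"
    using pair_unions_card[OF vw(1)] card_cross_vertices[OF vw(1)]
    unfolding layout_def vw(2) Union_cross_polytope by (auto simp: pair_unions_def)
  then show ?case using hdim_formulas_cross_polytope[OF vw(1), where 'f='f] vw(2)
    by (intro exI[of _ "[(\<Union>\<Gamma>, pair_unions d v w)]"] exI[of _ "[]"]) simp
next
  case (glue n \<Delta> \<Gamma> F)
  let ?D = "(\<Delta> - {F}) \<union> (\<Gamma> - {F})"
  have d2: "d \<ge> 2" "d \<ge> 1" using assms(2) by auto
  note G = cross_polytope_props[OF glue.hyps(2)]
  have D: "pure_cplx d \<Delta>" using glued_structure[OF glue.hyps(1) d2(1)] by blast
  have FD: "F \<in> faces \<Delta> d" using glue.hyps(4) facet_iff[OF D] by blast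
  have FG: "F \<in> faces \<Gamma> d" using glue.hyps(5) facet_iff[OF G(1)] by blast
  have D': "pure_cplx d ?D" by (rule pure_glue[OF D G(1,2) glue.hyps(3) FD FG d2(2)])
  have U: "\<Union>?D = \<Union>\<Delta> \<union> \<Union>\<Gamma>"
    by (rule Union_glue[OF pure_cplxD(1)[OF D] pure_cplxD(1)[OF G(1)]]) (use facesD(2)[OF FD] d2 in simp)
  obtain Cs Fs where CF: "length Cs = n" "Suc (length Fs) = n" "layout d (\<Union>\<Delta>) Cs"
    "\<forall>F\<in>set Fs. F \<subseteq> \<Union>\<Delta> \<and> card F = d" "\<And>W. hdim_formulas TYPE('f) d \<Delta> Cs Fs W"
    using glue.IH by blast
  obtain v w where vw: "cross_vertices d v w" "\<Gamma> = cross_polytope d v w"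
    using glue.hyps(2) by (rule is_cross_polytopeE)
  have fG: "hdim_formulas TYPE('f) d \<Gamma> [(\<Union>\<Gamma>, pair_unions d v w)] [] W" for W
    unfolding vw(2) by (rule hdim_formulas_cross_polytope[OF vw(1)])
  have "layout d (\<Union>?D) ((\<Union>\<Gamma>, pair_unions d v w) # Cs)"
  proof -
    have "layout d (\<Union>?D) Cs" unfolding U by (rule layout_mono[OF CF(3)]) blast
    moreover have "layout d (\<Union>?D) [(\<Union>\<Gamma>, pair_unions d v w)]"
      using pair_unions_card[OF vw(1)] card_cross_vertices[OF vw(1)]
      unfolding layout_def U unfolding vw(2) Union_cross_polytope by (auto simp: pair_unions_def)
    ultimately show ?thesis unfolding layout_def by simp
  qed
  moreover have "\<forall>H\<in>set (F # Fs). H \<subseteq> \<Union>?D \<and> card H = d"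
    using CF(4) facesD[OF FD] unfolding U by auto
  moreover have "hdim_formulas TYPE('f) d ?D ((\<Union>\<Gamma>, pair_unions d v w) # Cs) (F # Fs) W" for W
    by (rule hdim_formulas_glue[OF D G(1) glue.hyps(3) FD FG assms(2) D' CF(5) fG])
  ultimately show ?case using CF(1,2)
    by (intro exI[of _ "(\<Union>\<Gamma>, pair_unions d v w) # Cs"] exI[of _ "F # Fs"]) simp
qed

section \<open>Counting\<close>

definition subsets :: "'v set \<Rightarrow> nat \<Rightarrow> 'v set set" where
  "subsets V m = {W. W \<subseteq> V \<and> card W = m}"

lemma finite_subsets: "finite V \<Longrightarrow> finite (subsets V m)"
  by (simp add: subsets_def)

text \<open>Such a \<open>W\<close> is determined by its part outside \<open>A\<close>, of size
  \<open>m - card S\<close>. For \<open>m < card S\<close> there is none, and \<open>binom\<close>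
  is zero at the negative argument.\<close>

lemma sum_of_bool_subsets:
  assumes V: "finite V" "A \<subseteq> V" "S \<subseteq> A"
  shows "(\<Sum>W\<in>subsets V m. of_bool (W \<inter> A = S)) = binom (card V - card A) (int m - int (card S))"
proof -
  let ?X = "{W \<in> subsets V m. W \<inter> A = S}"
  have fA: "finite A" using V finite_subset by blast
  have fS: "finite S" using V(3) fA finite_subset by blast
  have "(\<Sum>W\<in>subsets V m. of_bool (W \<inter> A = S)) = int (card ?X)"
    using finite_subsets[OF V(1), of m] by (simp add: of_bool_def sum.If_cases Int_def)
  moreover have "int (card ?X) = binom (card V - card A) (int m - int (card S))"
  proof (cases "card S \<le> m")
    case False
    have "card S \<le> m" if "W \<in> ?X" for W
    proof -
      have W: "S \<subseteq> W" "W \<subseteq> V" "card W = m" using that by (auto simp: subsets_def)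
      have "finite W" using W V(1) finite_subset by blast
      then show ?thesis using card_mono W by blast
    qed
    then have X: "?X = {}" using False by blast
    show ?thesis unfolding X using False by (simp add: binom_def)
  next
    case True
    have cu: "card (X \<union> S) = card X + card S" if "X \<subseteq> V - A" for X
    proof (rule card_Un_disjoint)
      show "finite X" using that V(1) finite_subset by blast
    qed (use fS that V in auto)
    have "bij_betw (\<lambda>X. X \<union> S) {X. X \<subseteq> V - A \<and> card X = m - card S} ?X"
    proof (rule bij_betw_byWitness[where f' = "\<lambda>W. W - A"])
      show "(\<lambda>X. X \<union> S) ` {X. X \<subseteq> V - A \<and> card X = m - card S} \<subseteq> ?X"
        using cu V True by (auto simp: subsets_def)
      show "(\<lambda>W. W - A) ` ?X \<subseteq> {X. X \<subseteq> V - A \<and> card X = m - card S}"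
      proof
        fix X assume "X \<in> (\<lambda>W. W - A) ` ?X"
        then obtain W where W: "W \<subseteq> V" "card W = m" "W \<inter> A = S" "X = W - A" by (auto simp: subsets_def)
        have "X \<union> S = W" using W by blast
        moreover have X: "X \<subseteq> V - A" using W by blast
        ultimately show "X \<in> {X. X \<subseteq> V - A \<and> card X = m - card S}" using cu[OF X] W(2) by simp
      qed
    qed (use V in auto)
    then have "card ?X = card {X. X \<subseteq> V - A \<and> card X = m - card S}" by (rule bij_betw_same_card[symmetric])
    also have "\<dots> = card (V - A) choose (m - card S)" using n_subsets[of "V - A"] V(1) by simp
    also have "card (V - A) = card V - card A" using card_Diff_subset[OF fA V(2)] .
    finally show ?thesis using True by (simp add: binom_def nat_diff_distrib)
  qed
  ultimately show ?thesis by simp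
qed

lemma sum_of_bool_family:
  assumes V: "finite V" "A \<subseteq> V" and U: "\<And>S. S \<in> U \<Longrightarrow> S \<subseteq> A \<and> card S = s"
  shows "(\<Sum>W\<in>subsets V m. of_bool (W \<inter> A \<in> U)) = int (card U) * binom (card V - card A) (int m - int s)"
proof -
  have "finite (Pow A)" using V finite_subset by blast
  then have fU: "finite U" by (rule finite_subset[rotated]) (use U in blast)
  have "of_bool (W \<inter> A \<in> U) = (\<Sum>S\<in>U. of_bool (W \<inter> A = S) :: int)" for W
    using fU by (simp add: of_bool_def)
  then have "(\<Sum>W\<in>subsets V m. of_bool (W \<inter> A \<in> U)) = (\<Sum>W\<in>subsets V m. \<Sum>S\<in>U. of_bool (W \<inter> A = S) :: int)" by simp
  also have "\<dots> = (\<Sum>S\<in>U. \<Sum>W\<in>subsets V m. of_bool (W \<inter> A = S))" by (rule sum.swap)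
  also have "\<dots> = (\<Sum>S\<in>U. binom (card V - card A) (int m - int s))"
  proof (rule sum.cong[OF refl])
    fix S assume "S \<in> U"
    then have "S \<subseteq> A" "card S = s" using U by blast+
    then show "(\<Sum>W\<in>subsets V m. of_bool (W \<inter> A = S)) = binom (card V - card A) (int m - int s)"
      using sum_of_bool_subsets[OF V] by metis
  qed
  finally show ?thesis by simp
qed

lemma sum_sum_list: "(\<Sum>x\<in>A. \<Sum>y\<leftarrow>ys. g x y) = (\<Sum>y\<leftarrow>ys. \<Sum>x\<in>A. g x y)"
  for g :: "'a \<Rightarrow> 'b \<Rightarrow> 'c::comm_monoid_add"
  by (induction ys) (simp_all add: sum.distrib)

lemma sum_list_const: "(\<And>y. y \<in> set ys \<Longrightarrow> g y = c) \<Longrightarrow> (\<Sum>y\<leftarrow>ys. g y) = int (length ys) * c"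
  by (induction ys) (simp_all add: distrib_right)

text \<open>There are \<open>n\<close> cross-polytopes and \<open>n - 1\<close> glued facets among
  \<open>Suc n * d\<close> vertices. Fixing \<open>W\<close> on a cross-polytope leaves
  \<open>d * (n - 1)\<close> vertices free, fixing it on a facet leaves
  \<open>d * n\<close>.\<close>

theorem glued_hdim_sums:
  fixes \<Delta> :: "'v set set"
  assumes g: "glued d n \<Delta>" and d: "d \<ge> 3"
  shows "2 \<le> q \<Longrightarrow> q \<le> d - 2 \<Longrightarrow> (\<Sum>W\<in>subsets (\<Union>\<Delta>) m. hdim TYPE('f::field) (induced \<Delta> W) q) =
      int n * (int (d choose q) * binom (d * (n - 1)) (int m - 2 * int q))"
    "(\<Sum>W\<in>subsets (\<Union>\<Delta>) m. hdim TYPE('f) (induced \<Delta> W) 1 - hdim TYPE('f) (induced \<Delta> W) 0) =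
      int n * (int d * binom (d * (n - 1)) (int m - 2) - binom (d * (n - 1)) (int m)) + int (n - 1) * binom (d * n) (int m)"
    "(\<Sum>W\<in>subsets (\<Union>\<Delta>) m. hdim TYPE('f) (induced \<Delta> W) (d - 1) - hdim TYPE('f) (induced \<Delta> W) d) =
      int n * (int d * binom (d * (n - 1)) (int m - 2 * int (d - 1)) - binom (d * (n - 1)) (int m - 2 * int d)) +
      int (n - 1) * binom (d * n) (int m - int d)"
proof -
  let ?V = "\<Union>\<Delta>"
  have s: "finite ?V" "card ?V = Suc n * d" "n \<ge> 1" using glued_structure[OF g] d by auto
  obtain Cs Fs where CF: "length Cs = n" "Suc (length Fs) = n" "layout d ?V Cs"
    "\<forall>F\<in>set Fs. F \<subseteq> ?V \<and> card F = d" "\<And>W. hdim_formulas TYPE('f) d \<Delta> Cs Fs W"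
    using glued_hdim[OF g d, where 'f='f] by blast
  have lF: "length Fs = n - 1" using CF(2) by simp
  have c1: "card ?V - 2 * d = d * (n - 1)" "card ?V - d = d * n" using s(2,3) by (auto simp: algebra_simps diff_mult_distrib2)
  have C: "C \<subseteq> ?V" "card C = 2 * d" "card (U q) = d choose q" "S \<in> U q \<Longrightarrow> S \<subseteq> C \<and> card S = 2 * q"
    if "(C, U) \<in> set Cs" for C U q S using bspec[OF CF(3)[unfolded layout_def] that] by auto
  have sU: "(\<Sum>W\<in>subsets ?V m. of_bool (W \<inter> C \<in> U q)) = int (d choose q) * binom (d * (n - 1)) (int m - 2 * int q)"
    if "(C, U) \<in> set Cs" for C U q
    using sum_of_bool_family[OF s(1) C(1)[OF that], of "U q" "2 * q" m] C(2-4)[OF that] c1(1) by simp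
  have s0: "(\<Sum>W\<in>subsets ?V m. of_bool (W \<inter> C = {})) = binom (d * (n - 1)) (int m)" if "(C, U) \<in> set Cs" for C U
    using sum_of_bool_subsets[OF s(1) C(1)[OF that], of "{}" m] C(2)[OF that] c1(1) by simp
  have s1: "(\<Sum>W\<in>subsets ?V m. of_bool (C \<subseteq> W)) = binom (d * (n - 1)) (int m - 2 * int d)" if "(C, U) \<in> set Cs" for C U
  proof -
    have "of_bool (C \<subseteq> W) = (of_bool (W \<inter> C = C) :: int)" for W by (simp add: inf.absorb_iff2)
    then show ?thesis using sum_of_bool_subsets[OF s(1) C(1)[OF that] order_refl, of m] C(2)[OF that] c1(1) by simp
  qed
  have f0: "(\<Sum>W\<in>subsets ?V m. of_bool (W \<inter> F = {})) = binom (d * n) (int m)" if "F \<in> set Fs" for F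
    using sum_of_bool_subsets[OF s(1), of F "{}" m] CF(4) that c1(2) by simp
  have f1: "(\<Sum>W\<in>subsets ?V m. of_bool (F \<subseteq> W)) = binom (d * n) (int m - int d)" if "F \<in> set Fs" for F
  proof -
    have "of_bool (F \<subseteq> W) = (of_bool (W \<inter> F = F) :: int)" for W by (simp add: inf.absorb_iff2)
    then show ?thesis using sum_of_bool_subsets[OF s(1) _ order_refl, of F m] CF(4) that c1(2) by simp
  qed
  have h1: "hdim TYPE('f) (induced \<Delta> W) q = (\<Sum>(C, U)\<leftarrow>Cs. of_bool (W \<inter> C \<in> U q))" if "2 \<le> q" "q \<le> d - 2" for W q
    using CF(5)[of W] that unfolding hdim_formulas_def by blast
  have h2: "hdim TYPE('f) (induced \<Delta> W) 1 - hdim TYPE('f) (induced \<Delta> W) 0 =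
      (\<Sum>(C, U)\<leftarrow>Cs. of_bool (W \<inter> C \<in> U 1) - of_bool (W \<inter> C = {})) + (\<Sum>F\<leftarrow>Fs. of_bool (W \<inter> F = {}))" for W
    using CF(5)[of W] unfolding hdim_formulas_def by blast
  have h3: "hdim TYPE('f) (induced \<Delta> W) (d - 1) - hdim TYPE('f) (induced \<Delta> W) d =
      (\<Sum>(C, U)\<leftarrow>Cs. of_bool (W \<inter> C \<in> U (d - 1)) - of_bool (C \<subseteq> W)) + (\<Sum>F\<leftarrow>Fs. of_bool (F \<subseteq> W))" for W
    using CF(5)[of W] unfolding hdim_formulas_def by blast
  { assume q: "2 \<le> q" "q \<le> d - 2"
    have "(\<Sum>W\<in>subsets ?V m. \<Sum>x\<leftarrow>Cs. case x of (C, U) \<Rightarrow> of_bool (W \<inter> C \<in> U q)) =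
        int (length Cs) * (int (d choose q) * binom (d * (n - 1)) (int m - 2 * int q))"
      unfolding sum_sum_list by (rule sum_list_const) (use sU in auto)
    then show "(\<Sum>W\<in>subsets ?V m. hdim TYPE('f) (induced \<Delta> W) q) =
      int n * (int (d choose q) * binom (d * (n - 1)) (int m - 2 * int q))" unfolding h1[OF q] CF(1) . }
  have "(\<Sum>W\<in>subsets ?V m. \<Sum>x\<leftarrow>Cs. case x of (C, U) \<Rightarrow> of_bool (W \<inter> C \<in> U 1) - of_bool (W \<inter> C = {})) =
      int (length Cs) * (int (d choose 1) * binom (d * (n - 1)) (int m - 2 * int 1) - binom (d * (n - 1)) (int m))"
    unfolding sum_sum_list by (rule sum_list_const) (use sU[of _ _ 1] s0 in \<open>auto simp: sum_subtractf\<close>)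
  moreover have "(\<Sum>W\<in>subsets ?V m. \<Sum>F\<leftarrow>Fs. of_bool (W \<inter> F = {})) = int (length Fs) * binom (d * n) (int m)"
    unfolding sum_sum_list by (rule sum_list_const) (use f0 in auto)
  ultimately show "(\<Sum>W\<in>subsets ?V m. hdim TYPE('f) (induced \<Delta> W) 1 - hdim TYPE('f) (induced \<Delta> W) 0) =
      int n * (int d * binom (d * (n - 1)) (int m - 2) - binom (d * (n - 1)) (int m)) + int (n - 1) * binom (d * n) (int m)"
    unfolding h2 sum.distrib using CF(1) lF by simp
  have ch: "d choose (d - 1) = d" using d binomial_symmetric[of 1 d] by simp
  have "(\<Sum>W\<in>subsets ?V m. \<Sum>x\<leftarrow>Cs. case x of (C, U) \<Rightarrow> of_bool (W \<inter> C \<in> U (d - 1)) - of_bool (C \<subseteq> W)) =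
      int (length Cs) * (int (d choose (d - 1)) * binom (d * (n - 1)) (int m - 2 * int (d - 1)) - binom (d * (n - 1)) (int m - 2 * int d))"
    unfolding sum_sum_list by (rule sum_list_const) (use sU[of _ _ "d - 1"] s1 in \<open>auto simp: sum_subtractf\<close>)
  moreover have "(\<Sum>W\<in>subsets ?V m. \<Sum>F\<leftarrow>Fs. of_bool (F \<subseteq> W)) = int (length Fs) * binom (d * n) (int m - int d)"
    unfolding sum_sum_list by (rule sum_list_const) (use f1 in auto)
  ultimately show "(\<Sum>W\<in>subsets ?V m. hdim TYPE('f) (induced \<Delta> W) (d - 1) - hdim TYPE('f) (induced \<Delta> W) d) =
      int n * (int d * binom (d * (n - 1)) (int m - 2 * int (d - 1)) - binom (d * (n - 1)) (int m - 2 * int d)) +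
      int (n - 1) * binom (d * n) (int m - int d)"
    unfolding h3 sum.distrib using CF(1) lF ch by simp
qed

section \<open>Polynomials and graded free modules\<close>

abbreviation lkp :: "('a \<Rightarrow>\<^sub>0 'b::zero) \<Rightarrow> 'a \<Rightarrow> 'b" where "lkp \<equiv> Poly_Mapping.lookup"
abbreviation kys :: "('a \<Rightarrow>\<^sub>0 'b::zero) \<Rightarrow> 'a set" where "kys \<equiv> Poly_Mapping.keys"

lemma keys_plus_nat: "kys (a + b) = kys a \<union> kys b" for a b :: "'v \<Rightarrow>\<^sub>0 nat"
  by (auto simp: in_keys_iff lookup_add)

lemma mdeg_superset: "finite A \<Longrightarrow> kys m \<subseteq> A \<Longrightarrow> mdeg m = (\<Sum>v\<in>A. lkp m v)"
  unfolding mdeg_def by (rule sum.mono_neutral_left) (auto simp: in_keys_iff)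

lemma mdeg_plus: "mdeg (a + b) = mdeg a + mdeg b"
proof -
  have "mdeg (a + b) = (\<Sum>v\<in>kys a \<union> kys b. lkp (a + b) v)" by (rule mdeg_superset) (auto simp: keys_plus_nat)
  also have "\<dots> = mdeg a + mdeg b"
    using mdeg_superset[of "kys a \<union> kys b" a] mdeg_superset[of "kys a \<union> kys b" b] by (simp add: lookup_add sum.distrib)
  finally show ?thesis .
qed

lemma mdeg_0 [simp]: "mdeg 0 = 0" by (simp add: mdeg_def)

lemma keys_mult_cases:
  fixes p q :: "('v \<Rightarrow>\<^sub>0 nat) \<Rightarrow>\<^sub>0 'f::field"
  assumes "m \<in> kys (p * q)" obtains a b where "a \<in> kys p" "b \<in> kys q" "m = a + b"
  using assms keys_mult[of p q] by blast

lemma poly_ring_0 [simp]: "0 \<in> poly_ring V" by (simp add: poly_ring_def)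

lemma poly_ring_single: "kys m \<subseteq> V \<Longrightarrow> Poly_Mapping.single m c \<in> poly_ring V"
  by (simp add: poly_ring_def)

lemma poly_ring_1 [simp]: "1 \<in> poly_ring V" by (simp add: poly_ring_def)

lemma poly_ring_const [simp]: "Poly_Mapping.single 0 c \<in> poly_ring V" by (simp add: poly_ring_def)

lemma poly_ring_add: "p \<in> poly_ring V \<Longrightarrow> q \<in> poly_ring V \<Longrightarrow> p + q \<in> poly_ring V"
  using keys_add[of p q] by (auto simp: poly_ring_def)

lemma poly_ring_uminus: "p \<in> poly_ring V \<Longrightarrow> - p \<in> poly_ring V"
  by (simp add: poly_ring_def in_keys_iff)

lemma poly_ring_mult: "p \<in> poly_ring V \<Longrightarrow> q \<in> poly_ring V \<Longrightarrow> p * q \<in> poly_ring V"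
  unfolding poly_ring_def by (auto elim!: keys_mult_cases simp: keys_plus_nat) blast+

lemma poly_ring_sum: "(\<And>x. x \<in> A \<Longrightarrow> g x \<in> poly_ring V) \<Longrightarrow> (\<Sum>x\<in>A. g x) \<in> poly_ring V"
  by (induction A rule: infinite_finite_induct) (auto intro: poly_ring_add)

lemma smult_0_right [simp]: "smult p 0 = 0" by (rule poly_mapping_eqI) (simp add: lookup_smult)
lemma smult_0_left [simp]: "smult 0 u = 0" by (rule poly_mapping_eqI) (simp add: lookup_smult)
lemma smult_1 [simp]: "smult 1 u = u" by (rule poly_mapping_eqI) (simp add: lookup_smult)
lemma smult_add_right: "smult p (u + w) = smult p u + smult p w"
  by (rule poly_mapping_eqI) (simp add: lookup_smult lookup_add distrib_left)
lemma smult_add_left: "smult (p + q) u = smult p u + smult q u"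
  by (rule poly_mapping_eqI) (simp add: lookup_smult lookup_add distrib_right)
lemma smult_smult: "smult p (smult q u) = smult (p * q) u"
  by (rule poly_mapping_eqI) (simp add: lookup_smult mult.assoc)
lemma smult_minus: "smult (- 1) u = - u" by (rule poly_mapping_eqI) (simp add: lookup_smult)
lemma smult_diff_right: "smult p (u - w) = smult p u - smult p w"
  by (rule poly_mapping_eqI) (simp add: lookup_smult lookup_minus right_diff_distrib)
lemma smult_sum_right: "smult p (\<Sum>x\<in>A. g x) = (\<Sum>x\<in>A. smult p (g x))"
  by (induction A rule: infinite_finite_induct) (auto simp: smult_add_right)

lemma lookup_const_times: "lkp (Poly_Mapping.single 0 c * p) m = c * lkp p m"
  for p :: "('v \<Rightarrow>\<^sub>0 nat) \<Rightarrow>\<^sub>0 'f::field"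
  unfolding mult_map_scale_conv_mult[symmetric] by (simp add: Poly_Mapping.map.rep_eq when_def)

lemma lookup_fscale: "lkp (lkp (fscale c u) b) m = c * lkp (lkp u b) m"
  by (simp add: fscale_def lookup_smult lookup_const_times)

lemma fmodD:
  assumes "u \<in> fmod V G i" shows "lkp u b \<in> poly_ring V" "b \<ge> rk G i \<Longrightarrow> lkp u b = 0"
proof -
  have "b \<in> kys u \<Longrightarrow> b < rk G i" "lkp u b \<in> poly_ring V" using assms by (auto simp: fmod_def)
  then show "lkp u b \<in> poly_ring V" "b \<ge> rk G i \<Longrightarrow> lkp u b = 0" by (auto simp: in_keys_iff)
qed

lemma fmodI:
  assumes "\<And>b. lkp u b \<in> poly_ring V" "\<And>b. b \<ge> rk G i \<Longrightarrow> lkp u b = 0" shows "u \<in> fmod V G i"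
proof -
  have "b < rk G i" if "b \<in> kys u" for b
  proof (rule ccontr)
    assume "\<not> b < rk G i"
    then show False using assms(2)[of b] that by (simp add: in_keys_iff)
  qed
  then show ?thesis using assms(1) by (auto simp: fmod_def)
qed

lemma fmod_0 [simp]: "0 \<in> fmod V G i" by (rule fmodI) auto

lemma fmod_add: "u \<in> fmod V G i \<Longrightarrow> w \<in> fmod V G i \<Longrightarrow> u + w \<in> fmod V G i"
  by (rule fmodI) (simp_all add: lookup_add poly_ring_add fmodD[of _ V G i])

lemma fmod_smult: "p \<in> poly_ring V \<Longrightarrow> u \<in> fmod V G i \<Longrightarrow> smult p u \<in> fmod V G i"
  by (rule fmodI) (simp_all add: lookup_smult poly_ring_mult fmodD[of _ V G i])

lemma fmod_minus: "u \<in> fmod V G i \<Longrightarrow> - u \<in> fmod V G i"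
  unfolding smult_minus[symmetric] by (rule fmod_smult[OF poly_ring_uminus[OF poly_ring_1]])

lemma fmod_diff: "u \<in> fmod V G i \<Longrightarrow> w \<in> fmod V G i \<Longrightarrow> u - w \<in> fmod V G i"
  unfolding diff_conv_add_uminus by (rule fmod_add[OF _ fmod_minus])

lemma fmod_sum: "(\<And>x. x \<in> A \<Longrightarrow> g x \<in> fmod V G i) \<Longrightarrow> (\<Sum>x\<in>A. g x) \<in> fmod V G i"
  by (induction A rule: infinite_finite_induct) (auto intro: fmod_add)

definition hom_of_deg :: "(nat \<Rightarrow> nat) \<Rightarrow> nat \<Rightarrow> ('v, 'f::field) fvec \<Rightarrow> bool" where
  "hom_of_deg s n u \<longleftrightarrow> (\<forall>b. \<forall>m\<in>kys (lkp u b). mdeg m + s b = n)"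

lemma fmod_deg_iff: "u \<in> fmod_deg V G i n \<longleftrightarrow> u \<in> fmod V G i \<and> hom_of_deg (shift G i) n u"
  by (auto simp: fmod_deg_def hom_of_deg_def)

lemma hom_of_deg_0 [simp]: "hom_of_deg s n 0" by (simp add: hom_of_deg_def)

lemma hom_of_deg_add: "hom_of_deg s n u \<Longrightarrow> hom_of_deg s n w \<Longrightarrow> hom_of_deg s n (u + w)"
  unfolding hom_of_deg_def lookup_add by (meson UnE keys_add subsetD)

lemma hom_of_deg_sum: "(\<And>x. x \<in> A \<Longrightarrow> hom_of_deg s n (g x)) \<Longrightarrow> hom_of_deg s n (\<Sum>x\<in>A. g x)"
  by (induction A rule: infinite_finite_induct) (auto intro: hom_of_deg_add)

lemma hom_of_deg_smult:
  assumes "hom_of_deg s k u" "\<And>m. m \<in> kys p \<Longrightarrow> mdeg m + k = n"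
  shows "hom_of_deg s n (smult p u)"
  unfolding hom_of_deg_def lookup_smult
proof (intro allI ballI)
  fix b m assume "m \<in> kys (p * lkp u b)"
  then obtain m1 m2 where m: "m1 \<in> kys p" "m2 \<in> kys (lkp u b)" "m = m1 + m2" by (rule keys_mult_cases)
  then have "mdeg m2 + s b = k" using assms(1) by (auto simp: hom_of_deg_def)
  then show "mdeg m + s b = n" using assms(2)[OF m(1)] m(3) by (simp add: mdeg_plus)
qed

lemma fmod_deg_0 [simp]: "0 \<in> fmod_deg V G i n" by (simp add: fmod_deg_iff)

lemma fmod_deg_add: "u \<in> fmod_deg V G i n \<Longrightarrow> w \<in> fmod_deg V G i n \<Longrightarrow> u + w \<in> fmod_deg V G i n"
  by (simp add: fmod_deg_iff fmod_add hom_of_deg_add)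

lemma fmod_deg_fscale: "u \<in> fmod_deg V G i n \<Longrightarrow> fscale c u \<in> fmod_deg V G i n"
  unfolding fscale_def fmod_deg_iff
  by (intro conjI fmod_smult poly_ring_const hom_of_deg_smult[where k = n]) (auto split: if_splits)

lemma fmod_deg_diff: "u \<in> fmod_deg V G i n \<Longrightarrow> w \<in> fmod_deg V G i n \<Longrightarrow> u - w \<in> fmod_deg V G i n"
  unfolding fmod_deg_iff using fmod_diff[of u V G i w] hom_of_deg_add[of "shift G i" n u "- w"]
  by (simp add: hom_of_deg_def in_keys_iff)

lemma subspace_fmod_deg: "fv.subspace (fmod_deg V G i n)"
  by (rule fv.subspaceI) (auto intro: fmod_deg_add fmod_deg_fscale)

lemma finite_monomials: "finite V \<Longrightarrow> finite {m :: 'v \<Rightarrow>\<^sub>0 nat. kys m \<subseteq> V \<and> mdeg m \<le> n}"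
proof -
  assume V: "finite V"
  have "lkp m v \<le> n" if "kys m \<subseteq> V" "mdeg m \<le> n" for m v
  proof (cases "v \<in> V")
    case True
    then have "lkp m v \<le> mdeg m" unfolding mdeg_superset[OF V that(1)] using V by (intro member_le_sum) auto
    then show ?thesis using that by simp
  next
    case False
    then have "v \<notin> kys m" using that(1) by blast
    then show ?thesis by (simp add: in_keys_iff)
  qed
  then have le: "\<And>m v. kys m \<subseteq> V \<Longrightarrow> mdeg m \<le> n \<Longrightarrow> lkp m v \<le> n" .
  have "lkp ` {m. kys m \<subseteq> V \<and> mdeg m \<le> n} \<subseteq> {f. \<forall>v. (v \<in> V \<longrightarrow> f v \<in> {..n}) \<and> (v \<notin> V \<longrightarrow> f v = 0)}"
  proof (intro image_subsetI CollectI allI conjI impI)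
    fix m v assume m: "m \<in> {m. kys m \<subseteq> V \<and> mdeg m \<le> n}"
    show "lkp m v \<in> {..n}" using le m by simp
    assume "v \<notin> V"
    then have "v \<notin> kys m" using m by blast
    then show "lkp m v = 0" by (simp add: in_keys_iff)
  qed
  then have "finite (lkp ` {m. kys m \<subseteq> V \<and> mdeg m \<le> n})"
    using finite_set_of_finite_funs[OF V, of "{..n}" 0] finite_subset by blast
  moreover have "inj_on lkp {m. kys m \<subseteq> V \<and> mdeg m \<le> n}" by (auto intro: inj_onI poly_mapping_eqI)
  ultimately show ?thesis by (rule finite_imageD)
qed

text \<open>The coefficients embed the space into the functions on a finite set of pairs of a basis
  index and a monomial.\<close>

lemma fin_dim_fmod_deg:
  assumes "finite V" shows "fin_dim fscale (fmod_deg V G i n :: ('v, 'f::field) fvec set)"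
proof -
  let ?M = "{m :: 'v \<Rightarrow>\<^sub>0 nat. kys m \<subseteq> V \<and> mdeg m \<le> n}"
  let ?f = "\<lambda>u :: ('v, 'f) fvec. \<lambda>(b, m). lkp (lkp u b) m"
  have lin: "lin_on fscale fsc (fmod_deg V G i n) ?f"
    unfolding lin_on_def
    by (intro conjI ballI allI subspace_fmod_deg) (auto simp: fun_eq_iff lookup_add lookup_fscale fsc_def)
  have sub: "?f ` fmod_deg V G i n \<subseteq> fun_on ({..<rk G i} \<times> ?M)"
  proof (rule image_subsetI)
    fix u :: "('v, 'f) fvec" assume u: "u \<in> fmod_deg V G i n"
    show "?f u \<in> fun_on ({..<rk G i} \<times> ?M)"
    proof (rule fun_onI)
      fix x assume x: "x \<notin> {..<rk G i} \<times> ?M"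
      obtain b m where bm: "x = (b, m)" by (cases x)
      show "?f u x = 0"
      proof (rule ccontr)
        assume "?f u x \<noteq> 0"
        then have nz: "lkp (lkp u b) m \<noteq> 0" by (simp add: bm)
        then have m: "m \<in> kys (lkp u b)" by (simp add: in_keys_iff)
        have uf: "u \<in> fmod V G i" and ud: "hom_of_deg (shift G i) n u" using u by (auto simp: fmod_deg_iff)
        have "lkp u b \<noteq> 0" using nz by auto
        then have "b < rk G i" using fmodD(2)[OF uf, of b] by (meson not_less)
        moreover have "kys m \<subseteq> V" using m fmodD(1)[OF uf, of b] by (auto simp: poly_ring_def)
        moreover have "mdeg m + shift G i b = n" using ud m by (auto simp: hom_of_deg_def)
        ultimately show False using x bm by simp
      qed
    qed
  qed
  show ?thesis
  proof (rule fvff.fin_dim_inj[OF lin])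
    fix u :: "('v, 'f) fvec" assume "?f u = 0"
    then have "lkp (lkp u b) m = 0" for b m by (auto dest: fun_cong[of _ _ "(b, m)"])
    then show "u = 0" by (intro poly_mapping_eqI) simp
  next
    show "fin_dim fsc (?f ` fmod_deg V G i n)"
      by (rule fun_on_fin_dim_subset[OF _ sub]) (use finite_monomials[OF assms] in simp)
  qed
qed

subsection \<open>Graded homomorphisms\<close>

definition ghom ::
  "'v set \<Rightarrow> ('v, 'f::field) free_seq \<Rightarrow> nat \<Rightarrow> ('v, 'f) free_seq \<Rightarrow> nat \<Rightarrow> (('v, 'f) fvec \<Rightarrow> ('v, 'f) fvec) \<Rightarrow> bool"
where
  "ghom V G i H j f \<longleftrightarrow> (\<forall>u\<in>fmod V G i. f u \<in> fmod V H j) \<and>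
     (\<forall>u\<in>fmod V G i. \<forall>w\<in>fmod V G i. f (u + w) = f u + f w) \<and>
     (\<forall>p\<in>poly_ring V. \<forall>u\<in>fmod V G i. f (smult p u) = smult p (f u)) \<and>
     (\<forall>n. \<forall>u\<in>fmod_deg V G i n. f u \<in> fmod_deg V H j n)"

lemma ghomD:
  assumes "ghom V G i H j f"
  shows "u \<in> fmod V G i \<Longrightarrow> f u \<in> fmod V H j"
    "u \<in> fmod V G i \<Longrightarrow> w \<in> fmod V G i \<Longrightarrow> f (u + w) = f u + f w"
    "p \<in> poly_ring V \<Longrightarrow> u \<in> fmod V G i \<Longrightarrow> f (smult p u) = smult p (f u)"
    "u \<in> fmod_deg V G i n \<Longrightarrow> f u \<in> fmod_deg V H j n"
    "f 0 = 0"
    "u \<in> fmod V G i \<Longrightarrow> w \<in> fmod V G i \<Longrightarrow> f (u - w) = f u - f w"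
proof -
  show add: "\<And>u w. u \<in> fmod V G i \<Longrightarrow> w \<in> fmod V G i \<Longrightarrow> f (u + w) = f u + f w"
    using assms unfolding ghom_def by blast
  show sm: "\<And>p u. p \<in> poly_ring V \<Longrightarrow> u \<in> fmod V G i \<Longrightarrow> f (smult p u) = smult p (f u)"
    using assms unfolding ghom_def by blast
  show "u \<in> fmod V G i \<Longrightarrow> f u \<in> fmod V H j" "u \<in> fmod_deg V G i n \<Longrightarrow> f u \<in> fmod_deg V H j n"
    using assms unfolding ghom_def by blast+
  show "f 0 = 0" using sm[of 0 0] by simp
  assume u: "u \<in> fmod V G i" "w \<in> fmod V G i"
  have "f (u - w) = f (u + smult (- 1) w)" by (simp add: smult_minus)
  also have "\<dots> = f u + smult (- 1) (f w)"
    using add sm fmod_smult u poly_ring_uminus[OF poly_ring_1] by metis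
  finally show "f (u - w) = f u - f w" by (simp add: smult_minus)
qed

lemma ghom_sum:
  assumes "ghom V G i H j f" "\<And>x. x \<in> A \<Longrightarrow> g x \<in> fmod V G i"
  shows "f (\<Sum>x\<in>A. g x) = (\<Sum>x\<in>A. f (g x))"
  using assms(2)
proof (induction A rule: infinite_finite_induct)
  case (insert x A)
  then show ?case using ghomD(2)[OF assms(1)] fmod_sum[of A g V G i] by simp
qed (simp_all add: ghomD(5)[OF assms(1)])

lemma ghom_comp:
  assumes "ghom V G i H j f" "ghom V H j L k g" shows "ghom V G i L k (\<lambda>u. g (f u))"
  unfolding ghom_def using ghomD[OF assms(1)] ghomD[OF assms(2)] by simp

lemma ghom_diff:
  assumes "ghom V G i H j f" "ghom V G i H j g" shows "ghom V G i H j (\<lambda>u. f u - g u)"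
  unfolding ghom_def using ghomD(1-4)[OF assms(1)] ghomD(1-4)[OF assms(2)]
  by (simp add: fmod_diff fmod_deg_diff smult_diff_right)

lemma ghom_id: "ghom V G i G i (\<lambda>u. u)" by (simp add: ghom_def)

lemma ghom_zero: "ghom V G i H j (\<lambda>u. 0)" by (simp add: ghom_def)

definition unit_vec :: "nat \<Rightarrow> ('v, 'f::field) fvec" where "unit_vec b = Poly_Mapping.single b 1"

lemma lookup_smult_unit: "lkp (smult p (unit_vec b)) b' = (if b = b' then p else 0)"
  by (simp add: lookup_smult unit_vec_def lookup_single when_def)

lemma unit_vec_deg: "b < rk G i \<Longrightarrow> unit_vec b \<in> fmod_deg V G i (shift G i b)"
  unfolding fmod_deg_iff hom_of_deg_def
  by (intro conjI fmodI) (auto simp: unit_vec_def lookup_single when_def)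

lemma unit_vec_fmod: "b < rk G i \<Longrightarrow> unit_vec b \<in> fmod V G i"
  using unit_vec_deg fmod_deg_iff by metis

lemma fmod_expand:
  assumes "u \<in> fmod V G i" shows "u = (\<Sum>b<rk G i. smult (lkp u b) (unit_vec b))"
proof (rule poly_mapping_eqI)
  fix b'
  show "lkp u b' = lkp (\<Sum>b<rk G i. smult (lkp u b) (unit_vec b)) b'"
    unfolding lookup_sum lookup_smult_unit using fmodD(2)[OF assms, of b'] by (auto simp: not_less)
qed

lemma ghom_expand:
  assumes "ghom V G i H j f" "u \<in> fmod V G i"
  shows "f u = (\<Sum>b<rk G i. smult (lkp u b) (f (unit_vec b)))"
proof -
  have "f u = f (\<Sum>b<rk G i. smult (lkp u b) (unit_vec b))" using fmod_expand[OF assms(2)] by simp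
  also have "\<dots> = (\<Sum>b<rk G i. f (smult (lkp u b) (unit_vec b)))"
    by (rule ghom_sum[OF assms(1)]) (use fmodD(1)[OF assms(2)] in \<open>auto intro: fmod_smult unit_vec_fmod\<close>)
  also have "\<dots> = (\<Sum>b<rk G i. smult (lkp u b) (f (unit_vec b)))"
    by (rule sum.cong[OF refl], rule ghomD(3)[OF assms(1) fmodD(1)[OF assms(2)] unit_vec_fmod]) simp
  finally show ?thesis .
qed

definition extend_hom ::
  "('v, 'f::field) free_seq \<Rightarrow> nat \<Rightarrow> (nat \<Rightarrow> ('v, 'f) fvec) \<Rightarrow> ('v, 'f) fvec \<Rightarrow> ('v, 'f) fvec" where
  "extend_hom G i y u = (\<Sum>b<rk G i. smult (lkp u b) (y b))"

lemma ghom_extend_hom: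
  assumes "\<And>b. b < rk G i \<Longrightarrow> y b \<in> fmod_deg V H j (shift G i b)"
  shows "ghom V G i H j (extend_hom G i y)"
proof -
  have yf: "y b \<in> fmod V H j" if "b < rk G i" for b using assms[OF that] fmod_deg_iff by metis
  show ?thesis unfolding ghom_def
  proof (intro conjI ballI allI)
  fix u assume u: "u \<in> fmod V G i"
  show mem: "extend_hom G i y u \<in> fmod V H j"
    unfolding extend_hom_def using fmodD(1)[OF u] yf by (auto intro!: fmod_sum fmod_smult)
  show "extend_hom G i y (u + w) = extend_hom G i y u + extend_hom G i y w" for w
    by (simp add: extend_hom_def lookup_add smult_add_left sum.distrib)
  show "extend_hom G i y (smult p u) = smult p (extend_hom G i y u)" for p
    by (simp add: extend_hom_def lookup_smult smult_smult smult_sum_right)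
next
  fix n u assume u: "u \<in> fmod_deg V G i n"
  have "smult (lkp u b) (y b) \<in> fmod_deg V H j n" if b: "b < rk G i" for b
    unfolding fmod_deg_iff
  proof
    show "smult (lkp u b) (y b) \<in> fmod V H j"
      by (rule fmod_smult[OF fmodD(1)[of u V G i] yf[OF b]]) (use u in \<open>simp add: fmod_deg_iff\<close>)
    show "hom_of_deg (shift H j) n (smult (lkp u b) (y b))"
      by (rule hom_of_deg_smult[of _ "shift G i b"])
        (use assms[OF b] u in \<open>auto simp: fmod_deg_iff hom_of_deg_def\<close>)
  qed
  then show "extend_hom G i y u \<in> fmod_deg V H j n"
    unfolding extend_hom_def by (auto simp: fmod_deg_iff intro: fmod_sum hom_of_deg_sum)
  qed
qed

lemma extend_hom_unit: "b < rk G i \<Longrightarrow> extend_hom G i y (unit_vec b) = y b"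
proof -
  assume b: "b < rk G i"
  have "extend_hom G i y (unit_vec b) = (\<Sum>b'<rk G i. if b' = b then y b' else 0)"
    unfolding extend_hom_def by (rule sum.cong[OF refl]) (auto simp: unit_vec_def lookup_single when_def)
  then show ?thesis using b by simp
qed

subsection \<open>Homogeneous components\<close>

definition pcut :: "('m \<Rightarrow> bool) \<Rightarrow> ('m \<Rightarrow>\<^sub>0 'f::zero) \<Rightarrow> 'm \<Rightarrow>\<^sub>0 'f" where
  "pcut P p = Abs_poly_mapping (\<lambda>m. if P m then lkp p m else 0)"

lemma lookup_pcut: "lkp (pcut P p) m = (if P m then lkp p m else 0)"
proof -
  have "finite {m. (if P m then lkp p m else 0) \<noteq> 0}"
    by (rule finite_subset[OF _ finite_keys[of p]]) (auto simp: in_keys_iff)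
  then show ?thesis by (simp add: pcut_def)
qed

lemma pcut_0 [simp]: "pcut P 0 = 0" by (rule poly_mapping_eqI) (simp add: lookup_pcut)

definition component :: "(nat \<Rightarrow> nat) \<Rightarrow> nat \<Rightarrow> ('v, 'f::field) fvec \<Rightarrow> ('v, 'f) fvec" where
  "component s n u = Abs_poly_mapping (\<lambda>b. pcut (\<lambda>m. mdeg m + s b = n) (lkp u b))"

lemma lookup_component:
  "lkp (component s n u) b = pcut (\<lambda>m. mdeg m + s b = n) (lkp u b)"
proof -
  have "finite {b. pcut (\<lambda>m. mdeg m + s b = n) (lkp u b) \<noteq> 0}"
    by (intro finite_subset[OF _ finite_keys[of u]]) (auto simp: in_keys_iff)
  then show ?thesis by (simp add: component_def)
qed

lemma lookup2_component: "lkp (lkp (component s n u) b) m = (if mdeg m + s b = n then lkp (lkp u b) m else 0)"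
  by (simp add: lookup_component lookup_pcut)

lemma fvec_eqI: "(\<And>b m. lkp (lkp u b) m = lkp (lkp w b) m) \<Longrightarrow> u = w"
  by (intro poly_mapping_eqI)

lemma component_deg:
  assumes "u \<in> fmod V G i" shows "component (shift G i) n u \<in> fmod_deg V G i n"
  unfolding fmod_deg_iff
proof
  show "component (shift G i) n u \<in> fmod V G i"
  proof (rule fmodI)
    fix b
    show "lkp (component (shift G i) n u) b \<in> poly_ring V"
      using fmodD(1)[OF assms, of b] by (auto simp: poly_ring_def in_keys_iff lookup2_component split: if_splits)
    show "lkp (component (shift G i) n u) b = 0" if "b \<ge> rk G i"
      by (rule poly_mapping_eqI) (simp add: lookup2_component fmodD(2)[OF assms that])
  qed
  show "hom_of_deg (shift G i) n (component (shift G i) n u)"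
    by (auto simp: hom_of_deg_def in_keys_iff lookup2_component split: if_splits)
qed

lemma component_hom:
  assumes "hom_of_deg s n' u" shows "component s n u = (if n = n' then u else 0)"
proof (rule fvec_eqI)
  fix b m
  have "lkp (lkp u b) m \<noteq> 0 \<Longrightarrow> mdeg m + s b = n'" using assms by (auto simp: hom_of_deg_def in_keys_iff)
  then show "lkp (lkp (component s n u) b) m = lkp (lkp (if n = n' then u else 0) b) m"
    by (auto simp: lookup2_component)
qed

lemma component_sum: "component s n (\<Sum>x\<in>A. g x) = (\<Sum>x\<in>A. component s n (g x))"
  by (rule fvec_eqI) (simp add: lookup2_component lookup_sum)

lemma component_decompose:
  obtains N where "finite N" "u = (\<Sum>n\<in>N. component s n u)" "\<And>n. n \<notin> N \<Longrightarrow> component s n u = 0"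
proof -
  define N where "N = (\<Union>b\<in>kys u. (\<lambda>m. mdeg m + s b) ` kys (lkp u b))"
  have fin: "finite N" by (simp add: N_def)
  have inN: "mdeg m + s b \<in> N" if "lkp (lkp u b) m \<noteq> 0" for b m
  proof -
    have "lkp u b \<noteq> 0" using that by auto
    then have "b \<in> kys u" "m \<in> kys (lkp u b)" using that by (auto simp: in_keys_iff)
    then show ?thesis unfolding N_def by blast
  qed
  have "u = (\<Sum>n\<in>N. component s n u)"
  proof (rule fvec_eqI)
    fix b m show "lkp (lkp u b) m = lkp (lkp (\<Sum>n\<in>N. component s n u) b) m"
      using fin inN[of b m] by (auto simp: lookup_sum lookup2_component)
  qed
  moreover have "component s n u = 0" if "n \<notin> N" for n
  proof (rule fvec_eqI)
    fix b m show "lkp (lkp (component s n u) b) m = lkp (lkp 0 b) m"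
      using inN[of b m] that by (auto simp: lookup2_component)
  qed
  ultimately show ?thesis using that fin by blast
qed

text \<open>Lets a preimage of a homogeneous vector be replaced by its component of the right
  degree; exactness by itself provides no homogeneous preimage.\<close>

lemma ghom_component:
  assumes f: "ghom V G i H j f" and u: "u \<in> fmod V G i"
  shows "f (component (shift G i) n u) = component (shift H j) n (f u)"
proof -
  obtain N where N: "finite N" "u = (\<Sum>k\<in>N. component (shift G i) k u)" "\<And>k. k \<notin> N \<Longrightarrow> component (shift G i) k u = 0"
    by (rule component_decompose[of u "shift G i"]) (rule that)
  have "f u = f (\<Sum>k\<in>N. component (shift G i) k u)" using N(2) by simp
  also have "\<dots> = (\<Sum>k\<in>N. f (component (shift G i) k u))"
    by (rule ghom_sum[OF f]) (use component_deg[OF u] in \<open>auto simp: fmod_deg_iff\<close>)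
  finally have "component (shift H j) n (f u) = (\<Sum>k\<in>N. component (shift H j) n (f (component (shift G i) k u)))"
    by (simp add: component_sum)
  also have "\<dots> = (\<Sum>k\<in>N. if n = k then f (component (shift G i) k u) else 0)"
  proof (rule sum.cong[OF refl])
    fix k
    have "hom_of_deg (shift H j) k (f (component (shift G i) k u))"
      using ghomD(4)[OF f component_deg[OF u]] fmod_deg_iff by metis
    then show "component (shift H j) n (f (component (shift G i) k u)) = (if n = k then f (component (shift G i) k u) else 0)"
      by (rule component_hom)
  qed
  also have "\<dots> = f (component (shift G i) n u)"
    using N(1) N(3)[of n] ghomD(5)[OF f] by auto
  finally show ?thesis ..
qed

subsection \<open>Comparison of resolutions\<close>

text \<open>Free modules are projective: homogeneous preimages are chosen for the images of the
  basis vectors and extended linearly.\<close>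

lemma ghom_lift:
  assumes t: "ghom V G i H j t" and f: "ghom V H k H j f" and im: "t ` fmod V G i \<subseteq> f ` fmod V H k"
  shows "\<exists>s. ghom V G i H k s \<and> (\<forall>u\<in>fmod V G i. f (s u) = t u)"
proof -
  have "\<exists>y. y \<in> fmod_deg V H k (shift G i b) \<and> f y = t (unit_vec b)" if b: "b < rk G i" for b
  proof -
    obtain y where y: "y \<in> fmod V H k" "f y = t (unit_vec b)" using im unit_vec_fmod[OF b] by (metis imageE image_subset_iff)
    have "hom_of_deg (shift H j) (shift G i b) (t (unit_vec b))"
      using ghomD(4)[OF t unit_vec_deg[OF b]] fmod_deg_iff by metis
    then have "f (component (shift H k) (shift G i b) y) = t (unit_vec b)"
      unfolding ghom_component[OF f y(1)] y(2) by (simp add: component_hom)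
    then show ?thesis using component_deg[OF y(1)] by blast
  qed
  then obtain y where y: "\<And>b. b < rk G i \<Longrightarrow> y b \<in> fmod_deg V H k (shift G i b)"
    "\<And>b. b < rk G i \<Longrightarrow> f (y b) = t (unit_vec b)" by metis
  have s: "ghom V G i H k (extend_hom G i y)" by (rule ghom_extend_hom[OF y(1)])
  have "f (extend_hom G i y u) = t u" if u: "u \<in> fmod V G i" for u
    unfolding ghom_expand[OF ghom_comp[OF s f] u] ghom_expand[OF t u]
    by (rule sum.cong[OF refl]) (simp add: extend_hom_unit y(2))
  then show ?thesis using s by blast
qed

text \<open>Given as an image, this also makes sense at index 0, where the preceding map is the
  projection to \<open>S/J\<close>, which is not part of the record.\<close>

definition syz :: "'v set \<Rightarrow> ('v, 'f::field) free_seq \<Rightarrow> nat \<Rightarrow> ('v, 'f) fvec set" where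
  "syz V G i = bd G i ` fmod V G (Suc i)"

lemma resolutionD:
  assumes "graded_free_resolution V J G"
  shows "rk G 0 = 1" "shift G 0 0 = 0" "ghom V G (Suc i) G i (bd G i)" "syz V G 0 = ideal_fmod V J G 0"
    "syz V G (Suc i) = {u \<in> fmod V G (Suc i). bd G i u = 0}"
proof -
  show "rk G 0 = 1" "shift G 0 0 = 0" "syz V G 0 = ideal_fmod V J G 0"
    and s: "\<And>i. syz V G (Suc i) = {u \<in> fmod V G (Suc i). bd G i u = 0}"
    using assms unfolding graded_free_resolution_def syz_def by simp_all
  have "bd G i ` fmod V G (Suc i) \<subseteq> fmod V G i"
  proof (cases i)
    case 0 then show ?thesis using assms unfolding graded_free_resolution_def ideal_fmod_def by auto
  next
    case (Suc k) then show ?thesis using s[of k] unfolding syz_def by auto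
  qed
  moreover have "\<forall>u\<in>fmod V G (Suc i). \<forall>w\<in>fmod V G (Suc i). bd G i (u + w) = bd G i u + bd G i w"
    "\<forall>p\<in>poly_ring V. \<forall>u\<in>fmod V G (Suc i). bd G i (smult p u) = smult p (bd G i u)"
    "\<And>n. bd G i ` fmod_deg V G (Suc i) n \<subseteq> fmod_deg V G i n"
    using assms by (simp_all add: graded_free_resolution_def)
  ultimately show "ghom V G (Suc i) G i (bd G i)" by (simp add: ghom_def image_subset_iff)
qed

lemma syz_fmod: "graded_free_resolution V J G \<Longrightarrow> u \<in> syz V G i \<Longrightarrow> u \<in> fmod V G i"
  unfolding syz_def using ghomD(1)[OF resolutionD(3), of V J G] by auto

text \<open>Both resolutions begin with \<open>S\<close> itself, so the construction starts with the
  identity. That syzygies go to syzygies is carried along, because it is what makes the next lifting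
  possible.\<close>

lemma chain_map_exists:
  assumes G: "graded_free_resolution V J G" and H: "graded_free_resolution V J H"
  shows "\<exists>f. (\<forall>i. ghom V G i H i (f i)) \<and> f 0 = (\<lambda>u. u) \<and>
    (\<forall>i. \<forall>u\<in>fmod V G (Suc i). bd H i (f (Suc i) u) = f i (bd G i u))"
proof -
  let ?P = "\<lambda>i f. ghom V G i H i f \<and> f ` syz V G i \<subseteq> syz V H i \<and> (i = 0 \<longrightarrow> f = (\<lambda>u. u))"
  let ?R = "\<lambda>i f f'. \<forall>u\<in>fmod V G (Suc i). bd H i (f' u) = f (bd G i u)"
  have fm: "fmod V G 0 = fmod V H 0" using resolutionD(1)[OF G] resolutionD(1)[OF H] by (simp add: fmod_def)
  have "\<exists>f. \<forall>i. ?P i (f i) \<and> ?R i (f i) (f (Suc i))"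
  proof (rule dependent_nat_choice)
    have "syz V G 0 = syz V H 0"
      using resolutionD(4)[OF G] resolutionD(4)[OF H] fm by (simp add: ideal_fmod_def)
    moreover have "fmod_deg V G 0 n = fmod_deg V H 0 n" for n
    proof -
      have "hom_of_deg (shift G 0) n u \<longleftrightarrow> hom_of_deg (shift H 0) n u" if u: "u \<in> fmod V G 0" for u
      proof -
        have "shift G 0 b = shift H 0 b" if "m \<in> kys (lkp u b)" for b m
        proof -
          have "b = 0" using that fmodD(2)[OF u, of b] resolutionD(1)[OF G] by (cases b) auto
          then show ?thesis using resolutionD(2)[OF G] resolutionD(2)[OF H] by simp
        qed
        then show ?thesis unfolding hom_of_deg_def by metis
      qed
      then show ?thesis using fm by (auto simp: fmod_deg_iff)
    qed
    ultimately show "\<exists>f. ?P 0 f" using fm by (intro exI[of _ "\<lambda>u. u"]) (simp add: ghom_def)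
  next
    fix f i assume f: "?P i f"
    have t: "ghom V G (Suc i) H i (\<lambda>u. f (bd G i u))"
      by (rule ghom_comp[OF resolutionD(3)[OF G]]) (use f in blast)
    have "(\<lambda>u. f (bd G i u)) ` fmod V G (Suc i) \<subseteq> bd H i ` fmod V H (Suc i)"
      using f unfolding syz_def by blast
    then obtain s where s: "ghom V G (Suc i) H (Suc i) s" "\<forall>u\<in>fmod V G (Suc i). bd H i (s u) = f (bd G i u)"
      using ghom_lift[OF t resolutionD(3)[OF H]] by blast
    have "s u \<in> syz V H (Suc i)" if u: "u \<in> syz V G (Suc i)" for u
    proof -
      have u': "u \<in> fmod V G (Suc i)" "bd G i u = 0" using u resolutionD(5)[OF G] by auto
      have "f 0 = 0" by (rule ghomD(5)) (use f in blast)
      then show ?thesis using s(2) u' ghomD(1)[OF s(1) u'(1)] unfolding resolutionD(5)[OF H] by simp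
    qed
    then show "\<exists>f'. ?P (Suc i) f' \<and> ?R i f f'" using s by (intro exI[of _ s]) auto
  qed
  then obtain f where f: "\<forall>i. ?P i (f i) \<and> ?R i (f i) (f (Suc i))" by (rule exE)
  note f = conjunct1[OF spec[OF f]] conjunct2[OF spec[OF f]]
  have "f 0 = (\<lambda>u. u)" using conjunct2[OF conjunct2[OF f(1)[of 0]]] by simp
  moreover have "\<forall>i. ghom V G i H i (f i)" by (rule allI, rule conjunct1, rule f(1))
  moreover have "\<forall>i. \<forall>u\<in>fmod V G (Suc i). bd H i (f (Suc i) u) = f i (bd G i u)" by (rule allI, rule f(2))
  ultimately show ?thesis by (intro exI[of _ f] conjI)
qed

text \<open>The homotopy starts with zero since \<open>h 0\<close> is zero. The invariant on
  syzygies makes the difference that has to be lifted a cycle, hence by exactness a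
  boundary.\<close>

lemma homotopy_exists:
  assumes G: "graded_free_resolution V J G" and h: "\<And>i. ghom V G i G i (h i)"
    and h0: "\<And>u. u \<in> fmod V G 0 \<Longrightarrow> h 0 u = 0"
    and chain: "\<And>i u. u \<in> fmod V G (Suc i) \<Longrightarrow> bd G i (h (Suc i) u) = h i (bd G i u)"
  shows "\<exists>s. (\<forall>i. ghom V G i G (Suc i) (s i)) \<and> (\<forall>u. s 0 u = 0) \<and>
    (\<forall>i. \<forall>u\<in>fmod V G (Suc i). h (Suc i) u = bd G (Suc i) (s (Suc i) u) + s i (bd G i u))"
proof -
  note bdh = resolutionD(3)[OF G]
  let ?P = "\<lambda>i s. ghom V G i G (Suc i) s \<and> (\<forall>u\<in>syz V G i. bd G i (s u) = h i u) \<and> (i = 0 \<longrightarrow> s = (\<lambda>u. 0))"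
  let ?R = "\<lambda>i s s'. \<forall>u\<in>fmod V G (Suc i). h (Suc i) u = bd G (Suc i) (s' u) + s (bd G i u)"
  have "\<exists>s. \<forall>i. ?P i (s i) \<and> ?R i (s i) (s (Suc i))"
  proof (rule dependent_nat_choice)
    show "\<exists>s. ?P 0 s"
      using h0 syz_fmod[OF G] ghomD(5)[OF bdh] by (intro exI[of _ "\<lambda>u. 0"]) (auto simp: ghom_zero)
  next
    fix s i assume s: "?P i s"
    let ?t = "\<lambda>u. h (Suc i) u - s (bd G i u)"
    have t: "ghom V G (Suc i) G (Suc i) ?t"
      by (intro ghom_diff h ghom_comp[OF bdh]) (use s in blast)
    have "?t u \<in> syz V G (Suc i)" if u: "u \<in> fmod V G (Suc i)" for u
    proof -
      have "bd G i u \<in> syz V G i" using u unfolding syz_def by blast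
      then have "bd G i (s (bd G i u)) = h i (bd G i u)" using s by blast
      moreover have "s (bd G i u) \<in> fmod V G (Suc i)"
        by (rule ghomD(1)[OF _ ghomD(1)[OF bdh u]]) (use s in blast)
      ultimately have "bd G i (?t u) = 0"
        using ghomD(6)[OF bdh] ghomD(1)[OF h u] chain[OF u] by simp
      then show ?thesis using ghomD(1)[OF t u] unfolding resolutionD(5)[OF G] by simp
    qed
    then have "?t ` fmod V G (Suc i) \<subseteq> bd G (Suc i) ` fmod V G (Suc (Suc i))" unfolding syz_def by blast
    then obtain s' where s': "ghom V G (Suc i) G (Suc (Suc i)) s'" "\<forall>u\<in>fmod V G (Suc i). bd G (Suc i) (s' u) = ?t u"
      using ghom_lift[OF t bdh] by blast
    have "bd G (Suc i) (s' u) = h (Suc i) u" if u: "u \<in> syz V G (Suc i)" for u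
    proof -
      have u': "u \<in> fmod V G (Suc i)" "bd G i u = 0" using u resolutionD(5)[OF G] by auto
      have "s 0 = 0" by (rule ghomD(5)) (use s in blast)
      then show ?thesis using s'(2) u' by simp
    qed
    then show "\<exists>s'. ?P (Suc i) s' \<and> ?R i s s'" using s' by (intro exI[of _ s']) simp
  qed
  then obtain s where s: "\<And>i. ?P i (s i)" "\<And>i. ?R i (s i) (s (Suc i))" by blast
  have "s 0 = (\<lambda>u. 0)" using s(1)[of 0] by blast
  then have "\<forall>u. s 0 u = 0" by simp
  moreover have "\<forall>i. ghom V G i G (Suc i) (s i)" using s(1) by blast
  moreover have "\<forall>i. \<forall>u\<in>fmod V G (Suc i). h (Suc i) u = bd G (Suc i) (s (Suc i) u) + s i (bd G i u)" using s(2) by blast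
  ultimately show ?thesis by (intro exI[of _ s] conjI)
qed

section \<open>Independence of Tor from the resolution\<close>

definition ideal_in :: "'v set \<Rightarrow> ('v, 'f::field) mpoly set \<Rightarrow> bool" where
  "ideal_in V I \<longleftrightarrow> 0 \<in> I \<and> (\<forall>p\<in>I. \<forall>q\<in>I. p + q \<in> I) \<and> (\<forall>p\<in>poly_ring V. \<forall>q\<in>I. p * q \<in> I)"

lemma ideal_inD:
  assumes "ideal_in V I" shows "0 \<in> I" "p \<in> I \<Longrightarrow> q \<in> I \<Longrightarrow> p + q \<in> I" "p \<in> poly_ring V \<Longrightarrow> q \<in> I \<Longrightarrow> p * q \<in> I"
  using assms by (auto simp: ideal_in_def)

lemma ideal_in_sum: "ideal_in V I \<Longrightarrow> (\<And>x. x \<in> A \<Longrightarrow> g x \<in> I) \<Longrightarrow> (\<Sum>x\<in>A. g x) \<in> I"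
  by (induction A rule: infinite_finite_induct) (auto dest: ideal_inD)

lemma ideal_fmod_closed:
  assumes "ideal_in V I"
  shows "0 \<in> ideal_fmod V I G i" "u \<in> ideal_fmod V I G i \<Longrightarrow> w \<in> ideal_fmod V I G i \<Longrightarrow> u + w \<in> ideal_fmod V I G i"
    "p \<in> poly_ring V \<Longrightarrow> u \<in> ideal_fmod V I G i \<Longrightarrow> smult p u \<in> ideal_fmod V I G i"
  using ideal_inD[OF assms] by (auto simp: ideal_fmod_def fmod_add fmod_smult lookup_add lookup_smult)

text \<open>By linearity the entries of \<open>f u\<close> are combinations of the entries of
  \<open>u\<close>.\<close>

lemma ghom_ideal:
  assumes f: "ghom V G i H j f" and I: "ideal_in V I" and u: "u \<in> ideal_fmod V I G i"
  shows "f u \<in> ideal_fmod V I H j"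
proof -
  have uf: "u \<in> fmod V G i" and ui: "\<And>b. lkp u b \<in> I" using u by (auto simp: ideal_fmod_def)
  have "lkp (f u) c \<in> I" for c
  proof -
    have "lkp (f u) c = (\<Sum>b<rk G i. lkp (f (unit_vec b)) c * lkp u b)"
      unfolding ghom_expand[OF f uf] lookup_sum lookup_smult by (simp add: mult.commute)
    also have "\<dots> \<in> I"
      by (rule ideal_in_sum[OF I], rule ideal_inD(3)[OF I _ ui])
        (use ghomD(1)[OF f unit_vec_fmod] fmodD(1) in blast)
    finally show ?thesis .
  qed
  then show ?thesis using ghomD(1)[OF f uf] by (simp add: ideal_fmod_def)
qed

lemma tor_subspaces:
  assumes G: "graded_free_resolution V J G" and I: "ideal_in V I"
  shows "fv.subspace (tor_cycles V I G i n)" "fv.subspace (tor_boundaries V I G i n)"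
    "tor_boundaries V I G i n \<subseteq> tor_cycles V I G i n"
proof -
  note bdh = resolutionD(3)[OF G]
  have dm: "u \<in> fmod_deg V G k m \<Longrightarrow> u \<in> fmod V G k" for u k m by (simp add: fmod_deg_iff)
  show "fv.subspace (tor_cycles V I G i n)"
  proof (cases i)
    case 0 then show ?thesis by (simp add: tor_cycles_def subspace_fmod_deg)
  next
    case (Suc h)
    have e: "tor_cycles V I G i n = {u \<in> fmod_deg V G (Suc h) n. bd G h u \<in> ideal_fmod V I G h}"
      using Suc by (simp add: tor_cycles_def)
    show ?thesis unfolding e
    proof (rule fv.subspaceI)
      show "0 \<in> {u \<in> fmod_deg V G (Suc h) n. bd G h u \<in> ideal_fmod V I G h}"
        using ghomD(5)[OF bdh] ideal_fmod_closed(1)[OF I] by simp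
      fix u w c assume u: "u \<in> {u \<in> fmod_deg V G (Suc h) n. bd G h u \<in> ideal_fmod V I G h}"
      then show "fscale c u \<in> {u \<in> fmod_deg V G (Suc h) n. bd G h u \<in> ideal_fmod V I G h}"
        using fmod_deg_fscale[of u V G "Suc h" n c] ghomD(3)[OF bdh, of "Poly_Mapping.single 0 c" u] dm[of u "Suc h" n]
          ideal_fmod_closed(3)[OF I, of "Poly_Mapping.single 0 c" "bd G h u" G h]
        by (simp add: fscale_def)
      assume "w \<in> {u \<in> fmod_deg V G (Suc h) n. bd G h u \<in> ideal_fmod V I G h}"
      then show "u + w \<in> {u \<in> fmod_deg V G (Suc h) n. bd G h u \<in> ideal_fmod V I G h}"
        using u fmod_deg_add[of u V G "Suc h" n w] ghomD(2)[OF bdh, of u _ w] dm[of u "Suc h" n] dm[of w "Suc h" n]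
          ideal_fmod_closed(2)[OF I, of "bd G h u" G h "bd G h w"]
        by simp
    qed
  qed
  show "fv.subspace (tor_boundaries V I G i n)"
  proof (rule fv.subspaceI)
    show "0 \<in> tor_boundaries V I G i n"
      unfolding tor_boundaries_def using ghomD(5)[OF bdh] ideal_fmod_closed(1)[OF I]
      by (intro CollectI exI[of _ 0]) simp
    fix u u' c assume "u \<in> tor_boundaries V I G i n"
    then obtain w t where w: "u = bd G i w + t" "w \<in> fmod_deg V G (Suc i) n" "t \<in> ideal_fmod V I G i" "t \<in> fmod_deg V G i n"
      unfolding tor_boundaries_def by blast
    have "fscale c u = bd G i (fscale c w) + fscale c t"
      unfolding w(1) using ghomD(3)[OF bdh poly_ring_const dm[OF w(2)]] by (simp add: fscale_def smult_add_right)
    moreover have "fscale c t \<in> ideal_fmod V I G i"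
      unfolding fscale_def by (rule ideal_fmod_closed(3)[OF I poly_ring_const w(3)])
    ultimately show "fscale c u \<in> tor_boundaries V I G i n"
      unfolding tor_boundaries_def using fmod_deg_fscale[OF w(2)] fmod_deg_fscale[OF w(4)] by blast
    assume "u' \<in> tor_boundaries V I G i n"
    then obtain w' t' where w': "u' = bd G i w' + t'" "w' \<in> fmod_deg V G (Suc i) n" "t' \<in> ideal_fmod V I G i" "t' \<in> fmod_deg V G i n"
      unfolding tor_boundaries_def by blast
    have "u + u' = bd G i (w + w') + (t + t')"
      unfolding w(1) w'(1) using ghomD(2)[OF bdh dm[OF w(2)] dm[OF w'(2)]] by (simp add: algebra_simps)
    then show "u + u' \<in> tor_boundaries V I G i n"
      unfolding tor_boundaries_def
      using fmod_deg_add[OF w(2) w'(2)] fmod_deg_add[OF w(4) w'(4)] ideal_fmod_closed(2)[OF I w(3) w'(3)] by blast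
  qed
  show "tor_boundaries V I G i n \<subseteq> tor_cycles V I G i n"
  proof
    fix u assume "u \<in> tor_boundaries V I G i n"
    then obtain w t where w: "u = bd G i w + t" "w \<in> fmod_deg V G (Suc i) n" "t \<in> ideal_fmod V I G i" "t \<in> fmod_deg V G i n"
      unfolding tor_boundaries_def by blast
    have bw: "bd G i w \<in> fmod_deg V G i n" by (rule ghomD(4)[OF bdh w(2)])
    have u: "u \<in> fmod_deg V G i n" unfolding w(1) by (rule fmod_deg_add[OF bw w(4)])
    show "u \<in> tor_cycles V I G i n"
    proof (cases i)
      case 0 then show ?thesis using u by (simp add: tor_cycles_def)
    next
      case (Suc h)
      have "bd G i w \<in> syz V G (Suc h)" using dm[OF w(2)] Suc unfolding syz_def by blast
      then have "bd G h (bd G i w) = 0" unfolding resolutionD(5)[OF G] by blast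
      then have "bd G h u = bd G h t"
        using ghomD(2)[OF bdh] dm[OF bw] dm[OF w(4)] Suc unfolding w(1) by simp
      then have "bd G h u \<in> ideal_fmod V I G h" using ghom_ideal[OF bdh I] w(3) Suc by simp
      then show ?thesis using u Suc by (simp add: tor_cycles_def)
    qed
  qed
qed

lemma tor_cycles_deg: "tor_cycles V I G i n \<subseteq> fmod_deg V G i n"
  by (cases i) (auto simp: tor_cycles_def)

text \<open>A single inequality is enough, since the roles of the resolutions can be exchanged. It
  holds because a comparison map is injective on Tor: composed with one in the other direction it is
  homotopic to the identity.\<close>

lemma tor_dim_le:
  assumes V: "finite V" and I: "ideal_in V I"
    and G: "graded_free_resolution V J G" and H: "graded_free_resolution V J H"
  shows "fv.dim (tor_cycles V I G i n) - fv.dim (tor_boundaries V I G i n)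
    \<le> fv.dim (tor_cycles V I H i n) - fv.dim (tor_boundaries V I H i n)"
proof -
  note bG = resolutionD(3)[OF G] and bH = resolutionD(3)[OF H]
  have dm: "u \<in> fmod_deg V L k m \<Longrightarrow> u \<in> fmod V L k" for u k m and L :: "('a, 'b) free_seq" by (simp add: fmod_deg_iff)
  obtain f where f: "\<And>i. ghom V G i H i (f i)" "f 0 = (\<lambda>u. u)"
    "\<And>i u. u \<in> fmod V G (Suc i) \<Longrightarrow> bd H i (f (Suc i) u) = f i (bd G i u)"
    using chain_map_exists[OF G H] by blast
  obtain g where g: "\<And>i. ghom V H i G i (g i)" "g 0 = (\<lambda>u. u)"
    "\<And>i u. u \<in> fmod V H (Suc i) \<Longrightarrow> bd G i (g (Suc i) u) = g i (bd H i u)"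
    using chain_map_exists[OF H G] by blast
  \<comment> \<open>As a chain map that vanishes at index 0, the difference to the identity is
    null-homotopic.\<close>
  define h where "h i u = g i (f i u) - u" for i u
  have h: "ghom V G i G i (h i)" for i unfolding h_def by (intro ghom_diff ghom_comp[OF f(1) g(1)] ghom_id)
  have "\<exists>s. (\<forall>i. ghom V G i G (Suc i) (s i)) \<and> (\<forall>u. s 0 u = 0) \<and>
    (\<forall>i. \<forall>u\<in>fmod V G (Suc i). h (Suc i) u = bd G (Suc i) (s (Suc i) u) + s i (bd G i u))"
  proof (rule homotopy_exists[OF G h])
    show "h 0 u = 0" for u by (simp add: h_def f(2) g(2))
    fix i u assume u: "u \<in> fmod V G (Suc i)"
    have fu: "f (Suc i) u \<in> fmod V H (Suc i)" by (rule ghomD(1)[OF f(1) u])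
    show "bd G i (h (Suc i) u) = h i (bd G i u)"
      unfolding h_def using ghomD(6)[OF bG ghomD(1)[OF g(1) fu] u] g(3)[OF fu] f(3)[OF u] by simp
  qed
  then obtain s where s: "\<And>i. ghom V G i G (Suc i) (s i)"
    "\<And>i u. u \<in> fmod V G (Suc i) \<Longrightarrow> h (Suc i) u = bd G (Suc i) (s (Suc i) u) + s i (bd G i u)" by blast
  have cyc: "fL i u \<in> tor_cycles V I L' i n"
    if fL: "\<And>i. ghom V L i L' i (fL i)" "\<And>i u. u \<in> fmod V L (Suc i) \<Longrightarrow> bd L' i (fL (Suc i) u) = fL i (bd L i u)"
      and u: "u \<in> tor_cycles V I L i n" for L L' :: "('a, 'b) free_seq" and fL u
  proof -
    have ud: "u \<in> fmod_deg V L i n" using u tor_cycles_deg by blast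
    have fd: "fL i u \<in> fmod_deg V L' i n" by (rule ghomD(4)[OF fL(1) ud])
    show ?thesis
    proof (cases i)
      case 0 then show ?thesis using fd by (simp add: tor_cycles_def)
    next
      case (Suc k)
      have "bd L' k (fL i u) = fL k (bd L k u)" using fL(2) dm[OF ud] Suc by simp
      moreover have "bd L k u \<in> ideal_fmod V I L k" using u Suc by (simp add: tor_cycles_def)
      ultimately have "bd L' k (fL i u) \<in> ideal_fmod V I L' k" using ghom_ideal[OF fL(1) I] by simp
      then show ?thesis using fd Suc by (simp add: tor_cycles_def)
    qed
  qed
  have bnd: "fL i u \<in> tor_boundaries V I L' i n"
    if L: "graded_free_resolution V J L"
      and fL: "\<And>i. ghom V L i L' i (fL i)" "\<And>i u. u \<in> fmod V L (Suc i) \<Longrightarrow> bd L' i (fL (Suc i) u) = fL i (bd L i u)"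
      and u: "u \<in> tor_boundaries V I L i n" for L L' :: "('a, 'b) free_seq" and fL u
  proof -
    obtain w t where w: "u = bd L i w + t" "w \<in> fmod_deg V L (Suc i) n" "t \<in> ideal_fmod V I L i" "t \<in> fmod_deg V L i n"
      using u unfolding tor_boundaries_def by blast
    have "fL i u = bd L' i (fL (Suc i) w) + fL i t"
      unfolding w(1) using ghomD(2)[OF fL(1)] ghomD(1)[OF resolutionD(3)[OF L] dm[OF w(2)]] dm[OF w(4)] fL(2)[OF dm[OF w(2)]] by simp
    then show ?thesis unfolding tor_boundaries_def
      using ghomD(4)[OF fL(1) w(2)] ghomD(4)[OF fL(1) w(4)] ghom_ideal[OF fL(1) I w(3)] by blast
  qed
  show ?thesis
  proof (rule fv2.quotient_dim_le[where f = "f i"])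
    show "lin_on fscale fscale (tor_cycles V I G i n) (f i)"
      unfolding lin_on_def
    proof (intro conjI ballI allI tor_subspaces(1)[OF G I])
      fix x y c assume x: "x \<in> tor_cycles V I G i n"
      have xf: "x \<in> fmod V G i" using x tor_cycles_deg dm by blast
      show "f i (fscale c x) = fscale c (f i x)"
        unfolding fscale_def by (rule ghomD(3)[OF f(1) poly_ring_const xf])
      assume "y \<in> tor_cycles V I G i n"
      then have yf: "y \<in> fmod V G i" using tor_cycles_deg dm by blast
      show "f i (x + y) = f i x + f i y" by (rule ghomD(2)[OF f(1) xf yf])
    qed
    show "f i ` tor_cycles V I G i n \<subseteq> tor_cycles V I H i n" using cyc[where L = G and L' = H and fL = f, OF f(1,3)] by blast
    show "fin_dim fscale (tor_cycles V I G i n)"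
      by (rule fv.fin_dim_subset[OF fin_dim_fmod_deg[OF V] tor_cycles_deg])
    show "fin_dim fscale (tor_cycles V I H i n)"
      by (rule fv.fin_dim_subset[OF fin_dim_fmod_deg[OF V] tor_cycles_deg])
    show "fv.subspace (tor_cycles V I H i n)" "fv.subspace (tor_boundaries V I H i n)"
      "tor_boundaries V I H i n \<subseteq> tor_cycles V I H i n" by (rule tor_subspaces[OF H I])+
    show "tor_boundaries V I G i n \<subseteq> tor_cycles V I G i n" by (rule tor_subspaces(3)[OF G I])
    fix x assume x: "x \<in> tor_cycles V I G i n"
    have xd: "x \<in> fmod_deg V G i n" using x tor_cycles_deg by blast
    show "f i x \<in> tor_boundaries V I H i n \<longleftrightarrow> x \<in> tor_boundaries V I G i n"
    proof
      assume "x \<in> tor_boundaries V I G i n"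
      then show "f i x \<in> tor_boundaries V I H i n" using bnd[where L = G and L' = H and fL = f, OF G f(1,3)] by blast
    next
      assume "f i x \<in> tor_boundaries V I H i n"
      then have gf: "g i (f i x) \<in> tor_boundaries V I G i n" using bnd[where L = H and L' = G and fL = g, OF H g(1,3)] by blast
      \<comment> \<open>On a Tor cycle the homotopy formula writes \<open>h i x\<close> as a
        boundary plus an element of \<open>I G_i\<close>.\<close>
      have "h i x \<in> tor_boundaries V I G i n"
      proof (cases i)
        case 0
        then have "h i x = 0" by (simp add: h_def f(2) g(2))
        then show ?thesis using fv.subspace_0[OF tor_subspaces(2)[OF G I]] by simp
      next
        case (Suc k)
        have "h i x = bd G i (s i x) + s k (bd G k x)" using s(2) dm[OF xd] Suc by simp
        moreover have "s i x \<in> fmod_deg V G (Suc i) n" by (rule ghomD(4)[OF s(1) xd])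
        moreover have "bd G k x \<in> ideal_fmod V I G k" using x Suc by (simp add: tor_cycles_def)
        then have "s k (bd G k x) \<in> ideal_fmod V I G i" using ghom_ideal[OF s(1) I] Suc by simp
        moreover have "s k (bd G k x) \<in> fmod_deg V G i n"
          using ghomD(4)[OF s(1) ghomD(4)[OF bG]] xd Suc by simp
        ultimately show ?thesis unfolding tor_boundaries_def by blast
      qed
      then have "g i (f i x) - h i x \<in> tor_boundaries V I G i n"
        using gf fv.subspace_diff[OF tor_subspaces(2)[OF G I]] by blast
      then show "x \<in> tor_boundaries V I G i n" by (simp add: h_def)
    qed
  qed
qed

text \<open>A resolution exists, so the one chosen in \<open>tor_dim\<close> is one as well, and it
  can be compared with \<open>G\<close> in both directions.\<close>

theorem tor_dim_eq:
  assumes V: "finite V" and I: "ideal_in V I" and G: "graded_free_resolution V J G"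
  shows "tor_dim V I J i n = fv.dim (tor_cycles V I G i n) - fv.dim (tor_boundaries V I G i n)"
proof -
  let ?G = "SOME G. graded_free_resolution V J G"
  have "graded_free_resolution V J ?G" using G by (rule someI)
  then show ?thesis
    unfolding tor_dim_def Let_def
    using tor_dim_le[OF V I G, of ?G i n] tor_dim_le[OF V I _ G, of ?G i n] by simp
qed

section \<open>Monomials and monomial ideals\<close>

text \<open>The exponent vector of the squarefree monomial with support \<open>T\<close>.\<close>

definition ind :: "'v set \<Rightarrow> 'v \<Rightarrow>\<^sub>0 nat" where
  "ind T = (\<Sum>x\<in>T. Poly_Mapping.single x 1)"

lemma lookup_ind: "finite T \<Longrightarrow> lkp (ind T) v = of_bool (v \<in> T)"
  unfolding ind_def lookup_sum by (simp add: lookup_single when_def of_bool_def)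

lemma keys_ind: "finite T \<Longrightarrow> kys (ind T) = T"
  by (auto simp: in_keys_iff lookup_ind)

lemma mdeg_ind: "finite T \<Longrightarrow> mdeg (ind T) = card T"
  unfolding mdeg_def keys_ind by (simp add: lookup_ind)

lemma ind_insert: "finite T \<Longrightarrow> x \<notin> T \<Longrightarrow> ind (insert x T) = Poly_Mapping.single x 1 + ind T"
  by (simp add: ind_def)

lemma mono_eqI: "(\<And>v. lkp a v = lkp b v) \<Longrightarrow> a = b" by (rule poly_mapping_eqI)

text \<open>Subtraction of exponents is truncated at zero; inside the support of \<open>a\<close> it
  can be undone.\<close>

lemma add_minus_ind: "finite T \<Longrightarrow> T \<subseteq> kys a \<Longrightarrow> (a - ind T) + ind T = a"
proof (rule mono_eqI)
  fix v assume T: "finite T" "T \<subseteq> kys a"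
  have "v \<in> T \<Longrightarrow> lkp a v \<noteq> 0" using T by (auto simp: in_keys_iff)
  then show "lkp ((a - ind T) + ind T) v = lkp a v"
    using lookup_ind[OF T(1), of v] by (auto simp: lookup_add lookup_minus)
qed

lemma plus_minus_ind: "m + ind T - ind T = m" by simp

lemma keys_minus_subset: "kys (a - b) \<subseteq> kys a" for a b :: "'v \<Rightarrow>\<^sub>0 nat"
  by (auto simp: in_keys_iff lookup_minus)

lemma minus_ind_insert:
  "finite T \<Longrightarrow> x \<notin> T \<Longrightarrow> a - ind T - Poly_Mapping.single x 1 = a - ind (insert x T)"
  by (rule mono_eqI) (simp add: lookup_minus ind_insert lookup_add)

lemma lookup_monom_times:
  fixes p :: "('v \<Rightarrow>\<^sub>0 nat) \<Rightarrow>\<^sub>0 'f::field"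
  shows "lkp (Poly_Mapping.single k c * p) (k + m) = c * lkp p m"
  by (simp add: lookup_mult lookup_single when_mult)

lemma lookup_var_times:
  fixes p :: "('v \<Rightarrow>\<^sub>0 nat) \<Rightarrow>\<^sub>0 'f::field"
  shows "lkp (Poly_Mapping.single (Poly_Mapping.single x 1) c * p) m =
    (if x \<in> kys m then c * lkp p (m - Poly_Mapping.single x 1) else 0)"
proof (cases "x \<in> kys m")
  case True
  then have "lkp m x \<noteq> 0" by (simp add: in_keys_iff)
  then have "m = Poly_Mapping.single x 1 + (m - Poly_Mapping.single x 1)"
    by (intro mono_eqI) (auto simp: lookup_add lookup_minus lookup_single when_def)
  then show ?thesis using lookup_monom_times[of "Poly_Mapping.single x 1" c p "m - Poly_Mapping.single x 1"] True by simp
next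
  case False
  have "m \<notin> kys (Poly_Mapping.single (Poly_Mapping.single x 1) c * p)"
  proof
    assume "m \<in> kys (Poly_Mapping.single (Poly_Mapping.single x 1) c * p)"
    then obtain a b where ab: "a \<in> kys (Poly_Mapping.single (Poly_Mapping.single x (1::nat)) c)" "m = a + b"
      by (rule keys_mult_cases)
    then have "a = Poly_Mapping.single x 1" by (auto split: if_splits)
    then show False using False ab(2) by (simp add: keys_plus_nat)
  qed
  then show ?thesis using False by (simp add: in_keys_iff)
qed

lemma poly_expand: "p = (\<Sum>m\<in>kys p. Poly_Mapping.single m (lkp p m))"
proof (rule poly_mapping_eqI)
  fix m
  have "lkp (\<Sum>m\<in>kys p. Poly_Mapping.single m (lkp p m)) m = (\<Sum>m'\<in>kys p. if m' = m then lkp p m else 0)"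
    unfolding lookup_sum by (rule sum.cong) (auto simp: lookup_single when_def)
  then show "lkp p m = lkp (\<Sum>m\<in>kys p. Poly_Mapping.single m (lkp p m)) m"
    by (auto simp: in_keys_iff)
qed

lemma ideal_gen_0: "0 \<in> ideal_gen V A"
  unfolding ideal_gen_def by (rule CollectI, rule exI[of _ "{}"]) simp

lemma ideal_gen_add:
  assumes "p \<in> ideal_gen V A" "q \<in> ideal_gen V A" shows "p + q \<in> ideal_gen V A"
proof -
  obtain T c where T: "finite T" "T \<subseteq> A" "\<forall>a\<in>T. c a \<in> poly_ring V" "p = (\<Sum>a\<in>T. c a * a)"
    using assms(1) unfolding ideal_gen_def by blast
  obtain T' c' where T': "finite T'" "T' \<subseteq> A" "\<forall>a\<in>T'. c' a \<in> poly_ring V" "q = (\<Sum>a\<in>T'. c' a * a)"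
    using assms(2) unfolding ideal_gen_def by blast
  define e where "e a = (if a \<in> T then c a else 0) + (if a \<in> T' then c' a else 0)" for a
  have "p = (\<Sum>a\<in>T \<union> T'. (if a \<in> T then c a else 0) * a)"
    unfolding T(4) by (rule sum.mono_neutral_cong_left) (use T T' in auto)
  moreover have "q = (\<Sum>a\<in>T \<union> T'. (if a \<in> T' then c' a else 0) * a)"
    unfolding T'(4) by (rule sum.mono_neutral_cong_left) (use T T' in auto)
  ultimately have "p + q = (\<Sum>a\<in>T \<union> T'. e a * a)" by (simp add: e_def distrib_right sum.distrib)
  moreover have "\<forall>a\<in>T \<union> T'. e a \<in> poly_ring V" using T(3) T'(3) by (auto simp: e_def intro: poly_ring_add)
  ultimately show ?thesis unfolding ideal_gen_def using T(1,2) T'(1,2)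
    by (intro CollectI exI[of _ "T \<union> T'"] exI[of _ e]) auto
qed

lemma ideal_gen_sum: "(\<And>x. x \<in> B \<Longrightarrow> g x \<in> ideal_gen V A) \<Longrightarrow> (\<Sum>x\<in>B. g x) \<in> ideal_gen V A"
  by (induction B rule: infinite_finite_induct) (auto intro: ideal_gen_0 ideal_gen_add)

text \<open>A monomial ideal is spanned by the monomials in it, so membership is decided term by
  term.\<close>

lemma ideal_gen_monomial:
  assumes \<Gamma>: "\<And>g. g \<in> \<Gamma> \<Longrightarrow> kys g \<subseteq> V"
  shows "ideal_gen V ((\<lambda>g. Poly_Mapping.single g 1) ` \<Gamma>) =
    {p :: ('v, 'f::field) mpoly. p \<in> poly_ring V \<and> (\<forall>m\<in>kys p. \<exists>g\<in>\<Gamma>. \<exists>m'. m = m' + g)}" (is "?L = ?R")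
proof (intro equalityI subsetI)
  fix p :: "('v, 'f) mpoly" assume "p \<in> ?L"
  then obtain T c where T: "finite T" "T \<subseteq> (\<lambda>g. Poly_Mapping.single g 1) ` \<Gamma>" "\<forall>a\<in>T. c a \<in> poly_ring V" "p = (\<Sum>a\<in>T. c a * a)"
    unfolding ideal_gen_def by blast
  have t: "c a * a \<in> poly_ring V \<and> (\<forall>m\<in>kys (c a * a). \<exists>g\<in>\<Gamma>. \<exists>m'. m = m' + g)" if aT: "a \<in> T" for a
  proof -
    obtain g where g: "g \<in> \<Gamma>" "a = Poly_Mapping.single g 1" using subsetD[OF T(2) aT] by (rule imageE) (rule that)
    have "a \<in> poly_ring V" unfolding g(2) by (rule poly_ring_single[OF \<Gamma>[OF g(1)]])
    moreover have "\<exists>m'. m = m' + g" if "m \<in> kys (c a * a)" for m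
      using that by (rule keys_mult_cases) (auto simp: g(2))
    moreover have "c a \<in> poly_ring V" using T(3) aT by blast
    ultimately show ?thesis using g(1) poly_ring_mult[of "c a" V a] by blast
  qed
  have "p \<in> poly_ring V" unfolding T(4) by (rule poly_ring_sum) (use t in blast)
  moreover have "\<exists>g\<in>\<Gamma>. \<exists>m'. m = m' + g" if "m \<in> kys p" for m
  proof -
    have "(\<Sum>a\<in>T. lkp (c a * a) m) \<noteq> 0" using that unfolding T(4) by (simp add: in_keys_iff lookup_sum)
    then obtain a where "a \<in> T" "lkp (c a * a) m \<noteq> 0" by (meson sum.neutral)
    then show ?thesis using t[of a] by (simp add: in_keys_iff)
  qed
  ultimately show "p \<in> ?R" by blast
next
  fix p :: "('v, 'f) mpoly" assume p: "p \<in> ?R"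
  have "Poly_Mapping.single m (lkp p m) \<in> ?L" if m: "m \<in> kys p" for m
  proof -
    obtain g m' where g: "g \<in> \<Gamma>" "m = m' + g" using p m by blast
    have "kys m \<subseteq> V" using p m by (auto simp: poly_ring_def)
    then have c: "Poly_Mapping.single m' (lkp p m) \<in> poly_ring V" using g(2) by (intro poly_ring_single) (simp add: keys_plus_nat)
    let ?a = "Poly_Mapping.single g 1 :: ('v, 'f) mpoly"
    have "Poly_Mapping.single m (lkp p m) = (\<Sum>a\<in>{?a}. Poly_Mapping.single m' (lkp p m) * a)"
      unfolding g(2) by (simp add: mult_single)
    then show ?thesis unfolding ideal_gen_def using c g(1)
      by (intro CollectI exI[of _ "{?a}"] exI[of _ "\<lambda>_. Poly_Mapping.single m' (lkp p m)"]) auto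
  qed
  then show "p \<in> ?L" by (subst poly_expand[of p]) (rule ideal_gen_sum)
qed

lemma irrelevant_ideal_eq:
  "irrelevant_ideal V = {p :: ('v, 'f::field) mpoly. p \<in> poly_ring V \<and> lkp p 0 = 0}"
proof -
  let ?G = "(\<lambda>v. Poly_Mapping.single v (1::nat)) ` V"
  have "var ` V = (\<lambda>g. Poly_Mapping.single g 1 :: ('v, 'f) mpoly) ` ?G" by (simp add: image_image var_def)
  then have e1: "irrelevant_ideal V = {p :: ('v, 'f) mpoly. p \<in> poly_ring V \<and> (\<forall>m\<in>kys p. \<exists>g\<in>?G. \<exists>m'. m = m' + g)}"
    unfolding irrelevant_ideal_def by (simp only:) (rule ideal_gen_monomial, auto)
  have e2: "(\<forall>m\<in>kys p. \<exists>g\<in>?G. \<exists>m'. m = m' + g) \<longleftrightarrow> lkp p 0 = 0" if p: "p \<in> poly_ring V" for p :: "('v, 'f) mpoly"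
  proof
    assume a: "\<forall>m\<in>kys p. \<exists>g\<in>?G. \<exists>m'. m = m' + g"
    show "lkp p 0 = 0"
    proof (rule ccontr)
      assume "lkp p 0 \<noteq> 0"
      then have "0 \<in> kys p" by (simp add: in_keys_iff)
      then obtain g m' where "g \<in> ?G" "0 = m' + g" using a by blast
      then obtain v where "0 = m' + Poly_Mapping.single v (1::nat)" by blast
      then have "lkp 0 v = lkp (m' + Poly_Mapping.single v (1::nat)) v" by simp
      then show False by (simp add: lookup_add)
    qed
  next
    assume z: "lkp p 0 = 0"
    show "\<forall>m\<in>kys p. \<exists>g\<in>?G. \<exists>m'. m = m' + g"
    proof
      fix m assume m: "m \<in> kys p"
      then have "m \<noteq> 0" using z by (auto simp: in_keys_iff)
      then obtain v where v: "v \<in> kys m" by (metis all_not_in_conv in_keys_iff lookup_zero poly_mapping_eqI)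
      have "m = (m - Poly_Mapping.single v 1) + Poly_Mapping.single v 1"
        using v by (intro mono_eqI) (auto simp: lookup_add lookup_minus lookup_single when_def in_keys_iff)
      moreover have "v \<in> V" using v m p by (auto simp: poly_ring_def)
      ultimately show "\<exists>g\<in>?G. \<exists>m'. m = m' + g" by blast
    qed
  qed
  show ?thesis unfolding e1 by (rule Collect_cong, rule conj_cong[OF refl], rule e2)
qed

lemma prod_var: "finite \<sigma> \<Longrightarrow> (\<Prod>v\<in>\<sigma>. var v) = (Poly_Mapping.single (ind \<sigma>) 1 :: ('v, 'f::field) mpoly)"
proof (induction \<sigma> rule: finite_induct)
  case empty then show ?case by (simp add: ind_def)
next
  case (insert x \<sigma>) then show ?case by (simp add: var_def mult_single ind_insert)
qed

text \<open>Nonfaces are closed under enlarging, so a monomial in the vertex variables is divisible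
  by the squarefree monomial of a nonface exactly if its own support is a nonface.\<close>

lemma stanley_reisner_ideal_eq:
  assumes "cplx \<Delta>"
  shows "stanley_reisner_ideal \<Delta> =
    {p :: ('v, 'f::field) mpoly. p \<in> poly_ring (\<Union>\<Delta>) \<and> (\<forall>m\<in>kys p. kys m \<notin> \<Delta>)}"
proof -
  let ?G = "ind ` {\<sigma>. finite \<sigma> \<and> \<sigma> \<subseteq> \<Union>\<Delta> \<and> \<sigma> \<notin> \<Delta>}"
  have "{\<Prod>v\<in>\<sigma>. var v | \<sigma>. finite \<sigma> \<and> \<sigma> \<subseteq> \<Union>\<Delta> \<and> \<sigma> \<notin> \<Delta>} = (\<lambda>g. Poly_Mapping.single g 1 :: ('v, 'f) mpoly) ` ?G"
    unfolding image_image by (auto simp: prod_var image_iff) (metis prod_var)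
  then have e1: "stanley_reisner_ideal \<Delta> = {p :: ('v, 'f) mpoly. p \<in> poly_ring (\<Union>\<Delta>) \<and> (\<forall>m\<in>kys p. \<exists>g\<in>?G. \<exists>m'. m = m' + g)}"
    unfolding stanley_reisner_ideal_def by (simp only:) (rule ideal_gen_monomial, auto simp: keys_ind)
  have e2: "(\<exists>g\<in>?G. \<exists>m'. m = m' + g) \<longleftrightarrow> kys m \<notin> \<Delta>" if m: "kys m \<subseteq> \<Union>\<Delta>" for m
  proof
    assume "\<exists>g\<in>?G. \<exists>m'. m = m' + g"
    then obtain \<sigma> m' where s: "finite \<sigma>" "\<sigma> \<notin> \<Delta>" "m = m' + ind \<sigma>" by blast
    have "\<sigma> \<subseteq> kys m" unfolding s(3) keys_plus_nat keys_ind[OF s(1)] by blast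
    then show "kys m \<notin> \<Delta>" using s(2) cplxD(4)[OF assms] by blast
  next
    assume "kys m \<notin> \<Delta>"
    moreover have "m = (m - ind (kys m)) + ind (kys m)" by (rule add_minus_ind[symmetric]) auto
    ultimately show "\<exists>g\<in>?G. \<exists>m'. m = m' + g" using m by (intro bexI[of _ "ind (kys m)"]) auto
  qed
  have "(\<forall>m\<in>kys p. \<exists>g\<in>?G. \<exists>m'. m = m' + g) \<longleftrightarrow> (\<forall>m\<in>kys p. kys m \<notin> \<Delta>)"
    if "p \<in> poly_ring (\<Union>\<Delta>)" for p :: "('v, 'f) mpoly"
    by (rule ball_cong[OF refl], rule e2) (use that in \<open>simp add: poly_ring_def\<close>)
  then show ?thesis unfolding e1 by (intro Collect_cong conj_cong refl)
qed

lemma ideal_in_faces: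
  assumes "cplx \<Delta>"
  shows "ideal_in V {p :: ('v, 'f::field) mpoly. p \<in> poly_ring V \<and> (\<forall>m\<in>kys p. kys m \<notin> \<Delta>)}"
  unfolding ideal_in_def
proof (intro conjI ballI CollectI)
  fix p q :: "('v, 'f) mpoly"
  assume p: "p \<in> {p. p \<in> poly_ring V \<and> (\<forall>m\<in>kys p. kys m \<notin> \<Delta>)}" and q: "q \<in> {p. p \<in> poly_ring V \<and> (\<forall>m\<in>kys p. kys m \<notin> \<Delta>)}"
  show "p + q \<in> poly_ring V" using p q by (auto intro: poly_ring_add)
  fix m assume "m \<in> kys (p + q)"
  then have "m \<in> kys p \<union> kys q" using keys_add[of p q] by blast
  then show "kys m \<notin> \<Delta>" using p q by blast
next
  fix p q :: "('v, 'f) mpoly"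
  assume p: "p \<in> poly_ring V" and q: "q \<in> {p. p \<in> poly_ring V \<and> (\<forall>m\<in>kys p. kys m \<notin> \<Delta>)}"
  show "p * q \<in> poly_ring V" using p q by (auto intro: poly_ring_mult)
  fix m assume "m \<in> kys (p * q)"
  then obtain a b where ab: "b \<in> kys q" "m = a + b" by (rule keys_mult_cases)
  then have "kys b \<subseteq> kys m" "kys b \<notin> \<Delta>" using q by (auto simp: keys_plus_nat)
  then show "kys m \<notin> \<Delta>" using cplxD(4)[OF assms] by blast
qed (auto)

section \<open>The Koszul complex\<close>

text \<open>Bases of free modules are indexed by numbers, those of the Koszul complex by the
  \<open>i\<close>-subsets of \<open>V\<close>. Any enumeration will do; \<open>entry\<close> and
  \<open>from_entries\<close> hide it.\<close>

definition nth_subset :: "'v set \<Rightarrow> nat \<Rightarrow> nat \<Rightarrow> 'v set" where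
  "nth_subset V i = (SOME e. bij_betw e {..<card (subsets V i)} (subsets V i))"

definition subset_index :: "'v set \<Rightarrow> nat \<Rightarrow> 'v set \<Rightarrow> nat" where
  "subset_index V i = inv_into {..<card (subsets V i)} (nth_subset V i)"

lemma nth_subset_bij:
  assumes "finite V" shows "bij_betw (nth_subset V i) {..<card (subsets V i)} (subsets V i)"
proof -
  have "\<exists>e. bij_betw e {..<card (subsets V i)} (subsets V i)"
    using ex_bij_betw_nat_finite[OF finite_subsets[OF assms]] by (simp add: atLeast0LessThan)
  then show ?thesis unfolding nth_subset_def by (rule someI_ex)
qed

lemma subset_index:
  assumes "finite V" "T \<in> subsets V i"
  shows "subset_index V i T < card (subsets V i)" "nth_subset V i (subset_index V i T) = T"
proof -
  have T: "T \<in> nth_subset V i ` {..<card (subsets V i)}" using nth_subset_bij[OF assms(1)] assms(2) by (auto simp: bij_betw_def)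
  show "subset_index V i T < card (subsets V i)" unfolding subset_index_def using inv_into_into[OF T] by simp
  show "nth_subset V i (subset_index V i T) = T" unfolding subset_index_def by (rule f_inv_into_f[OF T])
qed

lemma nth_subset:
  assumes "finite V" "b < card (subsets V i)"
  shows "nth_subset V i b \<in> subsets V i" "subset_index V i (nth_subset V i b) = b"
  using nth_subset_bij[OF assms(1), of i] assms(2) unfolding subset_index_def bij_betw_def by auto

definition entry :: "'v set \<Rightarrow> nat \<Rightarrow> ('v, 'f::field) fvec \<Rightarrow> 'v set \<Rightarrow> ('v, 'f) mpoly" where
  "entry V i u T = lkp u (subset_index V i T)"

definition from_entries :: "'v set \<Rightarrow> nat \<Rightarrow> ('v set \<Rightarrow> ('v, 'f::field) mpoly) \<Rightarrow> ('v, 'f) fvec" where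
  "from_entries V i P = (\<Sum>b<card (subsets V i). Poly_Mapping.single b (P (nth_subset V i b)))"

text \<open>The differential is given by its entries: the coefficient of \<open>e_T\<close>
  collects, with signs, the variable \<open>x\<close> times the coefficient of the basis vector of
  \<open>insert x T\<close>. The basis vector of a set with \<open>i\<close> elements has degree
  \<open>i\<close>, hence the constant shift.\<close>

definition koszul :: "'v set \<Rightarrow> ('v, 'f::field) free_seq" where
  "koszul V = \<lparr>rk = \<lambda>i. card (subsets V i), shift = \<lambda>i b. i,
     bd = \<lambda>i u. from_entries V i (\<lambda>T. \<Sum>x\<in>V - T.
       Poly_Mapping.single (Poly_Mapping.single x 1) (eps x T) * entry V (Suc i) u (insert x T))\<rparr>"

lemma lookup_from_entries:
  "lkp (from_entries V i P) b = (if b < card (subsets V i) then P (nth_subset V i b) else 0)"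
  unfolding from_entries_def lookup_sum by (auto simp: lookup_single when_def)

lemma entry_from_entries:
  "finite V \<Longrightarrow> T \<in> subsets V i \<Longrightarrow> entry V i (from_entries V i P) T = P T"
  by (simp add: entry_def lookup_from_entries subset_index)

lemma koszul_fmod_iff:
  assumes "finite V"
  shows "u \<in> fmod V (koszul V) i \<longleftrightarrow> (\<forall>T\<in>subsets V i. entry V i u T \<in> poly_ring V) \<and> (\<forall>b\<ge>card (subsets V i). lkp u b = 0)"
proof
  assume "u \<in> fmod V (koszul V) i"
  then show "(\<forall>T\<in>subsets V i. entry V i u T \<in> poly_ring V) \<and> (\<forall>b\<ge>card (subsets V i). lkp u b = 0)"
    using fmodD[of u V "koszul V" i] by (simp add: entry_def koszul_def)
next
  assume a: "(\<forall>T\<in>subsets V i. entry V i u T \<in> poly_ring V) \<and> (\<forall>b\<ge>card (subsets V i). lkp u b = 0)"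
  show "u \<in> fmod V (koszul V) i"
  proof (rule fmodI)
    fix b
    show "lkp u b \<in> poly_ring V"
    proof (cases "b < card (subsets V i)")
      case True
      then have "entry V i u (nth_subset V i b) \<in> poly_ring V" using a nth_subset[OF assms] by blast
      then show ?thesis using nth_subset(2)[OF assms True] by (simp add: entry_def)
    next
      case False then show ?thesis using a by simp
    qed
    show "b \<ge> rk (koszul V) i \<Longrightarrow> lkp u b = 0" using a by (simp add: koszul_def)
  qed
qed

lemma koszul_deg_iff:
  assumes V: "finite V" and u: "u \<in> fmod V (koszul V) i"
  shows "hom_of_deg (shift (koszul V) i) n u \<longleftrightarrow> (\<forall>T\<in>subsets V i. \<forall>m\<in>kys (entry V i u T). mdeg m + i = n)"
proof
  assume "hom_of_deg (shift (koszul V) i) n u"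
  then show "\<forall>T\<in>subsets V i. \<forall>m\<in>kys (entry V i u T). mdeg m + i = n"
    by (auto simp: hom_of_deg_def entry_def koszul_def)
next
  assume a: "\<forall>T\<in>subsets V i. \<forall>m\<in>kys (entry V i u T). mdeg m + i = n"
  show "hom_of_deg (shift (koszul V) i) n u"
    unfolding hom_of_deg_def
  proof (intro allI ballI)
    fix b m assume m: "m \<in> kys (lkp u b)"
    have "b < card (subsets V i)" using m u koszul_fmod_iff[OF V] by (metis keys_zero empty_iff not_less)
    then have "nth_subset V i b \<in> subsets V i" "entry V i u (nth_subset V i b) = lkp u b"
      using nth_subset[OF V] by (auto simp: entry_def)
    then have "mdeg m + i = n" using a m by auto
    then show "mdeg m + shift (koszul V) i b = n" by (simp add: koszul_def)
  qed
qed

lemma koszul_eqI: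
  assumes V: "finite V" and u: "u \<in> fmod V (koszul V) i" "w \<in> fmod V (koszul V) i"
    and e: "\<And>T. T \<in> subsets V i \<Longrightarrow> entry V i u T = entry V i w T"
  shows "u = w"
proof (rule poly_mapping_eqI)
  fix b show "lkp u b = lkp w b"
  proof (cases "b < card (subsets V i)")
    case True
    then show ?thesis using e[OF nth_subset(1)[OF V True]] nth_subset(2)[OF V True] by (simp add: entry_def)
  next
    case False then show ?thesis using u koszul_fmod_iff[OF V] by (metis not_less)
  qed
qed

lemma from_entries_fmod:
  assumes "finite V" "\<And>T. T \<in> subsets V i \<Longrightarrow> P T \<in> poly_ring V"
  shows "from_entries V i P \<in> fmod V (koszul V) i"
  using assms by (auto simp: koszul_fmod_iff entry_from_entries lookup_from_entries)

lemma entry_bd: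
  assumes "finite V" "T \<in> subsets V i"
  shows "entry V i (bd (koszul V) i u) T =
    (\<Sum>x\<in>V - T. Poly_Mapping.single (Poly_Mapping.single x 1) (eps x T) * entry V (Suc i) u (insert x T))"
  unfolding koszul_def by (simp add: entry_from_entries[OF assms])

lemma entry_add: "entry V i (u + w) T = entry V i u T + entry V i w T" by (simp add: entry_def lookup_add)
lemma entry_smult: "entry V i (smult p u) T = p * entry V i u T" by (simp add: entry_def lookup_smult)
lemma entry_0 [simp]: "entry V i 0 T = 0" by (simp add: entry_def)

lemma insert_subsets: "finite V \<Longrightarrow> T \<in> subsets V i \<Longrightarrow> x \<in> V - T \<Longrightarrow> insert x T \<in> subsets V (Suc i)"
  by (auto simp: subsets_def card_insert_disjoint finite_subset)

lemma subsets_finite: "finite V \<Longrightarrow> T \<in> subsets V i \<Longrightarrow> finite T"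
  by (auto simp: subsets_def finite_subset)

lemma koszul_bd_fmod:
  assumes V: "finite V" and u: "u \<in> fmod V (koszul V) (Suc i)"
  shows "bd (koszul V) i u \<in> fmod V (koszul V) i"
proof -
  have "(\<Sum>x\<in>V - T. Poly_Mapping.single (Poly_Mapping.single x 1) (eps x T) * entry V (Suc i) u (insert x T)) \<in> poly_ring V"
    if T: "T \<in> subsets V i" for T
  proof (rule poly_ring_sum)
    fix x assume x: "x \<in> V - T"
    have "entry V (Suc i) u (insert x T) \<in> poly_ring V"
      using u insert_subsets[OF V T x] unfolding koszul_fmod_iff[OF V] by blast
    moreover have "Poly_Mapping.single (Poly_Mapping.single x 1) (eps x T) \<in> poly_ring V"
      by (rule poly_ring_single) (use x in auto)
    ultimately show "Poly_Mapping.single (Poly_Mapping.single x 1) (eps x T) * entry V (Suc i) u (insert x T) \<in> poly_ring V"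
      by (intro poly_ring_mult)
  qed
  then have "from_entries V i (\<lambda>T. \<Sum>x\<in>V - T.
       Poly_Mapping.single (Poly_Mapping.single x 1) (eps x T) * entry V (Suc i) u (insert x T)) \<in> fmod V (koszul V) i"
    by (rule from_entries_fmod[OF V])
  then show ?thesis by (simp add: koszul_def)
qed

text \<open>The coefficient of \<open>u\<close> at \<open>x^(a - T) e_T\<close>. In these coordinates the Koszul complex splits
  into one simplicial chain complex on the support of each multidegree \<open>a\<close>.\<close>

definition coeff_at :: "'v set \<Rightarrow> nat \<Rightarrow> ('v, 'f::field) fvec \<Rightarrow> ('v \<Rightarrow>\<^sub>0 nat) \<Rightarrow> 'v set \<Rightarrow> 'f" where
  "coeff_at V i u a T = lkp (entry V i u T) (a - ind T)"

text \<open>Multiplication by the variable \<open>x\<close> makes up for the passage from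
  \<open>insert x T\<close> to \<open>T\<close>, so the multidegree \<open>a\<close> is
  kept.\<close>

lemma coeff_at_bd:
  assumes V: "finite V" and T: "T \<in> subsets V i" "T \<subseteq> kys a" and a: "kys a \<subseteq> V"
  shows "coeff_at V i (bd (koszul V) i u) a T = bdry (kys a) (coeff_at V (Suc i) u a) T"
proof -
  have fT: "finite T" by (rule subsets_finite[OF V T(1)])
  have k: "x \<in> kys (a - ind T) \<longleftrightarrow> x \<in> kys a" if "x \<notin> T" for x
    using that lookup_ind[OF fT, of x] by (simp add: in_keys_iff lookup_minus)
  have "coeff_at V i (bd (koszul V) i u) a T =
      (\<Sum>x\<in>V - T. if x \<in> kys a then eps x T * coeff_at V (Suc i) u a (insert x T) else 0)"
    unfolding coeff_at_def entry_bd[OF V T(1)] lookup_sum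
    by (rule sum.cong[OF refl]) (simp add: lookup_var_times k minus_ind_insert[OF fT] del: One_nat_def)
  also have "\<dots> = (\<Sum>x\<in>kys a - T. eps x T * coeff_at V (Suc i) u a (insert x T))"
    by (rule sum.mono_neutral_cong_right) (use V a in auto)
  finally show ?thesis by (simp add: bdry_def)
qed

lemma coeff_at_plus_ind: "coeff_at V i u (m + ind T) T = lkp (entry V i u T) m"
  by (simp add: coeff_at_def)

lemma koszul_eq_0I:
  assumes V: "finite V" and u: "u \<in> fmod V (koszul V) i"
    and z: "\<And>a T. T \<in> subsets V i \<Longrightarrow> T \<subseteq> kys a \<Longrightarrow> kys a \<subseteq> V \<Longrightarrow> coeff_at V i u a T = 0"
  shows "u = 0"
proof (rule koszul_eqI[OF V u fmod_0])
  fix T assume T: "T \<in> subsets V i"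
  have "lkp (entry V i u T) m = 0" for m
  proof (rule ccontr)
    assume nz: "lkp (entry V i u T) m \<noteq> 0"
    have fT: "finite T" "T \<subseteq> V" using subsets_finite[OF V T] T by (auto simp: subsets_def)
    have "m \<in> kys (entry V i u T)" "entry V i u T \<in> poly_ring V" using nz u T koszul_fmod_iff[OF V] by (auto simp: in_keys_iff)
    then have "kys m \<subseteq> V" by (auto simp: poly_ring_def)
    then have "coeff_at V i u (m + ind T) T = 0"
      by (intro z[OF T]) (use fT in \<open>auto simp: keys_plus_nat keys_ind\<close>)
    then show False using nz by (simp add: coeff_at_plus_ind)
  qed
  then show "entry V i u T = entry V i 0 T" by (intro poly_mapping_eqI) simp
qed

text \<open>The contracting homotopy of a simplex with apex \<open>v\<close>. In the Koszul complex
  it is multiplication by \<open>e_v\<close>, up to sign, followed by division by the variable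
  \<open>v\<close>.\<close>

definition contr :: "'v \<Rightarrow> ('v set \<Rightarrow> 'f::field) \<Rightarrow> 'v set \<Rightarrow> 'f" where
  "contr v c T = (if v \<in> T then eps v (T - {v}) * c (T - {v}) else 0)"

text \<open>The homotopy identity: \<open>bdry\<close> after \<open>contr v\<close> plus
  \<open>contr v\<close> after \<open>bdry\<close> is the identity.\<close>

lemma bdry_contr:
  fixes c :: "'v set \<Rightarrow> 'f::field"
  assumes A: "finite A" "v \<in> A" "T \<subseteq> A"
  shows "bdry A (contr v c) T = c T - (if v \<in> T then eps v (T - {v}) * bdry A c (T - {v}) else 0)"
proof -
  have fT: "finite T" using A finite_subset by blast
  show ?thesis
  proof (cases "v \<in> T")
    case False
    have "bdry A (contr v c) T = (\<Sum>x\<in>A - T. if x = v then c T else 0)"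
      unfolding bdry_def by (rule sum.cong[OF refl]) (use False in \<open>auto simp: contr_def eps_square_left\<close>)
    then show ?thesis using A False by simp
  next
    case True
    let ?S = "T - {v}"
    have e: "A - ?S = insert v (A - T)" "insert v ?S = T" using A True by auto
    have "bdry A c ?S = eps v ?S * c T + (\<Sum>x\<in>A - T. eps x ?S * c (insert x ?S))"
      unfolding bdry_def e(1) using A(1) True e(2) by (subst sum.insert) auto
    moreover have "bdry A (contr v c) T = (\<Sum>x\<in>A - T. - eps v ?S * (eps x ?S * c (insert x ?S)))"
      unfolding bdry_def
    proof (rule sum.cong[OF refl])
      fix x assume x: "x \<in> A - T"
      have xv: "x \<noteq> v" "insert x T - {v} = insert x ?S" using x True by auto
      have "eps x (insert v ?S) * eps v ?S = - (eps v (insert x ?S) * eps x ?S :: 'f)"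
        by (rule eps_swap) (use fT x xv in auto)
      then have s: "eps x T * eps v ?S = - (eps v (insert x ?S) * eps x ?S :: 'f)" unfolding e(2) .
      have "eps x T * eps v (insert x ?S) = (eps x T * eps v ?S) * (eps v ?S * eps v (insert x ?S) :: 'f)"
        by (simp add: mult.assoc eps_square_left)
      also have "\<dots> = - (eps v (insert x ?S) * eps v (insert x ?S)) * (eps v ?S * eps x ?S)"
        unfolding s by (simp add: mult_ac)
      finally have "eps x T * eps v (insert x ?S) = - (eps v ?S * eps x ?S :: 'f)" by (simp add: eps_square)
      then show "eps x T * contr v c (insert x T) = - eps v ?S * (eps x ?S * c (insert x ?S))"
        unfolding contr_def xv(2) using True by (simp add: mult.assoc[symmetric])
    qed
    ultimately show ?thesis using True by (simp add: sum_negf sum_distrib_left distrib_left eps_square_left)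
  qed
qed

lemma bdry_cong: "(\<And>x. x \<in> A - T \<Longrightarrow> c (insert x T) = c' (insert x T)) \<Longrightarrow> bdry A c T = bdry A c' T"
  unfolding bdry_def by (rule sum.cong) auto

text \<open>In each multidegree \<open>a \<noteq> 0\<close> some variable of the support serves as
  the apex of a contracting homotopy. Only the constants in position 0 have multidegree 0, and
  \<open>const\<close> excludes them.\<close>

lemma koszul_exact:
  fixes u :: "('v, 'f::field) fvec"
  assumes V: "finite V" and u: "u \<in> fmod V (koszul V) i"
    and const: "i = 0 \<Longrightarrow> lkp (entry V 0 u {}) 0 = 0"
    and cyc: "\<And>h. i = Suc h \<Longrightarrow> bd (koszul V) h u = 0"
  shows "\<exists>w\<in>fmod V (koszul V) (Suc i). bd (koszul V) i w = u"
proof -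
  \<comment> \<open>The apex may depend on the multidegree but not on the set \<open>T\<close>, as
    the homotopy acts inside one multidegree.\<close>
  define ch where "ch a = (SOME v. v \<in> kys a)" for a :: "'v \<Rightarrow>\<^sub>0 nat"
  have ch: "ch a \<in> kys a" if "a \<noteq> 0" for a
  proof -
    have "\<exists>v. v \<in> kys a" using that by (metis in_keys_iff lookup_zero poly_mapping_eqI)
    then show ?thesis unfolding ch_def by (rule someI_ex)
  qed
  define P where "P T = Abs_poly_mapping (\<lambda>m. contr (ch (m + ind T)) (coeff_at V i u (m + ind T)) T)" for T
  \<comment> \<open>The homotopy is given coefficient by coefficient. A nonzero coefficient at
    \<open>m\<close> comes from \<open>m\<close> times one variable of \<open>T\<close> in one of
    finitely many entries of \<open>u\<close>, so the result is a polynomial.\<close>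
  have fin: "finite {m. contr (ch (m + ind T)) (coeff_at V i u (m + ind T)) T \<noteq> 0}" if T: "T \<in> subsets V (Suc i)" for T
  proof -
    have fT: "finite T" by (rule subsets_finite[OF V T])
    have "m \<in> (\<Union>v\<in>T. (\<lambda>m'. m' - Poly_Mapping.single v 1) ` kys (entry V i u (T - {v})))"
      if nz: "contr (ch (m + ind T)) (coeff_at V i u (m + ind T)) T \<noteq> 0" for m
    proof -
      obtain v where v: "v \<in> T" "coeff_at V i u (m + ind T) (T - {v}) \<noteq> 0"
        using nz by (auto simp: contr_def split: if_splits)
      have "ind T = Poly_Mapping.single v 1 + ind (T - {v})"
        using ind_insert[of "T - {v}" v] fT v(1) by (simp add: insert_absorb)
      then have e: "m + ind T = (m + Poly_Mapping.single v 1) + ind (T - {v})" by (simp only: add.assoc)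
      have "m + ind T - ind (T - {v}) = m + Poly_Mapping.single v 1" unfolding e by (rule plus_minus_ind)
      then have "m + Poly_Mapping.single v 1 \<in> kys (entry V i u (T - {v}))"
        using v(2) by (simp add: coeff_at_def in_keys_iff)
      then have "m + Poly_Mapping.single v 1 - Poly_Mapping.single v 1 \<in> (\<lambda>m'. m' - Poly_Mapping.single v 1) ` kys (entry V i u (T - {v}))"
        by (rule imageI)
      then have "m \<in> (\<lambda>m'. m' - Poly_Mapping.single v 1) ` kys (entry V i u (T - {v}))"
        unfolding add_diff_cancel_right' .
      then show ?thesis using v(1) by (rule UN_I[rotated])
    qed
    then have "{m. contr (ch (m + ind T)) (coeff_at V i u (m + ind T)) T \<noteq> 0} \<subseteq>
        (\<Union>v\<in>T. (\<lambda>m'. m' - Poly_Mapping.single v 1) ` kys (entry V i u (T - {v})))" by (intro subsetI, elim CollectE)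
    then show ?thesis by (rule finite_subset) (use fT in simp)
  qed
  have lP: "lkp (P T) m = contr (ch (m + ind T)) (coeff_at V i u (m + ind T)) T" if "T \<in> subsets V (Suc i)" for T m
    unfolding P_def using fin[OF that] by simp
  have ePR: "entry V i u T \<in> poly_ring V" if "T \<in> subsets V i" for T using u that koszul_fmod_iff[OF V] by blast
  have PR: "P T \<in> poly_ring V" if T: "T \<in> subsets V (Suc i)" for T
    unfolding poly_ring_def
  proof (intro CollectI ballI)
    fix m assume "m \<in> kys (P T)"
    then have "contr (ch (m + ind T)) (coeff_at V i u (m + ind T)) T \<noteq> 0" using lP[OF T] by (simp add: in_keys_iff)
    then obtain v where v: "v \<in> T" "coeff_at V i u (m + ind T) (T - {v}) \<noteq> 0" by (auto simp: contr_def split: if_splits)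
    have fT: "finite T" by (rule subsets_finite[OF V T])
    have "T - {v} \<in> subsets V i" using v(1) T fT by (auto simp: subsets_def)
    then have "kys (m + ind T - ind (T - {v})) \<subseteq> V"
      using v(2) ePR[of "T - {v}"] by (auto simp: coeff_at_def in_keys_iff poly_ring_def)
    moreover have "kys m \<subseteq> kys (m + ind T - ind (T - {v}))"
      using lookup_ind[OF fT] lookup_ind[of "T - {v}"] fT by (auto simp: in_keys_iff lookup_minus lookup_add)
    ultimately show "kys m \<subseteq> V" by blast
  qed
  define w where "w = from_entries V (Suc i) P"
  have wf: "w \<in> fmod V (koszul V) (Suc i)" unfolding w_def by (rule from_entries_fmod[OF V PR])
  have "bd (koszul V) i w - u = 0"
  proof (rule koszul_eq_0I[OF V fmod_diff[OF koszul_bd_fmod[OF V wf] u]])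
    fix a :: "'v \<Rightarrow>\<^sub>0 nat" and T assume T: "T \<in> subsets V i" "T \<subseteq> kys a" "kys a \<subseteq> V"
    have fT: "finite T" by (rule subsets_finite[OF V T(1)])
    have "coeff_at V i (bd (koszul V) i w) a T = coeff_at V i u a T"
    proof (cases "a = 0")
      case True
      then have "T = {}" "i = 0" using T by (auto simp: subsets_def)
      then have "coeff_at V i u a T = 0" using const True by (simp add: coeff_at_def ind_def)
      then show ?thesis unfolding coeff_at_bd[OF V T] using True by (simp add: bdry_def)
    next
      case False
      have cw: "coeff_at V (Suc i) w a (insert x T) = contr (ch a) (coeff_at V i u a) (insert x T)" if x: "x \<in> kys a - T" for x
      proof -
        have xV: "x \<in> V - T" using x T by blast
        have s: "insert x T \<in> subsets V (Suc i)" by (rule insert_subsets[OF V T(1) xV])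
        have am: "a - ind (insert x T) + ind (insert x T) = a" by (rule add_minus_ind) (use fT T x in auto)
        show ?thesis unfolding coeff_at_def[of V "Suc i"] w_def entry_from_entries[OF V s] lP[OF s] am ..
      qed
      have "coeff_at V i (bd (koszul V) i w) a T = bdry (kys a) (contr (ch a) (coeff_at V i u a)) T"
        unfolding coeff_at_bd[OF V T] by (rule bdry_cong) (rule cw)
      also have "\<dots> = coeff_at V i u a T - (if ch a \<in> T then eps (ch a) (T - {ch a}) * bdry (kys a) (coeff_at V i u a) (T - {ch a}) else 0)"
        by (rule bdry_contr[OF finite_keys ch[OF False] T(2)])
      also have "(if ch a \<in> T then eps (ch a) (T - {ch a}) * bdry (kys a) (coeff_at V i u a) (T - {ch a}) else 0) = 0"
      proof (cases "ch a \<in> T")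
        case in_T: True
        obtain h where h: "i = Suc h" using in_T T(1) fT by (cases i) (auto simp: subsets_def)
        have "T - {ch a} \<in> subsets V h" using in_T T(1) fT h by (auto simp: subsets_def)
        then have "bdry (kys a) (coeff_at V i u a) (T - {ch a}) = coeff_at V h (bd (koszul V) h u) a (T - {ch a})"
          unfolding h by (rule coeff_at_bd[OF V _ _ T(3), symmetric]) (use T in auto)
        also have "\<dots> = 0" using cyc[OF h] by (simp add: coeff_at_def)
        finally show ?thesis by simp
      qed simp
      finally show ?thesis by simp
    qed
    then show "coeff_at V i (bd (koszul V) i w - u) a T = 0" by (simp add: coeff_at_def entry_def lookup_minus)
  qed
  then show ?thesis using wf by (intro bexI[of _ w]) auto
qed

theorem koszul_resolution:
  assumes V: "finite V"
  shows "graded_free_resolution V (irrelevant_ideal V) (koszul V :: ('v, 'f::field) free_seq)"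
proof -
  let ?K = "koszul V :: ('v, 'f) free_seq"
  have s0: "subsets V 0 = {{}}" using V by (auto simp: subsets_def finite_subset)
  have rk: "rk ?K 0 = 1" "shift ?K 0 0 = 0" using s0 by (simp_all add: koszul_def)
  have add: "bd ?K i (u + w) = bd ?K i u + bd ?K i w" for i u w
    unfolding koszul_def by (rule poly_mapping_eqI)
      (simp add: lookup_from_entries lookup_add entry_add distrib_left sum.distrib)
  have sm: "bd ?K i (smult p u) = smult p (bd ?K i u)" for i p u
    unfolding koszul_def by (rule poly_mapping_eqI)
      (simp add: lookup_from_entries lookup_smult entry_smult sum_distrib_left mult.left_commute)
  have dg: "bd ?K i ` fmod_deg V ?K (Suc i) n \<subseteq> fmod_deg V ?K i n" for i n
  proof (rule image_subsetI)
    fix u assume u: "u \<in> fmod_deg V ?K (Suc i) n"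
    then have uf: "u \<in> fmod V ?K (Suc i)" and ud: "hom_of_deg (shift ?K (Suc i)) n u" by (auto simp: fmod_deg_iff)
    have bf: "bd ?K i u \<in> fmod V ?K i" by (rule koszul_bd_fmod[OF V uf])
    have "mdeg m + i = n" if T: "T \<in> subsets V i" and m: "m \<in> kys (entry V i (bd ?K i u) T)" for T m
    proof -
      have "(\<Sum>x\<in>V - T. lkp (Poly_Mapping.single (Poly_Mapping.single x 1) (eps x T) * entry V (Suc i) u (insert x T)) m) \<noteq> 0"
        using m unfolding entry_bd[OF V T] by (simp add: in_keys_iff lookup_sum)
      then obtain x where x: "x \<in> V - T"
        "m \<in> kys (Poly_Mapping.single (Poly_Mapping.single x 1) (eps x T) * entry V (Suc i) u (insert x T))"
        by (metis (no_types, lifting) in_keys_iff sum.neutral)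
      obtain a b where ab: "a \<in> kys (Poly_Mapping.single (Poly_Mapping.single x (1::nat)) (eps x T :: 'f))"
        "b \<in> kys (entry V (Suc i) u (insert x T))" "m = a + b" using x(2) by (rule keys_mult_cases)
      have "a = Poly_Mapping.single x 1" using ab(1) by (auto split: if_splits)
      then have "mdeg a = 1" by (simp add: mdeg_def)
      moreover have "mdeg b + Suc i = n" using ud ab(2) insert_subsets[OF V T x(1)] koszul_deg_iff[OF V uf] by blast
      ultimately show ?thesis using ab(3) by (simp add: mdeg_plus)
    qed
    then have "hom_of_deg (shift ?K i) n (bd ?K i u)" unfolding koszul_deg_iff[OF V bf] by blast
    then show "bd ?K i u \<in> fmod_deg V ?K i n" using bf by (simp add: fmod_deg_iff)
  qed
  have im0: "bd ?K 0 ` fmod V ?K 1 = ideal_fmod V (irrelevant_ideal V) ?K 0"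
  proof (intro equalityI subsetI)
    fix y assume "y \<in> bd ?K 0 ` fmod V ?K 1"
    then obtain u where u: "u \<in> fmod V ?K (Suc 0)" "y = bd ?K 0 u" by auto
    have yf: "y \<in> fmod V ?K 0" unfolding u(2) by (rule koszul_bd_fmod[OF V u(1)])
    have "lkp (entry V 0 y {}) 0 = 0"
      unfolding u(2) using s0 by (subst entry_bd[OF V]) (simp_all add: lookup_sum lookup_var_times del: One_nat_def)
    then have "lkp y b \<in> irrelevant_ideal V" for b
    proof (cases "b < card (subsets V 0)")
      case True
      then have "nth_subset V 0 b = {}" using nth_subset(1)[OF V True] s0 by simp
      then have "lkp y b = entry V 0 y {}" using nth_subset(2)[OF V True] by (simp add: entry_def)
      then show ?thesis using \<open>lkp (entry V 0 y {}) 0 = 0\<close> fmodD(1)[OF yf, of b] by (simp add: irrelevant_ideal_eq)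
    next
      case False
      then have "lkp y b = 0" using yf koszul_fmod_iff[OF V] by (metis not_less)
      then show ?thesis by (simp add: irrelevant_ideal_eq)
    qed
    then show "y \<in> ideal_fmod V (irrelevant_ideal V) ?K 0" using yf by (simp add: ideal_fmod_def)
  next
    fix u assume u: "u \<in> ideal_fmod V (irrelevant_ideal V) ?K 0"
    then have "u \<in> fmod V ?K 0" "lkp (entry V 0 u {}) 0 = 0"
      by (auto simp: ideal_fmod_def irrelevant_ideal_eq entry_def)
    then obtain w where "w \<in> fmod V ?K (Suc 0)" "bd ?K 0 w = u" using koszul_exact[OF V, of u 0] by auto
    then show "u \<in> bd ?K 0 ` fmod V ?K 1" by auto
  qed
  have im: "bd ?K (Suc i) ` fmod V ?K (Suc (Suc i)) = {u \<in> fmod V ?K (Suc i). bd ?K i u = 0}" for i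
  proof (intro equalityI subsetI)
    fix y assume "y \<in> bd ?K (Suc i) ` fmod V ?K (Suc (Suc i))"
    then obtain u where u: "u \<in> fmod V ?K (Suc (Suc i))" "y = bd ?K (Suc i) u" by blast
    have yf: "y \<in> fmod V ?K (Suc i)" unfolding u(2) by (rule koszul_bd_fmod[OF V u(1)])
    have "bd ?K i y = 0"
    proof (rule koszul_eq_0I[OF V koszul_bd_fmod[OF V yf]])
      fix a :: "'v \<Rightarrow>\<^sub>0 nat" and T assume T: "T \<in> subsets V i" "T \<subseteq> kys a" "kys a \<subseteq> V"
      have "coeff_at V (Suc i) y a (insert x T) = bdry (kys a) (coeff_at V (Suc (Suc i)) u a) (insert x T)" if x: "x \<in> kys a - T" for x
        unfolding u(2) by (rule coeff_at_bd[OF V insert_subsets[OF V T(1)] _ T(3)]) (use x T in auto)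
      then have "coeff_at V i (bd ?K i y) a T = bdry (kys a) (bdry (kys a) (coeff_at V (Suc (Suc i)) u a)) T"
        unfolding coeff_at_bd[OF V T] by (rule bdry_cong)
      then show "coeff_at V i (bd ?K i y) a T = 0" using bdry_bdry[OF finite_keys T(2)] by simp
    qed
    then show "y \<in> {u \<in> fmod V ?K (Suc i). bd ?K i u = 0}" using yf by blast
  next
    fix u assume u: "u \<in> {u \<in> fmod V ?K (Suc i). bd ?K i u = 0}"
    then obtain w where "w \<in> fmod V ?K (Suc (Suc i))" "bd ?K (Suc i) w = u" using koszul_exact[OF V, of u "Suc i"] by auto
    then show "u \<in> bd ?K (Suc i) ` fmod V ?K (Suc (Suc i))" by blast
  qed
  show ?thesis unfolding graded_free_resolution_def
    by (intro conjI allI ballI rk add sm dg im0 im)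
qed

section \<open>Betti numbers of Stanley-Reisner rings\<close>

lemma bdry_plus: "bdry V (y + y') \<rho> = bdry V y \<rho> + bdry V y' \<rho>" for y y' :: "'v set \<Rightarrow> 'f::field"
  unfolding bdry_def sum.distrib[symmetric] by (rule sum.cong[OF refl]) (simp add: distrib_left)

lemma bdry_fsc: "bdry V (fsc r y) \<rho> = r * bdry V y \<rho>" for y :: "'v set \<Rightarrow> 'f::field"
  unfolding bdry_def sum_distrib_left by (rule sum.cong[OF refl]) (simp add: fsc_def)

text \<open>The faces of multidegree \<open>a\<close> of the Koszul complex of the Stanley--Reisner ring.\<close>

definition strand :: "'v set set \<Rightarrow> ('v \<Rightarrow>\<^sub>0 nat) \<Rightarrow> 'v set set" where
  "strand \<Delta> a = {T. T \<subseteq> kys a \<and> kys (a - ind T) \<in> \<Delta>}"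

text \<open>No condition is imposed at sets outside the strand, as their monomials are zero in the
  Stanley--Reisner ring.\<close>

definition strand_cycles :: "'v set set \<Rightarrow> ('v \<Rightarrow>\<^sub>0 nat) \<Rightarrow> nat \<Rightarrow> ('v set \<Rightarrow> 'f::field) set" where
  "strand_cycles \<Delta> a i = {y \<in> fun_on (faces (strand \<Delta> a) i).
     \<forall>T\<in>strand \<Delta> a. Suc (card T) = i \<longrightarrow> bdry (kys a) y T = 0}"

definition strand_bd :: "'v set set \<Rightarrow> ('v \<Rightarrow>\<^sub>0 nat) \<Rightarrow> nat \<Rightarrow> ('v set \<Rightarrow> 'f::field) \<Rightarrow> 'v set \<Rightarrow> 'f" where
  "strand_bd \<Delta> a i y = (\<lambda>T. if T \<in> faces (strand \<Delta> a) i then bdry (kys a) y T else 0)"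

lemma finite_strand: "finite (faces (strand \<Delta> a) i)"
proof -
  have "faces (strand \<Delta> a) i \<subseteq> Pow (kys a)" by (auto simp: strand_def faces_def)
  then show ?thesis by (rule finite_subset) simp
qed

text \<open>Enlarging \<open>T\<close> can only shrink the support of the cofactor. Since the strand
  is closed upwards inside the support of \<open>a\<close>, it is the boundary that has to be cut
  off.\<close>

lemma strand_insert:
  assumes "cplx \<Delta>" "T \<in> strand \<Delta> a" "x \<in> kys a - T" shows "insert x T \<in> strand \<Delta> a"
proof -
  have T: "T \<subseteq> kys a" "kys (a - ind T) \<in> \<Delta>" using assms(2) by (auto simp: strand_def)
  have fT: "finite T" using T(1) finite_keys finite_subset by blast
  have "kys (a - ind (insert x T)) \<subseteq> kys (a - ind T)"
    using keys_minus_subset[of "a - ind T" "Poly_Mapping.single x 1"] minus_ind_insert[OF fT] assms(3) by simp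
  then have "kys (a - ind (insert x T)) \<in> \<Delta>" by (rule cplxD(4)[OF assms(1) T(2)])
  then show ?thesis using T(1) assms(3) by (simp add: strand_def)
qed

lemma strand_faces_insert:
  assumes "cplx \<Delta>" "T \<in> faces (strand \<Delta> a) i" "x \<in> kys a - T" shows "insert x T \<in> faces (strand \<Delta> a) (Suc i)"
proof -
  have T: "T \<in> strand \<Delta> a" "card T = i" using assms(2) by (auto simp: faces_def)
  have "T \<subseteq> kys a" using T by (simp add: strand_def)
  then have "finite T" using finite_keys finite_subset by blast
  then show ?thesis using strand_insert[OF assms(1) T(1) assms(3)] T(2) assms(3) by (simp add: faces_def)
qed

lemma strand_cyclesD:
  "y \<in> strand_cycles \<Delta> a i \<Longrightarrow> y \<in> fun_on (faces (strand \<Delta> a) i)"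
  "y \<in> strand_cycles \<Delta> a i \<Longrightarrow> T \<in> strand \<Delta> a \<Longrightarrow> Suc (card T) = i \<Longrightarrow> bdry (kys a) y T = 0"
  by (auto simp: strand_cycles_def)

lemma strand_cyclesI:
  "y \<in> fun_on (faces (strand \<Delta> a) i) \<Longrightarrow> (\<And>T. T \<in> strand \<Delta> a \<Longrightarrow> Suc (card T) = i \<Longrightarrow> bdry (kys a) y T = 0) \<Longrightarrow>
    y \<in> strand_cycles \<Delta> a i"
  by (auto simp: strand_cycles_def)

lemma subspace_strand_cycles: "ff.subspace (strand_cycles \<Delta> a i :: ('v set \<Rightarrow> 'f::field) set)"
proof (rule ff.subspaceI)
  show "0 \<in> strand_cycles \<Delta> a i" by (rule strand_cyclesI) (simp_all add: fun_on_def bdry_def)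
  fix y y' :: "'v set \<Rightarrow> 'f" and r assume y: "y \<in> strand_cycles \<Delta> a i"
  show "fsc r y \<in> strand_cycles \<Delta> a i"
    by (rule strand_cyclesI[OF ff.subspace_scale[OF subspace_fun_on strand_cyclesD(1)[OF y]]])
      (simp add: bdry_fsc strand_cyclesD(2)[OF y])
  assume y': "y' \<in> strand_cycles \<Delta> a i"
  show "y + y' \<in> strand_cycles \<Delta> a i"
    by (rule strand_cyclesI[OF ff.subspace_add[OF subspace_fun_on strand_cyclesD(1)[OF y] strand_cyclesD(1)[OF y']]])
      (simp add: bdry_plus strand_cyclesD(2)[OF y] strand_cyclesD(2)[OF y'])
qed

lemma strand_rank_nullity:
  "ff.dim (strand_bd \<Delta> a i ` fun_on (faces (strand \<Delta> a) (Suc i)) :: ('v set \<Rightarrow> 'f::field) set) +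
    ff.dim (strand_cycles \<Delta> a (Suc i) :: ('v set \<Rightarrow> 'f) set) = card (faces (strand \<Delta> a) (Suc i))"
proof -
  let ?X = "faces (strand \<Delta> a) (Suc i)"
  have lin: "lin_on fsc fsc (fun_on ?X :: ('v set \<Rightarrow> 'f) set) (strand_bd \<Delta> a i)"
    unfolding lin_on_def
    by (intro conjI ballI allI subspace_fun_on) (simp_all add: strand_bd_def fun_eq_iff bdry_plus bdry_fsc fsc_apply)
  have "{y \<in> fun_on ?X. strand_bd \<Delta> a i y = 0} = (strand_cycles \<Delta> a (Suc i) :: ('v set \<Rightarrow> 'f) set)"
  proof (intro equalityI subsetI)
    fix y :: "'v set \<Rightarrow> 'f" assume y: "y \<in> {y \<in> fun_on ?X. strand_bd \<Delta> a i y = 0}"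
    show "y \<in> strand_cycles \<Delta> a (Suc i)"
    proof (rule strand_cyclesI)
      show "y \<in> fun_on ?X" using y by blast
      fix T assume T: "T \<in> strand \<Delta> a" "Suc (card T) = Suc i"
      have "strand_bd \<Delta> a i y T = 0" using y by simp
      then show "bdry (kys a) y T = 0" using T by (simp add: strand_bd_def faces_def)
    qed
  next
    fix y :: "'v set \<Rightarrow> 'f" assume y: "y \<in> strand_cycles \<Delta> a (Suc i)"
    have "strand_bd \<Delta> a i y T = 0" for T
      using strand_cyclesD(2)[OF y, of T] by (simp add: strand_bd_def faces_def)
    then show "y \<in> {y \<in> fun_on ?X. strand_bd \<Delta> a i y = 0}" using strand_cyclesD(1)[OF y] by (simp add: fun_eq_iff)
  qed
  moreover have "ff.dim (fun_on ?X :: ('v set \<Rightarrow> 'f) set) = card ?X" by (rule fun_on_dim(1)[OF finite_strand])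
  ultimately show ?thesis using ff2.rank_nullity_on[OF lin fun_on_dim(2)[OF finite_strand]] by simp
qed

text \<open>Since \<open>v\<close> occurs at least twice in \<open>a\<close>, adding
  \<open>v\<close> to \<open>T\<close> or removing it leaves the support of the cofactor unchanged.
  The strand is thus stable under coning with apex \<open>v\<close>, and the contracting homotopy of
  the full simplex restricts to it.\<close>

lemma strand_exact:
  assumes D: "cplx \<Delta>" and v: "lkp a v \<ge> 2"
  shows "strand_bd \<Delta> a i ` fun_on (faces (strand \<Delta> a) (Suc i)) = (strand_cycles \<Delta> a i :: ('v set \<Rightarrow> 'f::field) set)"
proof (intro equalityI subsetI)
  fix z :: "'v set \<Rightarrow> 'f" assume "z \<in> strand_bd \<Delta> a i ` fun_on (faces (strand \<Delta> a) (Suc i))"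
  then obtain y where y: "y \<in> fun_on (faces (strand \<Delta> a) (Suc i))" "z = strand_bd \<Delta> a i y" by blast
  show "z \<in> strand_cycles \<Delta> a i"
  proof (rule strand_cyclesI)
    show "z \<in> fun_on (faces (strand \<Delta> a) i)" unfolding y(2) by (rule fun_onI) (simp add: strand_bd_def)
    fix T assume T: "T \<in> strand \<Delta> a" "Suc (card T) = i"
    have "bdry (kys a) z T = bdry (kys a) (bdry (kys a) y) T"
    proof (rule bdry_cong)
      fix x assume "x \<in> kys a - T"
      then have "insert x T \<in> faces (strand \<Delta> a) i"
        using strand_faces_insert[OF D, of T a "card T" x] T by (simp add: faces_def)
      then show "z (insert x T) = bdry (kys a) y (insert x T)" by (simp add: y(2) strand_bd_def)
    qed
    then show "bdry (kys a) z T = 0" using bdry_bdry[OF finite_keys, of T a y] T(1) by (simp add: strand_def)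
  qed
next
  fix z :: "'v set \<Rightarrow> 'f" assume z: "z \<in> strand_cycles \<Delta> a i"
  have va: "v \<in> kys a" using v by (simp add: in_keys_iff)
  have rem: "T - {v} \<in> strand \<Delta> a \<longleftrightarrow> T \<in> strand \<Delta> a" if T: "v \<in> T" "T \<subseteq> kys a" for T
  proof -
    have fT: "finite T" using T(2) finite_keys finite_subset by blast
    have "kys (a - ind (T - {v})) = kys (a - ind T)"
    proof (intro set_eqI)
      fix x show "x \<in> kys (a - ind (T - {v})) \<longleftrightarrow> x \<in> kys (a - ind T)"
        using v fT by (cases "x = v") (simp_all add: in_keys_iff lookup_minus lookup_ind of_bool_def)
    qed
    then show ?thesis using T by (auto simp: strand_def)
  qed
  have sub: "T \<subseteq> kys a" if "T \<in> strand \<Delta> a" for T using that by (simp add: strand_def)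
  have cs: "contr v z \<in> fun_on (faces (strand \<Delta> a) (Suc i))"
  proof (rule fun_onI)
    fix T assume T: "T \<notin> faces (strand \<Delta> a) (Suc i)"
    show "contr v z T = 0"
    proof (cases "v \<in> T")
      case True
      have "T - {v} \<notin> faces (strand \<Delta> a) i"
      proof
        assume "T - {v} \<in> faces (strand \<Delta> a) i"
        then have s: "T - {v} \<in> strand \<Delta> a" "card (T - {v}) = i" by (auto simp: faces_def)
        have Ta: "T \<subseteq> kys a" using sub[OF s(1)] va by blast
        then have "finite T" using finite_keys finite_subset by blast
        then have "card T = Suc i" using s(2) True by (metis card.remove)
        then show False using T rem[OF True Ta] s(1) by (simp add: faces_def)
      qed
      then show ?thesis using fun_onD[OF strand_cyclesD(1)[OF z]] by (simp add: contr_def)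
    qed (simp add: contr_def)
  qed
  have "strand_bd \<Delta> a i (contr v z) = z"
  proof
    fix T show "strand_bd \<Delta> a i (contr v z) T = z T"
    proof (cases "T \<in> faces (strand \<Delta> a) i")
      case True
      then have T: "T \<in> strand \<Delta> a" "card T = i" by (auto simp: faces_def)
      have "bdry (kys a) z (T - {v}) = 0" if vT: "v \<in> T"
      proof (rule strand_cyclesD(2)[OF z])
        show "T - {v} \<in> strand \<Delta> a" using rem[OF vT sub[OF T(1)]] T(1) by blast
        have "finite T" using sub[OF T(1)] finite_keys finite_subset by blast
        then show "Suc (card (T - {v})) = i" using T(2) vT by (metis card.remove)
      qed
      then have "bdry (kys a) (contr v z) T = z T" using bdry_contr[OF finite_keys va sub[OF T(1)], of z] by simp
      then show ?thesis using True by (simp add: strand_bd_def)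
    next
      case False then show ?thesis using fun_onD[OF strand_cyclesD(1)[OF z]] by (simp add: strand_bd_def)
    qed
  qed
  then show "z \<in> strand_bd \<Delta> a i ` fun_on (faces (strand \<Delta> a) (Suc i))" using cs by (metis imageI)
qed

text \<open>Cycles minus boundaries, the boundaries being counted by rank-nullity one step
  higher.\<close>

definition strand_homology :: "'f::field itself \<Rightarrow> 'v set set \<Rightarrow> ('v \<Rightarrow>\<^sub>0 nat) \<Rightarrow> nat \<Rightarrow> int" where
  "strand_homology _ \<Delta> a i = int (ff.dim (strand_cycles \<Delta> a i :: ('v set \<Rightarrow> 'f) set)) +
     int (ff.dim (strand_cycles \<Delta> a (Suc i) :: ('v set \<Rightarrow> 'f) set)) - int (card (faces (strand \<Delta> a) (Suc i)))"

lemma strand_homology_not_squarefree: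
  assumes "cplx \<Delta>" "lkp a v \<ge> 2" shows "strand_homology TYPE('f::field) \<Delta> a i = 0"
  using strand_rank_nullity[of \<Delta> a i, where 'f='f] unfolding strand_exact[OF assms] strand_homology_def by simp

text \<open>Complementation in \<open>W\<close> turns the squarefree strand into the cochain complex of the induced
  subcomplex; the product of signs makes the two differentials agree.\<close>

definition compl_sign :: "'v set \<Rightarrow> 'v set \<Rightarrow> 'f::field" where
  "compl_sign W \<sigma> = (\<Prod>x\<in>\<sigma>. eps x (W - {x}))"

lemma compl_sign_square: "compl_sign W \<sigma> * compl_sign W \<sigma> = 1"
  unfolding compl_sign_def prod.distrib[symmetric] by (simp add: eps_square)

lemma compl_sign_square_left: "compl_sign W \<sigma> * (compl_sign W \<sigma> * a) = a"
  by (simp add: mult.assoc[symmetric] compl_sign_square)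

definition compl_fun :: "'v set \<Rightarrow> ('v set \<Rightarrow> 'f::field) \<Rightarrow> 'v set \<Rightarrow> 'f" where
  "compl_fun W y = (\<lambda>\<sigma>. if \<sigma> \<subseteq> W then compl_sign W \<sigma> * y (W - \<sigma>) else 0)"

lemma cob_compl_fun:
  fixes y :: "'v set \<Rightarrow> 'f::field"
  assumes W: "finite W" "\<sigma> \<subseteq> W"
  shows "cob (compl_fun W y) \<sigma> = compl_sign W \<sigma> * bdry W y (W - \<sigma>)"
proof -
  have fs: "finite \<sigma>" using W finite_subset by blast
  have e: "W - (W - \<sigma>) = \<sigma>" using W by blast
  show ?thesis unfolding cob_def bdry_def e sum_distrib_left
  proof (rule sum.cong[OF refl])
    fix x assume x: "x \<in> \<sigma>"
    have i: "insert x (W - \<sigma>) = W - (\<sigma> - {x})" using x W by blast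
    have "W - {x} = (W - \<sigma>) \<union> (\<sigma> - {x})" using x W by blast
    then have h: "eps x (W - {x}) = (eps x (W - \<sigma>) * eps x (\<sigma> - {x}) :: 'f)"
      using eps_Un[of "W - \<sigma>" "\<sigma> - {x}" x, where 'b='f] W(1) fs by auto
    \<comment> \<open>The factor of \<open>compl_sign\<close> at \<open>x\<close> is a product of
      two incidence signs. One cancels against the sign in \<open>bdry\<close>, and the other is the
      sign in \<open>cob\<close>.\<close>
    have "compl_sign W \<sigma> = (eps x (W - \<sigma>) * eps x (\<sigma> - {x}) * compl_sign W (\<sigma> - {x}) :: 'f)"
      unfolding compl_sign_def h[symmetric] by (rule prod.remove[OF fs x])
    then have "compl_sign W \<sigma> * eps x (W - \<sigma>) = (eps x (W - \<sigma>) * eps x (W - \<sigma>)) * (eps x (\<sigma> - {x}) * compl_sign W (\<sigma> - {x}) :: 'f)"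
      by (simp add: mult_ac)
    then have s: "compl_sign W \<sigma> * eps x (W - \<sigma>) = (eps x (\<sigma> - {x}) * compl_sign W (\<sigma> - {x}) :: 'f)"
      by (simp add: eps_square)
    have "\<sigma> - {x} \<subseteq> W" using W by blast
    then show "eps x (\<sigma> - {x}) * compl_fun W y (\<sigma> - {x}) = compl_sign W \<sigma> * (eps x (W - \<sigma>) * y (insert x (W - \<sigma>)))"
      unfolding i compl_fun_def mult.assoc[symmetric] s by (simp add: mult.assoc)
  qed
qed

lemma strand_squarefree:
  assumes "finite W" shows "strand \<Delta> (ind W) = {T. T \<subseteq> W \<and> W - T \<in> \<Delta>}"
proof -
  have "kys (ind W - ind T) = W - T" if "T \<subseteq> W" for T
    using lookup_ind[OF assms] lookup_ind[OF finite_subset[OF that assms]] that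
    by (auto simp: in_keys_iff lookup_minus of_bool_def split: if_splits)
  then show ?thesis by (auto simp: strand_def keys_ind[OF assms])
qed

text \<open>Complementation matches size \<open>i\<close> in the strand with size \<open>q\<close>
  in the induced complex, and the ridges of the one with the cofaces of the other.\<close>

lemma strand_cycles_squarefree:
  fixes \<Delta> :: "'v set set"
  assumes D: "cplx \<Delta>" and W: "finite W" "card W = i + q"
  shows "ff.dim (strand_cycles \<Delta> (ind W) i :: ('v set \<Rightarrow> 'f::field) set) = zdim TYPE('f) (induced \<Delta> W) q"
    "card (faces (strand \<Delta> (ind W)) i) = fnum (induced \<Delta> W) q"
proof -
  let ?K = "induced \<Delta> W" and ?S = "strand \<Delta> (ind W)"
  note S = strand_squarefree[OF W(1), of \<Delta>]
  have K: "cplx ?K" by (rule cplx_induced[OF D])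
  have cc: "card (W - T) + card T = card W" if "T \<subseteq> W" for T
    using card_Diff_subset[OF finite_subset[OF that W(1)] that] card_mono[OF W(1) that] by simp
  have dd: "W - (W - T) = T" if "T \<subseteq> W" for T using that by blast
  have fS: "T \<in> faces ?S i \<longleftrightarrow> T \<subseteq> W \<and> W - T \<in> faces ?K q" for T
    using cc[of T] W(2) unfolding S by (auto simp: faces_def induced_def)
  have fS': "T \<in> ?S \<and> Suc (card T) = i \<longleftrightarrow> T \<subseteq> W \<and> W - T \<in> faces ?K (Suc q)" for T
    using cc[of T] W(2) unfolding S by (auto simp: faces_def induced_def)
  have "bij_betw (\<lambda>T. W - T) (faces ?S i) (faces ?K q)"
  proof (rule bij_betw_byWitness[where f' = "\<lambda>T. W - T"])
    show "\<forall>T\<in>faces ?S i. W - (W - T) = T" using fS dd by blast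
    have sub: "\<sigma> \<subseteq> W" if "\<sigma> \<in> faces ?K q" for \<sigma> using that by (auto simp: faces_def induced_def)
    show "\<forall>\<sigma>\<in>faces ?K q. W - (W - \<sigma>) = \<sigma>" using sub dd by blast
    show "(\<lambda>T. W - T) ` faces ?S i \<subseteq> faces ?K q" using fS by blast
    show "(\<lambda>T. W - T) ` faces ?K q \<subseteq> faces ?S i"
    proof (rule image_subsetI)
      fix \<sigma> assume s: "\<sigma> \<in> faces ?K q"
      show "W - \<sigma> \<in> faces ?S i" unfolding fS dd[OF sub[OF s]] using s by blast
    qed
  qed
  then show "card (faces ?S i) = fnum ?K q" unfolding fnum_def by (rule bij_betw_same_card)
  have lin: "lin_on fsc fsc (strand_cycles \<Delta> (ind W) i :: ('v set \<Rightarrow> 'f) set) (compl_fun W)"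
    unfolding lin_on_def
    by (intro conjI ballI allI subspace_strand_cycles) (simp_all add: compl_fun_def fun_eq_iff fsc_apply algebra_simps)
  have fd: "fin_dim fsc (strand_cycles \<Delta> (ind W) i :: ('v set \<Rightarrow> 'f) set)"
    by (rule fun_on_fin_dim_subset[OF finite_strand]) (use strand_cyclesD(1) in blast)
  have inj: "y = 0" if y: "y \<in> strand_cycles \<Delta> (ind W) i" and z: "compl_fun W y = 0" for y :: "'v set \<Rightarrow> 'f"
  proof
    fix T show "y T = 0 T"
    proof (cases "T \<subseteq> W")
      case True
      have "compl_fun W y (W - T) = 0" using z by simp
      then have "compl_sign W (W - T) * y T = 0" using dd[OF True] by (simp add: compl_fun_def)
      then have "compl_sign W (W - T) * (compl_sign W (W - T) * y T) = 0" by simp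
      then show ?thesis by (simp only: compl_sign_square_left) simp
    next
      case False
      then have "T \<notin> faces ?S i" using fS by blast
      then show ?thesis using fun_onD[OF strand_cyclesD(1)[OF y]] by simp
    qed
  qed
  have im: "compl_fun W ` strand_cycles \<Delta> (ind W) i = (cocyc ?K q :: ('v set \<Rightarrow> 'f) set)"
  proof (intro equalityI subsetI)
    fix c :: "'v set \<Rightarrow> 'f" assume "c \<in> compl_fun W ` strand_cycles \<Delta> (ind W) i"
    then obtain y where y: "y \<in> strand_cycles \<Delta> (ind W) i" "c = compl_fun W y" by blast
    show "c \<in> cocyc ?K q"
    proof (rule cocycI)
      show "c \<in> fun_on (faces ?K q)"
      proof (rule fun_onI)
        fix \<sigma> assume s: "\<sigma> \<notin> faces ?K q"
        show "c \<sigma> = 0"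
        proof (cases "\<sigma> \<subseteq> W")
          case True
          then have "W - \<sigma> \<notin> faces ?S i" using fS[of "W - \<sigma>"] dd[OF True] s by simp
          then show ?thesis using fun_onD[OF strand_cyclesD(1)[OF y(1)]] by (simp add: y(2) compl_fun_def)
        qed (simp add: y(2) compl_fun_def)
      qed
      fix \<sigma> assume s: "\<sigma> \<in> faces ?K (Suc q)"
      then have sW: "\<sigma> \<subseteq> W" by (auto simp: faces_def induced_def)
      have "W - \<sigma> \<in> ?S \<and> Suc (card (W - \<sigma>)) = i" unfolding fS' using s dd[OF sW] by auto
      then have "bdry W y (W - \<sigma>) = 0" using strand_cyclesD(2)[OF y(1)] by (simp add: keys_ind[OF W(1)])
      then show "cob c \<sigma> = 0" unfolding y(2) cob_compl_fun[OF W(1) sW] by simp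
    qed
  next
    fix c :: "'v set \<Rightarrow> 'f" assume c: "c \<in> cocyc ?K q"
    define y where "y T = (if T \<subseteq> W then compl_sign W (W - T) * c (W - T) else 0)" for T
    have cy: "compl_fun W y = c"
    proof
      fix \<sigma> show "compl_fun W y \<sigma> = c \<sigma>"
      proof (cases "\<sigma> \<subseteq> W")
        case True then show ?thesis using dd[OF True] by (simp add: compl_fun_def y_def compl_sign_square_left)
      next
        case False
        then have "\<sigma> \<notin> faces ?K q" by (auto simp: faces_def induced_def)
        then show ?thesis using False fun_onD[OF cocycD(1)[OF c]] by (simp add: compl_fun_def)
      qed
    qed
    have "y \<in> strand_cycles \<Delta> (ind W) i"
    proof (rule strand_cyclesI)
      show "y \<in> fun_on (faces ?S i)"
      proof (rule fun_onI)
        fix T assume "T \<notin> faces ?S i"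
        then show "y T = 0" unfolding fS using fun_onD[OF cocycD(1)[OF c]] by (auto simp: y_def)
      qed
      fix T assume T: "T \<in> ?S" "Suc (card T) = i"
      then have T': "T \<subseteq> W" "W - T \<in> faces ?K (Suc q)" using fS'[of T] by blast+
      have "compl_sign W (W - T) * bdry W y T = 0"
        using cob_compl_fun[OF W(1), of "W - T" y] cocycD(2)[OF c T'(2)] dd[OF T'(1)] by (simp add: cy)
      then have "compl_sign W (W - T) * (compl_sign W (W - T) * bdry W y T) = 0" by simp
      then have "bdry W y T = 0" by (simp only: compl_sign_square_left)
      then show "bdry (kys (ind W)) y T = 0" by (simp add: keys_ind[OF W(1)])
    qed
    then show "c \<in> compl_fun W ` strand_cycles \<Delta> (ind W) i" using cy by (metis imageI)
  qed
  show "ff.dim (strand_cycles \<Delta> (ind W) i :: ('v set \<Rightarrow> 'f) set) = zdim TYPE('f) ?K q"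
    unfolding zdim_def by (rule ff2.dim_bij_on[OF lin fd inj im])
qed

lemma strand_homology_squarefree:
  assumes D: "cplx \<Delta>" and W: "finite W" "card W = i + q"
  shows "strand_homology TYPE('f::field) \<Delta> (ind W) i = hdim TYPE('f) (induced \<Delta> W) q"
proof (cases q)
  case (Suc p)
  then have "card W = Suc i + p" using W(2) by simp
  note s = strand_cycles_squarefree(1)[OF D W(1) this, where 'f='f] strand_cycles_squarefree(2)[OF D W(1) this]
  show ?thesis unfolding strand_homology_def s strand_cycles_squarefree(1)[OF D W, where 'f='f] Suc by (simp add: hdim_def)
next
  case 0
  \<comment> \<open>For \<open>q = 0\<close> no set of size \<open>i + 1\<close> fits into
    \<open>W\<close>, which matches the absence of a lower term in \<open>hdim\<close>.\<close>
  have "T \<notin> faces (strand \<Delta> (ind W)) (Suc i)" for T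
    using card_mono[OF W(1), of T] W(2) 0 unfolding strand_squarefree[OF W(1)] by (auto simp: faces_def)
  then have e: "faces (strand \<Delta> (ind W)) (Suc i) = {}" by blast
  have "strand_cycles \<Delta> (ind W) (Suc i) = {0 :: 'a set \<Rightarrow> 'f}"
  proof (intro equalityI subsetI)
    fix y :: "'a set \<Rightarrow> 'f" assume "y \<in> strand_cycles \<Delta> (ind W) (Suc i)"
    then have "y \<in> fun_on {}" using strand_cyclesD(1) e by metis
    then show "y \<in> {0}" by (auto simp: fun_on_def)
  qed (use ff.subspace_0[OF subspace_strand_cycles] in auto)
  then show ?thesis unfolding strand_homology_def strand_cycles_squarefree(1)[OF D W, where 'f='f] 0
    by (simp add: e hdim_def)
qed

section \<open>Assembling the strands into Tor\<close>

definition monomials :: "'v set \<Rightarrow> nat \<Rightarrow> ('v \<Rightarrow>\<^sub>0 nat) set" where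
  "monomials V n = {a. kys a \<subseteq> V \<and> mdeg a = n}"

lemma finite_monomials_deg: "finite V \<Longrightarrow> finite (monomials V n)"
  by (rule finite_subset[OF _ finite_monomials[of V n]]) (auto simp: monomials_def)

text \<open>The multidegrees with all entries at most 1 are the exponent vectors of the subsets of
  \<open>V\<close>; all others contribute zero.\<close>

lemma sum_strand_homology:
  assumes D: "cplx \<Delta>" and V: "finite V"
  shows "(\<Sum>a\<in>monomials V (i + q). strand_homology TYPE('f::field) \<Delta> a i) =
    (\<Sum>W\<in>subsets V (i + q). hdim TYPE('f) (induced \<Delta> W) q)"
proof -
  have fin: "finite W" if "W \<in> subsets V (i + q)" for W by (rule subsets_finite[OF V that])
  have inj: "inj_on ind (subsets V (i + q))"
    by (rule inj_onI) (metis keys_ind fin)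
  have sub: "ind ` subsets V (i + q) \<subseteq> monomials V (i + q)"
    using fin by (auto simp: monomials_def keys_ind mdeg_ind subsets_def)
  have "(\<Sum>a\<in>monomials V (i + q). strand_homology TYPE('f) \<Delta> a i) = (\<Sum>a\<in>ind ` subsets V (i + q). strand_homology TYPE('f) \<Delta> a i)"
  proof (rule sum.mono_neutral_right[OF finite_monomials_deg[OF V] sub], rule ballI)
    fix a assume a: "a \<in> monomials V (i + q) - ind ` subsets V (i + q)"
    have "\<exists>v. lkp a v \<ge> 2"
    proof (rule ccontr)
      assume "\<nexists>v. lkp a v \<ge> 2"
      then have le: "lkp a v < 2" for v by (meson not_less)
      have e: "a = ind (kys a)"
      proof (rule mono_eqI)
        fix v show "lkp a v = lkp (ind (kys a)) v"
          using le[of v] lookup_ind[of "kys a" v] by (auto simp: in_keys_iff)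
      qed
      have "mdeg a = mdeg (ind (kys a))" by (rule arg_cong[OF e])
      also have "\<dots> = card (kys a)" by (rule mdeg_ind) simp
      finally have "kys a \<in> subsets V (i + q)" using a by (simp add: monomials_def subsets_def)
      then show False using a e by blast
    qed
    then obtain v where "lkp a v \<ge> 2" by blast
    then show "strand_homology TYPE('f) \<Delta> a i = 0" by (rule strand_homology_not_squarefree[OF D])
  qed
  also have "\<dots> = (\<Sum>W\<in>subsets V (i + q). strand_homology TYPE('f) \<Delta> (ind W) i)" by (rule sum.reindex[OF inj, unfolded comp_def])
  also have "\<dots> = (\<Sum>W\<in>subsets V (i + q). hdim TYPE('f) (induced \<Delta> W) q)"
  proof (rule sum.cong[OF refl])
    fix W assume W: "W \<in> subsets V (i + q)"
    then have c: "card W = i + q" by (simp add: subsets_def)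
    show "strand_homology TYPE('f) \<Delta> (ind W) i = hdim TYPE('f) (induced \<Delta> W) q"
      by (rule strand_homology_squarefree[OF D fin[OF W] c])
  qed
  finally show ?thesis .
qed

text \<open>A basis of the degree \<open>n\<close> part of the Koszul complex tensored with the
  Stanley--Reisner ring: the pair \<open>(a, T)\<close> stands for
  \<open>x^(a - T) e_T\<close>.\<close>

definition cells :: "'v set set \<Rightarrow> nat \<Rightarrow> nat \<Rightarrow> (('v \<Rightarrow>\<^sub>0 nat) \<times> 'v set) set" where
  "cells \<Delta> n i = (SIGMA a:monomials (\<Union>\<Delta>) n. faces (strand \<Delta> a) i)"

definition cell_cycles :: "'v set set \<Rightarrow> nat \<Rightarrow> nat \<Rightarrow> (('v \<Rightarrow>\<^sub>0 nat) \<times> 'v set \<Rightarrow> 'f::field) set" where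
  "cell_cycles \<Delta> n i = {c. (\<forall>a\<in>monomials (\<Union>\<Delta>) n. (\<lambda>T. c (a, T)) \<in> strand_cycles \<Delta> a i) \<and>
     (\<forall>a. a \<notin> monomials (\<Union>\<Delta>) n \<longrightarrow> (\<forall>T. c (a, T) = 0))}"

definition cell_bd :: "'v set set \<Rightarrow> nat \<Rightarrow> nat \<Rightarrow> (('v \<Rightarrow>\<^sub>0 nat) \<times> 'v set \<Rightarrow> 'f::field) \<Rightarrow> ('v \<Rightarrow>\<^sub>0 nat) \<times> 'v set \<Rightarrow> 'f" where
  "cell_bd \<Delta> n i c = (\<lambda>(a, T). if (a, T) \<in> cells \<Delta> n i then bdry (kys a) (\<lambda>T'. c (a, T')) T else 0)"

text \<open>Reduction modulo the Stanley--Reisner ideal.\<close>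

definition to_cells :: "'v set set \<Rightarrow> nat \<Rightarrow> nat \<Rightarrow> ('v, 'f::field) fvec \<Rightarrow> ('v \<Rightarrow>\<^sub>0 nat) \<times> 'v set \<Rightarrow> 'f" where
  "to_cells \<Delta> n i u = (\<lambda>(a, T). if (a, T) \<in> cells \<Delta> n i then coeff_at (\<Union>\<Delta>) i u a T else 0)"

lemma finite_cells: "finite (\<Union>\<Delta>) \<Longrightarrow> finite (cells \<Delta> n i)"
  unfolding cells_def by (intro finite_SigmaI finite_monomials_deg finite_strand)

lemma cells_iff: "(a, T) \<in> cells \<Delta> n i \<longleftrightarrow> kys a \<subseteq> \<Union>\<Delta> \<and> mdeg a = n \<and> T \<subseteq> kys a \<and> kys (a - ind T) \<in> \<Delta> \<and> card T = i"
  by (auto simp: cells_def monomials_def faces_def strand_def)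

lemma cell_cycles_iff:
  "c \<in> cell_cycles \<Delta> n i \<longleftrightarrow> c \<in> fun_on (cells \<Delta> n i) \<and>
    (\<forall>h. i = Suc h \<longrightarrow> cell_bd \<Delta> n h c = 0)"
proof
  assume c: "c \<in> cell_cycles \<Delta> n i"
  have f: "(\<lambda>T. c (a, T)) \<in> strand_cycles \<Delta> a i" if "a \<in> monomials (\<Union>\<Delta>) n" for a using c that by (simp add: cell_cycles_def)
  have "c (a, T) = 0" if nc: "(a, T) \<notin> cells \<Delta> n i" for a T
  proof (cases "a \<in> monomials (\<Union>\<Delta>) n")
    case True
    then have "T \<notin> faces (strand \<Delta> a) i" using nc by (simp add: cells_def)
    then show ?thesis by (rule fun_onD[OF strand_cyclesD(1)[OF f[OF True]]])
  next
    case False then show ?thesis using c by (simp add: cell_cycles_def)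
  qed
  then have "c \<in> fun_on (cells \<Delta> n i)" by (intro fun_onI) auto
  moreover have "cell_bd \<Delta> n h c = 0" if h: "i = Suc h" for h
  proof (rule ext, clarify)
    fix a T show "cell_bd \<Delta> n h c (a, T) = 0 (a, T)"
    proof (cases "(a, T) \<in> cells \<Delta> n h")
      case True
      then have "a \<in> monomials (\<Union>\<Delta>) n" "T \<in> strand \<Delta> a" "Suc (card T) = i" using h by (auto simp: cells_def faces_def)
      then have "bdry (kys a) (\<lambda>T'. c (a, T')) T = 0" using strand_cyclesD(2)[OF f] by blast
      then show ?thesis using True by (simp add: cell_bd_def)
    qed (simp add: cell_bd_def)
  qed
  ultimately show "c \<in> fun_on (cells \<Delta> n i) \<and> (\<forall>h. i = Suc h \<longrightarrow> cell_bd \<Delta> n h c = 0)" by blast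
next
  assume c: "c \<in> fun_on (cells \<Delta> n i) \<and> (\<forall>h. i = Suc h \<longrightarrow> cell_bd \<Delta> n h c = 0)"
  have cz: "c x = 0" if "x \<notin> cells \<Delta> n i" for x using c fun_onD[OF _ that] by blast
  have "(\<lambda>T. c (a, T)) \<in> strand_cycles \<Delta> a i" if a: "a \<in> monomials (\<Union>\<Delta>) n" for a
  proof (rule strand_cyclesI)
    show "(\<lambda>T. c (a, T)) \<in> fun_on (faces (strand \<Delta> a) i)" by (rule fun_onI, rule cz) (simp add: cells_def)
    fix T assume T: "T \<in> strand \<Delta> a" "Suc (card T) = i"
    have "cell_bd \<Delta> n (card T) c = 0" using c T(2) by simp
    then have "cell_bd \<Delta> n (card T) c (a, T) = 0" by simp
    moreover have "(a, T) \<in> cells \<Delta> n (card T)" using a T by (simp add: cells_def faces_def)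
    ultimately show "bdry (kys a) (\<lambda>T. c (a, T)) T = 0" by (simp add: cell_bd_def)
  qed
  moreover have "c (a, T) = 0" if "a \<notin> monomials (\<Union>\<Delta>) n" for a T by (rule cz) (use that in \<open>simp add: cells_def\<close>)
  ultimately show "c \<in> cell_cycles \<Delta> n i" unfolding cell_cycles_def by blast
qed

lemma dim_cell_cycles:
  fixes \<Delta> :: "'v set set"
  assumes "finite (\<Union>\<Delta>)"
  shows "ff.dim (cell_cycles \<Delta> n i :: (('v \<Rightarrow>\<^sub>0 nat) \<times> 'v set \<Rightarrow> 'f::field) set) =
    (\<Sum>a\<in>monomials (\<Union>\<Delta>) n. ff.dim (strand_cycles \<Delta> a i :: ('v set \<Rightarrow> 'f) set))"
  unfolding cell_cycles_def
proof (rule dim_fibrewise[where X = "Pow (\<Union>\<Delta>)"])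
  fix a assume a: "a \<in> monomials (\<Union>\<Delta>) n"
  show "strand_cycles \<Delta> a i \<subseteq> (fun_on (Pow (\<Union>\<Delta>)) :: ('v set \<Rightarrow> 'f) set)"
  proof (intro subsetI fun_onI)
    fix y :: "'v set \<Rightarrow> 'f" and T assume y: "y \<in> strand_cycles \<Delta> a i" and T: "T \<notin> Pow (\<Union>\<Delta>)"
    have "T \<notin> faces (strand \<Delta> a) i" using T a by (auto simp: faces_def strand_def monomials_def)
    then show "y T = 0" by (rule fun_onD[OF strand_cyclesD(1)[OF y]])
  qed
qed (use assms finite_monomials_deg subspace_strand_cycles in auto)

lemma card_cells: "finite (\<Union>\<Delta>) \<Longrightarrow> card (cells \<Delta> n i) = (\<Sum>a\<in>monomials (\<Union>\<Delta>) n. card (faces (strand \<Delta> a) i))"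
  unfolding cells_def by (rule card_SigmaI) (auto intro: finite_monomials_deg finite_strand)

lemma cell_rank_nullity:
  fixes \<Delta> :: "'v set set"
  assumes "finite (\<Union>\<Delta>)"
  shows "ff.dim (cell_bd \<Delta> n i ` fun_on (cells \<Delta> n (Suc i)) :: (('v \<Rightarrow>\<^sub>0 nat) \<times> 'v set \<Rightarrow> 'f::field) set) +
    ff.dim (cell_cycles \<Delta> n (Suc i) :: (('v \<Rightarrow>\<^sub>0 nat) \<times> 'v set \<Rightarrow> 'f) set) = card (cells \<Delta> n (Suc i))"
proof -
  let ?X = "cells \<Delta> n (Suc i)"
  have e: "cell_bd \<Delta> n i c (a, T) = (if (a, T) \<in> cells \<Delta> n i then bdry (kys a) (\<lambda>T'. c (a, T')) T else 0)"
    for a T and c :: "('v \<Rightarrow>\<^sub>0 nat) \<times> 'v set \<Rightarrow> 'f"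
    by (simp add: cell_bd_def)
  have lin: "lin_on fsc fsc (fun_on ?X :: (('v \<Rightarrow>\<^sub>0 nat) \<times> 'v set \<Rightarrow> 'f) set) (cell_bd \<Delta> n i)"
    unfolding lin_on_def
  proof (intro conjI ballI allI subspace_fun_on)
    fix c c' :: "('v \<Rightarrow>\<^sub>0 nat) \<times> 'v set \<Rightarrow> 'f" and r
    show "cell_bd \<Delta> n i (c + c') = cell_bd \<Delta> n i c + cell_bd \<Delta> n i c'"
    proof (rule ext, clarify)
      fix a :: "'v \<Rightarrow>\<^sub>0 nat" and T
      show "cell_bd \<Delta> n i (c + c') (a, T) = (cell_bd \<Delta> n i c + cell_bd \<Delta> n i c') (a, T)"
        unfolding plus_fun_apply e by (simp add: bdry_def sum.distrib distrib_left)
    qed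
    show "cell_bd \<Delta> n i (fsc r c) = fsc r (cell_bd \<Delta> n i c)"
    proof (rule ext, clarify)
      fix a :: "'v \<Rightarrow>\<^sub>0 nat" and T
      show "cell_bd \<Delta> n i (fsc r c) (a, T) = fsc r (cell_bd \<Delta> n i c) (a, T)"
        unfolding fsc_apply e by (simp add: bdry_def sum_distrib_left mult.left_commute)
    qed
  qed
  have "{c \<in> fun_on ?X. cell_bd \<Delta> n i c = 0} = (cell_cycles \<Delta> n (Suc i) :: (('v \<Rightarrow>\<^sub>0 nat) \<times> 'v set \<Rightarrow> 'f) set)"
    by (rule set_eqI) (simp add: cell_cycles_iff)
  moreover have "ff.dim (fun_on ?X :: (('v \<Rightarrow>\<^sub>0 nat) \<times> 'v set \<Rightarrow> 'f) set) = card ?X"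
    by (rule fun_on_dim(1)[OF finite_cells[OF assms]])
  ultimately show ?thesis using ff2.rank_nullity_on[OF lin fun_on_dim(2)[OF finite_cells[OF assms]]] by simp
qed

lemma to_cells_plus: "to_cells \<Delta> n i (u + w) = to_cells \<Delta> n i u + to_cells \<Delta> n i w"
  by (rule ext) (auto simp: to_cells_def coeff_at_def entry_add lookup_add)

lemma to_cells_fscale: "to_cells \<Delta> n i (fscale r u) = fsc r (to_cells \<Delta> n i u)"
  by (rule ext) (auto simp: to_cells_def coeff_at_def entry_def lookup_fscale fsc_def)

text \<open>Adding a vertex of the support to a cell gives a cell again, so every coefficient that
  enters the boundary at a cell survives the reduction.\<close>

lemma to_cells_bd:
  assumes D: "cplx \<Delta>" and V: "finite (\<Union>\<Delta>)"
  shows "to_cells \<Delta> n i (bd (koszul (\<Union>\<Delta>)) i u) = cell_bd \<Delta> n i (to_cells \<Delta> n (Suc i) u)"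
proof (rule ext, clarify)
  fix a :: "'a \<Rightarrow>\<^sub>0 nat" and T
  show "to_cells \<Delta> n i (bd (koszul (\<Union>\<Delta>)) i u) (a, T) = cell_bd \<Delta> n i (to_cells \<Delta> n (Suc i) u) (a, T)"
  proof (cases "(a, T) \<in> cells \<Delta> n i")
    case True
    then have m: "a \<in> monomials (\<Union>\<Delta>) n" "T \<in> faces (strand \<Delta> a) i" by (auto simp: cells_def)
    have T: "T \<in> subsets (\<Union>\<Delta>) i" "T \<subseteq> kys a" "kys a \<subseteq> \<Union>\<Delta>" using True by (auto simp: cells_iff subsets_def)
    have "coeff_at (\<Union>\<Delta>) i (bd (koszul (\<Union>\<Delta>)) i u) a T = bdry (kys a) (coeff_at (\<Union>\<Delta>) (Suc i) u a) T"
      by (rule coeff_at_bd[OF V T])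
    also have "\<dots> = bdry (kys a) (\<lambda>T'. to_cells \<Delta> n (Suc i) u (a, T')) T"
    proof (rule bdry_cong)
      fix x assume "x \<in> kys a - T"
      then have "(a, insert x T) \<in> cells \<Delta> n (Suc i)" using strand_faces_insert[OF D m(2)] m(1) by (simp add: cells_def)
      then show "coeff_at (\<Union>\<Delta>) (Suc i) u a (insert x T) = to_cells \<Delta> n (Suc i) u (a, insert x T)" by (simp add: to_cells_def)
    qed
    finally show ?thesis using True by (simp add: to_cells_def cell_bd_def)
  qed (simp add: to_cells_def cell_bd_def)
qed

text \<open>A coefficient survives the reduction exactly if the support of its monomial is a face.
  Together with surjectivity this makes \<open>to_cells\<close> a concrete model of the quotient map
  from \<open>G_i\<close> to \<open>G_i / I G_i\<close> in degree \<open>n\<close>.\<close>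

lemma to_cells_eq_0:
  fixes \<Delta> :: "'v set set" and u :: "('v, 'f::field) fvec"
  assumes D: "cplx \<Delta>" and V: "finite (\<Union>\<Delta>)" and u: "u \<in> fmod_deg (\<Union>\<Delta>) (koszul (\<Union>\<Delta>)) i n"
  shows "to_cells \<Delta> n i u = 0 \<longleftrightarrow> u \<in> ideal_fmod (\<Union>\<Delta>) (stanley_reisner_ideal \<Delta>) (koszul (\<Union>\<Delta>)) i"
proof -
  let ?V = "\<Union>\<Delta>"
  have uf: "u \<in> fmod ?V (koszul ?V) i" using u unfolding fmod_deg_iff by (rule conjunct1)
  have ud: "hom_of_deg (shift (koszul ?V :: ('v, 'f) free_seq) i) n u" using u unfolding fmod_deg_iff by (rule conjunct2)
  have ring: "\<forall>T\<in>subsets ?V i. entry ?V i u T \<in> poly_ring ?V" and zero: "\<forall>b\<ge>card (subsets ?V i). lkp u b = 0"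
    using conjunct1[OF iffD1[OF koszul_fmod_iff[OF V] uf]] conjunct2[OF iffD1[OF koszul_fmod_iff[OF V] uf]] by this
  show ?thesis
  proof
    assume z: "to_cells \<Delta> n i u = 0"
    have "lkp u b \<in> stanley_reisner_ideal \<Delta>" for b
    proof (cases "b < card (subsets ?V i)")
      case True
      let ?T = "nth_subset ?V i b"
      have T: "?T \<in> subsets ?V i" and e: "entry ?V i u ?T = lkp u b"
        using nth_subset[OF V True] by (auto simp: entry_def)
      have fT: "finite ?T" "?T \<subseteq> ?V" "card ?T = i" using subsets_finite[OF V T] T by (auto simp: subsets_def)
      have "kys m \<notin> \<Delta>" if m: "m \<in> kys (lkp u b)" for m
      proof
        assume mD: "kys m \<in> \<Delta>"
        have "mdeg m + i = n" using ud T m unfolding koszul_deg_iff[OF V uf] e[symmetric] by blast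
        moreover have "kys m \<subseteq> ?V" using mD by blast
        ultimately have "(m + ind ?T, ?T) \<in> cells \<Delta> n i"
          using fT mD by (simp add: cells_iff keys_plus_nat keys_ind mdeg_plus mdeg_ind)
        then have "to_cells \<Delta> n i u (m + ind ?T, ?T) = lkp (lkp u b) m"
          by (simp add: to_cells_def coeff_at_plus_ind e)
        then show False using z m by (simp add: in_keys_iff)
      qed
      then show ?thesis using bspec[OF ring T] e by (simp add: stanley_reisner_ideal_eq[OF D])
    next
      case False
      then have "lkp u b = 0" using zero by simp
      then show ?thesis by (simp add: stanley_reisner_ideal_eq[OF D])
    qed
    then show "u \<in> ideal_fmod ?V (stanley_reisner_ideal \<Delta>) (koszul ?V) i" using uf by (simp add: ideal_fmod_def)
  next
    assume I: "u \<in> ideal_fmod ?V (stanley_reisner_ideal \<Delta>) (koszul ?V) i"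
    show "to_cells \<Delta> n i u = 0"
    proof (rule ext, clarify)
      fix a :: "'v \<Rightarrow>\<^sub>0 nat" and T
      show "to_cells \<Delta> n i u (a, T) = 0 (a, T)"
      proof (cases "(a, T) \<in> cells \<Delta> n i")
        case True
        have "entry ?V i u T \<in> stanley_reisner_ideal \<Delta>" using I by (simp add: ideal_fmod_def entry_def)
        then have "a - ind T \<notin> kys (entry ?V i u T)" using True by (auto simp: stanley_reisner_ideal_eq[OF D] cells_iff)
        then show ?thesis by (simp add: to_cells_def coeff_at_def in_keys_iff)
      qed (simp add: to_cells_def)
    qed
  qed
qed

text \<open>The entries are read off from \<open>c\<close>; they are polynomials because there are
  only finitely many cells.\<close>

lemma to_cells_surj:
  fixes \<Delta> :: "'v set set" and c :: "('v \<Rightarrow>\<^sub>0 nat) \<times> 'v set \<Rightarrow> 'f::field"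
  assumes D: "cplx \<Delta>" and V: "finite (\<Union>\<Delta>)" and c: "c \<in> fun_on (cells \<Delta> n i)"
  shows "\<exists>u\<in>fmod_deg (\<Union>\<Delta>) (koszul (\<Union>\<Delta>)) i n. to_cells \<Delta> n i u = c"
proof -
  let ?V = "\<Union>\<Delta>"
  define P where "P T = Abs_poly_mapping (\<lambda>m. c (m + ind T, T))" for T
  have "finite {m. c (m + ind T, T) \<noteq> 0}" for T
  proof -
    have "inj_on (\<lambda>m. (m + ind T, T)) {m. c (m + ind T, T) \<noteq> 0}" by (rule inj_onI) simp
    moreover have "(\<lambda>m. (m + ind T, T)) ` {m. c (m + ind T, T) \<noteq> 0} \<subseteq> cells \<Delta> n i"
      using fun_onD[OF c] by blast
    ultimately show ?thesis using finite_cells[OF V] finite_imageD finite_subset by metis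
  qed
  then have lP: "lkp (P T) m = c (m + ind T, T)" for T m unfolding P_def by simp
  have keysP: "(m + ind T, T) \<in> cells \<Delta> n i" if "m \<in> kys (P T)" for m T
    using that lP fun_onD[OF c] by (metis in_keys_iff)
  have PR: "P T \<in> poly_ring ?V" for T
    unfolding poly_ring_def using keysP[of _ T] by (auto simp: cells_iff keys_plus_nat)
  define u where "u = from_entries ?V i P"
  have uf: "u \<in> fmod ?V (koszul ?V) i" unfolding u_def by (rule from_entries_fmod[OF V PR])
  have ue: "entry ?V i u T = P T" if "T \<in> subsets ?V i" for T unfolding u_def by (rule entry_from_entries[OF V that])
  have "mdeg m + i = n" if T: "T \<in> subsets ?V i" and m: "m \<in> kys (entry ?V i u T)" for T m
    using keysP[of m T] m ue[OF T] subsets_finite[OF V T] by (simp add: cells_iff mdeg_plus mdeg_ind)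
  then have "hom_of_deg (shift (koszul ?V) i) n u" unfolding koszul_deg_iff[OF V uf] by blast
  then have "u \<in> fmod_deg ?V (koszul ?V) i n" using uf by (simp add: fmod_deg_iff)
  moreover have "to_cells \<Delta> n i u = c"
  proof (rule ext, clarify)
    fix a :: "'v \<Rightarrow>\<^sub>0 nat" and T
    show "to_cells \<Delta> n i u (a, T) = c (a, T)"
    proof (cases "(a, T) \<in> cells \<Delta> n i")
      case True
      then have T: "T \<in> subsets ?V i" "T \<subseteq> kys a" by (auto simp: cells_iff subsets_def)
      have "a - ind T + ind T = a" by (rule add_minus_ind[OF subsets_finite[OF V T(1)] T(2)])
      then show ?thesis using True by (simp add: to_cells_def coeff_at_def ue[OF T(1)] lP)
    next
      case False then show ?thesis using fun_onD[OF c] by (simp add: to_cells_def)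
    qed
  qed
  ultimately show ?thesis by blast
qed

lemma to_cells_fun_on: "to_cells \<Delta> n i u \<in> fun_on (cells \<Delta> n i)"
  by (rule fun_onI) (auto simp: to_cells_def)

text \<open>Modulo the ideal, Tor cycles and Tor boundaries become the cell cycles and the image of
  \<open>cell_bd\<close>. What is lost is the same space in both cases, so the difference of
  dimensions is unaffected. By rank-nullity it is a combination of dimensions and cell counts, each
  of which splits over multidegrees.\<close>

theorem hochster:
  fixes \<Delta> :: "'v set set"
  assumes D: "cplx \<Delta>"
  shows "int (betti TYPE('f::field) \<Delta> i (i + q)) = (\<Sum>W\<in>subsets (\<Union>\<Delta>) (i + q). hdim TYPE('f) (induced \<Delta> W) q)"
proof -
  let ?V = "\<Union>\<Delta>" and ?K = "koszul (\<Union>\<Delta>) :: ('v, 'f) free_seq" and ?I = "stanley_reisner_ideal \<Delta> :: ('v, 'f) mpoly set"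
  let ?n = "i + q"
  let ?Q = "to_cells \<Delta> ?n :: nat \<Rightarrow> ('v, 'f) fvec \<Rightarrow> _" and ?C = "tor_cycles ?V ?I ?K i ?n" and ?B = "tor_boundaries ?V ?I ?K i ?n"
  have V: "finite ?V" using cplxD(1,3)[OF D] by blast
  have I: "ideal_in ?V ?I" unfolding stanley_reisner_ideal_eq[OF D] by (rule ideal_in_faces[OF D])
  have G: "graded_free_resolution ?V (irrelevant_ideal ?V) ?K" by (rule koszul_resolution[OF V])
  note sub = tor_subspaces[OF G I, of i ?n] and bK = resolutionD(3)[OF G]
  have fdC: "fin_dim fscale ?C" by (rule fv.fin_dim_subset[OF fin_dim_fmod_deg[OF V] tor_cycles_deg])
  have fdB: "fin_dim fscale ?B" by (rule fv.fin_dim_subset[OF fdC sub(3)])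
  have lin: "lin_on fscale fsc U (?Q i)" if "fv.subspace U" for U
    unfolding lin_on_def using that by (simp add: to_cells_plus to_cells_fscale)
  have imC: "?Q i ` ?C = cell_cycles \<Delta> ?n i"
  proof (intro equalityI subsetI)
    fix c assume "c \<in> ?Q i ` ?C"
    then obtain u where u: "u \<in> ?C" "c = ?Q i u" by blast
    have "cell_bd \<Delta> ?n h c = 0" if h: "i = Suc h" for h
    proof -
      have ud: "u \<in> fmod_deg ?V ?K (Suc h) ?n" and ui: "bd ?K h u \<in> ideal_fmod ?V ?I ?K h"
        using u(1) unfolding tor_cycles_def h by auto
      have "?Q h (bd ?K h u) = 0" using to_cells_eq_0[OF D V ghomD(4)[OF bK ud]] ui by blast
      then show ?thesis unfolding u(2) h to_cells_bd[OF D V] .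
    qed
    then show "c \<in> cell_cycles \<Delta> ?n i" unfolding cell_cycles_iff u(2) using to_cells_fun_on by blast
  next
    fix c :: "('v \<Rightarrow>\<^sub>0 nat) \<times> 'v set \<Rightarrow> 'f" assume c: "c \<in> cell_cycles \<Delta> ?n i"
    obtain u where u: "u \<in> fmod_deg ?V ?K i ?n" "?Q i u = c"
      using to_cells_surj[OF D V] c unfolding cell_cycles_iff by blast
    have "u \<in> ?C"
    proof (cases i)
      case 0 then show ?thesis using u(1) by (simp add: tor_cycles_def)
    next
      case (Suc h)
      have ud: "u \<in> fmod_deg ?V ?K (Suc h) ?n" using u(1) Suc by simp
      have "cell_bd \<Delta> ?n h c = 0" using c Suc unfolding cell_cycles_iff by blast
      then have "?Q h (bd ?K h u) = 0" unfolding to_cells_bd[OF D V] using u(2) Suc by simp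
      then have "bd ?K h u \<in> ideal_fmod ?V ?I ?K h" using to_cells_eq_0[OF D V ghomD(4)[OF bK ud]] by blast
      then show ?thesis using ud unfolding tor_cycles_def Suc by simp
    qed
    then show "c \<in> ?Q i ` ?C" using u(2) by blast
  qed
  have imB: "?Q i ` ?B = cell_bd \<Delta> ?n i ` fun_on (cells \<Delta> ?n (Suc i))"
  proof (intro equalityI subsetI)
    fix c assume "c \<in> ?Q i ` ?B"
    then obtain w t where w: "c = ?Q i (bd ?K i w + t)" "w \<in> fmod_deg ?V ?K (Suc i) ?n" "t \<in> ideal_fmod ?V ?I ?K i" "t \<in> fmod_deg ?V ?K i ?n"
      unfolding tor_boundaries_def by blast
    have "?Q i t = 0" using to_cells_eq_0[OF D V w(4)] w(3) by blast
    then have "c = cell_bd \<Delta> ?n i (?Q (Suc i) w)" unfolding w(1) to_cells_plus to_cells_bd[OF D V] by simp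
    then show "c \<in> cell_bd \<Delta> ?n i ` fun_on (cells \<Delta> ?n (Suc i))" using to_cells_fun_on by blast
  next
    fix c :: "('v \<Rightarrow>\<^sub>0 nat) \<times> 'v set \<Rightarrow> 'f" assume "c \<in> cell_bd \<Delta> ?n i ` fun_on (cells \<Delta> ?n (Suc i))"
    then obtain e where e: "e \<in> fun_on (cells \<Delta> ?n (Suc i))" "c = cell_bd \<Delta> ?n i e" by blast
    obtain w where w: "w \<in> fmod_deg ?V ?K (Suc i) ?n" "?Q (Suc i) w = e" using to_cells_surj[OF D V e(1)] by blast
    have "bd ?K i w + 0 \<in> ?B" unfolding tor_boundaries_def using w(1) ideal_fmod_closed(1)[OF I] fmod_deg_0 by blast
    moreover have "?Q i (bd ?K i w + 0) = c" using e(2) w(2) to_cells_bd[OF D V, of ?n i w] by simp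
    ultimately show "c \<in> ?Q i ` ?B" by blast
  qed
  \<comment> \<open>Both sides are the degree \<open>?n\<close> part of \<open>I G_i\<close>, which
    the Tor boundaries contain by definition.\<close>
  have ker: "{u \<in> ?C. ?Q i u = 0} = {u \<in> ?B. ?Q i u = 0}"
  proof (intro equalityI subsetI)
    fix u assume "u \<in> {u \<in> ?C. ?Q i u = 0}"
    then have u: "u \<in> fmod_deg ?V ?K i ?n" "?Q i u = 0" using tor_cycles_deg by blast+
    then have "u \<in> ideal_fmod ?V ?I ?K i" using to_cells_eq_0[OF D V] by blast
    then have "bd ?K i 0 + u \<in> ?B" unfolding tor_boundaries_def using u(1) fmod_deg_0 by blast
    then show "u \<in> {u \<in> ?B. ?Q i u = 0}" using u(2) ghomD(5)[OF bK, of i] by simp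
  qed (use sub(3) in blast)
  have dC: "fv.dim ?C = ff.dim (cell_cycles \<Delta> ?n i :: (('v \<Rightarrow>\<^sub>0 nat) \<times> 'v set \<Rightarrow> 'f) set) + fv.dim {u \<in> ?B. ?Q i u = 0}"
    using fvff.rank_nullity_on[OF lin[OF sub(1)] fdC] unfolding imC ker .
  have dB: "fv.dim ?B = ff.dim (cell_bd \<Delta> ?n i ` fun_on (cells \<Delta> ?n (Suc i)) :: (('v \<Rightarrow>\<^sub>0 nat) \<times> 'v set \<Rightarrow> 'f) set) + fv.dim {u \<in> ?B. ?Q i u = 0}"
    using fvff.rank_nullity_on[OF lin[OF sub(2)] fdB] unfolding imB .
  have le: "fv.dim ?B \<le> fv.dim ?C" by (rule fv.dim_mono_fin[OF fdC sub(1,2,3)])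
  have "betti TYPE('f) \<Delta> i ?n = fv.dim ?C - fv.dim ?B"
    unfolding betti_def by (rule tor_dim_eq[OF V I G])
  then have "int (betti TYPE('f) \<Delta> i ?n) = int (ff.dim (cell_cycles \<Delta> ?n i :: (('v \<Rightarrow>\<^sub>0 nat) \<times> 'v set \<Rightarrow> 'f) set)) +
      int (ff.dim (cell_cycles \<Delta> ?n (Suc i) :: (('v \<Rightarrow>\<^sub>0 nat) \<times> 'v set \<Rightarrow> 'f) set)) - int (card (cells \<Delta> ?n (Suc i)))"
    using le dC dB cell_rank_nullity[OF V, where 'f='f, of ?n i] by linarith
  also have "\<dots> = (\<Sum>a\<in>monomials ?V ?n. strand_homology TYPE('f) \<Delta> a i)"
    unfolding dim_cell_cycles[OF V] card_cells[OF V] strand_homology_def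
    by (simp add: sum.distrib sum_subtractf)
  also have "\<dots> = (\<Sum>W\<in>subsets ?V ?n. hdim TYPE('f) (induced \<Delta> W) q)" by (rule sum_strand_homology[OF D V])
  finally show ?thesis .
qed

text \<open>At \<open>i = (k - 1) * d + 1\<close> the expression of the last case equals -1, because
  its three summands are \<open>k - 2\<close>, \<open>-(k - 1)\<close> and 0. The total degree is
  then \<open>k * d\<close>, and the Betti number is 0: the difference counted below includes the
  top class of the full complex. Hence this index is excluded.\<close>

theorem theorem7p7:
  fixes d k :: nat and \<Delta> :: "'v set set"
  assumes "d \<ge> 3" and "k \<ge> 2"
    and "stacked_cross_polytopal_sphere d k \<Delta>"
  shows "betti TYPE('f::field) \<Delta> 0 0 = 1 \<and> betti TYPE('f) \<Delta> ((k - 1) * d) (k * d) = 1 \<and>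
    (\<forall>i. int (betti TYPE('f) \<Delta> i (i + 1)) =
        int (k - 2) * binom (d * (k - 1)) (int i + 1)
        - int (k - 1) * binom (d * (k - 2)) (int i + 1)
        + int (d * (k - 1)) * binom (d * (k - 2)) (int i - 1)) \<and>
    (\<forall>i j. 2 \<le> j \<and> j \<le> d - 2 \<longrightarrow> int (betti TYPE('f) \<Delta> i (i + j)) =
        int (k - 1) * binom d (int j) * binom (d * (k - 2)) (int i - int j)) \<and>
    (\<forall>i. i \<noteq> (k - 1) * d + 1 \<longrightarrow> int (betti TYPE('f) \<Delta> i (i + (d - 1))) =
        int (k - 2) * binom (d * (k - 1)) (int i - 1)
        - int (k - 1) * binom (d * (k - 2)) (int i - int d - 1)
        + int (d * (k - 1)) * binom (d * (k - 2)) (int i - int d + 1))"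
proof -
  let ?V = "\<Union>\<Delta>"
  \<comment> \<open>Writing \<open>k = l + 2\<close> removes the truncated subtractions from
    \<open>k\<close>; the number of copies is \<open>l + 1\<close>.\<close>
  obtain l where k: "k = l + 2" using \<open>k \<ge> 2\<close> by (metis le_Suc_ex add.commute)
  have d: "d \<ge> 2" using \<open>d \<ge> 3\<close> by simp
  have kl: "k - 1 = l + 1" "k - 2 = l" "l + 1 - 1 = l" using k by simp_all
  have g: "glued d (l + 1) \<Delta>" using stacked_glued[OF assms(3) d] by (simp only: kl)
  have pc: "pure_cplx d \<Delta>" and V: "finite ?V" and cardV: "card ?V = k * d"
    using glued_structure[OF g d] k by auto
  note D = pure_cplxD(1)[OF pc]
  note H = hochster[OF D, where 'f='f]
  note sums = glued_hdim_sums[OF g \<open>d \<ge> 3\<close>, unfolded kl]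
  have nonempty: "induced \<Delta> W \<noteq> {{}}" if W: "W \<subseteq> ?V" "W \<noteq> {}" for W
  proof -
    obtain x F where "x \<in> W" "x \<in> F" "F \<in> \<Delta>" using W by blast
    then have "{x} \<in> induced \<Delta> W" using cplxD(4)[OF D, of F "{x}"] by (simp add: induced_def)
    then show ?thesis by blast
  qed
  \<comment> \<open>Reduced cohomology in degree -1 only sees whether \<open>W\<close> is
    empty.\<close>
  have h0: "hdim TYPE('f) (induced \<Delta> W) 0 = of_bool (W = {})" if W: "W \<subseteq> ?V" for W
  proof (cases "W = {}")
    case True
    have "induced \<Delta> {} = {{}}" using cplxD(2)[OF D] by (auto simp: induced_def)
    then show ?thesis using True hdim_0[OF cplx_induced[OF D], where 'f='f, of "{}"] by simp
  next
    case False
    then show ?thesis using nonempty[OF W False] hdim_0[OF cplx_induced[OF D], where 'f='f, of W] by simp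
  qed
  have "subsets ?V 0 = {{}}" using V by (auto simp: subsets_def dest: finite_subset)
  then have "int (betti TYPE('f) \<Delta> 0 (0 + 0)) = 1" unfolding H by (simp add: h0)
  then have b0: "betti TYPE('f) \<Delta> 0 0 = 1" by simp
  \<comment> \<open>By its size only the full vertex set occurs in the sum, and its top cohomology
    has dimension 1.\<close>
  have "subsets ?V (k * d) = {?V}" using card_subset_eq[OF V] cardV by (auto simp: subsets_def)
  moreover have kd: "(k - 1) * d + d = k * d" using k by simp
  ultimately have "int (betti TYPE('f) \<Delta> ((k - 1) * d) ((k - 1) * d + d)) = 1"
    unfolding H by (simp add: glued_hdim_top[OF g d])
  then have btop: "betti TYPE('f) \<Delta> ((k - 1) * d) (k * d) = 1" unfolding kd by simp
  have b1: "int (betti TYPE('f) \<Delta> i (i + 1)) = int l * binom (d * (l + 1)) (int i + 1)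
      - int (l + 1) * binom (d * l) (int i + 1) + int (d * (l + 1)) * binom (d * l) (int i - 1)" for i
  proof -
    \<comment> \<open>These sets are nonempty, so the term in degree -1 is zero and the known
      difference can be inserted.\<close>
    have "(\<Sum>W\<in>subsets ?V (i + 1). hdim TYPE('f) (induced \<Delta> W) 1) =
        (\<Sum>W\<in>subsets ?V (i + 1). hdim TYPE('f) (induced \<Delta> W) 1 - hdim TYPE('f) (induced \<Delta> W) 0)"
      by (rule sum.cong[OF refl]) (auto simp: subsets_def h0)
    also have "\<dots> = int (l + 1) * (int d * binom (d * l) (int (i + 1) - 2) - binom (d * l) (int (i + 1))) +
        int l * binom (d * (l + 1)) (int (i + 1))"
      by (rule sums(2))
    also have "int (i + 1) - 2 = int i - 1" by simp
    finally show ?thesis unfolding H by (simp add: algebra_simps)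
  qed
  have bj: "int (betti TYPE('f) \<Delta> i (i + j)) = int (l + 1) * binom d (int j) * binom (d * l) (int i - int j)"
    if j: "2 \<le> j" "j \<le> d - 2" for i j
  proof -
    have "int (i + j) - 2 * int j = int i - int j" by simp
    moreover have "binom d (int j) = int (d choose j)" by (simp add: binom_def)
    ultimately show ?thesis unfolding H sums(1)[OF j] by simp
  qed
  have bd: "int (betti TYPE('f) \<Delta> i (i + (d - 1))) = int l * binom (d * (l + 1)) (int i - 1)
      - int (l + 1) * binom (d * l) (int i - int d - 1) + int (d * (l + 1)) * binom (d * l) (int i - int d + 1)"
    if i: "i \<noteq> (l + 1) * d + 1" for i
  proof -
    let ?m = "i + (d - 1)"
    \<comment> \<open>\<open>hdim\<close> at \<open>d\<close> is nonzero only if \<open>W\<close> is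
      the full vertex set, of size \<open>k * d\<close>; the excluded index is the one where
      \<open>?m\<close> equals this number.\<close>
    have hd0: "hdim TYPE('f) (induced \<Delta> W) d = 0" if "W \<in> subsets ?V ?m" for W
    proof -
      have "k * d = (l + 1) * d + d" using k by simp
      then have "?m \<noteq> k * d" using i d by linarith
      then have "\<not> ?V \<subseteq> W" using that cardV by (auto simp: subsets_def)
      then show ?thesis by (simp add: glued_hdim_top[OF g d])
    qed
    have "(\<Sum>W\<in>subsets ?V ?m. hdim TYPE('f) (induced \<Delta> W) (d - 1)) =
        (\<Sum>W\<in>subsets ?V ?m. hdim TYPE('f) (induced \<Delta> W) (d - 1) - hdim TYPE('f) (induced \<Delta> W) d)"
      by (rule sum.cong[OF refl]) (simp add: hd0)
    also have "\<dots> = int (l + 1) * (int d * binom (d * l) (int ?m - 2 * int (d - 1)) - binom (d * l) (int ?m - 2 * int d)) +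
        int l * binom (d * (l + 1)) (int ?m - int d)"
      by (rule sums(3))
    also have "int ?m - 2 * int (d - 1) = int i - int d + 1" using d by linarith
    also have "int ?m - 2 * int d = int i - int d - 1" using d by linarith
    also have "int ?m - int d = int i - 1" using d by linarith
    finally show ?thesis unfolding H by (simp add: algebra_simps)
  qed
  show ?thesis unfolding kl(1,2)
    using b0 btop[unfolded kl(1)] b1 bj bd by blast
qed

end
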